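(* Let $(L,A)$ be a Lie pair over $M$ with a splitting $j:L/A\to L$ of $0\to A\to L\to L/A\to0$ and $B=j(L/A)$, let $E$ be an $A$-module, and let $\nabla$ be an $L$-connection on $E$ extending the $A$-action. Let $\mathfrak a=C(L)=\Gamma(\Lambda L^\vee)$ be the associated dDG-algebra, $\mathfrak m=\mathfrak a\otimes\Gamma(E)$ the associated DG-$\mathfrak a$-module, $d^{0,1}_{\mathfrak m}$ the connection on $\mathfrak m$ induced by $\nabla$, and $R_{\mathfrak m}$ its curvature. Then $R_{\mathfrak m}$ is the only DG-$\mathfrak a$-module map from $\mathfrak m$ to $\mathfrak m(1)[1]$ satisfying $$i_ai_bR_{\mathfrak m}(e)=\mathrm{At}^\nabla(a)(b,e)\qquad\text{for all }a\in\Gamma(A),\ b\in\Gamma(B),\ e\in\Gamma(E).$$ Consequently, $\mu$ sends the Atiyah class $\alpha_{(L,A),E}$ to $\alpha_{\mathfrak m}$ in cohomology.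
   Context: $\mathbb K=\mathbb R$ or $\mathbb C$. A Lie pair $(L,A)$ is a Lie algebroid $L\to M$ with a Lie subalgebroid $A$ over the same base; $B\cong L/A$ is an $A$-module via $a\cdot\overline l=\overline{[a,l]}$. An $A$-module is a vector bundle $E$ with a flat $A$-connection; an $L$-connection $\nabla$ on $E$ extends the $A$-action if $\nabla_ae=a\cdot e$ for $a\in\Gamma(A)$. Atiyah class of the Lie pair: with $R^\nabla(l,l')=\nabla_l\nabla_{l'}-\nabla_{l'}\nabla_l-\nabla_{[l,l']}$, the formula $\mathrm{At}^\nabla(a)(\overline l,e)=R^\nabla(a,l)e$ defines a 1-cocycle of $A$ with values in $\mathrm{Hom}(L/A\otimes E,E)$ whose class $\alpha_{(L,A),E}\in H^1(A,\mathrm{Hom}(L/A\otimes E,E))$ is independent of $\nabla$. A (bigraded) DG-algebra on $M$ is a bigraded sheaf of algebras $\mathfrak a$ with a derivation $\bar d_{\mathfrak a}$ of bidegree $(1,0)$ and square zero. A dDG-algebra is a DG-algebra with in addition a derivation $d_{\mathfrak a}$ of bidegree $(0,1)$ with $\bar d_{\mathfrak a}d_{\mathfrak a}+d_{\mathfrak a}\bar d_{\mathfrak a}=0$. A DG-$\mathfrak a$-module is a bigraded sheaf of $\mathfrak a$-modules $\mathfrak m$ with an additive map $\bar d_{\mathfrak m}$ of bidegree $(1,0)$, $\bar d_{\mathfrak m}^2=0$, $\bar d_{\mathfrak m}(\alpha m)=\bar d_{\mathfrak a}(\alpha)m+(-1)^{|\alpha|}\alpha\bar d_{\mathfrak m}(m)$.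 A connection on $\mathfrak m$ is an additive map $d_{\mathfrak m}$ of bidegree $(0,1)$ with $d_{\mathfrak m}(\alpha m)=d_{\mathfrak a}(\alpha)m+(-1)^{|\alpha|}\alpha d_{\mathfrak m}(m)$; its curvature is $R_{\mathfrak m}=-(d_{\mathfrak m}\bar d_{\mathfrak m}+\bar d_{\mathfrak m}d_{\mathfrak m})$. The shifts of bidegree $(1,0)$ and $(0,1)$ are denoted $[1]$ and $(1)$. $\mathrm{Hom}^{\bullet,\bullet}(\mathfrak m,\mathfrak m)$ denotes the bigraded space of $\mathfrak a$-linear (graded) maps. The curvature is a cocycle in $(\mathrm{Hom}^{\bullet,1}(\mathfrak m,\mathfrak m),[\bar d_{\mathfrak m},\cdot])$ and its class $\alpha_{\mathfrak m}\in H^1$ is independent of the connection. In the present case, $\mathfrak a=C(L)\cong C(A)\otimes C(B)$ with $C(A)=\Gamma(\Lambda A^\vee)$, $C(B)=\Gamma(\Lambda B^\vee)$, bigraded by ($A$-form degree, $B$-form degree). The differential $d_L$ decomposes as $d^{1,0}_{\mathfrak a}+d^{0,1}_{\mathfrak a}+d^{-1,2}_{\mathfrak a}$ by bidegree, and the dDG-structure is $(\bar d_{\mathfrak a},d_{\mathfrak a})=(d^{1,0}_{\mathfrak a},d^{0,1}_{\mathfrak a})$. The extension $d_\nabla$ of $\nabla$ to $\mathfrak m=\Gamma(\Lambda L^\vee\otimes E)$ decomposes as $d^{1,0}_{\mathfrak m}+d^{0,1}_{\mathfrak m}+d^{-1,2}_{\mathfrak m}$; $\bar d_{\mathfrak m}=d^{1,0}_{\mathfrak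 m}$ is the Chevalley--Eilenberg differential of $A$ with values in $\Lambda B^\vee\otimes E$ and $d_{\mathfrak m}=d^{0,1}_{\mathfrak m}$ is a connection. $i_a,i_b$ are contractions of forms. The DG-$\mathfrak a$-module isomorphism $\mu:\mathfrak a\otimes\Gamma(\mathrm{End}(E))\to\mathrm{Hom}^{\bullet,\bullet}(\mathfrak m,\mathfrak m)$ is determined by $\mu(x)|_{\Gamma(E)}=x$. $\mathrm{At}^\nabla$ is viewed as the element of $\mathfrak a^{1,1}\otimes\Gamma(\mathrm{End}(E))$ with $i_ai_b\mathrm{At}^\nabla=\mathrm{At}^\nabla(a)(b,\cdot)$, i.e. $\Lambda^\bullet A^\vee\otimes\mathrm{Hom}(B\otimes E,E)$ is identified with $\Lambda^\bullet A^\vee\otimes\Lambda^1B^\vee\otimes\mathrm{End}(E)\subset\mathfrak a\otimes\mathrm{End}(E)$ via $\omega\otimes\beta\otimes\psi\mapsto-(\omega\wedge\beta)\otimes\psi$. *)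

theory Defs
  imports "HOL-Analysis.Analysis" "HOL-Library.Function_Algebras"
begin

text \<open>
  Conventions.  The ground field is a type \<open>'k :: {real_normed_field, euclidean_space}\<close>; by
  Frobenius' theorem such a field is \<open>\<real>\<close> or \<open>\<complex>\<close>.  The manifold is a whole type \<open>'m\<close>.  Sums and
  differences of functions, sections, forms and operators are pointwise (Function_Algebras).
  Partially defined maps (forms, operators, homomorphisms) are made total by the value \<open>0\<close> outside
  their domain, so that equality of functions is equality of the mathematical objects.
\<close>

section \<open>Manifolds and smooth functions\<close>

text \<open>\<open>C\<^sup>k\<close>-regularity of a function on an open subset of a finite-dimensional space.\<close>

fun Ck_on :: "nat \<Rightarrow> 'a::real_normed_vector set \<Rightarrow> ('a \<Rightarrow> 'b::real_normed_vector) \<Rightarrow> bool" where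
  "Ck_on 0 S f \<longleftrightarrow> continuous_on S f"
| "Ck_on (Suc k) S f \<longleftrightarrow>
     (\<forall>x\<in>S. f differentiable (at x)) \<and> (\<forall>v. Ck_on k S (\<lambda>x. frechet_derivative f (at x) v))"

definition smooth_on :: "'a::real_normed_vector set \<Rightarrow> ('a \<Rightarrow> 'b::real_normed_vector) \<Rightarrow> bool" where
  "smooth_on S f \<longleftrightarrow> (\<forall>k. Ck_on k S f)"

text \<open>
  An atlas is a set of charts \<open>(U, \<phi>)\<close>, where only \<open>\<phi>\<close> on \<open>U\<close> matters.  The model space is a
  finite-dimensional real inner product space rather than an \<open>euclidean_space\<close>, because the latter
  class excludes dimension 0 (where Lie algebroids are Lie algebras).
\<close>

type_synonym ('m, 'a) atlas = "('m set \<times> ('m \<Rightarrow> 'a)) set"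

definition smooth_manifold ::
    "('m::{t2_space, second_countable_topology}, 'a::real_inner) atlas \<Rightarrow> bool" where
  "smooth_manifold atl \<longleftrightarrow>
     (\<exists>Bs. finite Bs \<and> span Bs = (UNIV :: 'a set)) \<and>
     (\<Union>(U, \<phi>)\<in>atl. U) = UNIV \<and>
     (\<forall>(U, \<phi>)\<in>atl. open U \<and> open (\<phi> ` U) \<and> inj_on \<phi> U \<and>
        homeomorphism U (\<phi> ` U) \<phi> (inv_into U \<phi>)) \<and>
     (\<forall>(U, \<phi>)\<in>atl. \<forall>(V, \<psi>)\<in>atl. smooth_on (\<phi> ` (U \<inter> V)) (\<psi> \<circ> inv_into U \<phi>))"

definition smooth_fun_on ::
    "('m, 'a::real_inner) atlas \<Rightarrow> 'm set \<Rightarrow> ('m \<Rightarrow> 'k::real_normed_vector) \<Rightarrow> bool" where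
  "smooth_fun_on atl U f \<longleftrightarrow> (\<forall>(V, \<phi>)\<in>atl. smooth_on (\<phi> ` (U \<inter> V)) (f \<circ> inv_into V \<phi>))"

definition smooth_funs :: "('m, 'a::real_inner) atlas \<Rightarrow> ('m \<Rightarrow> 'k::real_normed_field) set" where
  "smooth_funs atl = {f. smooth_fun_on atl UNIV f}"

text \<open>
  An element of \<open>T\<^sub>x M \<otimes> \<K>\<close>: a \<open>\<K>\<close>-linear derivation at \<open>x\<close> of the algebra of smooth
  \<open>\<K>\<close>-valued functions.
\<close>

definition tangent_vector ::
    "('m, 'a::real_inner) atlas \<Rightarrow> 'm \<Rightarrow> (('m \<Rightarrow> 'k::real_normed_field) \<Rightarrow> 'k) \<Rightarrow> bool" where
  "tangent_vector atl x X \<longleftrightarrow>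
     (\<forall>f\<in>smooth_funs atl. \<forall>g\<in>smooth_funs atl.
        X (f + g) = X f + X g \<and> X (f * g) = X f * g x + f x * X g) \<and>
     (\<forall>c. \<forall>f\<in>smooth_funs atl. X (\<lambda>y. c * f y) = c * X f)"

section \<open>Vector bundles\<close>

text \<open>
  The fibres are subspaces of one \<open>\<K>\<close>-vector space \<open>('v, scl)\<close>, which carries no topology and
  merely hosts them (the direct sum of all fibres will always do).  The smooth structure is given
  by local frames: a frame \<open>(V, es)\<close> consists of sections \<open>es\<close> over an open set \<open>V\<close> which form a
  basis of every fibre over \<open>V\<close>, and different frames are related by smooth functions.  The rank is
  locally constant.
\<close>

record ('m, 'k, 'v) vbundle =
  scl :: "'k \<Rightarrow> 'v \<Rightarrow> 'v"
  fib :: "'m \<Rightarrow> 'v set"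
  frames :: "('m set \<times> ('m \<Rightarrow> 'v) list) set"

definition basis_at :: "('k::field \<Rightarrow> 'v::ab_group_add \<Rightarrow> 'v) \<Rightarrow> ('m \<Rightarrow> 'v) list \<Rightarrow> 'm \<Rightarrow> 'v set \<Rightarrow> bool" where
  "basis_at s es x F \<longleftrightarrow>
     distinct (map (\<lambda>e. e x) es) \<and> \<not> module.dependent s ((\<lambda>e. e x) ` set es) \<and>
     module.span s ((\<lambda>e. e x) ` set es) = F"

definition smooth_section_on ::
    "('m, 'a::real_inner) atlas \<Rightarrow> ('m, 'k::real_normed_field, 'v::ab_group_add, 'z) vbundle_scheme
     \<Rightarrow> 'm set \<Rightarrow> ('m \<Rightarrow> 'v) \<Rightarrow> bool" where
  "smooth_section_on atl E U s \<longleftrightarrow>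
     (\<forall>x\<in>U. s x \<in> fib E x) \<and>
     (\<forall>(V, es)\<in>frames E. \<exists>c. (\<forall>i<length es. smooth_fun_on atl (U \<inter> V) (c i)) \<and>
        (\<forall>x\<in>U \<inter> V. s x = (\<Sum>i<length es. scl E (c i x) ((es ! i) x))))"

definition vector_bundle ::
    "('m::topological_space, 'a::real_inner) atlas
     \<Rightarrow> ('m, 'k::real_normed_field, 'v::ab_group_add, 'z) vbundle_scheme \<Rightarrow> bool" where
  "vector_bundle atl E \<longleftrightarrow>
     vector_space (scl E) \<and>
     (\<forall>x. module.subspace (scl E) (fib E x)) \<and>
     (\<Union>(V, es)\<in>frames E. V) = UNIV \<and>
     (\<forall>(V, es)\<in>frames E. open V \<and> (\<forall>x\<in>V. basis_at (scl E) es x (fib E x)) \<and>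
        (\<forall>e\<in>set es. smooth_section_on atl E V e))"

definition secs ::
    "('m, 'a::real_inner) atlas \<Rightarrow> ('m, 'k::real_normed_field, 'v::ab_group_add, 'z) vbundle_scheme
     \<Rightarrow> ('m \<Rightarrow> 'v) set" where
  "secs atl E = {s. smooth_section_on atl E UNIV s}"

definition smul :: "('m, 'k, 'v, 'z) vbundle_scheme \<Rightarrow> ('m \<Rightarrow> 'k) \<Rightarrow> ('m \<Rightarrow> 'v) \<Rightarrow> 'm \<Rightarrow> 'v" where
  "smul E f s = (\<lambda>x. scl E (f x) (s x))"

definition bundle_map ::
    "('m::topological_space, 'a::real_inner) atlas
     \<Rightarrow> ('m, 'k::real_normed_field, 'v::ab_group_add, 'y) vbundle_scheme
     \<Rightarrow> ('m, 'k, 'w::ab_group_add, 'z) vbundle_scheme \<Rightarrow> ('m \<Rightarrow> 'v \<Rightarrow> 'w) \<Rightarrow> bool" where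
  "bundle_map atl E F h \<longleftrightarrow>
     (\<forall>x. \<forall>v\<in>fib E x. h x v \<in> fib F x \<and> (\<forall>w\<in>fib E x. h x (v + w) = h x v + h x w) \<and>
        (\<forall>c. h x (scl E c v) = scl F c (h x v))) \<and>
     (\<forall>U s. open U \<longrightarrow> smooth_section_on atl E U s \<longrightarrow> smooth_section_on atl F U (\<lambda>x. h x (s x)))"

text \<open>A family of subspaces \<open>S x \<subseteq> E\<^sub>x\<close> that is locally spanned by a frame of smooth sections of \<open>E\<close>.\<close>

definition subbundle ::
    "('m::topological_space, 'a::real_inner) atlas
     \<Rightarrow> ('m, 'k::real_normed_field, 'v::ab_group_add, 'z) vbundle_scheme \<Rightarrow> ('m \<Rightarrow> 'v set) \<Rightarrow> bool" where
  "subbundle atl E S \<longleftrightarrow>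
     (\<forall>x. \<exists>U es. open U \<and> x \<in> U \<and> (\<forall>e\<in>set es. smooth_section_on atl E U e) \<and>
        (\<forall>y\<in>U. basis_at (scl E) es y (S y)))"

definition secs_in ::
    "('m, 'a::real_inner) atlas \<Rightarrow> ('m, 'k::real_normed_field, 'v::ab_group_add, 'z) vbundle_scheme
     \<Rightarrow> ('m \<Rightarrow> 'v set) \<Rightarrow> ('m \<Rightarrow> 'v) set" where
  "secs_in atl E S = {s \<in> secs atl E. \<forall>x. s x \<in> S x}"

section \<open>Lie algebroids, Lie pairs and their modules\<close>

text \<open>The anchor sends \<open>v \<in> L\<^sub>x\<close> to a derivation at \<open>x\<close>; the bracket lives on global sections.\<close>

record ('m, 'k, 'l) lie_algebroid = "('m, 'k, 'l) vbundle" +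
  anchor :: "'m \<Rightarrow> 'l \<Rightarrow> ('m \<Rightarrow> 'k) \<Rightarrow> 'k"
  bracket :: "('m \<Rightarrow> 'l) \<Rightarrow> ('m \<Rightarrow> 'l) \<Rightarrow> 'm \<Rightarrow> 'l"

definition der :: "('m, 'k, 'l) lie_algebroid \<Rightarrow> ('m \<Rightarrow> 'l) \<Rightarrow> ('m \<Rightarrow> 'k) \<Rightarrow> 'm \<Rightarrow> 'k" where
  "der L l f = (\<lambda>x. anchor L x (l x) f)"

definition is_lie_algebroid ::
    "('m::topological_space, 'a::real_inner) atlas
     \<Rightarrow> ('m, 'k::real_normed_field, 'l::ab_group_add) lie_algebroid \<Rightarrow> bool" where
  "is_lie_algebroid atl L \<longleftrightarrow>
     vector_bundle atl L \<and>
     (\<forall>x. \<forall>v\<in>fib L x. tangent_vector atl x (anchor L x v)) \<and>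
     (\<forall>x. \<forall>v\<in>fib L x. \<forall>f\<in>smooth_funs atl.
        (\<forall>w\<in>fib L x. anchor L x (v + w) f = anchor L x v f + anchor L x w f) \<and>
        (\<forall>c. anchor L x (scl L c v) f = c * anchor L x v f)) \<and>
     (\<forall>l\<in>secs atl L. \<forall>f\<in>smooth_funs atl. der L l f \<in> smooth_funs atl) \<and>
     (\<forall>l\<in>secs atl L. \<forall>l'\<in>secs atl L. bracket L l l' \<in> secs atl L \<and>
        bracket L l l' = - bracket L l' l \<and>
        (\<forall>l''\<in>secs atl L. bracket L l (l' + l'') = bracket L l l' + bracket L l l'' \<and>
           bracket L l (bracket L l' l'') + bracket L l' (bracket L l'' l)
             + bracket L l'' (bracket L l l') = 0) \<and>
        (\<forall>c. bracket L l (\<lambda>x. scl L c (l' x)) = (\<lambda>x. scl L c (bracket L l l' x))) \<and>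
        (\<forall>f\<in>smooth_funs atl.
           bracket L l (smul L f l') = smul L f (bracket L l l') + smul L (der L l f) l' \<and>
           der L (bracket L l l') f = der L l (der L l' f) - der L l' (der L l f)))"

definition lie_pair ::
    "('m::topological_space, 'a::real_inner) atlas
     \<Rightarrow> ('m, 'k::real_normed_field, 'l::ab_group_add) lie_algebroid \<Rightarrow> ('m \<Rightarrow> 'l set) \<Rightarrow> bool" where
  "lie_pair atl L A \<longleftrightarrow>
     is_lie_algebroid atl L \<and> subbundle atl L A \<and>
     (\<forall>a\<in>secs_in atl L A. \<forall>a'\<in>secs_in atl L A. bracket L a a' \<in> secs_in atl L A)"

text \<open>
  \<open>Q\<close>, with projection \<open>q\<close>, is (a model of) the quotient bundle \<open>L/A\<close>.  A splitting of
  \<open>0 \<rightarrow> A \<rightarrow> L \<rightarrow> L/A \<rightarrow> 0\<close> is a bundle map \<open>j\<close> with \<open>q \<circ> j = id\<close>.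
\<close>

definition quotient_bundle ::
    "('m::topological_space, 'a::real_inner) atlas
     \<Rightarrow> ('m, 'k::real_normed_field, 'l::ab_group_add, 'z) vbundle_scheme \<Rightarrow> ('m \<Rightarrow> 'l set)
     \<Rightarrow> ('m, 'k, 'q::ab_group_add) vbundle \<Rightarrow> ('m \<Rightarrow> 'l \<Rightarrow> 'q) \<Rightarrow> bool" where
  "quotient_bundle atl L A Q q \<longleftrightarrow>
     vector_bundle atl Q \<and> bundle_map atl L Q q \<and>
     (\<forall>x. q x ` fib L x = fib Q x \<and> {v \<in> fib L x. q x v = 0} = A x)"

definition splitting ::
    "('m::topological_space, 'a::real_inner) atlas
     \<Rightarrow> ('m, 'k::real_normed_field, 'l::ab_group_add, 'z) vbundle_scheme
     \<Rightarrow> ('m, 'k, 'q::ab_group_add) vbundle \<Rightarrow> ('m \<Rightarrow> 'l \<Rightarrow> 'q) \<Rightarrow> ('m \<Rightarrow> 'q \<Rightarrow> 'l) \<Rightarrow> bool" where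
  "splitting atl L Q q j \<longleftrightarrow>
     bundle_map atl Q L j \<and> (\<forall>x. \<forall>w\<in>fib Q x. q x (j x w) = w)"

definition app :: "('m \<Rightarrow> 'v \<Rightarrow> 'w) \<Rightarrow> ('m \<Rightarrow> 'v) \<Rightarrow> 'm \<Rightarrow> 'w" where
  "app h s = (\<lambda>x. h x (s x))"

definition compl :: "('m, 'k, 'q) vbundle \<Rightarrow> ('m \<Rightarrow> 'q \<Rightarrow> 'l) \<Rightarrow> 'm \<Rightarrow> 'l set" where
  "compl Q j = (\<lambda>x. j x ` fib Q x)"

definition projB :: "('m \<Rightarrow> 'l \<Rightarrow> 'q) \<Rightarrow> ('m \<Rightarrow> 'q \<Rightarrow> 'l) \<Rightarrow> ('m \<Rightarrow> 'l) \<Rightarrow> 'm \<Rightarrow> 'l" where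
  "projB q j l = app j (app q l)"

definition projA :: "('m \<Rightarrow> 'l::ab_group_add \<Rightarrow> 'q) \<Rightarrow> ('m \<Rightarrow> 'q \<Rightarrow> 'l) \<Rightarrow> ('m \<Rightarrow> 'l) \<Rightarrow> 'm \<Rightarrow> 'l" where
  "projA q j l = l - projB q j l"

text \<open>
  A connection along a \<open>C\<^sup>\<infinity>(M)\<close>-module \<open>X\<close> of sections of \<open>L\<close>: an \<open>L\<close>-connection for
  \<open>X = \<Gamma>(L)\<close> and an \<open>A\<close>-connection for \<open>X = \<Gamma>(A)\<close>.
\<close>

definition lie_connection ::
    "('m, 'a::real_inner) atlas \<Rightarrow> ('m, 'k::real_normed_field, 'l::ab_group_add) lie_algebroid
     \<Rightarrow> ('m \<Rightarrow> 'l) set \<Rightarrow> ('m, 'k, 'e::ab_group_add) vbundle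
     \<Rightarrow> (('m \<Rightarrow> 'l) \<Rightarrow> ('m \<Rightarrow> 'e) \<Rightarrow> 'm \<Rightarrow> 'e) \<Rightarrow> bool" where
  "lie_connection atl L X E D \<longleftrightarrow>
     (\<forall>l\<in>X. \<forall>e\<in>secs atl E. D l e \<in> secs atl E \<and>
        (\<forall>l'\<in>X. D (l + l') e = D l e + D l' e) \<and>
        (\<forall>e'\<in>secs atl E. D l (e + e') = D l e + D l e') \<and>
        (\<forall>f\<in>smooth_funs atl. D (smul L f l) e = smul E f (D l e) \<and>
           D l (smul E f e) = smul E f (D l e) + smul E (der L l f) e))"

definition conn_curv ::
    "('m, 'k, 'l) lie_algebroid \<Rightarrow> (('m \<Rightarrow> 'l) \<Rightarrow> ('m \<Rightarrow> 'e) \<Rightarrow> 'm \<Rightarrow> 'e::ab_group_add)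
     \<Rightarrow> ('m \<Rightarrow> 'l) \<Rightarrow> ('m \<Rightarrow> 'l) \<Rightarrow> ('m \<Rightarrow> 'e) \<Rightarrow> 'm \<Rightarrow> 'e" where
  "conn_curv L D l l' e = D l (D l' e) - D l' (D l e) - D (bracket L l l') e"

definition lie_module ::
    "('m::topological_space, 'a::real_inner) atlas
     \<Rightarrow> ('m, 'k::real_normed_field, 'l::ab_group_add) lie_algebroid \<Rightarrow> ('m \<Rightarrow> 'l set)
     \<Rightarrow> ('m, 'k, 'e::ab_group_add) vbundle \<Rightarrow> (('m \<Rightarrow> 'l) \<Rightarrow> ('m \<Rightarrow> 'e) \<Rightarrow> 'm \<Rightarrow> 'e) \<Rightarrow> bool" where
  "lie_module atl L A E act \<longleftrightarrow>
     vector_bundle atl E \<and> lie_connection atl L (secs_in atl L A) E act \<and>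
     (\<forall>a\<in>secs_in atl L A. \<forall>a'\<in>secs_in atl L A. \<forall>e\<in>secs atl E. conn_curv L act a a' e = 0)"

definition extending_connection ::
    "('m, 'a::real_inner) atlas \<Rightarrow> ('m, 'k::real_normed_field, 'l::ab_group_add) lie_algebroid
     \<Rightarrow> ('m \<Rightarrow> 'l set) \<Rightarrow> ('m, 'k, 'e::ab_group_add) vbundle
     \<Rightarrow> (('m \<Rightarrow> 'l) \<Rightarrow> ('m \<Rightarrow> 'e) \<Rightarrow> 'm \<Rightarrow> 'e) \<Rightarrow> (('m \<Rightarrow> 'l) \<Rightarrow> ('m \<Rightarrow> 'e) \<Rightarrow> 'm \<Rightarrow> 'e) \<Rightarrow> bool" where
  "extending_connection atl L A E act nabla \<longleftrightarrow>
     lie_connection atl L (secs atl L) E nabla \<and>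
     (\<forall>a\<in>secs_in atl L A. \<forall>e\<in>secs atl E. nabla a e = act a e)"

section \<open>Forms\<close>

definition signed :: "nat \<Rightarrow> 'w::ab_group_add \<Rightarrow> 'w" where
  "signed n w = (if even n then w else - w)"

definition delete_at :: "nat \<Rightarrow> 'x list \<Rightarrow> 'x list" where
  "delete_at i xs = take i xs @ drop (Suc i) xs"

definition on_lists :: "'x set \<Rightarrow> ('x list \<Rightarrow> 'w::zero) \<Rightarrow> 'x list \<Rightarrow> 'w" where
  "on_lists X \<omega> = (\<lambda>xs. if set xs \<subseteq> X then \<omega> xs else 0)"

text \<open>
  Forms on the bundle with module of sections \<open>X\<close>, with values in the module \<open>Y\<close>, both modules
  over the ring \<open>C\<close>: alternating \<open>C\<close>-multilinear maps, as functions on lists of arguments.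
  Such a function comprises components of all form degrees.
\<close>

definition forms ::
    "'c set \<Rightarrow> 'x::ab_group_add set \<Rightarrow> ('c \<Rightarrow> 'x \<Rightarrow> 'x) \<Rightarrow> 'w::ab_group_add set \<Rightarrow> ('c \<Rightarrow> 'w \<Rightarrow> 'w)
     \<Rightarrow> ('x list \<Rightarrow> 'w) set" where
  "forms C X sX Y sY = {\<omega>. \<omega> = on_lists X \<omega> \<and>
     (\<forall>xs. set xs \<subseteq> X \<longrightarrow> \<omega> xs \<in> Y \<and>
        (\<forall>i<length xs. \<forall>x\<in>X. \<forall>y\<in>X. \<omega> (xs[i := x + y]) = \<omega> (xs[i := x]) + \<omega> (xs[i := y])) \<and>
        (\<forall>i<length xs. \<forall>x\<in>X. \<forall>f\<in>C. \<omega> (xs[i := sX f x]) = sY f (\<omega> (xs[i := x]))) \<and>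
        (\<not> distinct xs \<longrightarrow> \<omega> xs = 0))}"

definition of_degree :: "nat \<Rightarrow> ('x list \<Rightarrow> 'w::zero) set \<Rightarrow> ('x list \<Rightarrow> 'w) set" where
  "of_degree k F = {\<omega> \<in> F. \<forall>xs. \<omega> xs \<noteq> 0 \<longrightarrow> length xs = k}"

definition form0 :: "'w::zero \<Rightarrow> 'x list \<Rightarrow> 'w" where
  "form0 w = (\<lambda>xs. if xs = [] then w else 0)"

definition contract :: "'x \<Rightarrow> ('x list \<Rightarrow> 'w) \<Rightarrow> 'x list \<Rightarrow> 'w" where
  "contract x \<omega> = (\<lambda>xs. \<omega> (x # xs))"

text \<open>
  The wedge product (with respect to a pairing of the values) as a sum over shuffles without
  factorials: the arguments with index in \<open>S\<close> go to the first factor, and the exponent counts the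
  inversions.
\<close>

definition wedge ::
    "('u \<Rightarrow> 'v \<Rightarrow> 'w::ab_group_add) \<Rightarrow> ('x list \<Rightarrow> 'u) \<Rightarrow> ('x list \<Rightarrow> 'v) \<Rightarrow> 'x list \<Rightarrow> 'w" where
  "wedge pair \<omega> \<eta> = (\<lambda>xs. \<Sum>S\<in>Pow {..<length xs}.
     signed (card {(i, j). i < j \<and> i \<in> {..<length xs} - S \<and> j \<in> S})
       (pair (\<omega> (nths xs S)) (\<eta> (nths xs (- S)))))"

text \<open>The Chevalley--Eilenberg differential, for values acted upon through \<open>act\<close>.\<close>

definition ce_diff ::
    "'x set \<Rightarrow> ('x \<Rightarrow> 'x \<Rightarrow> 'x) \<Rightarrow> ('x \<Rightarrow> 'w \<Rightarrow> 'w::ab_group_add) \<Rightarrow> ('x list \<Rightarrow> 'w) \<Rightarrow> 'x list \<Rightarrow> 'w" where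
  "ce_diff X br act \<omega> = on_lists X (\<lambda>xs.
     (\<Sum>i<length xs. signed i (act (xs ! i) (\<omega> (delete_at i xs)))) +
     (\<Sum>(i, j) | i < j \<and> j < length xs.
        signed (i + j) (\<omega> (br (xs ! i) (xs ! j) # delete_at i (delete_at j xs)))))"

text \<open>
  Bidegrees for forms on \<open>L = A \<oplus> B\<close>, where \<open>XA = \<Gamma>(A)\<close> and \<open>XB = \<Gamma>(B)\<close>: a form has bidegree
  \<open>(p, q)\<close> if it vanishes on all families of sections of \<open>A\<close> and \<open>B\<close> except those with \<open>p\<close>
  members in \<open>A\<close> and \<open>q\<close> members in \<open>B\<close>.  \<open>bipart\<close> extracts the component of bidegree \<open>(p, q)\<close>.
\<close>

definition bideg ::
    "'x set \<Rightarrow> 'x set \<Rightarrow> ('x list \<Rightarrow> 'w::zero) set \<Rightarrow> nat \<Rightarrow> nat \<Rightarrow> ('x list \<Rightarrow> 'w) set" where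
  "bideg XA XB F p q = {\<omega> \<in> F. \<forall>as bs. set as \<subseteq> XA \<longrightarrow> set bs \<subseteq> XB \<longrightarrow> \<omega> (as @ bs) \<noteq> 0 \<longrightarrow>
     length as = p \<and> length bs = q}"

definition bipart ::
    "'x set \<Rightarrow> ('x \<Rightarrow> 'x) \<Rightarrow> ('x \<Rightarrow> 'x) \<Rightarrow> nat \<Rightarrow> nat \<Rightarrow> ('x list \<Rightarrow> 'w::ab_group_add) \<Rightarrow> 'x list \<Rightarrow> 'w" where
  "bipart X pA pB p q \<omega> = on_lists X (\<lambda>xs. if length xs = p + q
     then \<Sum>S | S \<subseteq> {..<length xs} \<and> card S = p.
       \<omega> (map (\<lambda>i. if i \<in> S then pA (xs ! i) else pB (xs ! i)) [0..<length xs])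
     else 0)"

text \<open>
  The part of bidegree \<open>(r, s)\<close>, where \<open>r + s = 1\<close>, of an operator \<open>D\<close> of total degree 1: the
  component of \<open>D \<omega>\<close> in form degree \<open>n\<close> is assembled from the components of \<open>\<omega>\<close> of bidegree
  \<open>(p, n - 1 - p)\<close>.
\<close>

definition op_part ::
    "'x set \<Rightarrow> ('x \<Rightarrow> 'x) \<Rightarrow> ('x \<Rightarrow> 'x) \<Rightarrow> nat \<Rightarrow> nat \<Rightarrow> (('x list \<Rightarrow> 'w) \<Rightarrow> 'x list \<Rightarrow> 'w)
     \<Rightarrow> ('x list \<Rightarrow> 'w::ab_group_add) \<Rightarrow> 'x list \<Rightarrow> 'w" where
  "op_part X pA pB r s D \<omega> = (\<lambda>xs. \<Sum>p<length xs.
     bipart X pA pB (p + r) (length xs - 1 - p + s)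
       (D (bipart X pA pB p (length xs - 1 - p) \<omega>)) xs)"

section \<open>Bigraded DG-structures\<close>

text \<open>
  A bigraded object is the family of its homogeneous components.  Maps are considered on
  homogeneous elements and have the value \<open>0\<close> at all other arguments.  All bigradings occurring
  here vanish outside non-negative bidegrees.
\<close>

definition homog :: "(nat \<Rightarrow> nat \<Rightarrow> 'b set) \<Rightarrow> 'b set" where
  "homog G = (\<Union>p q. G p q)"

definition on_homog :: "(nat \<Rightarrow> nat \<Rightarrow> 'b set) \<Rightarrow> ('b \<Rightarrow> 'b::zero) \<Rightarrow> 'b \<Rightarrow> 'b" where
  "on_homog G F = (\<lambda>\<omega>. if \<omega> \<in> homog G then F \<omega> else 0)"

record 'c ddg_alg =
  acomp :: "nat \<Rightarrow> nat \<Rightarrow> 'c set"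
  amult :: "'c \<Rightarrow> 'c \<Rightarrow> 'c"
  adbar :: "'c \<Rightarrow> 'c"
  ad :: "'c \<Rightarrow> 'c"

record ('c, 'b) dg_mod =
  mcomp :: "nat \<Rightarrow> nat \<Rightarrow> 'b set"
  mact :: "'c \<Rightarrow> 'b \<Rightarrow> 'b"
  mdbar :: "'b \<Rightarrow> 'b"

definition bigraded_map ::
    "('c, 'b::ab_group_add) dg_mod \<Rightarrow> nat \<Rightarrow> nat \<Rightarrow> ('b \<Rightarrow> 'b) \<Rightarrow> bool" where
  "bigraded_map \<mm> r s F \<longleftrightarrow>
     F = on_homog (mcomp \<mm>) F \<and>
     (\<forall>p q. \<forall>\<omega>\<in>mcomp \<mm> p q. F \<omega> \<in> mcomp \<mm> (p + r) (q + s) \<and>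
        (\<forall>\<eta>\<in>mcomp \<mm> p q. F (\<omega> + \<eta>) = F \<omega> + F \<eta>))"

definition dg_connection ::
    "'c ddg_alg \<Rightarrow> ('c, 'b::ab_group_add) dg_mod \<Rightarrow> ('b \<Rightarrow> 'b) \<Rightarrow> bool" where
  "dg_connection \<aa> \<mm> d \<longleftrightarrow>
     bigraded_map \<mm> 0 1 d \<and>
     (\<forall>p q p' q'. \<forall>\<alpha>\<in>acomp \<aa> p q. \<forall>\<omega>\<in>mcomp \<mm> p' q'.
        d (mact \<mm> \<alpha> \<omega>) = mact \<mm> (ad \<aa> \<alpha>) \<omega> + signed (p + q) (mact \<mm> \<alpha> (d \<omega>)))"

definition dg_curvature :: "('c, 'b::ab_group_add) dg_mod \<Rightarrow> ('b \<Rightarrow> 'b) \<Rightarrow> 'b \<Rightarrow> 'b" where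
  "dg_curvature \<mm> d = (\<lambda>\<omega>. - (d (mdbar \<mm> \<omega>) + mdbar \<mm> (d \<omega>)))"

text \<open>\<open>Hom\<^bsup>r,s\<^esup>(\<mm>, \<mm>)\<close>, with the Koszul sign rule for the total degree, and its differential.\<close>

definition dg_Hom ::
    "'c ddg_alg \<Rightarrow> ('c, 'b::ab_group_add) dg_mod \<Rightarrow> nat \<Rightarrow> nat \<Rightarrow> ('b \<Rightarrow> 'b) set" where
  "dg_Hom \<aa> \<mm> r s = {F. bigraded_map \<mm> r s F \<and>
     (\<forall>p q p' q'. \<forall>\<alpha>\<in>acomp \<aa> p q. \<forall>\<omega>\<in>mcomp \<mm> p' q'.
        F (mact \<mm> \<alpha> \<omega>) = signed ((r + s) * (p + q)) (mact \<mm> \<alpha> (F \<omega>)))}"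

definition dg_commutator :: "('c, 'b::ab_group_add) dg_mod \<Rightarrow> nat \<Rightarrow> ('b \<Rightarrow> 'b) \<Rightarrow> 'b \<Rightarrow> 'b" where
  "dg_commutator \<mm> n F = (\<lambda>\<omega>. mdbar \<mm> (F \<omega>) - signed n (F (mdbar \<mm> \<omega>)))"

text \<open>
  DG-module maps \<open>\<mm> \<rightarrow> \<mm>(1)[1]\<close>.  The two shifts have total degree 2, so no signs appear in
  the action and the differential of \<open>\<mm>(1)[1]\<close>.
\<close>

definition dg_map_shift11 ::
    "'c ddg_alg \<Rightarrow> ('c, 'b::ab_group_add) dg_mod \<Rightarrow> ('b \<Rightarrow> 'b) \<Rightarrow> bool" where
  "dg_map_shift11 \<aa> \<mm> F \<longleftrightarrow>
     bigraded_map \<mm> 1 1 F \<and>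
     (\<forall>\<alpha>\<in>homog (acomp \<aa>). \<forall>\<omega>\<in>homog (mcomp \<mm>). F (mact \<mm> \<alpha> \<omega>) = mact \<mm> \<alpha> (F \<omega>)) \<and>
     (\<forall>\<omega>\<in>homog (mcomp \<mm>). F (mdbar \<mm> \<omega>) = mdbar \<mm> (F \<omega>))"

text \<open>Equality of cohomology classes; the class of a cocycle \<open>z\<close> is \<open>cohomologous Z B `` {z}\<close>.\<close>

definition cohomologous :: "'x::ab_group_add set \<Rightarrow> 'x set \<Rightarrow> ('x \<times> 'x) set" where
  "cohomologous Z B = {(x, y). x \<in> Z \<and> y \<in> Z \<and> y - x \<in> B}"

definition Hom_cohom ::
    "'c ddg_alg \<Rightarrow> ('c, 'b::ab_group_add) dg_mod \<Rightarrow> (('b \<Rightarrow> 'b) \<times> ('b \<Rightarrow> 'b)) set" where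
  "Hom_cohom \<aa> \<mm> = cohomologous {F \<in> dg_Hom \<aa> \<mm> 1 1. dg_commutator \<mm> 2 F = 0}
     (dg_commutator \<mm> 1 ` dg_Hom \<aa> \<mm> 0 1)"

text \<open>The class \<open>\<alpha>\<^sub>\<mm>\<close> in \<open>H\<^sup>1(Hom\<^bsup>\<bullet>,1\<^esup>(\<mm>, \<mm>))\<close>: the common class of the curvatures of all connections.\<close>

definition dg_atiyah_class :: "'c ddg_alg \<Rightarrow> ('c, 'b::ab_group_add) dg_mod \<Rightarrow> ('b \<Rightarrow> 'b) set" where
  "dg_atiyah_class \<aa> \<mm> =
     (THE c. \<exists>d. dg_connection \<aa> \<mm> d \<and> c = Hom_cohom \<aa> \<mm> `` {dg_curvature \<mm> d})"

section \<open>The DG-structures associated with a Lie pair\<close>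

text \<open>\<open>\<Gamma>(\<Lambda>\<^sup>p A\<^sup>\<or> \<otimes> \<Lambda>\<^sup>q B\<^sup>\<or>) \<otimes> Y\<close> inside the \<open>Y\<close>-valued forms on \<open>L\<close>.\<close>

definition lp_comp ::
    "('m, 'a::real_inner) atlas \<Rightarrow> ('m, 'k::real_normed_field, 'l::ab_group_add) lie_algebroid
     \<Rightarrow> ('m \<Rightarrow> 'l set) \<Rightarrow> ('m, 'k, 'q) vbundle \<Rightarrow> ('m \<Rightarrow> 'q \<Rightarrow> 'l)
     \<Rightarrow> 'w::ab_group_add set \<Rightarrow> (('m \<Rightarrow> 'k) \<Rightarrow> 'w \<Rightarrow> 'w) \<Rightarrow> nat \<Rightarrow> nat \<Rightarrow> (('m \<Rightarrow> 'l) list \<Rightarrow> 'w) set" where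
  "lp_comp atl L A Q j Y sY =
     bideg (secs_in atl L A) (secs_in atl L (compl Q j)) (forms (smooth_funs atl) (secs atl L) (smul L) Y sY)"

definition lp_alg ::
    "('m, 'a::real_inner) atlas \<Rightarrow> ('m, 'k::real_normed_field, 'l::ab_group_add) lie_algebroid
     \<Rightarrow> ('m \<Rightarrow> 'l set) \<Rightarrow> ('m, 'k, 'q) vbundle \<Rightarrow> ('m \<Rightarrow> 'l \<Rightarrow> 'q) \<Rightarrow> ('m \<Rightarrow> 'q \<Rightarrow> 'l)
     \<Rightarrow> (('m \<Rightarrow> 'l) list \<Rightarrow> 'm \<Rightarrow> 'k) ddg_alg" where
  "lp_alg atl L A Q q j =
     (let G = lp_comp atl L A Q j (smooth_funs atl) (*);
          d = (\<lambda>r s. on_homog G (op_part (secs atl L) (projA q j) (projB q j) r s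
                 (ce_diff (secs atl L) (bracket L) (der L))))
      in \<lparr>acomp = G, amult = wedge (*), adbar = d 1 0, ad = d 0 1\<rparr>)"

definition lp_d ::
    "('m, 'a::real_inner) atlas \<Rightarrow> ('m, 'k::real_normed_field, 'l::ab_group_add) lie_algebroid
     \<Rightarrow> ('m \<Rightarrow> 'l set) \<Rightarrow> ('m, 'k, 'q) vbundle \<Rightarrow> ('m \<Rightarrow> 'l \<Rightarrow> 'q) \<Rightarrow> ('m \<Rightarrow> 'q \<Rightarrow> 'l)
     \<Rightarrow> ('m, 'k, 'e::ab_group_add) vbundle \<Rightarrow> (('m \<Rightarrow> 'l) \<Rightarrow> ('m \<Rightarrow> 'e) \<Rightarrow> 'm \<Rightarrow> 'e) \<Rightarrow> nat \<Rightarrow> nat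
     \<Rightarrow> (('m \<Rightarrow> 'l) list \<Rightarrow> 'm \<Rightarrow> 'e) \<Rightarrow> ('m \<Rightarrow> 'l) list \<Rightarrow> 'm \<Rightarrow> 'e" where
  "lp_d atl L A Q q j E nabla r s =
     on_homog (lp_comp atl L A Q j (secs atl E) (smul E))
       (op_part (secs atl L) (projA q j) (projB q j) r s (ce_diff (secs atl L) (bracket L) nabla))"

definition lp_mod ::
    "('m, 'a::real_inner) atlas \<Rightarrow> ('m, 'k::real_normed_field, 'l::ab_group_add) lie_algebroid
     \<Rightarrow> ('m \<Rightarrow> 'l set) \<Rightarrow> ('m, 'k, 'q) vbundle \<Rightarrow> ('m \<Rightarrow> 'l \<Rightarrow> 'q) \<Rightarrow> ('m \<Rightarrow> 'q \<Rightarrow> 'l)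
     \<Rightarrow> ('m, 'k, 'e::ab_group_add) vbundle \<Rightarrow> (('m \<Rightarrow> 'l) \<Rightarrow> ('m \<Rightarrow> 'e) \<Rightarrow> 'm \<Rightarrow> 'e)
     \<Rightarrow> (('m \<Rightarrow> 'l) list \<Rightarrow> 'm \<Rightarrow> 'k, ('m \<Rightarrow> 'l) list \<Rightarrow> 'm \<Rightarrow> 'e) dg_mod" where
  "lp_mod atl L A Q q j E nabla =
     \<lparr>mcomp = lp_comp atl L A Q j (secs atl E) (smul E), mact = wedge (smul E),
      mdbar = lp_d atl L A Q q j E nabla 1 0\<rparr>"

section \<open>The Atiyah class of a Lie pair\<close>

definition lin_maps ::
    "'c set \<Rightarrow> 'x::ab_group_add set \<Rightarrow> ('c \<Rightarrow> 'x \<Rightarrow> 'x) \<Rightarrow> 'w::ab_group_add set \<Rightarrow> ('c \<Rightarrow> 'w \<Rightarrow> 'w)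
     \<Rightarrow> ('x \<Rightarrow> 'w) set" where
  "lin_maps C X sX Y sY = {h. (\<forall>x. x \<notin> X \<longrightarrow> h x = 0) \<and>
     (\<forall>x\<in>X. h x \<in> Y \<and> (\<forall>y\<in>X. h (x + y) = h x + h y) \<and> (\<forall>f\<in>C. h (sX f x) = sY f (h x)))}"

definition end_secs ::
    "('m, 'a::real_inner) atlas \<Rightarrow> ('m, 'k::real_normed_field, 'e::ab_group_add) vbundle
     \<Rightarrow> (('m \<Rightarrow> 'e) \<Rightarrow> 'm \<Rightarrow> 'e) set" where
  "end_secs atl E = lin_maps (smooth_funs atl) (secs atl E) (smul E) (secs atl E) (smul E)"

definition end_smul ::
    "('m, 'k, 'e) vbundle \<Rightarrow> ('m \<Rightarrow> 'k) \<Rightarrow> (('m \<Rightarrow> 'e) \<Rightarrow> 'm \<Rightarrow> 'e) \<Rightarrow> ('m \<Rightarrow> 'e) \<Rightarrow> 'm \<Rightarrow> 'e" where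
  "end_smul E f \<psi> = (\<lambda>e. smul E f (\<psi> e))"

text \<open>\<open>\<Gamma>(Hom(L/A \<otimes> E, E))\<close>, in curried form.\<close>

definition hom_secs ::
    "('m, 'a::real_inner) atlas \<Rightarrow> ('m, 'k::real_normed_field, 'q::ab_group_add) vbundle
     \<Rightarrow> ('m, 'k, 'e::ab_group_add) vbundle \<Rightarrow> (('m \<Rightarrow> 'q) \<Rightarrow> ('m \<Rightarrow> 'e) \<Rightarrow> 'm \<Rightarrow> 'e) set" where
  "hom_secs atl Q E = lin_maps (smooth_funs atl) (secs atl Q) (smul Q) (end_secs atl E) (end_smul E)"

text \<open>The \<open>A\<close>-action \<open>a \<cdot> q(l) = q([a, l])\<close> on \<open>L/A\<close>.\<close>

definition quot_act ::
    "('m, 'a::real_inner) atlas \<Rightarrow> ('m, 'k::real_normed_field, 'l::ab_group_add) lie_algebroid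
     \<Rightarrow> ('m \<Rightarrow> 'l \<Rightarrow> 'q) \<Rightarrow> ('m \<Rightarrow> 'l) \<Rightarrow> ('m \<Rightarrow> 'q) \<Rightarrow> 'm \<Rightarrow> 'q" where
  "quot_act atl L q a w = (THE u. \<exists>l\<in>secs atl L. app q l = w \<and> u = app q (bracket L a l))"

definition hom_act ::
    "('m, 'a::real_inner) atlas \<Rightarrow> ('m, 'k::real_normed_field, 'l::ab_group_add) lie_algebroid
     \<Rightarrow> ('m, 'k, 'q::ab_group_add) vbundle \<Rightarrow> ('m \<Rightarrow> 'l \<Rightarrow> 'q) \<Rightarrow> ('m, 'k, 'e::ab_group_add) vbundle
     \<Rightarrow> (('m \<Rightarrow> 'l) \<Rightarrow> ('m \<Rightarrow> 'e) \<Rightarrow> 'm \<Rightarrow> 'e)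
     \<Rightarrow> ('m \<Rightarrow> 'l) \<Rightarrow> (('m \<Rightarrow> 'q) \<Rightarrow> ('m \<Rightarrow> 'e) \<Rightarrow> 'm \<Rightarrow> 'e) \<Rightarrow> ('m \<Rightarrow> 'q) \<Rightarrow> ('m \<Rightarrow> 'e) \<Rightarrow> 'm \<Rightarrow> 'e" where
  "hom_act atl L Q q E act a \<Phi> = (\<lambda>w e. if w \<in> secs atl Q \<and> e \<in> secs atl E
     then act a (\<Phi> w e) - \<Phi> (quot_act atl L q a w) e - \<Phi> w (act a e) else 0)"

text \<open>\<open>At\<^sup>\<nabla>(a)(q(l), e) = R\<^sup>\<nabla>(a, l) e\<close>, and \<open>At\<^sup>\<nabla>\<close> as a 1-form on \<open>A\<close> with values in
  \<open>Hom(L/A \<otimes> E, E)\<close>.\<close>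

definition At ::
    "('m, 'a::real_inner) atlas \<Rightarrow> ('m, 'k::real_normed_field, 'l::ab_group_add) lie_algebroid
     \<Rightarrow> ('m \<Rightarrow> 'l \<Rightarrow> 'q) \<Rightarrow> (('m \<Rightarrow> 'l) \<Rightarrow> ('m \<Rightarrow> 'e) \<Rightarrow> 'm \<Rightarrow> 'e::ab_group_add)
     \<Rightarrow> ('m \<Rightarrow> 'l) \<Rightarrow> ('m \<Rightarrow> 'q) \<Rightarrow> ('m \<Rightarrow> 'e) \<Rightarrow> 'm \<Rightarrow> 'e" where
  "At atl L q nabla a w e = (THE u. \<exists>l\<in>secs atl L. app q l = w \<and> u = conn_curv L nabla a l e)"

definition At_form ::
    "('m, 'a::real_inner) atlas \<Rightarrow> ('m, 'k::real_normed_field, 'l::ab_group_add) lie_algebroid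
     \<Rightarrow> ('m \<Rightarrow> 'l set) \<Rightarrow> ('m, 'k, 'q::ab_group_add) vbundle \<Rightarrow> ('m \<Rightarrow> 'l \<Rightarrow> 'q)
     \<Rightarrow> ('m, 'k, 'e::ab_group_add) vbundle \<Rightarrow> (('m \<Rightarrow> 'l) \<Rightarrow> ('m \<Rightarrow> 'e) \<Rightarrow> 'm \<Rightarrow> 'e)
     \<Rightarrow> ('m \<Rightarrow> 'l) list \<Rightarrow> ('m \<Rightarrow> 'q) \<Rightarrow> ('m \<Rightarrow> 'e) \<Rightarrow> 'm \<Rightarrow> 'e" where
  "At_form atl L A Q q E nabla = on_lists (secs_in atl L A) (\<lambda>xs. case xs of
     [a] \<Rightarrow> (\<lambda>w e. if w \<in> secs atl Q \<and> e \<in> secs atl E then At atl L q nabla a w e else 0)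
   | _ \<Rightarrow> 0)"

definition A_cohom ::
    "('m, 'a::real_inner) atlas \<Rightarrow> ('m, 'k::real_normed_field, 'l::ab_group_add) lie_algebroid
     \<Rightarrow> ('m \<Rightarrow> 'l set) \<Rightarrow> ('m, 'k, 'q::ab_group_add) vbundle \<Rightarrow> ('m \<Rightarrow> 'l \<Rightarrow> 'q)
     \<Rightarrow> ('m, 'k, 'e::ab_group_add) vbundle \<Rightarrow> (('m \<Rightarrow> 'l) \<Rightarrow> ('m \<Rightarrow> 'e) \<Rightarrow> 'm \<Rightarrow> 'e)
     \<Rightarrow> ((('m \<Rightarrow> 'l) list \<Rightarrow> ('m \<Rightarrow> 'q) \<Rightarrow> ('m \<Rightarrow> 'e) \<Rightarrow> 'm \<Rightarrow> 'e)
         \<times> (('m \<Rightarrow> 'l) list \<Rightarrow> ('m \<Rightarrow> 'q) \<Rightarrow> ('m \<Rightarrow> 'e) \<Rightarrow> 'm \<Rightarrow> 'e)) set" where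
  "A_cohom atl L A Q q E act =
     (let F = forms (smooth_funs atl) (secs_in atl L A) (smul L)
                (hom_secs atl Q E) (\<lambda>f \<Phi> w. end_smul E f (\<Phi> w));
          d = ce_diff (secs_in atl L A) (bracket L) (hom_act atl L Q q E act)
      in cohomologous {\<phi> \<in> of_degree 1 F. d \<phi> = 0} (d ` of_degree 0 F))"

text \<open>The class \<open>\<alpha>\<^bsub>(L,A),E\<^esub>\<close> in \<open>H\<^sup>1(A, Hom(L/A \<otimes> E, E))\<close>: the common class of all \<open>At\<^sup>\<nabla>\<close>.\<close>

definition atiyah_class ::
    "('m, 'a::real_inner) atlas \<Rightarrow> ('m, 'k::real_normed_field, 'l::ab_group_add) lie_algebroid
     \<Rightarrow> ('m \<Rightarrow> 'l set) \<Rightarrow> ('m, 'k, 'q::ab_group_add) vbundle \<Rightarrow> ('m \<Rightarrow> 'l \<Rightarrow> 'q)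
     \<Rightarrow> ('m, 'k, 'e::ab_group_add) vbundle \<Rightarrow> (('m \<Rightarrow> 'l) \<Rightarrow> ('m \<Rightarrow> 'e) \<Rightarrow> 'm \<Rightarrow> 'e)
     \<Rightarrow> (('m \<Rightarrow> 'l) list \<Rightarrow> ('m \<Rightarrow> 'q) \<Rightarrow> ('m \<Rightarrow> 'e) \<Rightarrow> 'm \<Rightarrow> 'e) set" where
  "atiyah_class atl L A Q q E act =
     (THE c. \<exists>nabla. extending_connection atl L A E act nabla \<and>
        c = A_cohom atl L A Q q E act `` {At_form atl L A Q q E nabla})"

text \<open>
  The identification of \<open>\<Lambda> A\<^sup>\<or> \<otimes> Hom(L/A \<otimes> E, E)\<close> with a part of \<open>\<Lambda> L\<^sup>\<or> \<otimes> End(E)\<close>, sending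
  \<open>\<omega> \<otimes> \<beta> \<otimes> \<psi>\<close> to \<open>- (\<omega> \<and> \<beta>) \<otimes> \<psi>\<close>.  It is the negative of the wedge product of the form,
  extended by zero on \<open>B\<close>, with the tautological \<open>L/A\<close>-valued 1-form \<open>q\<close> on \<open>L\<close>.
\<close>

definition to_end_form ::
    "('m, 'a::real_inner) atlas \<Rightarrow> ('m, 'k::real_normed_field, 'l::ab_group_add) lie_algebroid
     \<Rightarrow> ('m \<Rightarrow> 'l \<Rightarrow> 'q::ab_group_add) \<Rightarrow> ('m \<Rightarrow> 'q \<Rightarrow> 'l)
     \<Rightarrow> (('m \<Rightarrow> 'l) list \<Rightarrow> ('m \<Rightarrow> 'q) \<Rightarrow> ('m \<Rightarrow> 'e) \<Rightarrow> 'm \<Rightarrow> 'e::ab_group_add)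
     \<Rightarrow> ('m \<Rightarrow> 'l) list \<Rightarrow> ('m \<Rightarrow> 'e) \<Rightarrow> 'm \<Rightarrow> 'e" where
  "to_end_form atl L q j \<phi> = - wedge (\<lambda>\<Phi> w. \<Phi> w)
     (on_lists (secs atl L) (\<lambda>xs. \<phi> (map (projA q j) xs)))
     (on_lists (secs atl L) (\<lambda>xs. case xs of [l] \<Rightarrow> app q l | _ \<Rightarrow> 0))"

text \<open>
  The isomorphism \<open>\<mu> : \<aa> \<otimes> \<Gamma>(End E) \<rightarrow> Hom(\<mm>, \<mm>)\<close>: \<open>\<mu>(x)\<close> is the \<open>\<aa>\<close>-linear map, of the
  bidegree of \<open>x\<close>, whose restriction to \<open>\<Gamma>(E)\<close> is \<open>x\<close>.
\<close>

definition mu ::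
    "('m, 'a::real_inner) atlas \<Rightarrow> ('m, 'k::real_normed_field, 'l::ab_group_add) lie_algebroid
     \<Rightarrow> ('m \<Rightarrow> 'l set) \<Rightarrow> ('m, 'k, 'q) vbundle \<Rightarrow> ('m \<Rightarrow> 'l \<Rightarrow> 'q) \<Rightarrow> ('m \<Rightarrow> 'q \<Rightarrow> 'l)
     \<Rightarrow> ('m, 'k, 'e::ab_group_add) vbundle \<Rightarrow> (('m \<Rightarrow> 'l) \<Rightarrow> ('m \<Rightarrow> 'e) \<Rightarrow> 'm \<Rightarrow> 'e)
     \<Rightarrow> (('m \<Rightarrow> 'l) list \<Rightarrow> ('m \<Rightarrow> 'e) \<Rightarrow> 'm \<Rightarrow> 'e)
     \<Rightarrow> (('m \<Rightarrow> 'l) list \<Rightarrow> 'm \<Rightarrow> 'e) \<Rightarrow> ('m \<Rightarrow> 'l) list \<Rightarrow> 'm \<Rightarrow> 'e" where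
  "mu atl L A Q q j E nabla x = (THE F. \<exists>p r.
     x \<in> lp_comp atl L A Q j (end_secs atl E) (end_smul E) p r \<and>
     F \<in> dg_Hom (lp_alg atl L A Q q j) (lp_mod atl L A Q q j E nabla) p r \<and>
     (\<forall>e\<in>secs atl E. F (form0 e) = (\<lambda>xs. x xs e)))"

end

(*
  Forms are determined by their contractions, so operators on forms are handled through Cartan's
  formula i_x d + d i_x = L_x, and identities between d, L_x, the wedge product and the bidegree
  projections become inductions on the list of arguments.  In bidegree (1,1) only d^{1,0} and
  d^{0,1} contribute to d_nabla o d_nabla, whose value on a section e of E is the curvature
  R^nabla(-,-)e; hence R_m(e) is minus the (1,1)-part of R^nabla(-,-)e, which is the Atiyah cocycle.

  Locally, a form with values in E is a combination of products of scalar forms with sections of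
  E, and bump functions make these sections global.  Hence a linear map of the DG-module is
  determined by its values on the sections of E; this gives the uniqueness, and also reduces
  (d^{1,0})^2 = 0 on the module to the flatness of the action on E.

  The classes are compared representative by representative: the cocycles in the Atiyah class are
  exactly the At^{nabla'} for the L-connections nabla' extending the action, mu sends At^{nabla'} to
  the curvature of the connection induced by nabla', and the class of the DG-module consists of the
  curvatures of all its connections.
*)

theory Submission
  imports Defs
begin

section \<open>Calculus of alternating forms on lists\<close>

text \<open>The bidegree argument rests on one bound: \<open>d\<close> raises the A-degree by at
  most one, because A is closed under the bracket. Its components thus have bidegrees (r, 1 - r)
  with r \<le> 1, and two of them compose to (1, 1) only as d^{1,0} d^{0,1} or d^{0,1} d^{1,0}, and
  to (2, 0) only as (d^{1,0})^2. Since d_nabla need not square to zero, (d^{1,0})^2 = 0 cannot be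
  read off from it; instead the square is shown to be linear over the algebra and is tested on
  sections of E. The algebra takes place over an abstract Lie--Rinehart algebra. Geometry enters to
  provide that structure and the bump functions, which are needed because bracket, connections and
  forms are given on global sections. Signs: i_a i_b puts b into the first place and a into the
  second, so the minus sign of the curvature is absorbed by R(b, a) = - R(a, b); the minus sign of
  \<open>to_end_form\<close> compensates the same exchange. The classes for different connections
  can be compared because the DG-module is the same for all of them: d^{1,0} sees a connection only
  along A.\<close>

lemma signed_simps [simp]:
  "signed 0 w = w" "signed (Suc n) w = - signed n w" "signed n (0 :: 'w::ab_group_add) = 0"
  "signed n (- w) = - signed n w" "signed n (signed n w) = w" 
  by (auto simp: signed_def)

lemma signed_add: "signed n (v + w) = signed n v + signed n w"
  by (auto simp: signed_def)

lemma signed_diff: "signed n (v - w) = signed n v - signed n w"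
  by (auto simp: signed_def)

lemma signed_add_exp: "signed (m + n) w = signed m (signed n w)"
  by (auto simp: signed_def)

lemma signed_even: "even n \<Longrightarrow> signed n w = w"
  by (auto simp: signed_def)

lemma contract_apply: "contract x \<omega> xs = \<omega> (x # xs)"
  by (simp add: contract_def)

lemma contract_arith [simp]:
  "contract x (\<omega> + \<eta>) = contract x \<omega> + contract x \<eta>"
  "contract x (\<omega> - \<eta>) = contract x \<omega> - contract x \<eta>"
  "contract x (- \<omega>) = - contract x \<omega>"
  "contract x 0 = 0"
  by (auto simp: fun_eq_iff contract_apply)

text \<open>The grading involution. Reading the sign off from the number of arguments gives Leibniz
  rules for forms with components of several degrees, without a degree as parameter.\<close>

definition gsign :: "('x list \<Rightarrow> 'w::ab_group_add) \<Rightarrow> 'x list \<Rightarrow> 'w" where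
  "gsign \<omega> = (\<lambda>xs. signed (length xs) (\<omega> xs))"

lemma gsign_apply: "gsign \<omega> xs = signed (length xs) (\<omega> xs)"
  by (simp add: gsign_def)

lemma contract_gsign [simp]: "contract x (gsign \<omega>) = - gsign (contract x \<omega>)"
  by (auto simp: fun_eq_iff gsign_def contract_apply)

lemma gsign_arith [simp]:
  "gsign (\<omega> + \<eta>) = gsign \<omega> + gsign \<eta>" "gsign (\<omega> - \<eta>) = gsign \<omega> - gsign \<eta>"
  "gsign (- \<omega>) = - gsign \<omega>" "gsign 0 = 0" "gsign \<omega> [] = \<omega> []"
  by (auto simp: fun_eq_iff gsign_def signed_add signed_diff)

lemma Pow_lessThan_Suc:
  "Pow {..<Suc n} = image Suc ` Pow {..<n} \<union> (\<lambda>T. insert 0 (Suc ` T)) ` Pow {..<n}"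
proof -
  have "Pow (Suc ` {..<n}) = image Suc ` Pow {..<n}"
    by (rule image_Pow_surj [OF refl, symmetric])
  then show ?thesis
    by (simp add: lessThan_Suc_eq_insert_0 Pow_insert image_image)
qed

text \<open>In a shuffle, a subset without 0 sends the first argument to the second factor, a subset
  with 0 to the first. The splitting turns sums over shuffles into recursions on the list of
  arguments.\<close>

lemma sum_Pow_lessThan_Suc:
  "(\<Sum>S\<in>Pow {..<Suc n}. f S)
     = (\<Sum>T\<in>Pow {..<n}. f (Suc ` T)) + (\<Sum>T\<in>Pow {..<n}. f (insert 0 (Suc ` T)))"
proof -
  have inj1: "inj_on (image Suc) (Pow {..<n})"
    by (auto intro!: inj_onI simp: inj_image_eq_iff)
  have "inj_on (\<lambda>T. insert 0 (Suc ` T)) (Pow {..<n})"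
    by (rule inj_onI) (metis Zero_not_Suc imageE insert_ident inj_Suc inj_image_eq_iff)
  moreover have "image Suc ` Pow {..<n} \<inter> (\<lambda>T. insert 0 (Suc ` T)) ` Pow {..<n} = {}"
    by auto
  ultimately show ?thesis
    using inj1 by (simp add: Pow_lessThan_Suc sum.union_disjoint sum.reindex)
qed

lemma wedge_Nil [simp]: "wedge pair \<omega> \<eta> [] = pair (\<omega> []) (\<eta> [])"
  by (simp add: wedge_def)

text \<open>An index 0 outside the subset precedes all its members and creates \<open>card T\<close>
  new inversions; inside the subset it creates none. The term \<open>card T\<close> is what becomes
  \<open>gsign\<close> on the first factor of a wedge product.\<close>

lemma card_inversions_Suc:
  assumes "T \<subseteq> {..<n}"
  shows "card {(i, j). i < j \<and> i \<in> {..<Suc n} - Suc ` T \<and> j \<in> Suc ` T}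
       = card T + card {(i, j). i < j \<and> i \<in> {..<n} - T \<and> j \<in> T}" (is "card ?S = _ + card ?R")
    and "card {(i, j). i < j \<and> i \<in> {..<Suc n} - insert 0 (Suc ` T) \<and> j \<in> insert 0 (Suc ` T)}
       = card {(i, j). i < j \<and> i \<in> {..<n} - T \<and> j \<in> T}" (is "card ?S' = _")
proof -
  have fin: "finite T" using assms finite_subset by blast
  have finR: "finite ?R"
    by (rule finite_subset [of _ "{..<n} \<times> T"]) (use fin in auto)
  have inj: "inj_on (map_prod Suc Suc) ?R"
    by (auto intro!: inj_onI)
  have "?S = {0} \<times> Suc ` T \<union> map_prod Suc Suc ` ?R"
  proof (intro set_eqI, clarify)
    fix i j :: nat
    show "((i, j) \<in> ?S) = ((i, j) \<in> {0} \<times> Suc ` T \<union> map_prod Suc Suc ` ?R)"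
      by (cases i; cases j) (auto simp: image_iff)
  qed
  moreover have "({0} \<times> Suc ` T) \<inter> map_prod Suc Suc ` ?R = {}" by auto
  ultimately show "card ?S = card T + card ?R"
    using fin finR card_image [OF inj]
    by (simp add: card_Un_disjoint card_image card_cartesian_product del: mem_Collect_eq)
  have "?S' = map_prod Suc Suc ` ?R"
  proof (intro set_eqI, clarify)
    fix i j :: nat
    show "((i, j) \<in> ?S') = ((i, j) \<in> map_prod Suc Suc ` ?R)"
      by (cases i; cases j) (auto simp: image_iff)
  qed
  then show "card ?S' = card ?R" by (simp only: card_image [OF inj])
qed

text \<open>Contraction is an antiderivation of the wedge product. The only property of the pairing
  that enters is its sign rule on the left, so the rule covers both scalar multiplication and the
  evaluation of homomorphisms.\<close>

lemma wedge_Cons: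
  assumes "\<And>u v. pair (- u) v = - pair u v"
  shows "wedge pair \<omega> \<eta> (x # xs)
     = wedge pair (contract x \<omega>) \<eta> xs + wedge pair (gsign \<omega>) (contract x \<eta>) xs"
proof -
  let ?n = "length xs"
  let ?sg = "\<lambda>n S. signed (card {(i, j). i < j \<and> i \<in> {..<n} - S \<and> j \<in> S})"
  let ?f = "\<lambda>S. ?sg (Suc ?n) S (pair (\<omega> (nths (x # xs) S)) (\<eta> (nths (x # xs) (- S))))"
  have pair: "pair (signed n u) v = signed n (pair u v)" for n u v
    using assms by (simp add: signed_def)
  have A: "?f (insert 0 (Suc ` T)) = ?sg ?n T (pair (contract x \<omega> (nths xs T)) (\<eta> (nths xs (- T))))"
    if "T \<subseteq> {..<?n}" for T
  proof -
    have "{j. Suc j \<notin> Suc ` T} = - T" "{j. Suc j \<in> Suc ` T} = T" by auto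
    then show ?thesis
      unfolding card_inversions_Suc(2) [OF that] by (simp add: nths_Cons contract_apply)
  qed
  have B: "?f (Suc ` T) = ?sg ?n T (pair (gsign \<omega> (nths xs T)) (contract x \<eta> (nths xs (- T))))"
    if "T \<subseteq> {..<?n}" for T
  proof -
    have "{j. Suc j \<notin> Suc ` T} = - T" "{j. Suc j \<in> Suc ` T} = T" by auto
    moreover have "{i. i < ?n \<and> i \<in> T} = T" using that by auto
    moreover have "0 \<notin> Suc ` T" by auto
    ultimately have "length (nths xs T) = card T"
      and "nths (x # xs) (Suc ` T) = nths xs T" "nths (x # xs) (- (Suc ` T)) = x # nths xs (- T)"
      by (simp_all add: nths_Cons length_nths)
    then show ?thesis
      unfolding card_inversions_Suc(1) [OF that]
      by (simp only: add.commute [of "card T"] signed_add_exp gsign_def pair contract_apply)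
  qed
  show ?thesis
    unfolding wedge_def
    using A B by (simp add: sum_Pow_lessThan_Suc)
qed

text \<open>The commutation rule i_y L_x = L_x i_y - i_[x,y], read as a recursion on the
  arguments.\<close>

fun lie_der :: "('x \<Rightarrow> 'x \<Rightarrow> 'x) \<Rightarrow> ('x \<Rightarrow> 'w \<Rightarrow> 'w) \<Rightarrow> 'x \<Rightarrow> ('x list \<Rightarrow> 'w::ab_group_add) \<Rightarrow> 'x list \<Rightarrow> 'w" where
  "lie_der br act x \<omega> [] = act x (\<omega> [])"
| "lie_der br act x \<omega> (y # ys) = lie_der br act x (contract y \<omega>) ys - \<omega> (br x y # ys)"

text \<open>Cartan's formula \<open>i\<^sub>x d = L\<^sub>x - d i\<^sub>x\<close> as a recursive definition of \<open>d\<close>.\<close>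

fun cartan_d :: "('x \<Rightarrow> 'x \<Rightarrow> 'x) \<Rightarrow> ('x \<Rightarrow> 'w \<Rightarrow> 'w) \<Rightarrow> ('x list \<Rightarrow> 'w::ab_group_add) \<Rightarrow> 'x list \<Rightarrow> 'w" where
  "cartan_d br act \<omega> [] = 0"
| "cartan_d br act \<omega> (x # xs) = lie_der br act x \<omega> xs - cartan_d br act (contract x \<omega>) xs"

text \<open>Integral degrees avoid boundary cases.\<close>

fun bip :: "('x \<Rightarrow> 'x) \<Rightarrow> ('x \<Rightarrow> 'x) \<Rightarrow> int \<Rightarrow> int \<Rightarrow> ('x list \<Rightarrow> 'w::ab_group_add) \<Rightarrow> 'x list \<Rightarrow> 'w" where
  "bip pA pB p q \<omega> [] = (if p = 0 \<and> q = 0 then \<omega> [] else 0)"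
| "bip pA pB p q \<omega> (x # xs) =
     bip pA pB (p - 1) q (contract (pA x) \<omega>) xs + bip pA pB p (q - 1) (contract (pB x) \<omega>) xs"

lemma contract_lie_der [simp]:
  "contract y (lie_der br act x \<omega>) = lie_der br act x (contract y \<omega>) - contract (br x y) \<omega>"
  by (auto simp: fun_eq_iff contract_apply)

lemma contract_cartan_d [simp]:
  "contract x (cartan_d br act \<omega>) = lie_der br act x \<omega> - cartan_d br act (contract x \<omega>)"
  by (auto simp: fun_eq_iff contract_apply)

lemma contract_bip [simp]:
  "contract x (bip pA pB p q \<omega>)
     = bip pA pB (p - 1) q (contract (pA x) \<omega>) + bip pA pB p (q - 1) (contract (pB x) \<omega>)"
  by (auto simp: fun_eq_iff contract_apply)

section \<open>Forms over a Lie--Rinehart algebra\<close>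

text \<open>The algebraic shadow of a Lie algebroid: \<open>C\<close> plays the smooth functions,
  \<open>X\<close> the sections, \<open>rho\<close> the anchor. Carrier sets are used because smooth
  functions and sections are only subsets of their function types. \<open>br_self\<close> is listed
  besides \<open>br_skew\<close> since 2 need not be invertible here.\<close>

locale lie_rinehart = X: module sX for sX :: "'c::comm_ring_1 \<Rightarrow> 'x::ab_group_add \<Rightarrow> 'x" +
  fixes C :: "'c set" and X :: "'x set" and br :: "'x \<Rightarrow> 'x \<Rightarrow> 'x" and rho :: "'x \<Rightarrow> 'c \<Rightarrow> 'c"
  assumes C_one: "1 \<in> C" and C_add: "f \<in> C \<Longrightarrow> g \<in> C \<Longrightarrow> f + g \<in> C"
    and C_uminus: "f \<in> C \<Longrightarrow> - f \<in> C" and C_mult: "f \<in> C \<Longrightarrow> g \<in> C \<Longrightarrow> f * g \<in> C"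
    and X_zero: "0 \<in> X" and X_add: "x \<in> X \<Longrightarrow> y \<in> X \<Longrightarrow> x + y \<in> X"
    and X_scale: "f \<in> C \<Longrightarrow> x \<in> X \<Longrightarrow> sX f x \<in> X"
    and br_closed: "x \<in> X \<Longrightarrow> y \<in> X \<Longrightarrow> br x y \<in> X"
    and br_self: "x \<in> X \<Longrightarrow> br x x = 0"
    and br_skew: "x \<in> X \<Longrightarrow> y \<in> X \<Longrightarrow> br x y = - br y x"
    and br_add: "x \<in> X \<Longrightarrow> y \<in> X \<Longrightarrow> z \<in> X \<Longrightarrow> br x (y + z) = br x y + br x z"
    and br_scale: "f \<in> C \<Longrightarrow> x \<in> X \<Longrightarrow> y \<in> X \<Longrightarrow> br x (sX f y) = sX f (br x y) + sX (rho x f) y"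
    and jacobi: "x \<in> X \<Longrightarrow> y \<in> X \<Longrightarrow> z \<in> X \<Longrightarrow> br x (br y z) + br y (br z x) + br z (br x y) = 0"
    and rho_closed: "x \<in> X \<Longrightarrow> f \<in> C \<Longrightarrow> rho x f \<in> C"
    and rho_add_left: "x \<in> X \<Longrightarrow> y \<in> X \<Longrightarrow> f \<in> C \<Longrightarrow> rho (x + y) f = rho x f + rho y f"
    and rho_scale: "x \<in> X \<Longrightarrow> f \<in> C \<Longrightarrow> g \<in> C \<Longrightarrow> rho (sX f x) g = f * rho x g"
    and rho_add: "x \<in> X \<Longrightarrow> f \<in> C \<Longrightarrow> g \<in> C \<Longrightarrow> rho x (f + g) = rho x f + rho x g"
    and rho_mult: "x \<in> X \<Longrightarrow> f \<in> C \<Longrightarrow> g \<in> C \<Longrightarrow> rho x (f * g) = f * rho x g + rho x f * g"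
    and rho_br: "x \<in> X \<Longrightarrow> y \<in> X \<Longrightarrow> f \<in> C \<Longrightarrow> rho (br x y) f = rho x (rho y f) - rho y (rho x f)"
begin

lemma X_uminus: "x \<in> X \<Longrightarrow> - x \<in> X"
  using X_scale [OF C_uminus [OF C_one], of x] by simp

lemma X_diff: "x \<in> X \<Longrightarrow> y \<in> X \<Longrightarrow> x - y \<in> X"
  using X_add [of x "- y"] X_uminus by simp

lemma C_zero: "0 \<in> C"
  using C_add [OF C_one C_uminus [OF C_one]] by simp

lemma br_add_left: "x \<in> X \<Longrightarrow> y \<in> X \<Longrightarrow> z \<in> X \<Longrightarrow> br (x + y) z = br x z + br y z"
  using br_add [of z x y] br_skew [of "x + y" z] br_skew [of x z] br_skew [of y z] X_add
  by simp

lemma br_scale_left: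
  "f \<in> C \<Longrightarrow> x \<in> X \<Longrightarrow> y \<in> X \<Longrightarrow> br (sX f x) y = sX f (br x y) - sX (rho y f) x"
  using br_scale [of f y x] br_skew [of "sX f x" y] br_skew [of x y] X_scale
  by (simp add: X.scale_minus_right)

end

text \<open>Connections rather than actions: flatness is an explicit premise of those lemmas that
  use it, since \<open>nabla\<close> is flat only along A.\<close>

locale lie_rinehart_conn = lie_rinehart sX C X br rho + Y: module sY
  for sX :: "'c::comm_ring_1 \<Rightarrow> 'x::ab_group_add \<Rightarrow> 'x" and C X br rho
    and sY :: "'c \<Rightarrow> 'w::ab_group_add \<Rightarrow> 'w" +
  fixes Y :: "'w set" and act :: "'x \<Rightarrow> 'w \<Rightarrow> 'w"
  assumes Y_zero: "0 \<in> Y" and Y_add: "v \<in> Y \<Longrightarrow> w \<in> Y \<Longrightarrow> v + w \<in> Y"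
    and Y_scale: "f \<in> C \<Longrightarrow> w \<in> Y \<Longrightarrow> sY f w \<in> Y"
    and act_closed: "x \<in> X \<Longrightarrow> w \<in> Y \<Longrightarrow> act x w \<in> Y"
    and act_add_left: "x \<in> X \<Longrightarrow> y \<in> X \<Longrightarrow> w \<in> Y \<Longrightarrow> act (x + y) w = act x w + act y w"
    and act_scale_left: "x \<in> X \<Longrightarrow> f \<in> C \<Longrightarrow> w \<in> Y \<Longrightarrow> act (sX f x) w = sY f (act x w)"
    and act_add: "x \<in> X \<Longrightarrow> v \<in> Y \<Longrightarrow> w \<in> Y \<Longrightarrow> act x (v + w) = act x v + act x w"
    and act_scale: "x \<in> X \<Longrightarrow> f \<in> C \<Longrightarrow> w \<in> Y \<Longrightarrow> act x (sY f w) = sY f (act x w) + sY (rho x f) w"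

text \<open>Scalar forms are forms with values in \<open>C\<close> itself, on which
  \<open>rho\<close> acts. Every fact about module-valued forms is thereby also available, with
  prefix \<open>S\<close>, for the algebra.\<close>

lemma (in lie_rinehart) scalar_lie_rinehart_conn: "lie_rinehart_conn sX C X br rho (*) C rho"
  by unfold_locales
    (auto simp: algebra_simps C_zero C_add C_mult rho_closed rho_add_left rho_scale rho_add rho_mult)

sublocale lie_rinehart \<subseteq> S: lie_rinehart_conn sX C X br rho "(*)" C rho
  by (rule scalar_lie_rinehart_conn)

context lie_rinehart_conn
begin

abbreviation Lie :: "'x \<Rightarrow> ('x list \<Rightarrow> 'w) \<Rightarrow> 'x list \<Rightarrow> 'w" where
  "Lie \<equiv> lie_der br act"

abbreviation d :: "('x list \<Rightarrow> 'w) \<Rightarrow> 'x list \<Rightarrow> 'w" where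
  "d \<equiv> cartan_d br act"

lemma Y_uminus: "w \<in> Y \<Longrightarrow> - w \<in> Y"
  using Y_scale [OF C_uminus [OF C_one], of w] by simp

lemma Y_diff: "v \<in> Y \<Longrightarrow> w \<in> Y \<Longrightarrow> v - w \<in> Y"
  using Y_add [of v "- w"] Y_uminus by simp

lemma Y_sum: "(\<And>i. i \<in> I \<Longrightarrow> f i \<in> Y) \<Longrightarrow> sum f I \<in> Y"
  by (induction I rule: infinite_finite_induct) (auto simp: Y_zero Y_add)

lemma act_zero [simp]: "x \<in> X \<Longrightarrow> act x 0 = 0"
  using act_add [of x 0 0] Y_zero by simp

lemma act_uminus: "x \<in> X \<Longrightarrow> w \<in> Y \<Longrightarrow> act x (- w) = - act x w"
  using act_add [of x w "- w"] Y_uminus by (simp add: eq_neg_iff_add_eq_0 add.commute)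

lemma act_diff: "x \<in> X \<Longrightarrow> v \<in> Y \<Longrightarrow> w \<in> Y \<Longrightarrow> act x (v - w) = act x v - act x w"
  using act_add [of x v "- w"] act_uminus Y_uminus by simp

text \<open>A form is described through its contractions, so that closure properties become inductions on
  the bound \<open>n\<close>.  Unlike for \<open>forms\<close>, the values at arguments outside \<open>X\<close> are arbitrary.\<close>

fun frm_upto :: "nat \<Rightarrow> ('x list \<Rightarrow> 'w) \<Rightarrow> bool" where
  "frm_upto 0 \<omega> = (\<omega> [] \<in> Y)"
| "frm_upto (Suc n) \<omega> = (\<omega> [] \<in> Y \<and> (\<forall>x\<in>X. frm_upto n (contract x \<omega>)
     \<and> (\<forall>y\<in>X. \<forall>zs. set zs \<subseteq> X \<longrightarrow> \<omega> ((x + y) # zs) = \<omega> (x # zs) + \<omega> (y # zs))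
     \<and> (\<forall>f\<in>C. \<forall>zs. set zs \<subseteq> X \<longrightarrow> \<omega> (sX f x # zs) = sY f (\<omega> (x # zs)))
     \<and> (\<forall>zs. set zs \<subseteq> X \<longrightarrow> \<omega> (x # x # zs) = 0)))"

definition frm :: "('x list \<Rightarrow> 'w) \<Rightarrow> bool" where
  "frm \<omega> \<longleftrightarrow> (\<forall>n. frm_upto n \<omega>)"

lemma frm_Nil: "frm \<omega> \<Longrightarrow> \<omega> [] \<in> Y"
  by (metis frm_upto.simps(1) frm_def)

lemma frm_contract: "frm \<omega> \<Longrightarrow> x \<in> X \<Longrightarrow> frm (contract x \<omega>)"
  by (metis frm_upto.simps(2) frm_def)

lemma frm_add_head:
  "frm \<omega> \<Longrightarrow> x \<in> X \<Longrightarrow> y \<in> X \<Longrightarrow> set zs \<subseteq> X \<Longrightarrow> \<omega> ((x + y) # zs) = \<omega> (x # zs) + \<omega> (y # zs)"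
  by (metis frm_upto.simps(2) frm_def)

lemma frm_scale_head:
  "frm \<omega> \<Longrightarrow> x \<in> X \<Longrightarrow> f \<in> C \<Longrightarrow> set zs \<subseteq> X \<Longrightarrow> \<omega> (sX f x # zs) = sY f (\<omega> (x # zs))"
  by (metis frm_upto.simps(2) frm_def)

lemma frm_repeat: "frm \<omega> \<Longrightarrow> x \<in> X \<Longrightarrow> set zs \<subseteq> X \<Longrightarrow> \<omega> (x # x # zs) = 0"
  by (metis frm_upto.simps(2) frm_def)

lemma frm_zero_head: "frm \<omega> \<Longrightarrow> set zs \<subseteq> X \<Longrightarrow> \<omega> (0 # zs) = 0"
  using frm_add_head [of \<omega> 0 0 zs] X_zero by simp

lemma frm_uminus_head: "frm \<omega> \<Longrightarrow> x \<in> X \<Longrightarrow> set zs \<subseteq> X \<Longrightarrow> \<omega> (- x # zs) = - \<omega> (x # zs)"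
  using frm_add_head [of \<omega> x "- x" zs] frm_zero_head [of \<omega> zs] X_uminus
  by (simp add: eq_neg_iff_add_eq_0 add.commute)

lemma frm_diff_head:
  "frm \<omega> \<Longrightarrow> x \<in> X \<Longrightarrow> y \<in> X \<Longrightarrow> set zs \<subseteq> X \<Longrightarrow> \<omega> ((x - y) # zs) = \<omega> (x # zs) - \<omega> (y # zs)"
  using frm_add_head [of \<omega> x "- y" zs] frm_uminus_head X_uminus by simp

text \<open>Polarization: the form is expanded on the repeated argument \<open>x + y\<close>, where
  it vanishes.\<close>

lemma frm_swap:
  assumes "frm \<omega>" "x \<in> X" "y \<in> X" "set zs \<subseteq> X"
  shows "\<omega> (x # y # zs) = - \<omega> (y # x # zs)"
proof -
  have "0 = \<omega> ((x + y) # (x + y) # zs)"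
    using assms frm_repeat X_add by simp
  also have "\<dots> = \<omega> (x # (x + y) # zs) + \<omega> (y # (x + y) # zs)"
    using assms X_add by (intro frm_add_head) auto
  also have "\<dots> = \<omega> (x # y # zs) + \<omega> (y # x # zs)"
    using assms frm_add_head [OF frm_contract [OF assms(1,2)], of x y zs]
      frm_add_head [OF frm_contract [OF assms(1,3)], of x y zs] frm_repeat [OF assms(1)]
    by (simp add: contract_apply)
  finally show ?thesis by (simp add: eq_neg_iff_add_eq_0)
qed

lemma frm_Y: "frm \<omega> \<Longrightarrow> set xs \<subseteq> X \<Longrightarrow> \<omega> xs \<in> Y"
proof (induction xs arbitrary: \<omega>)
  case (Cons x xs)
  then have "contract x \<omega> xs \<in> Y"
    by (intro Cons.IH frm_contract) auto
  then show ?case by (simp add: contract_apply)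
qed (simp add: frm_Nil)

lemma frm_move:
  assumes "frm \<omega>" "x \<in> X" "set ys \<subseteq> X" "set zs \<subseteq> X"
  shows "\<omega> (ys @ x # zs) = signed (length ys) (\<omega> (x # ys @ zs))"
  using assms
proof (induction ys arbitrary: \<omega>)
  case (Cons y ys)
  have "\<omega> ((y # ys) @ x # zs) = contract y \<omega> (ys @ x # zs)" by (simp add: contract_apply)
  also have "\<dots> = signed (length ys) (contract y \<omega> (x # ys @ zs))"
    using Cons.prems by (intro Cons.IH frm_contract) auto
  also have "\<dots> = signed (length ys) (\<omega> (y # x # ys @ zs))"
    by (simp add: contract_apply)
  also have "\<dots> = signed (length (y # ys)) (\<omega> (x # y # ys @ zs))"
    using frm_swap [of \<omega> x y "ys @ zs"] Cons.prems by simp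
  finally show ?case by simp
qed simp

text \<open>The recursive description forbids repetitions only in two adjacent places at the head,
  so both copies of the repeated argument are moved to the front.\<close>

lemma frm_not_distinct:
  assumes "frm \<omega>" "set xs \<subseteq> X" "\<not> distinct xs"
  shows "\<omega> xs = 0"
proof -
  obtain us y vs ws where xs: "xs = us @ [y] @ vs @ [y] @ ws"
    using assms(3) not_distinct_decomp by blast
  have "\<omega> xs = signed (length us) (\<omega> (y # us @ vs @ y # ws))"
    using assms frm_move [of \<omega> y us "vs @ y # ws"] xs by simp
  also have "\<omega> (y # us @ vs @ y # ws) = contract y \<omega> ((us @ vs) @ y # ws)"
    by (simp add: contract_apply)
  also have "\<dots> = signed (length (us @ vs)) (contract y \<omega> (y # us @ vs @ ws))"
    using assms xs frm_move [of "contract y \<omega>" y "us @ vs" ws] frm_contract by simp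
  also have "\<dots> = signed (length (us @ vs)) (\<omega> (y # y # us @ vs @ ws))"
    by (simp add: contract_apply)
  also have "\<dots> = 0" using assms xs frm_repeat [of \<omega> y "us @ vs @ ws"] by simp
  finally show ?thesis by simp
qed

lemma frm_list_update_add:
  "frm \<omega> \<Longrightarrow> set xs \<subseteq> X \<Longrightarrow> i < length xs \<Longrightarrow> x \<in> X \<Longrightarrow> y \<in> X
    \<Longrightarrow> \<omega> (xs[i := x + y]) = \<omega> (xs[i := x]) + \<omega> (xs[i := y])"
proof (induction xs arbitrary: i \<omega>)
  case (Cons z zs)
  show ?case
  proof (cases i)
    case 0
    then show ?thesis using Cons.prems frm_add_head by simp
  next
    case (Suc k)
    have "contract z \<omega> (zs[k := x + y]) = contract z \<omega> (zs[k := x]) + contract z \<omega> (zs[k := y])"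
      using Cons.prems Suc by (intro Cons.IH frm_contract) auto
    then show ?thesis using Suc by (simp add: contract_apply)
  qed
qed simp

lemma frm_list_update_scale:
  "frm \<omega> \<Longrightarrow> set xs \<subseteq> X \<Longrightarrow> i < length xs \<Longrightarrow> x \<in> X \<Longrightarrow> f \<in> C
    \<Longrightarrow> \<omega> (xs[i := sX f x]) = sY f (\<omega> (xs[i := x]))"
proof (induction xs arbitrary: i \<omega>)
  case (Cons z zs)
  show ?case
  proof (cases i)
    case 0
    then show ?thesis using Cons.prems frm_scale_head by simp
  next
    case (Suc k)
    have "contract z \<omega> (zs[k := sX f x]) = sY f (contract z \<omega> (zs[k := x]))"
      using Cons.prems Suc by (intro Cons.IH frm_contract) auto
    then show ?thesis using Suc by (simp add: contract_apply)
  qed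
qed simp

lemma forms_contract:
  assumes "\<omega> \<in> forms C X sX Y sY" "x \<in> X"
  shows "contract x \<omega> \<in> forms C X sX Y sY"
proof -
  let ?P = "\<lambda>xs. \<omega> xs \<in> Y \<and>
        (\<forall>i<length xs. \<forall>x\<in>X. \<forall>y\<in>X. \<omega> (xs[i := x + y]) = \<omega> (xs[i := x]) + \<omega> (xs[i := y])) \<and>
        (\<forall>i<length xs. \<forall>x\<in>X. \<forall>f\<in>C. \<omega> (xs[i := sX f x]) = sY f (\<omega> (xs[i := x]))) \<and>
        (\<not> distinct xs \<longrightarrow> \<omega> xs = 0)"
  have P: "?P xs" if "set xs \<subseteq> X" for xs
    using assms that by (auto simp: forms_def)
  have "contract x \<omega> = on_lists X (contract x \<omega>)"
  proof
    fix xs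
    have "\<omega> = on_lists X \<omega>" using assms by (simp add: forms_def)
    then have "\<omega> (x # xs) = on_lists X \<omega> (x # xs)" by (rule fun_cong)
    then show "contract x \<omega> xs = on_lists X (contract x \<omega>) xs"
      using assms(2) by (cases "set xs \<subseteq> X") (simp_all add: on_lists_def contract_apply)
  qed
  moreover have "\<omega> (x # xs) \<in> Y \<and>
        (\<forall>i<length xs. \<forall>u\<in>X. \<forall>y\<in>X. \<omega> (x # xs[i := u + y]) = \<omega> (x # xs[i := u]) + \<omega> (x # xs[i := y])) \<and>
        (\<forall>i<length xs. \<forall>u\<in>X. \<forall>f\<in>C. \<omega> (x # xs[i := sX f u]) = sY f (\<omega> (x # xs[i := u]))) \<and>
        (\<not> distinct xs \<longrightarrow> \<omega> (x # xs) = 0)" if "set xs \<subseteq> X" for xs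
  proof (intro conjI allI ballI impI)
    fix i u y assume "i < length xs" "u \<in> X" "y \<in> X"
    then show "\<omega> (x # xs[i := u + y]) = \<omega> (x # xs[i := u]) + \<omega> (x # xs[i := y])"
      using P [of "x # xs"] assms that by (auto dest!: spec [of _ "Suc i"])
  next
    fix i u f assume "i < length xs" "u \<in> X" "f \<in> C"
    then show "\<omega> (x # xs[i := sX f u]) = sY f (\<omega> (x # xs[i := u]))"
      using P [of "x # xs"] assms that by (auto dest!: spec [of _ "Suc i"])
  qed (use P [of "x # xs"] assms that in auto)
  ultimately show ?thesis by (simp add: forms_def contract_apply)
qed

lemma forms_frm:
  assumes "\<omega> \<in> forms C X sX Y sY" shows "frm \<omega>"
proof -
  have "frm_upto n \<omega>" for n using assms
  proof (induction n arbitrary: \<omega>)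
    case 0
    then show ?case by (auto simp: forms_def)
  next
    case (Suc n)
    have *: "\<omega> xs \<in> Y \<and>
        (\<forall>i<length xs. \<forall>x\<in>X. \<forall>y\<in>X. \<omega> (xs[i := x + y]) = \<omega> (xs[i := x]) + \<omega> (xs[i := y])) \<and>
        (\<forall>i<length xs. \<forall>x\<in>X. \<forall>f\<in>C. \<omega> (xs[i := sX f x]) = sY f (\<omega> (xs[i := x]))) \<and>
        (\<not> distinct xs \<longrightarrow> \<omega> xs = 0)" if "set xs \<subseteq> X" for xs
      using Suc.prems that unfolding forms_def by blast
    have "\<omega> ((x + y) # zs) = \<omega> (x # zs) + \<omega> (y # zs)" if "x \<in> X" "y \<in> X" "set zs \<subseteq> X" for x y zs
      using * [of "x # zs"] that by (auto dest!: spec [of _ 0])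
    moreover have "\<omega> (sX f x # zs) = sY f (\<omega> (x # zs))" if "x \<in> X" "f \<in> C" "set zs \<subseteq> X" for x f zs
      using * [of "x # zs"] that by (auto dest!: spec [of _ 0])
    moreover have "\<omega> (x # x # zs) = 0" if "x \<in> X" "set zs \<subseteq> X" for x zs
      using * [of "x # x # zs"] that by auto
    moreover have "frm_upto n (contract x \<omega>)" if "x \<in> X" for x
      by (rule Suc.IH [OF forms_contract [OF Suc.prems that]])
    ultimately show ?case
      using * [of "[]"] by auto
  qed
  then show ?thesis by (simp add: frm_def)
qed

lemma frm_on_lists:
  assumes "frm \<omega>" shows "frm (on_lists X \<omega>)"
proof -
  have "frm_upto n (on_lists X \<omega>)" for n using assms
  proof (induction n arbitrary: \<omega>)
    case 0
    then show ?case by (simp add: on_lists_def frm_Nil)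
  next
    case (Suc n)
    have "contract x (on_lists X \<omega>) = on_lists X (contract x \<omega>)" if "x \<in> X" for x
      using that by (auto simp: on_lists_def fun_eq_iff contract_apply)
    then have "frm_upto n (contract x (on_lists X \<omega>))" if "x \<in> X" for x
      using Suc.IH [OF frm_contract [OF Suc.prems that]] that by simp
    then show ?case
      using Suc.prems frm_Nil frm_add_head frm_scale_head frm_repeat X_add X_scale
      by (simp add: on_lists_def)
  qed
  then show ?thesis by (simp add: frm_def)
qed

text \<open>The bridge between the two descriptions: conditions at the head of every iterated
  contraction amount to conditions at all positions. \<open>on_lists\<close> fixes the values at
  arguments outside \<open>X\<close>, which \<open>frm\<close> leaves open.\<close>

lemma forms_iff: "\<omega> \<in> forms C X sX Y sY \<longleftrightarrow> frm \<omega> \<and> \<omega> = on_lists X \<omega>"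
proof
  assume "\<omega> \<in> forms C X sX Y sY"
  then show "frm \<omega> \<and> \<omega> = on_lists X \<omega>"
    using forms_frm unfolding forms_def by blast
next
  assume *: "frm \<omega> \<and> \<omega> = on_lists X \<omega>"
  then have "frm \<omega>" by simp
  then have "\<omega> xs \<in> Y \<and>
        (\<forall>i<length xs. \<forall>x\<in>X. \<forall>y\<in>X. \<omega> (xs[i := x + y]) = \<omega> (xs[i := x]) + \<omega> (xs[i := y])) \<and>
        (\<forall>i<length xs. \<forall>x\<in>X. \<forall>f\<in>C. \<omega> (xs[i := sX f x]) = sY f (\<omega> (xs[i := x]))) \<and>
        (\<not> distinct xs \<longrightarrow> \<omega> xs = 0)" if "set xs \<subseteq> X" for xs
    using that by (simp add: frm_Y frm_list_update_add frm_list_update_scale frm_not_distinct)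
  with * show "\<omega> \<in> forms C X sX Y sY"
    unfolding forms_def by blast
qed

lemma frm_upto_add: "frm_upto n \<omega> \<Longrightarrow> frm_upto n \<eta> \<Longrightarrow> frm_upto n (\<omega> + \<eta>)"
  by (induction n arbitrary: \<omega> \<eta>) (auto simp: Y_add Y.scale_right_distrib)

lemma frm_upto_uminus: "frm_upto n \<omega> \<Longrightarrow> frm_upto n (- \<omega>)"
  by (induction n arbitrary: \<omega>) (auto simp: Y_uminus)

lemma frm_upto_diff: "frm_upto n \<omega> \<Longrightarrow> frm_upto n \<eta> \<Longrightarrow> frm_upto n (\<omega> - \<eta>)"
  using frm_upto_add [of n \<omega> "- \<eta>"] frm_upto_uminus by simp

lemma frm_upto_zero: "frm_upto n 0"
proof (induction n)
  case (Suc n)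
  have "frm_upto n (contract x 0)" for x :: 'x
    unfolding contract_arith by (rule Suc.IH)
  then show "frm_upto (Suc n) 0" by (simp add: Y_zero del: contract_arith)
qed (simp add: Y_zero)

lemma frm_add: "frm \<omega> \<Longrightarrow> frm \<eta> \<Longrightarrow> frm (\<omega> + \<eta>)"
  and frm_diff: "frm \<omega> \<Longrightarrow> frm \<eta> \<Longrightarrow> frm (\<omega> - \<eta>)"
  and frm_uminus: "frm \<omega> \<Longrightarrow> frm (- \<omega>)"
  and frm_zero: "frm 0"
  by (simp_all add: frm_def frm_upto_add frm_upto_diff frm_upto_uminus frm_upto_zero)

lemma frm_gsign:
  assumes "frm \<omega>" shows "frm (gsign \<omega>)"
proof -
  have "frm_upto n (gsign \<omega>)" for n using assms
  proof (induction n arbitrary: \<omega>)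
    case (Suc n)
    then have "frm_upto n (contract x (gsign \<omega>))" if "x \<in> X" for x
      using that by (simp add: frm_upto_uminus frm_contract)
    then show ?case using Suc.prems
      by (simp add: frm_Nil) (auto simp: gsign_def signed_def frm_add_head frm_scale_head frm_repeat)
  qed (simp add: frm_Nil)
  then show ?thesis by (simp add: frm_def)
qed

end

section \<open>The Lie derivative and the Chevalley--Eilenberg differential\<close>

context lie_rinehart_conn
begin

text \<open>\<open>act\<close> is additive only on \<open>Y\<close>, so linearity of
  \<open>Lie\<close> and \<open>d\<close> asks for values in \<open>Y\<close>. This condition is
  weaker than \<open>frm\<close> and propagates first; that \<open>Lie\<close> and \<open>d\<close>
  preserve \<open>frm\<close> is then proved with the help of that linearity.\<close>

definition vals :: "('x list \<Rightarrow> 'w) \<Rightarrow> bool" where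
  "vals \<omega> \<longleftrightarrow> (\<forall>xs. set xs \<subseteq> X \<longrightarrow> \<omega> xs \<in> Y)"

lemma frm_vals: "frm \<omega> \<Longrightarrow> vals \<omega>"
  by (simp add: vals_def frm_Y)

lemma vals_contract: "vals \<omega> \<Longrightarrow> x \<in> X \<Longrightarrow> vals (contract x \<omega>)"
  by (simp add: vals_def contract_apply)

lemma valsD: "vals \<omega> \<Longrightarrow> set xs \<subseteq> X \<Longrightarrow> \<omega> xs \<in> Y"
  by (simp add: vals_def)

lemma vals_arith:
  "vals \<omega> \<Longrightarrow> vals \<eta> \<Longrightarrow> vals (\<omega> + \<eta>)" "vals \<omega> \<Longrightarrow> vals \<eta> \<Longrightarrow> vals (\<omega> - \<eta>)"
  "vals \<omega> \<Longrightarrow> vals (- \<omega>)" "vals \<omega> \<Longrightarrow> vals (gsign \<omega>)" "vals 0"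
  "f \<in> C \<Longrightarrow> vals \<omega> \<Longrightarrow> vals (\<lambda>xs. sY f (\<omega> xs))"
  by (auto simp: vals_def Y_add Y_diff Y_uminus Y_zero Y_scale gsign_def signed_def)

lemma vals_lie_der: "vals \<omega> \<Longrightarrow> x \<in> X \<Longrightarrow> vals (Lie x \<omega>)"
proof -
  have "set xs \<subseteq> X \<Longrightarrow> vals \<omega> \<Longrightarrow> x \<in> X \<Longrightarrow> Lie x \<omega> xs \<in> Y" for xs
  proof (induction xs arbitrary: \<omega>)
    case (Cons y ys)
    then have "Lie x (contract y \<omega>) ys \<in> Y"
      by (intro Cons.IH vals_contract) auto
    moreover have "\<omega> (br x y # ys) \<in> Y"
      using Cons.prems by (intro valsD) (auto simp: br_closed)
    ultimately show ?case by (simp add: Y_diff)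
  qed (simp add: act_closed valsD)
  then show "vals \<omega> \<Longrightarrow> x \<in> X \<Longrightarrow> vals (Lie x \<omega>)"
    by (simp add: vals_def)
qed

lemma vals_cartan_d: "vals \<omega> \<Longrightarrow> vals (d \<omega>)"
proof -
  have "set xs \<subseteq> X \<Longrightarrow> vals \<omega> \<Longrightarrow> d \<omega> xs \<in> Y" for xs
  proof (induction xs arbitrary: \<omega>)
    case (Cons y ys)
    then have "d (contract y \<omega>) ys \<in> Y"
      by (intro Cons.IH vals_contract) auto
    then show ?case using Cons.prems vals_lie_der [of \<omega> y] by (simp add: Y_diff valsD)
  qed (simp add: Y_zero)
  then show "vals \<omega> \<Longrightarrow> vals (d \<omega>)"
    by (simp add: vals_def)
qed

lemma lie_der_cong:
  assumes "set xs \<subseteq> X" "x \<in> X" "\<And>ys. set ys \<subseteq> X \<Longrightarrow> \<omega> ys = \<eta> ys"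
  shows "Lie x \<omega> xs = Lie x \<eta> xs"
  using assms
proof (induction xs arbitrary: \<omega> \<eta>)
  case (Cons y ys)
  have "Lie x (contract y \<omega>) ys = Lie x (contract y \<eta>) ys"
    using Cons.prems by (intro Cons.IH) (auto simp: contract_apply)
  then show ?case using Cons.prems by (simp add: br_closed)
qed simp

lemma cartan_d_cong:
  assumes "set xs \<subseteq> X" "\<And>ys. set ys \<subseteq> X \<Longrightarrow> \<omega> ys = \<eta> ys"
  shows "d \<omega> xs = d \<eta> xs"
  using assms
proof (induction xs arbitrary: \<omega> \<eta>)
  case (Cons y ys)
  have "d (contract y \<omega>) ys = d (contract y \<eta>) ys"
    using Cons.prems by (intro Cons.IH) (auto simp: contract_apply)
  then show ?case using Cons.prems lie_der_cong [of ys y \<omega> \<eta>] by simp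
qed simp

lemma lie_der_add:
  assumes "set xs \<subseteq> X" "x \<in> X" "vals \<omega>" "vals \<eta>"
  shows "Lie x (\<omega> + \<eta>) xs = Lie x \<omega> xs + Lie x \<eta> xs"
  using assms
proof (induction xs arbitrary: \<omega> \<eta>)
  case (Cons y ys)
  have "Lie x (contract y \<omega> + contract y \<eta>) ys
      = Lie x (contract y \<omega>) ys + Lie x (contract y \<eta>) ys"
    using Cons.prems by (intro Cons.IH vals_contract) auto
  then show "Lie x (\<omega> + \<eta>) (y # ys) = Lie x \<omega> (y # ys) + Lie x \<eta> (y # ys)" by simp
qed (simp add: act_add valsD)

lemma lie_der_uminus:
  assumes "set xs \<subseteq> X" "x \<in> X" "vals \<omega>"
  shows "Lie x (- \<omega>) xs = - Lie x \<omega> xs"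
  using assms
proof (induction xs arbitrary: \<omega>)
  case (Cons y ys)
  have "Lie x (- contract y \<omega>) ys = - Lie x (contract y \<omega>) ys"
    using Cons.prems by (intro Cons.IH vals_contract) auto
  then show "Lie x (- \<omega>) (y # ys) = - Lie x \<omega> (y # ys)" by simp
qed (simp add: act_uminus valsD)

lemma lie_der_diff:
  assumes "set xs \<subseteq> X" "x \<in> X" "vals \<omega>" "vals \<eta>"
  shows "Lie x (\<omega> - \<eta>) xs = Lie x \<omega> xs - Lie x \<eta> xs"
  using lie_der_add [of xs x \<omega> "- \<eta>"] lie_der_uminus [of xs x \<eta>] vals_arith assms by simp

lemma lie_der_zero: "set xs \<subseteq> X \<Longrightarrow> x \<in> X \<Longrightarrow> Lie x 0 xs = 0"
  using lie_der_diff [of xs x 0 0] vals_arith(5) by simp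

lemma lie_der_scale:
  assumes "set xs \<subseteq> X" "x \<in> X" "vals \<omega>" "f \<in> C"
  shows "Lie x (\<lambda>xs. sY f (\<omega> xs)) xs = sY f (Lie x \<omega> xs) + sY (rho x f) (\<omega> xs)"
  using assms
proof (induction xs arbitrary: \<omega>)
  case (Cons y ys)
  have "Lie x (\<lambda>xs. sY f (contract y \<omega> xs)) ys
      = sY f (Lie x (contract y \<omega>) ys) + sY (rho x f) (contract y \<omega> ys)"
    using Cons.prems by (intro Cons.IH vals_contract) auto
  moreover have "contract y (\<lambda>xs. sY f (\<omega> xs)) = (\<lambda>xs. sY f (contract y \<omega> xs))"
    by (auto simp: fun_eq_iff contract_apply)
  ultimately show ?case by (simp add: contract_apply Y.scale_right_diff_distrib)
qed (simp add: act_scale valsD)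

lemma lie_der_gsign:
  assumes "set xs \<subseteq> X" "x \<in> X" "vals \<omega>"
  shows "Lie x (gsign \<omega>) xs = gsign (Lie x \<omega>) xs"
  using assms
proof (induction xs arbitrary: \<omega>)
  case (Cons y ys)
  have "Lie x (gsign (contract y \<omega>)) ys = gsign (Lie x (contract y \<omega>)) ys"
    using Cons.prems by (intro Cons.IH vals_contract) auto
  moreover have "Lie x (- gsign (contract y \<omega>)) ys = - Lie x (gsign (contract y \<omega>)) ys"
    using Cons.prems by (intro lie_der_uminus vals_arith vals_contract) auto
  ultimately show "Lie x (gsign \<omega>) (y # ys) = gsign (Lie x \<omega>) (y # ys)"
    by (simp add: gsign_apply signed_diff)
qed simp

lemma cartan_d_add:
  assumes "set xs \<subseteq> X" "vals \<omega>" "vals \<eta>"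
  shows "d (\<omega> + \<eta>) xs = d \<omega> xs + d \<eta> xs"
  using assms
proof (induction xs arbitrary: \<omega> \<eta>)
  case (Cons y ys)
  have "d (contract y \<omega> + contract y \<eta>) ys
      = d (contract y \<omega>) ys + d (contract y \<eta>) ys"
    using Cons.prems by (intro Cons.IH vals_contract) auto
  then show "d (\<omega> + \<eta>) (y # ys) = d \<omega> (y # ys) + d \<eta> (y # ys)" using Cons.prems lie_der_add [of ys y \<omega> \<eta>] by simp
qed simp

lemma cartan_d_uminus:
  assumes "set xs \<subseteq> X" "vals \<omega>"
  shows "d (- \<omega>) xs = - d \<omega> xs"
  using assms
proof (induction xs arbitrary: \<omega>)
  case (Cons y ys)
  have "d (- contract y \<omega>) ys = - d (contract y \<omega>) ys"
    using Cons.prems by (intro Cons.IH vals_contract) auto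
  then show "d (- \<omega>) (y # ys) = - d \<omega> (y # ys)" using Cons.prems lie_der_uminus [of ys y \<omega>] by simp
qed simp

lemma cartan_d_diff:
  assumes "set xs \<subseteq> X" "vals \<omega>" "vals \<eta>"
  shows "d (\<omega> - \<eta>) xs = d \<omega> xs - d \<eta> xs"
  using cartan_d_add [of xs \<omega> "- \<eta>"] cartan_d_uminus [of xs \<eta>] vals_arith assms by simp

lemma cartan_d_zero: "set xs \<subseteq> X \<Longrightarrow> d 0 xs = 0"
  using cartan_d_diff [of xs 0 0] vals_arith(5) by simp

lemma cartan_d_gsign:
  assumes "set xs \<subseteq> X" "vals \<omega>"
  shows "d (gsign \<omega>) xs = - gsign (d \<omega>) xs"
  using assms
proof (induction xs arbitrary: \<omega>)
  case (Cons y ys)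
  have "d (gsign (contract y \<omega>)) ys = - gsign (d (contract y \<omega>)) ys"
    using Cons.prems by (intro Cons.IH vals_contract) auto
  moreover have "d (- gsign (contract y \<omega>)) ys = - d (gsign (contract y \<omega>)) ys"
    using Cons.prems by (intro cartan_d_uminus vals_arith vals_contract) auto
  moreover have "Lie y (gsign \<omega>) ys = gsign (Lie y \<omega>) ys"
    using Cons.prems by (intro lie_der_gsign) auto
  ultimately show "d (gsign \<omega>) (y # ys) = - gsign (d \<omega>) (y # ys)"
    by (simp add: gsign_apply signed_diff)
qed simp

text \<open>Linearity over \<open>C\<close> survives because the derivative of the function produced
  by \<open>act\<close> cancels against the one produced by \<open>br_scale\<close>. On a repeated
  argument \<open>y\<close>, the two terms containing \<open>br x y\<close> cancel by
  antisymmetry.\<close>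

lemma frm_lie_der:
  assumes "frm \<omega>" "x \<in> X"
  shows "frm (Lie x \<omega>)"
proof -
  have "frm_upto n (Lie x \<omega>)" for n using assms
  proof (induction n arbitrary: \<omega>)
    case 0
    then show ?case by (simp add: frm_Nil act_closed)
  next
    case (Suc n)
    note \<omega> = Suc.prems(1) and x = Suc.prems(2)
    have "frm_upto n (contract y (Lie x \<omega>))" if y: "y \<in> X" for y
      unfolding contract_lie_der using \<omega> x y
      by (intro frm_upto_diff Suc.IH) (auto simp: frm_contract br_closed frm_def [symmetric] intro: frm_def [THEN iffD1, rule_format])
    moreover have "Lie x \<omega> ((y + z) # zs) = Lie x \<omega> (y # zs) + Lie x \<omega> (z # zs)"
      if "y \<in> X" "z \<in> X" "set zs \<subseteq> X" for y z zs
    proof -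
      have "Lie x (contract (y + z) \<omega>) zs = Lie x (contract y \<omega> + contract z \<omega>) zs"
        using that \<omega> x by (intro lie_der_cong) (auto simp: contract_apply frm_add_head)
      also have "\<dots> = Lie x (contract y \<omega>) zs + Lie x (contract z \<omega>) zs"
        using that \<omega> x by (intro lie_der_add frm_vals frm_contract) auto
      finally show ?thesis using that \<omega> x by (simp add: br_add frm_add_head br_closed)
    qed
    moreover have "Lie x \<omega> (sX f y # zs) = sY f (Lie x \<omega> (y # zs))"
      if "f \<in> C" "y \<in> X" "set zs \<subseteq> X" for f y zs
    proof -
      have "Lie x (contract (sX f y) \<omega>) zs = Lie x (\<lambda>zs. sY f (contract y \<omega> zs)) zs"
        using that \<omega> x by (intro lie_der_cong) (auto simp: contract_apply frm_scale_head)
      also have "\<dots> = sY f (Lie x (contract y \<omega>) zs) + sY (rho x f) (contract y \<omega> zs)"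
        using that \<omega> x by (intro lie_der_scale frm_vals frm_contract) auto
      finally show ?thesis using that \<omega> x
        by (simp add: br_scale frm_add_head frm_scale_head br_closed X_scale rho_closed
            contract_apply Y.scale_right_diff_distrib)
    qed
    moreover have "Lie x \<omega> (y # y # zs) = 0" if "y \<in> X" "set zs \<subseteq> X" for y zs
    proof -
      have "Lie x (contract y (contract y \<omega>)) zs = Lie x 0 zs"
        using that \<omega> x by (intro lie_der_cong) (auto simp: contract_apply frm_repeat)
      then show ?thesis
        using that \<omega> x lie_der_zero [of zs x] frm_swap [of \<omega> y "br x y" zs]
        by (simp add: contract_apply br_closed)
    qed
    ultimately show ?case
      using \<omega> x by (simp add: frm_Nil act_closed)
  qed
  then show ?thesis by (simp add: frm_def)
qed

lemma lie_der_add_left: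
  assumes "set xs \<subseteq> X" "x \<in> X" "y \<in> X" "frm \<omega>"
  shows "Lie (x + y) \<omega> xs = Lie x \<omega> xs + Lie y \<omega> xs"
  using assms
proof (induction xs arbitrary: \<omega>)
  case (Cons z zs)
  have "Lie (x + y) (contract z \<omega>) zs
      = Lie x (contract z \<omega>) zs + Lie y (contract z \<omega>) zs"
    using Cons.prems by (intro Cons.IH frm_contract) auto
  then show ?case using Cons.prems by (simp add: br_add_left frm_add_head br_closed)
qed (simp add: act_add_left frm_Nil)

text \<open>Both sides measure the failure of \<open>C\<close>-linearity, by \<open>df \<and> i\<^sub>x \<omega>\<close>.\<close>

lemma lie_der_scale_left:
  assumes "set xs \<subseteq> X" "x \<in> X" "f \<in> C" "frm \<omega>"
  shows "Lie (sX f x) \<omega> xs - sY f (Lie x \<omega> xs)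
    = d (\<lambda>zs. sY f (contract x \<omega> zs)) xs - sY f (d (contract x \<omega>) xs)"
  using assms
proof (induction xs arbitrary: \<omega>)
  case (Cons y ys)
  let ?\<omega> = "contract y \<omega>"
  have fr: "frm ?\<omega>" "frm (contract x \<omega>)" "frm (contract y (contract x \<omega>))"
    using Cons.prems by (auto intro!: frm_contract)
  \<comment> \<open>The induction hypothesis speaks of i_x i_y, whereas the recursion for
    \<open>d\<close> produces i_y i_x.\<close>
  have sw: "contract x ?\<omega> zs = - contract y (contract x \<omega>) zs" if "set zs \<subseteq> X" for zs
    using that Cons.prems frm_swap [of \<omega> y x zs] by (simp add: contract_apply)
  have "Lie (sX f x) ?\<omega> ys - sY f (Lie x ?\<omega> ys)
    = d (\<lambda>zs. sY f (contract x ?\<omega> zs)) ys - sY f (d (contract x ?\<omega>) ys)"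
    using Cons.prems by (intro Cons.IH frm_contract) auto
  also have "d (contract x ?\<omega>) ys = d (- contract y (contract x \<omega>)) ys"
    using Cons.prems sw by (intro cartan_d_cong) auto
  also have "\<dots> = - d (contract y (contract x \<omega>)) ys"
    using Cons.prems fr by (intro cartan_d_uminus frm_vals) auto
  also have "d (\<lambda>zs. sY f (contract x ?\<omega> zs)) ys
     = d (- (\<lambda>zs. sY f (contract y (contract x \<omega>) zs))) ys"
    using Cons.prems sw by (intro cartan_d_cong) auto
  also have "\<dots> = - d (\<lambda>zs. sY f (contract y (contract x \<omega>) zs)) ys"
    using Cons.prems fr by (intro cartan_d_uminus vals_arith frm_vals) auto
  also have "(\<lambda>zs. sY f (contract y (contract x \<omega>) zs)) = contract y (\<lambda>zs. sY f (contract x \<omega> zs))"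
    by (auto simp: fun_eq_iff contract_apply)
  finally have 1: "Lie (sX f x) ?\<omega> ys = sY f (Lie x ?\<omega> ys)
    - d (contract y (\<lambda>zs. sY f (contract x \<omega> zs))) ys
    + sY f (d (contract y (contract x \<omega>)) ys)"
    by (simp add: algebra_simps)
  have 2: "Lie y (\<lambda>zs. sY f (contract x \<omega> zs)) ys
     = sY f (Lie y (contract x \<omega>) ys) + sY (rho y f) (contract x \<omega> ys)"
    using Cons.prems fr by (intro lie_der_scale frm_vals) auto
  have 3: "\<omega> (br (sX f x) y # ys) = sY f (\<omega> (br x y # ys)) - sY (rho y f) (contract x \<omega> ys)"
    using Cons.prems
    by (simp add: br_scale_left frm_diff_head frm_scale_head br_closed X_scale rho_closed contract_apply)
  show ?case
    by (simp add: 1 2 3 Y.scale_right_diff_distrib)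
qed (use act_scale_left frm_Nil in simp)

text \<open>Linearity in the first argument rests on \<open>lie_der_add_left\<close> and
  \<open>lie_der_scale_left\<close>. On a repeated argument the two terms L_y i_y cancel, and what
  remains contains [y, y] or i_y i_y.\<close>

lemma frm_cartan_d:
  assumes "frm \<omega>"
  shows "frm (d \<omega>)"
proof -
  have "frm_upto n (d \<omega>)" for n using assms
  proof (induction n arbitrary: \<omega>)
    case 0
    then show ?case by (simp add: Y_zero)
  next
    case (Suc n)
    note \<omega> = Suc.prems(1)
    have "frm_upto n (contract y (d \<omega>))" if y: "y \<in> X" for y
      unfolding contract_cartan_d using \<omega> y frm_lie_der [OF \<omega> y]
      by (intro frm_upto_diff Suc.IH) (auto simp: frm_contract intro: frm_def [THEN iffD1, rule_format])
    moreover have "d \<omega> ((y + z) # zs) = d \<omega> (y # zs) + d \<omega> (z # zs)"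
      if "y \<in> X" "z \<in> X" "set zs \<subseteq> X" for y z zs
    proof -
      have "d (contract (y + z) \<omega>) zs = d (contract y \<omega> + contract z \<omega>) zs"
        using that \<omega> by (intro cartan_d_cong) (auto simp: contract_apply frm_add_head)
      also have "\<dots> = d (contract y \<omega>) zs + d (contract z \<omega>) zs"
        using that \<omega> by (intro cartan_d_add frm_vals frm_contract) auto
      finally show ?thesis using that \<omega> by (simp add: lie_der_add_left)
    qed
    moreover have "d \<omega> (sX f y # zs) = sY f (d \<omega> (y # zs))"
      if "f \<in> C" "y \<in> X" "set zs \<subseteq> X" for f y zs
    proof -
      have "d (contract (sX f y) \<omega>) zs = d (\<lambda>zs. sY f (contract y \<omega> zs)) zs"
        using that \<omega> by (intro cartan_d_cong) (auto simp: contract_apply frm_scale_head)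
      then show ?thesis using that \<omega> lie_der_scale_left [of zs y f \<omega>]
        by (simp add: Y.scale_right_diff_distrib algebra_simps)
    qed
    moreover have "d \<omega> (y # y # zs) = 0" if "y \<in> X" "set zs \<subseteq> X" for y zs
    proof -
      have "d (contract y (contract y \<omega>)) zs = d 0 zs"
        using that \<omega> by (intro cartan_d_cong) (auto simp: contract_apply frm_repeat)
      then show ?thesis
        using that \<omega> cartan_d_zero [of zs] by (simp add: br_self frm_zero_head)
    qed
    ultimately show ?case
      by (simp add: Y_zero)
  qed
  then show ?thesis by (simp add: frm_def)
qed

text \<open>The recursion leaves the bracket in the place of the argument it replaces; moving it to
  the front past the earlier arguments accounts for the alternating signs.\<close>

lemma lie_der_explicit:
  assumes "set xs \<subseteq> X" "x \<in> X" "frm \<omega>"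
  shows "Lie x \<omega> xs = act x (\<omega> xs)
    + (\<Sum>j<length xs. signed (Suc j) (\<omega> (br x (xs ! j) # delete_at j xs)))"
  using assms
proof (induction xs arbitrary: \<omega>)
  case (Cons y ys)
  have 1: "Lie x (contract y \<omega>) ys = act x (contract y \<omega> ys)
    + (\<Sum>j<length ys. signed (Suc j) (contract y \<omega> (br x (ys ! j) # delete_at j ys)))"
    using Cons.prems by (intro Cons.IH frm_contract) auto
  have 2: "(\<Sum>j<length ys. signed (Suc j) (contract y \<omega> (br x (ys ! j) # delete_at j ys)))
    = (\<Sum>j<length ys. signed (Suc (Suc j)) (\<omega> (br x (ys ! j) # y # delete_at j ys)))"
  proof (rule sum.cong)
    fix j assume "j \<in> {..<length ys}"
    then have "ys ! j \<in> X" "set (delete_at j ys) \<subseteq> X"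
      using Cons.prems set_take_subset [of j ys] set_drop_subset [of "Suc j" ys]
      by (auto simp: delete_at_def)
    then show "signed (Suc j) (contract y \<omega> (br x (ys ! j) # delete_at j ys))
      = signed (Suc (Suc j)) (\<omega> (br x (ys ! j) # y # delete_at j ys))"
      using Cons.prems frm_swap [of \<omega> y "br x (ys ! j)" "delete_at j ys"]
      by (simp add: contract_apply br_closed)
  qed simp
  have IH: "Lie x (contract y \<omega>) ys = act x (\<omega> (y # ys))
    + (\<Sum>j<length ys. signed (Suc (Suc j)) (\<omega> (br x (ys ! j) # y # delete_at j ys)))"
    using 1 unfolding 2 by (simp only: contract_apply)
  have "delete_at 0 (y # ys) = ys" "delete_at (Suc k) (y # ys) = y # delete_at k ys" for k
    by (simp_all add: delete_at_def)
  then show ?case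
    unfolding list.size add_0_right add_Suc_right sum.lessThan_Suc_shift
    by (simp add: IH)
qed simp

lemma sum_increasing_pairs_Suc:
  "(\<Sum>(i, j) | i < j \<and> j < Suc n. h i j)
    = (\<Sum>j<n. h 0 (Suc j)) + (\<Sum>(i, j) | i < j \<and> j < n. h (Suc i) (Suc j) :: 'w)"
proof -
  let ?P = "{(i::nat, j). i < j \<and> j < n}"
  have fin: "finite ?P"
    by (rule finite_subset [of _ "{..<n} \<times> {..<n}"]) auto
  have eq: "{(i::nat, j). i < j \<and> j < Suc n} = (\<lambda>j. (0, Suc j)) ` {..<n} \<union> map_prod Suc Suc ` ?P"
  proof (intro set_eqI, clarify)
    fix i j :: nat
    show "((i, j) \<in> {(i, j). i < j \<and> j < Suc n}) = ((i, j) \<in> (\<lambda>j. (0, Suc j)) ` {..<n} \<union> map_prod Suc Suc ` ?P)"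
      by (cases i; cases j) (auto simp: image_iff)
  qed
  have "inj_on (map_prod Suc Suc) ?P" "inj_on (\<lambda>j. (0::nat, Suc j)) {..<n}"
    by (auto intro!: inj_onI)
  then show ?thesis
    unfolding eq using fin
    by (subst sum.union_disjoint) (auto simp: sum.reindex case_prod_unfold)
qed

text \<open>Identifies Cartan's recursion with the sum that defines \<open>ce_diff\<close>: the
  terms involving the first index come from \<open>Lie\<close>, all others from the differential of
  the contraction.\<close>

lemma cartan_d_explicit:
  assumes "set xs \<subseteq> X" "frm \<omega>"
  shows "d \<omega> xs =
     (\<Sum>i<length xs. signed i (act (xs ! i) (\<omega> (delete_at i xs)))) +
     (\<Sum>(i, j) | i < j \<and> j < length xs.
        signed (i + j) (\<omega> (br (xs ! i) (xs ! j) # delete_at i (delete_at j xs))))"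
  using assms
proof (induction xs arbitrary: \<omega>)
  case (Cons x xs)
  have del: "delete_at 0 (y # ys) = ys" "delete_at (Suc k) (y # ys) = y # delete_at k ys" for k y and ys :: "'x list"
    by (simp_all add: delete_at_def)
  have IH: "d (contract x \<omega>) xs =
     (\<Sum>i<length xs. signed i (act (xs ! i) (contract x \<omega> (delete_at i xs)))) +
     (\<Sum>(i, j) | i < j \<and> j < length xs.
        signed (i + j) (contract x \<omega> (br (xs ! i) (xs ! j) # delete_at i (delete_at j xs))))"
    using Cons.prems by (intro Cons.IH frm_contract) auto
  have del_sub: "set (delete_at i ys) \<subseteq> X" if "set ys \<subseteq> X" for i ys
    using that set_take_subset [of i ys] set_drop_subset [of "Suc i" ys]
    by (auto simp: delete_at_def)
  have pairs: "(\<Sum>(i, j) | i < j \<and> j < length xs.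
        signed (i + j) (contract x \<omega> (br (xs ! i) (xs ! j) # delete_at i (delete_at j xs))))
     = - (\<Sum>(i, j) | i < j \<and> j < length xs.
        signed (i + j) (\<omega> (br (xs ! i) (xs ! j) # x # delete_at i (delete_at j xs))))"
    unfolding sum_negf [symmetric]
  proof (rule sum.cong [OF refl])
    fix p assume "p \<in> {(i, j). i < j \<and> j < length xs}"
    then obtain i j where p: "p = (i, j)" and ij: "i < j" "j < length xs" by blast
    then have "xs ! i \<in> X" "xs ! j \<in> X"
      using Cons.prems by (auto intro!: subsetD [OF _ nth_mem])
    then show "(case p of (i, j) \<Rightarrow> signed (i + j) (contract x \<omega> (br (xs ! i) (xs ! j) # delete_at i (delete_at j xs))))
      = - (case p of (i, j) \<Rightarrow> signed (i + j) (\<omega> (br (xs ! i) (xs ! j) # x # delete_at i (delete_at j xs))))"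
      using Cons.prems frm_swap [of \<omega> x "br (xs ! i) (xs ! j)" "delete_at i (delete_at j xs)"]
      by (simp add: p contract_apply br_closed del_sub)
  qed
  have "Lie x \<omega> xs = act x (\<omega> xs)
    + (\<Sum>j<length xs. signed (Suc j) (\<omega> (br x (xs ! j) # delete_at j xs)))"
    using Cons.prems by (intro lie_der_explicit) auto
  then show ?case
    unfolding list.size add_0_right add_Suc_right sum.lessThan_Suc_shift sum_increasing_pairs_Suc
      cartan_d.simps IH pairs
    by (simp add: del contract_apply sum_negf algebra_simps)
qed simp

lemma ce_diff_eq: "frm \<omega> \<Longrightarrow> ce_diff X br act \<omega> = on_lists X (d \<omega>)"
  by (auto simp: ce_diff_def on_lists_def fun_eq_iff cartan_d_explicit)

end

lemma (in lie_rinehart) br_uminus: "x \<in> X \<Longrightarrow> y \<in> X \<Longrightarrow> br x (- y) = - br x y"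
  using br_add [of x y "- y"] br_add [of x 0 0] X_uminus X_zero
  by (simp add: eq_neg_iff_add_eq_0 add.commute)

section \<open>Wedge products, the Leibniz rule and the square of the differential\<close>

context lie_rinehart_conn
begin

abbreviation wdg :: "('x list \<Rightarrow> 'c) \<Rightarrow> ('x list \<Rightarrow> 'w) \<Rightarrow> 'x list \<Rightarrow> 'w" where
  "wdg \<equiv> wedge sY"

lemma wdg_Cons [simp]:
  "wdg \<alpha> \<omega> (x # xs) = wdg (contract x \<alpha>) \<omega> xs + wdg (gsign \<alpha>) (contract x \<omega>) xs"
  by (rule wedge_Cons) simp

lemma contract_wdg [simp]:
  "contract x (wdg \<alpha> \<omega>) = wdg (contract x \<alpha>) \<omega> + wdg (gsign \<alpha>) (contract x \<omega>)"
  by (auto simp: fun_eq_iff contract_apply)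

lemma wdg_arith:
  "wdg (\<alpha> + \<beta>) \<omega> = wdg \<alpha> \<omega> + wdg \<beta> \<omega>" "wdg \<alpha> (\<omega> + \<eta>) = wdg \<alpha> \<omega> + wdg \<alpha> \<eta>"
  "wdg (- \<alpha>) \<omega> = - wdg \<alpha> \<omega>" "wdg \<alpha> (- \<omega>) = - wdg \<alpha> \<omega>"
  "wdg (\<alpha> - \<beta>) \<omega> = wdg \<alpha> \<omega> - wdg \<beta> \<omega>" "wdg \<alpha> (\<omega> - \<eta>) = wdg \<alpha> \<omega> - wdg \<alpha> \<eta>"
  "wdg 0 \<omega> = 0" "wdg \<alpha> 0 = 0"
  by (auto simp: wedge_def fun_eq_iff sum.distrib sum_negf sum_subtractf signed_add signed_diff
      Y.scale_left_distrib Y.scale_right_distrib Y.scale_left_diff_distrib Y.scale_right_diff_distrib)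

lemma wdg_cong:
  assumes "set xs \<subseteq> X" "\<And>ys. set ys \<subseteq> X \<Longrightarrow> \<alpha> ys = \<beta> ys" "\<And>ys. set ys \<subseteq> X \<Longrightarrow> \<omega> ys = \<eta> ys"
  shows "wdg \<alpha> \<omega> xs = wdg \<beta> \<eta> xs"
proof -
  have "set (nths xs S) \<subseteq> X" for S
    using assms(1) set_nths_subset [of xs S] by blast
  then show ?thesis using assms(2,3) by (simp add: wedge_def)
qed

lemma vals_wdg: "S.vals \<alpha> \<Longrightarrow> vals \<omega> \<Longrightarrow> vals (wdg \<alpha> \<omega>)"
proof (unfold vals_def S.vals_def, intro allI impI)
  fix xs assume *: "\<forall>xs. set xs \<subseteq> X \<longrightarrow> \<alpha> xs \<in> C" "\<forall>xs. set xs \<subseteq> X \<longrightarrow> \<omega> xs \<in> Y" "set xs \<subseteq> X"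
  have "set (nths xs S) \<subseteq> X" for S
    using *(3) set_nths_subset [of xs S] by blast
  with * show "wdg \<alpha> \<omega> xs \<in> Y"
    by (auto simp: wedge_def signed_def intro!: Y_sum Y_scale Y_uminus)
qed

lemma gsign_gsign [simp]: "gsign (gsign \<omega>) = \<omega>"
  by (simp add: gsign_def)

text \<open>On a repeated argument the two mixed terms cancel, because contraction anticommutes with
  \<open>gsign\<close>; the other two contain a double contraction with the same section.\<close>

lemma frm_wdg:
  assumes "S.frm \<alpha>" "frm \<omega>"
  shows "frm (wdg \<alpha> \<omega>)"
proof -
  have "frm_upto n (wdg \<alpha> \<omega>)" for n using assms
  proof (induction n arbitrary: \<alpha> \<omega>)
    case 0
    then show ?case by (simp add: Y_scale frm_Nil S.frm_Nil)
  next
    case (Suc n)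
    note \<alpha> = Suc.prems(1) and \<omega> = Suc.prems(2)
    have "frm_upto n (contract y (wdg \<alpha> \<omega>))" if y: "y \<in> X" for y
      unfolding contract_wdg using \<alpha> \<omega> y
      by (intro frm_upto_add Suc.IH) (auto simp: frm_contract S.frm_contract S.frm_gsign)
    moreover have "wdg \<alpha> \<omega> ((y + z) # zs) = wdg \<alpha> \<omega> (y # zs) + wdg \<alpha> \<omega> (z # zs)"
      if "y \<in> X" "z \<in> X" "set zs \<subseteq> X" for y z zs
    proof -
      have "wdg (contract (y + z) \<alpha>) \<omega> zs = wdg (contract y \<alpha> + contract z \<alpha>) \<omega> zs"
        using that \<alpha> \<omega> by (intro wdg_cong) (auto simp: contract_apply S.frm_add_head)
      moreover have "wdg (gsign \<alpha>) (contract (y + z) \<omega>) zs = wdg (gsign \<alpha>) (contract y \<omega> + contract z \<omega>) zs"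
        using that \<alpha> \<omega> by (intro wdg_cong) (auto simp: contract_apply frm_add_head)
      ultimately show ?thesis by (simp add: wdg_arith)
    qed
    moreover have "wdg \<alpha> \<omega> (sX f y # zs) = sY f (wdg \<alpha> \<omega> (y # zs))"
      if "f \<in> C" "y \<in> X" "set zs \<subseteq> X" for f y zs
    proof -
      have "wdg (contract (sX f y) \<alpha>) \<omega> zs = wdg (\<lambda>zs. f * contract y \<alpha> zs) \<omega> zs"
        using that \<alpha> \<omega> by (intro wdg_cong) (auto simp: contract_apply S.frm_scale_head)
      also have "\<dots> = sY f (wdg (contract y \<alpha>) \<omega> zs)"
        by (auto simp: wedge_def signed_def Y.scale_sum_right intro!: sum.cong)
      moreover have "wdg (gsign \<alpha>) (contract (sX f y) \<omega>) zs = wdg (gsign \<alpha>) (\<lambda>zs. sY f (contract y \<omega> zs)) zs"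
        using that \<alpha> \<omega> by (intro wdg_cong) (auto simp: contract_apply frm_scale_head)
      moreover have "\<dots> = sY f (wdg (gsign \<alpha>) (contract y \<omega>) zs)"
        by (auto simp: wedge_def signed_def Y.scale_sum_right mult.commute intro!: sum.cong)
      ultimately show ?thesis by (simp add: Y.scale_right_distrib)
    qed
    moreover have "wdg \<alpha> \<omega> (y # y # zs) = 0" if "y \<in> X" "set zs \<subseteq> X" for y zs
    proof -
      have "wdg (contract y (contract y \<alpha>)) \<omega> zs = wdg 0 \<omega> zs"
        using that \<alpha> by (intro wdg_cong) (auto simp: contract_apply S.frm_repeat)
      moreover have "wdg \<alpha> (contract y (contract y \<omega>)) zs = wdg \<alpha> 0 zs"
        using that \<omega> by (intro wdg_cong) (auto simp: contract_apply frm_repeat)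
      ultimately show ?thesis
        by (simp add: wdg_arith)
    qed
    ultimately show ?case
      using \<alpha> \<omega> by (simp add: frm_Nil S.frm_Nil Y_scale del: wdg_Cons contract_wdg)
  qed
  then show ?thesis by (simp add: frm_def)
qed

lemma lie_der_wdg:
  assumes "set xs \<subseteq> X" "x \<in> X" "S.vals \<alpha>" "vals \<omega>"
  shows "Lie x (wdg \<alpha> \<omega>) xs = wdg (lie_der br rho x \<alpha>) \<omega> xs + wdg \<alpha> (Lie x \<omega>) xs"
  using assms
proof (induction xs arbitrary: \<alpha> \<omega>)
  case (Cons y ys)
  have y: "y \<in> X" "set ys \<subseteq> X" using Cons.prems by auto
  have 1: "Lie x (contract y (wdg \<alpha> \<omega>)) ys
      = Lie x (wdg (contract y \<alpha>) \<omega>) ys + Lie x (wdg (gsign \<alpha>) (contract y \<omega>)) ys"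
    unfolding contract_wdg using Cons.prems y
    by (intro lie_der_add vals_wdg S.vals_arith S.vals_contract vals_contract) auto
  have 2: "Lie x (wdg (contract y \<alpha>) \<omega>) ys
      = wdg (lie_der br rho x (contract y \<alpha>)) \<omega> ys + wdg (contract y \<alpha>) (Lie x \<omega>) ys"
    using Cons.prems y by (intro Cons.IH S.vals_contract) auto
  have 3: "Lie x (wdg (gsign \<alpha>) (contract y \<omega>)) ys
      = wdg (lie_der br rho x (gsign \<alpha>)) (contract y \<omega>) ys + wdg (gsign \<alpha>) (Lie x (contract y \<omega>)) ys"
    using Cons.prems y by (intro Cons.IH S.vals_arith vals_contract) auto
  have 4: "wdg (lie_der br rho x (gsign \<alpha>)) (contract y \<omega>) ys = wdg (gsign (lie_der br rho x \<alpha>)) (contract y \<omega>) ys"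
    using Cons.prems y by (intro wdg_cong S.lie_der_gsign) auto
  have "Lie x (wdg \<alpha> \<omega>) (y # ys)
      = Lie x (contract y (wdg \<alpha> \<omega>)) ys - contract (br x y) (wdg \<alpha> \<omega>) ys"
    by (simp only: lie_der.simps contract_apply)
  then show "Lie x (wdg \<alpha> \<omega>) (y # ys)
      = wdg (lie_der br rho x \<alpha>) \<omega> (y # ys) + wdg \<alpha> (Lie x \<omega>) (y # ys)"
    unfolding 1 2 3 4 by (simp add: wdg_arith)
qed (simp add: act_scale S.valsD valsD)

text \<open>Cartan's formula transfers the rule from \<open>contract\<close>, an antiderivation, and
  \<open>Lie\<close>, a derivation. The signs fit because both \<open>contract\<close> and
  \<open>d\<close> anticommute with \<open>gsign\<close>.\<close>

lemma cartan_d_wdg: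
  assumes "set xs \<subseteq> X" "S.vals \<alpha>" "vals \<omega>"
  shows "d (wdg \<alpha> \<omega>) xs
    = wdg (cartan_d br rho \<alpha>) \<omega> xs + wdg (gsign \<alpha>) (d \<omega>) xs"
  using assms
proof (induction xs arbitrary: \<alpha> \<omega>)
  case (Cons y ys)
  have y: "y \<in> X" "set ys \<subseteq> X" using Cons.prems by auto
  have 1: "d (contract y (wdg \<alpha> \<omega>)) ys
      = d (wdg (contract y \<alpha>) \<omega>) ys + d (wdg (gsign \<alpha>) (contract y \<omega>)) ys"
    unfolding contract_wdg using Cons.prems y
    by (intro cartan_d_add vals_wdg S.vals_arith S.vals_contract vals_contract) auto
  have 2: "d (wdg (contract y \<alpha>) \<omega>) ys
      = wdg (cartan_d br rho (contract y \<alpha>)) \<omega> ys + wdg (gsign (contract y \<alpha>)) (d \<omega>) ys"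
    using Cons.prems y by (intro Cons.IH S.vals_contract) auto
  have 3: "d (wdg (gsign \<alpha>) (contract y \<omega>)) ys
      = wdg (cartan_d br rho (gsign \<alpha>)) (contract y \<omega>) ys
      + wdg (gsign (gsign \<alpha>)) (d (contract y \<omega>)) ys"
    using Cons.prems y by (intro Cons.IH S.vals_arith vals_contract) auto
  have 4: "wdg (cartan_d br rho (gsign \<alpha>)) (contract y \<omega>) ys
      = wdg (- gsign (cartan_d br rho \<alpha>)) (contract y \<omega>) ys"
    using Cons.prems y by (intro wdg_cong) (auto simp: S.cartan_d_gsign)
  have 5: "Lie y (wdg \<alpha> \<omega>) ys
      = wdg (lie_der br rho y \<alpha>) \<omega> ys + wdg \<alpha> (Lie y \<omega>) ys"
    using Cons.prems y by (intro lie_der_wdg) auto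
  have "d (wdg \<alpha> \<omega>) (y # ys)
      = Lie y (wdg \<alpha> \<omega>) ys - d (contract y (wdg \<alpha> \<omega>)) ys"
    by (simp only: cartan_d.simps)
  then show "d (wdg \<alpha> \<omega>) (y # ys)
    = wdg (cartan_d br rho \<alpha>) \<omega> (y # ys) + wdg (gsign \<alpha>) (d \<omega>) (y # ys)"
    unfolding 1 2 3 4 5 by (simp add: wdg_arith)
qed simp

text \<open>Flatness settles the value on the empty list, and the Jacobi identity deals with each
  further argument.\<close>

lemma lie_der_br:
  assumes flat: "\<And>x y w. x \<in> X \<Longrightarrow> y \<in> X \<Longrightarrow> w \<in> Y \<Longrightarrow> act (br x y) w = act x (act y w) - act y (act x w)"
  and "set xs \<subseteq> X" "x \<in> X" "y \<in> X" "frm \<omega>"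
  shows "Lie x (Lie y \<omega>) xs - Lie y (Lie x \<omega>) xs
    = Lie (br x y) \<omega> xs"
  using assms(2-)
proof (induction xs arbitrary: \<omega>)
  case (Cons z zs)
  have z: "z \<in> X" "set zs \<subseteq> X" and xy: "x \<in> X" "y \<in> X" and \<omega>: "frm \<omega>" using Cons.prems by auto
  have exp: "Lie u (Lie v \<omega>) (z # zs)
      = Lie u (Lie v (contract z \<omega>)) zs - Lie u (contract (br v z) \<omega>) zs
        - (Lie v (contract (br u z) \<omega>) zs - \<omega> (br v (br u z) # zs))"
    if uv: "u \<in> X" "v \<in> X" for u v
  proof -
    have "Lie u (contract z (Lie v \<omega>)) zs
      = Lie u (Lie v (contract z \<omega>)) zs - Lie u (contract (br v z) \<omega>) zs"
      unfolding contract_lie_der using z uv \<omega>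
      by (intro lie_der_diff vals_lie_der frm_vals frm_contract) (auto simp: br_closed)
    then show ?thesis by (simp only: lie_der.simps)
  qed
  have IH: "Lie x (Lie y (contract z \<omega>)) zs
     - Lie y (Lie x (contract z \<omega>)) zs = Lie (br x y) (contract z \<omega>) zs"
    using z xy \<omega> by (intro Cons.IH frm_contract) auto
  have "br x (br y z) = br (br x y) z + br y (br x z)"
  proof -
    have "br z x = - br x z" "br z (br x y) = - br (br x y) z"
      using xy z by (auto intro!: br_skew br_closed)
    moreover have "br y (- br x z) = - br y (br x z)"
      using xy z by (intro br_uminus br_closed)
    ultimately show ?thesis
      using jacobi [OF xy z(1)] by (simp add: algebra_simps)
  qed
  then have "\<omega> (br x (br y z) # zs) = \<omega> (br (br x y) z # zs) + \<omega> (br y (br x z) # zs)"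
    using frm_add_head [OF \<omega>] z xy br_closed by simp
  then show ?case
    unfolding exp [OF xy] exp [OF xy(2,1)] using IH by (simp add: algebra_simps)
qed (simp add: flat frm_Nil)

text \<open>Contracted with \<open>y\<close>, the difference of the two sides becomes [L_x, L_y] -
  L_[x,y], which vanishes by \<open>lie_der_br\<close>, minus the same difference for i_y
  \<omega>.\<close>

lemma lie_der_cartan_d:
  assumes flat: "\<And>x y w. x \<in> X \<Longrightarrow> y \<in> X \<Longrightarrow> w \<in> Y \<Longrightarrow> act (br x y) w = act x (act y w) - act y (act x w)"
  and "set xs \<subseteq> X" "x \<in> X" "frm \<omega>"
  shows "Lie x (d \<omega>) xs = d (Lie x \<omega>) xs"
  using assms(2-)
proof (induction xs arbitrary: \<omega>)
  case (Cons y ys)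
  have y: "y \<in> X" "set ys \<subseteq> X" and x: "x \<in> X" and \<omega>: "frm \<omega>" using Cons.prems by auto
  have 1: "Lie x (contract y (d \<omega>)) ys
    = Lie x (Lie y \<omega>) ys - Lie x (d (contract y \<omega>)) ys"
    unfolding contract_cartan_d using y x \<omega>
    by (intro lie_der_diff vals_lie_der vals_cartan_d frm_vals frm_contract) auto
  have 2: "d (contract y (Lie x \<omega>)) ys
    = d (Lie x (contract y \<omega>)) ys - d (contract (br x y) \<omega>) ys"
    unfolding contract_lie_der using y x \<omega>
    by (intro cartan_d_diff vals_lie_der frm_vals frm_contract) (auto simp: br_closed)
  have 3: "Lie x (d (contract y \<omega>)) ys = d (Lie x (contract y \<omega>)) ys"
    using y x \<omega> by (intro Cons.IH frm_contract) auto
  have 4: "Lie x (Lie y \<omega>) ys - Lie y (Lie x \<omega>) ys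
    = Lie (br x y) \<omega> ys"
    using y x \<omega> flat by (intro lie_der_br) auto
  show ?case
    using 1 2 3 4
    by (simp only: lie_der.simps cartan_d.simps) (simp add: algebra_simps)
qed simp

text \<open>i_y d d = L_y d - d i_y d = (L_y d - d L_y) + d d i_y, so the commutation of
  \<open>Lie\<close> with \<open>d\<close> leaves only the induction hypothesis.\<close>

lemma cartan_d_square:
  assumes flat: "\<And>x y w. x \<in> X \<Longrightarrow> y \<in> X \<Longrightarrow> w \<in> Y \<Longrightarrow> act (br x y) w = act x (act y w) - act y (act x w)"
  and "set xs \<subseteq> X" "frm \<omega>"
  shows "d (d \<omega>) xs = 0"
  using assms(2-)
proof (induction xs arbitrary: \<omega>)
  case (Cons y ys)
  have y: "y \<in> X" "set ys \<subseteq> X" and \<omega>: "frm \<omega>" using Cons.prems by auto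
  have 1: "d (contract y (d \<omega>)) ys
    = d (Lie y \<omega>) ys - d (d (contract y \<omega>)) ys"
    unfolding contract_cartan_d using y \<omega>
    by (intro cartan_d_diff vals_lie_der vals_cartan_d frm_vals frm_contract) auto
  have 2: "d (d (contract y \<omega>)) ys = 0"
    using y \<omega> by (intro Cons.IH frm_contract) auto
  show ?case
    using 1 2 lie_der_cartan_d [OF flat y(2) y(1) \<omega>]
    by (simp only: cartan_d.simps) simp
qed simp

lemma cartan_d_degree:
  "set xs \<subseteq> X \<Longrightarrow> (\<And>ys. set ys \<subseteq> X \<Longrightarrow> length ys \<noteq> n \<Longrightarrow> \<omega> ys = 0) \<Longrightarrow> length xs \<noteq> Suc n
    \<Longrightarrow> d \<omega> xs = 0"
proof (induction xs arbitrary: \<omega> n)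
  case (Cons x xs)
  have lie: "Lie x \<eta> ys = 0"
    if "set ys \<subseteq> X" "\<And>zs. set zs \<subseteq> X \<Longrightarrow> length zs \<noteq> m \<Longrightarrow> \<eta> zs = 0" "length ys \<noteq> m" for \<eta> ys m
    using that
  proof (induction ys arbitrary: \<eta> m)
    case Nil
    then show ?case using Cons.prems(1) by simp
  next
    case (Cons y ys)
    have "Lie x (contract y \<eta>) ys = 0"
    proof (cases m)
      case 0
      then have "Lie x (contract y \<eta>) ys = Lie x 0 ys"
        using Cons.prems \<open>set (x # xs) \<subseteq> X\<close> by (intro lie_der_cong) (auto simp: contract_apply)
      then show ?thesis using Cons.prems \<open>set (x # xs) \<subseteq> X\<close> lie_der_zero by simp
    next
      case (Suc k)
      show ?thesis
      proof (rule Cons.IH [where m = k])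
        show "contract y \<eta> zs = 0" if "set zs \<subseteq> X" "length zs \<noteq> k" for zs
          using Cons.prems(1,2) that Suc by (simp add: contract_apply)
      qed (use Cons.prems Suc in auto)
    qed
    then show ?case using Cons.prems \<open>set (x # xs) \<subseteq> X\<close> br_closed by simp
  qed
  have "Lie x \<omega> xs = 0"
    using Cons.prems by (intro lie [where m = n]) auto
  moreover have "d (contract x \<omega>) xs = 0"
  proof (cases n)
    case 0
    then have "d (contract x \<omega>) xs = d 0 xs"
      using Cons.prems by (intro cartan_d_cong) (auto simp: contract_apply)
    then show ?thesis using Cons.prems cartan_d_zero by simp
  next
    case (Suc k)
    show ?thesis
    proof (rule Cons.IH [where n = k])
      show "contract x \<omega> zs = 0" if "set zs \<subseteq> X" "length zs \<noteq> k" for zs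
        using Cons.prems(1,2) that Suc by (simp add: contract_apply)
    qed (use Cons.prems Suc in auto)
  qed
  ultimately show ?case by simp
qed simp

end

section \<open>Bidegrees\<close>

lemma sum_fun_apply: "(\<Sum>i\<in>I. h i) x = (\<Sum>i\<in>I. h i x :: 'w::ab_group_add)"
  by (induction I rule: infinite_finite_induct) auto

lemma bip_arith:
  fixes \<omega> \<eta> :: "'a list \<Rightarrow> 'b::ab_group_add"
  shows "bip pA pB p q (\<omega> + \<eta>) = bip pA pB p q \<omega> + bip pA pB p q \<eta>"
  "bip pA pB p q (- \<omega>) = - bip pA pB p q \<omega>"
  "bip pA pB p q (\<omega> - \<eta>) = bip pA pB p q \<omega> - bip pA pB p q \<eta>"
  "bip pA pB p q (0 :: 'a list \<Rightarrow> 'b) = 0"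
proof -
  have add: "bip pA pB p q (\<omega> + \<eta>) xs = bip pA pB p q \<omega> xs + bip pA pB p q \<eta> xs" for p q xs and \<omega> \<eta> :: "'a list \<Rightarrow> 'b"
  proof (induction xs arbitrary: p q \<omega> \<eta>)
    case (Cons x xs)
    show "bip pA pB p q (\<omega> + \<eta>) (x # xs) = bip pA pB p q \<omega> (x # xs) + bip pA pB p q \<eta> (x # xs)"
      by (simp add: Cons.IH [of _ _ "contract u \<omega>" "contract u \<eta>" for u])
  qed simp
  have uminus: "bip pA pB p q (- \<omega>) xs = - bip pA pB p q \<omega> xs" for p q xs and \<omega> :: "'a list \<Rightarrow> 'b"
  proof (induction xs arbitrary: p q \<omega>)
    case (Cons x xs)
    show "bip pA pB p q (- \<omega>) (x # xs) = - bip pA pB p q \<omega> (x # xs)"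
      by (simp add: Cons.IH [of _ _ "contract u \<omega>" for u])
  qed simp
  have diff: "bip pA pB p q (\<omega> - \<eta>) = bip pA pB p q \<omega> - bip pA pB p q \<eta>" for \<omega> \<eta> :: "'a list \<Rightarrow> 'b"
  proof (rule ext)
    fix xs
    have "bip pA pB p q (\<omega> - \<eta>) xs = bip pA pB p q (\<omega> + - \<eta>) xs"
      by simp
    then show "bip pA pB p q (\<omega> - \<eta>) xs = (bip pA pB p q \<omega> - bip pA pB p q \<eta>) xs"
      unfolding add uminus by simp
  qed
  show "bip pA pB p q (\<omega> + \<eta>) = bip pA pB p q \<omega> + bip pA pB p q \<eta>"
    by (auto simp: fun_eq_iff add)
  show "bip pA pB p q (- \<omega>) = - bip pA pB p q \<omega>"
    by (auto simp: fun_eq_iff uminus)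
  show "bip pA pB p q (\<omega> - \<eta>) = bip pA pB p q \<omega> - bip pA pB p q \<eta>"
    by (rule diff)
  show "bip pA pB p q (0 :: 'a list \<Rightarrow> 'b) = 0"
    using diff [of 0 0] by simp
qed

lemma bip_gsign: "bip pA pB p q (gsign \<omega>) = gsign (bip pA pB p q \<omega>)"
proof -
  have "bip pA pB p q (gsign \<omega>) xs = gsign (bip pA pB p q \<omega>) xs" for xs
  proof (induction xs arbitrary: p q \<omega>)
    case (Cons x xs)
    show "bip pA pB p q (gsign \<omega>) (x # xs) = gsign (bip pA pB p q \<omega>) (x # xs)"
      by (simp add: gsign_apply signed_add bip_arith Cons.IH [of _ _ "contract u \<omega>" for u])
  qed simp
  then show ?thesis by auto
qed

lemma bip_eq_0: "p + q \<noteq> int (length xs) \<or> p < 0 \<or> q < 0 \<Longrightarrow> bip pA pB p q \<omega> xs = 0"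
  by (induction xs arbitrary: p q \<omega>) auto

lemma bip_sum: "finite I \<Longrightarrow> bip pA pB p q (\<Sum>i\<in>I. \<omega> i) = (\<Sum>i\<in>I. bip pA pB p q (\<omega> i))"
proof (induction I rule: finite_induct)
  case (insert i I)
  then show "bip pA pB p q (\<Sum>i\<in>insert i I. \<omega> i) = (\<Sum>i\<in>insert i I. bip pA pB p q (\<omega> i))"
    by (simp add: bip_arith)
next
  case empty
  show "bip pA pB p q (\<Sum>i\<in>{}. \<omega> i) = (\<Sum>i\<in>{}. bip pA pB p q (\<omega> i))"
    by (simp only: sum.empty bip_arith)
qed

text \<open>The decomposition L = A + B is encoded by an idempotent, with A as its kernel and B as
  its image. Only the kernel is required to be closed under the bracket, as for the Lie subalgebroid
  of a Lie pair.\<close>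

locale lie_rinehart_split = lie_rinehart sX C X br rho
  for sX :: "'c::comm_ring_1 \<Rightarrow> 'x::ab_group_add \<Rightarrow> 'x" and C X br rho +
  fixes pA pB :: "'x \<Rightarrow> 'x"
  assumes pB_closed: "x \<in> X \<Longrightarrow> pB x \<in> X"
    and pA_eq: "x \<in> X \<Longrightarrow> pA x = x - pB x"
    and pB_add: "x \<in> X \<Longrightarrow> y \<in> X \<Longrightarrow> pB (x + y) = pB x + pB y"
    and pB_scale: "x \<in> X \<Longrightarrow> f \<in> C \<Longrightarrow> pB (sX f x) = sX f (pB x)"
    and pB_pB: "x \<in> X \<Longrightarrow> pB (pB x) = pB x"
    and pB_br: "x \<in> X \<Longrightarrow> y \<in> X \<Longrightarrow> pB x = 0 \<Longrightarrow> pB y = 0 \<Longrightarrow> pB (br x y) = 0"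
begin

definition XA where "XA = {x \<in> X. pB x = 0}"

definition XB where "XB = {x \<in> X. pB x = x}"

lemma pA_closed: "x \<in> X \<Longrightarrow> pA x \<in> X"
  by (simp add: pA_eq X_diff pB_closed)

lemma pA_plus_pB: "x \<in> X \<Longrightarrow> pA x + pB x = x"
  by (simp add: pA_eq)

lemma pB_pA: "x \<in> X \<Longrightarrow> pB (pA x) = 0"
  using pB_add [OF pA_closed pB_closed, of x x] by (simp add: pA_plus_pB pB_pB)

lemma pA_pA: "x \<in> X \<Longrightarrow> pA (pA x) = pA x"
  using pA_eq [OF pA_closed, of x] pB_pA by simp

lemma pA_pB: "x \<in> X \<Longrightarrow> pA (pB x) = 0"
  using pA_eq [OF pB_closed, of x] pB_pB by simp

lemma pA_add: "x \<in> X \<Longrightarrow> y \<in> X \<Longrightarrow> pA (x + y) = pA x + pA y"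
  by (simp add: pA_eq pB_add X_add)

lemma pA_scale: "x \<in> X \<Longrightarrow> f \<in> C \<Longrightarrow> pA (sX f x) = sX f (pA x)"
  by (simp add: pA_eq pB_scale X_scale X.scale_right_diff_distrib)

lemma XA_X: "x \<in> XA \<Longrightarrow> x \<in> X" and XB_X: "x \<in> XB \<Longrightarrow> x \<in> X"
  by (auto simp: XA_def XB_def)

lemma XA_simps: "x \<in> XA \<Longrightarrow> pA x = x" "x \<in> XA \<Longrightarrow> pB x = 0"
  and XB_simps: "x \<in> XB \<Longrightarrow> pA x = 0" "x \<in> XB \<Longrightarrow> pB x = x"
  by (auto simp: XA_def XB_def pA_eq)

lemma pA_XA: "x \<in> X \<Longrightarrow> pA x \<in> XA" and pB_XB: "x \<in> X \<Longrightarrow> pB x \<in> XB"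
  by (simp_all add: XA_def XB_def pA_closed pB_closed pB_pA pB_pB)

lemma br_XA: "x \<in> XA \<Longrightarrow> y \<in> XA \<Longrightarrow> br x y \<in> XA"
  by (auto simp: XA_def br_closed pB_br)

end

locale lie_rinehart_conn_split = lie_rinehart_split sX C X br rho pA pB + lie_rinehart_conn sX C X br rho sY Y act
  for sX :: "'c::comm_ring_1 \<Rightarrow> 'x::ab_group_add \<Rightarrow> 'x" and C X br rho pA pB
    and sY :: "'c \<Rightarrow> 'w::ab_group_add \<Rightarrow> 'w" and Y act

lemma (in lie_rinehart_split) scalar_lie_rinehart_conn_split: "lie_rinehart_conn_split sX C X br rho pA pB (*) C rho"
  by unfold_locales

sublocale lie_rinehart_split \<subseteq> S: lie_rinehart_conn_split sX C X br rho pA pB "(*)" C rho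
  by (rule scalar_lie_rinehart_conn_split)

context lie_rinehart_conn_split
begin

abbreviation bp :: "int \<Rightarrow> int \<Rightarrow> ('x list \<Rightarrow> 'w) \<Rightarrow> 'x list \<Rightarrow> 'w" where
  "bp \<equiv> bip pA pB"

lemma bp_cong:
  assumes "set xs \<subseteq> X" "\<And>ys. set ys \<subseteq> X \<Longrightarrow> \<omega> ys = \<eta> ys"
  shows "bp p q \<omega> xs = bp p q \<eta> xs"
  using assms
proof (induction xs arbitrary: p q \<omega> \<eta>)
  case (Cons x xs)
  have "bp p q (contract u \<omega>) xs = bp p q (contract u \<eta>) xs" if "u \<in> X" for u p q
    using Cons.prems that by (intro Cons.IH) (auto simp: contract_apply)
  then show ?case using Cons.prems by (simp add: pA_closed pB_closed)
qed simp

lemma bp_scale: "bp p q (\<lambda>xs. sY f (\<omega> xs)) xs = sY f (bp p q \<omega> xs)"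
proof (induction xs arbitrary: p q \<omega>)
  case (Cons x xs)
  have "contract u (\<lambda>xs. sY f (\<omega> xs)) = (\<lambda>xs. sY f (contract u \<omega> xs))" for u
    by (auto simp: fun_eq_iff contract_apply)
  then show ?case
    by (simp add: Y.scale_right_distrib Cons.IH [of _ _ "contract u \<omega>" for u])
qed simp

lemma bp_contract_linear:
  assumes "frm \<omega>" "set zs \<subseteq> X" "x \<in> X" "y \<in> X"
  shows "bp p q (contract (x + y) \<omega>) zs = bp p q (contract x \<omega>) zs + bp p q (contract y \<omega>) zs"
    and "f \<in> C \<Longrightarrow> bp p q (contract (sX f x) \<omega>) zs = sY f (bp p q (contract x \<omega>) zs)"
proof -
  have "bp p q (contract (x + y) \<omega>) zs = bp p q (contract x \<omega> + contract y \<omega>) zs"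
    using assms by (intro bp_cong) (auto simp: contract_apply frm_add_head)
  then show "bp p q (contract (x + y) \<omega>) zs = bp p q (contract x \<omega>) zs + bp p q (contract y \<omega>) zs"
    by (simp add: bip_arith)
  have "bp p q (contract (sX f x) \<omega>) zs = bp p q (\<lambda>zs. sY f (contract x \<omega> zs)) zs" if "f \<in> C"
    using assms that by (intro bp_cong) (auto simp: contract_apply frm_scale_head)
  then show "f \<in> C \<Longrightarrow> bp p q (contract (sX f x) \<omega>) zs = sY f (bp p q (contract x \<omega>) zs)"
    by (simp add: bp_scale)
qed

lemma bp_contract_zero: "frm \<omega> \<Longrightarrow> set zs \<subseteq> X \<Longrightarrow> bp p q (contract 0 \<omega>) zs = 0"
  using bp_contract_linear(1) [of \<omega> zs 0 0 p q] X_zero by simp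

text \<open>On a repeated argument \<open>y\<close> the mixed terms contract with
  \<open>pA y\<close> and \<open>pB y\<close> in both orders and cancel by antisymmetry.\<close>

lemma frm_bp:
  assumes "frm \<omega>" shows "frm (bp p q \<omega>)"
proof -
  have "frm_upto n (bp p q \<omega>)" for n using assms
  proof (induction n arbitrary: p q \<omega>)
    case 0
    then show ?case by (simp add: frm_Nil Y_zero)
  next
    case (Suc n)
    note \<omega> = Suc.prems(1)
    have "frm_upto n (contract y (bp p q \<omega>))" if y: "y \<in> X" for y
      unfolding contract_bip using \<omega> y
      by (intro frm_upto_add Suc.IH frm_contract) (auto simp: pA_closed pB_closed)
    moreover have "bp p q \<omega> ((y + z) # zs) = bp p q \<omega> (y # zs) + bp p q \<omega> (z # zs)"
      if "y \<in> X" "z \<in> X" "set zs \<subseteq> X" for y z zs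
      using that \<omega> by (simp add: pA_add pB_add bp_contract_linear pA_closed pB_closed)
    moreover have "bp p q \<omega> (sX f y # zs) = sY f (bp p q \<omega> (y # zs))"
      if "f \<in> C" "y \<in> X" "set zs \<subseteq> X" for f y zs
      using that \<omega> by (simp add: pA_scale pB_scale bp_contract_linear pA_closed pB_closed Y.scale_right_distrib)
    moreover have "bp p q \<omega> (y # y # zs) = 0" if y: "y \<in> X" and zs: "set zs \<subseteq> X" for y zs
    proof -
      have same: "bp r s (contract u (contract u \<omega>)) zs = 0" if "u \<in> X" for r s u
      proof -
        have "bp r s (contract u (contract u \<omega>)) zs = bp r s 0 zs"
          using \<omega> zs that by (intro bp_cong) (auto simp: contract_apply frm_repeat)
        then show ?thesis by (simp add: bip_arith)
      qed
      have sw: "bp r s (contract u (contract v \<omega>)) zs = bp r s (- contract v (contract u \<omega>)) zs"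
        if "u \<in> X" "v \<in> X" for r s u v
        using \<omega> zs that frm_swap by (intro bp_cong) (auto simp: contract_apply)
      have "bp r s (contract (pA y) (contract (pB y) \<omega>)) zs
          = - bp r s (contract (pB y) (contract (pA y) \<omega>)) zs" for r s
        using sw [of "pA y" "pB y" r s] y by (simp add: bip_arith pA_closed pB_closed)
      then show ?thesis using y
        by (simp add: bip_arith same pA_closed pB_closed)
    qed
    ultimately show ?case
      using \<omega> by (simp add: frm_Nil Y_zero)
  qed
  then show ?thesis by (simp add: frm_def)
qed

text \<open>The projections to the bidegrees are orthogonal idempotents because \<open>pA\<close>
  and \<open>pB\<close> are; the premise \<open>frm \<omega>\<close> makes the contractions with
  \<open>pA (pB x) = 0\<close> and \<open>pB (pA x) = 0\<close> vanish.\<close>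

lemma bp_bp:
  assumes "frm \<omega>" "set xs \<subseteq> X"
  shows "bp p q (bp r s \<omega>) xs = (if p = r \<and> q = s then bp p q \<omega> xs else 0)"
  using assms
proof (induction xs arbitrary: p q r s \<omega>)
  case (Cons x xs)
  have x: "x \<in> X" "set xs \<subseteq> X" using Cons.prems by auto
  have IH: "bp p q (bp r s (contract u \<omega>)) xs = (if p = r \<and> q = s then bp p q (contract u \<omega>) xs else 0)"
    if "u \<in> X" for u p q r s
    using x that Cons.prems by (intro Cons.IH frm_contract) auto
  have zero: "bp p q (bp r s (contract 0 \<omega>)) xs = 0" for p q r s
    using x Cons.prems IH [of 0] X_zero by (simp add: bp_contract_zero)
  show ?case
    using x by (simp add: bip_arith IH pA_closed pB_closed pA_pA pA_pB pB_pA pB_pB zero)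
qed auto

lemma bp_append:
  assumes "frm \<omega>" "set as \<subseteq> XA" "set bs \<subseteq> XB"
  shows "bp p q \<omega> (as @ bs) = (if p = int (length as) \<and> q = int (length bs) then \<omega> (as @ bs) else 0)"
  using assms
proof (induction as arbitrary: p q \<omega>)
  case Nil
  then show ?case
  proof (induction bs arbitrary: p q \<omega>)
    case (Cons b bs)
    have "bp p (q - 1) (contract b \<omega>) ([] @ bs)
       = (if p = int (length ([] :: 'x list)) \<and> q - 1 = int (length bs) then contract b \<omega> ([] @ bs) else 0)"
      using Cons.prems by (intro Cons.IH frm_contract) (auto simp: XB_X)
    moreover have "bp (p - 1) q (contract 0 \<omega>) bs = 0"
      using Cons.prems by (intro bp_contract_zero) (auto simp: XB_X)
    ultimately show ?case using Cons.prems by (auto simp: XB_simps contract_apply)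
  qed auto
next
  case (Cons a as)
  have "bp (p - 1) q (contract a \<omega>) (as @ bs)
     = (if p - 1 = int (length as) \<and> q = int (length bs) then contract a \<omega> (as @ bs) else 0)"
    using Cons.prems by (intro Cons.IH frm_contract) (auto simp: XA_X)
  moreover have "bp p (q - 1) (contract 0 \<omega>) (as @ bs) = 0"
    using Cons.prems by (intro bp_contract_zero) (auto simp: XB_X XA_X)
  ultimately show ?case using Cons.prems by (auto simp: XA_simps contract_apply)
qed

text \<open>Every argument splits into its A-part and its B-part, and a B-argument can be moved
  behind the A-arguments up to sign. Hence the sorted lists on which \<open>bideg\<close> is defined
  suffice.\<close>

lemma frm_eq_0:
  assumes "frm \<omega>" "\<And>as bs. set as \<subseteq> XA \<Longrightarrow> set bs \<subseteq> XB \<Longrightarrow> \<omega> (as @ bs) = 0" "set xs \<subseteq> X"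
  shows "\<omega> xs = 0"
  using assms
proof (induction xs arbitrary: \<omega>)
  case Nil
  then show ?case using Nil.prems(2) [of "[]" "[]"] by simp
next
  case (Cons x xs)
  have x: "x \<in> X" "set xs \<subseteq> X" using Cons.prems by auto
  have "contract (pA x) \<omega> xs = 0"
  proof (rule Cons.IH)
    show "contract (pA x) \<omega> (as @ bs) = 0" if "set as \<subseteq> XA" "set bs \<subseteq> XB" for as bs
      using Cons.prems(2) [of "pA x # as" bs] that x pA_XA by (simp add: contract_apply)
  qed (use Cons.prems x in \<open>auto intro!: frm_contract pA_closed\<close>)
  moreover have "contract (pB x) \<omega> xs = 0"
  proof (rule Cons.IH)
    show "contract (pB x) \<omega> (as @ bs) = 0" if "set as \<subseteq> XA" "set bs \<subseteq> XB" for as bs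
      using Cons.prems(2) [of as "pB x # bs"] that x pB_XB pB_closed
        frm_move [of \<omega> "pB x" as bs] Cons.prems(1) XA_X XB_X
      by (force simp: contract_apply signed_def subset_eq split: if_splits)
  qed (use Cons.prems x in \<open>auto intro!: frm_contract pB_closed\<close>)
  ultimately show ?case
    using frm_add_head [OF Cons.prems(1) pA_closed pB_closed, of x x xs] x
    by (simp add: contract_apply pA_plus_pB)
qed

text \<open>Homogeneity as invariance under a projection. Unlike \<open>bideg\<close> this passes
  directly to contractions with sections of A or B, allows negative degrees, and disregards values
  outside \<open>X\<close>.\<close>

definition hom :: "int \<Rightarrow> int \<Rightarrow> ('x list \<Rightarrow> 'w) \<Rightarrow> bool" where
  "hom p q \<omega> \<longleftrightarrow> frm \<omega> \<and> (\<forall>xs. set xs \<subseteq> X \<longrightarrow> bp p q \<omega> xs = \<omega> xs)"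

lemma hom_frm: "hom p q \<omega> \<Longrightarrow> frm \<omega>"
  by (simp add: hom_def)

lemma hom_bp_self: "hom p q \<omega> \<Longrightarrow> set xs \<subseteq> X \<Longrightarrow> bp p q \<omega> xs = \<omega> xs"
  by (simp add: hom_def)

lemma hom_bp: "frm \<omega> \<Longrightarrow> hom p q (bp p q \<omega>)"
  by (simp add: hom_def frm_bp bp_bp)

lemma hom_bp_other:
  assumes "hom p q \<omega>" "set xs \<subseteq> X" "p \<noteq> r \<or> q \<noteq> s"
  shows "bp r s \<omega> xs = 0"
proof -
  have "bp r s \<omega> xs = bp r s (bp p q \<omega>) xs"
    using assms by (intro bp_cong) (auto simp: hom_bp_self)
  then show ?thesis using assms bp_bp [of \<omega> xs r s p q] by (auto simp: hom_frm)
qed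

lemma hom_length: "hom p q \<omega> \<Longrightarrow> set xs \<subseteq> X \<Longrightarrow> p + q \<noteq> int (length xs) \<Longrightarrow> \<omega> xs = 0"
  by (metis bip_eq_0 hom_bp_self)

lemma hom_cong:
  assumes "hom p q \<omega>" "frm \<eta>" "\<And>ys. set ys \<subseteq> X \<Longrightarrow> \<eta> ys = \<omega> ys"
  shows "hom p q \<eta>"
  using assms bp_cong [of _ \<eta> \<omega>] by (simp add: hom_def)

text \<open>From right to left by evaluating the projection on sorted lists; from left to right
  because \<open>bp p q \<omega> - \<omega>\<close> vanishes on sorted lists and hence everywhere by
  \<open>frm_eq_0\<close>.\<close>

lemma bideg_forms_iff:
  "\<omega> \<in> bideg XA XB (forms C X sX Y sY) p q \<longleftrightarrow> hom (int p) (int q) \<omega> \<and> \<omega> = on_lists X \<omega>"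
proof
  assume "hom (int p) (int q) \<omega> \<and> \<omega> = on_lists X \<omega>"
  then have h: "hom (int p) (int q) \<omega>" and f: "\<omega> \<in> forms C X sX Y sY"
    by (auto simp: forms_iff hom_frm)
  have "length as = p \<and> length bs = q" if "set as \<subseteq> XA" "set bs \<subseteq> XB" "\<omega> (as @ bs) \<noteq> 0" for as bs
  proof -
    have "set (as @ bs) \<subseteq> X" using that XA_X XB_X by auto
    then show ?thesis
      using that hom_bp_self [OF h, of "as @ bs"] bp_append [OF hom_frm [OF h] that(1,2), of p q]
      by (auto split: if_splits)
  qed
  with f show "\<omega> \<in> bideg XA XB (forms C X sX Y sY) p q"
    by (auto simp: bideg_def)
next
  assume a: "\<omega> \<in> bideg XA XB (forms C X sX Y sY) p q"
  then have f: "frm \<omega>" "\<omega> = on_lists X \<omega>"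
    by (auto simp: bideg_def forms_iff)
  have "bp p q \<omega> xs - \<omega> xs = 0" if "set xs \<subseteq> X" for xs
  proof -
    have "(bp p q \<omega> - \<omega>) xs = 0"
    proof (rule frm_eq_0)
      show "frm (bp p q \<omega> - \<omega>)" by (intro frm_diff frm_bp f)
      show "(bp p q \<omega> - \<omega>) (as @ bs) = 0" if "set as \<subseteq> XA" "set bs \<subseteq> XB" for as bs
        using a that bp_append [OF f(1) that, of p q] by (auto simp: bideg_def)
    qed (rule that)
    then show ?thesis by simp
  qed
  with f show "hom (int p) (int q) \<omega> \<and> \<omega> = on_lists X \<omega>"
    by (auto simp: hom_def)
qed

lemma bp_total:
  assumes "frm \<omega>" "set xs \<subseteq> X"
  shows "(\<Sum>r\<le>length xs. bp (int r) (int (length xs) - int r) \<omega> xs) = \<omega> xs"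
  using assms
proof (induction xs arbitrary: \<omega>)
  case (Cons x xs)
  have x: "x \<in> X" "set xs \<subseteq> X" using Cons.prems by auto
  let ?n = "length xs"
  have IH: "(\<Sum>r\<le>?n. bp (int r) (int ?n - int r) (contract u \<omega>) xs) = contract u \<omega> xs" if "u \<in> X" for u
    using x that Cons.prems by (intro Cons.IH frm_contract) auto
  \<comment> \<open>Both sums have one summand more than the induction hypothesis, at
    \<open>r = 0\<close> here and at \<open>r = Suc ?n\<close> below. It has a negative degree and
    vanishes.\<close>
  have "(\<Sum>r\<le>Suc ?n. bp (int r - 1) (int (Suc ?n) - int r) (contract (pA x) \<omega>) xs) = contract (pA x) \<omega> xs"
    unfolding sum.atMost_Suc_shift using IH [of "pA x"] x by (simp add: bip_eq_0 pA_closed)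
  moreover have "(\<Sum>r\<le>Suc ?n. bp (int r) (int (Suc ?n) - int r - 1) (contract (pB x) \<omega>) xs) = contract (pB x) \<omega> xs"
    using IH [of "pB x"] x by (simp add: bip_eq_0 pB_closed)
  ultimately show ?case
    using frm_add_head [OF Cons.prems(1) pA_closed pB_closed, of x x xs] x
    by (simp add: sum.distrib contract_apply pA_plus_pB del: sum.atMost_Suc of_nat_Suc)
qed simp

lemma hom_contract_A: "hom p q \<omega> \<Longrightarrow> a \<in> XA \<Longrightarrow> hom (p - 1) q (contract a \<omega>)"
  and hom_contract_B: "hom p q \<omega> \<Longrightarrow> b \<in> XB \<Longrightarrow> hom p (q - 1) (contract b \<omega>)"
proof -
  show "hom (p - 1) q (contract a \<omega>)" if h: "hom p q \<omega>" and a: "a \<in> XA"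
  proof (unfold hom_def, intro conjI allI impI)
    show "frm (contract a \<omega>)" using h a by (intro frm_contract) (auto simp: hom_frm XA_X)
    show "bp (p - 1) q (contract a \<omega>) xs = contract a \<omega> xs" if "set xs \<subseteq> X" for xs
      using hom_bp_self [OF h, of "a # xs"] that a hom_frm [OF h]
      by (simp add: XA_simps XA_X contract_apply bp_contract_zero)
  qed
  show "hom p (q - 1) (contract b \<omega>)" if h: "hom p q \<omega>" and b: "b \<in> XB"
  proof (unfold hom_def, intro conjI allI impI)
    show "frm (contract b \<omega>)" using h b by (intro frm_contract) (auto simp: hom_frm XB_X)
    show "bp p (q - 1) (contract b \<omega>) xs = contract b \<omega> xs" if "set xs \<subseteq> X" for xs
      using hom_bp_self [OF h, of "b # xs"] that b hom_frm [OF h]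
      by (simp add: XB_simps XB_X contract_apply bp_contract_zero)
  qed
qed

lemma hom_arith:
  "hom p q \<omega> \<Longrightarrow> hom p q \<eta> \<Longrightarrow> hom p q (\<omega> + \<eta>)"
  "hom p q \<omega> \<Longrightarrow> hom p q \<eta> \<Longrightarrow> hom p q (\<omega> - \<eta>)"
  "hom p q \<omega> \<Longrightarrow> hom p q (- \<omega>)" "hom p q 0" "hom p q \<omega> \<Longrightarrow> hom p q (gsign \<omega>)"
  by (auto simp: hom_def frm_add frm_diff frm_uminus frm_zero frm_gsign bip_arith bip_gsign gsign_apply)

text \<open>\<open>A\<close>-degree less than \<open>k\<close>.  This filtration is respected by \<open>d\<close> because \<open>A\<close> is
  closed under the bracket.\<close>

fun Adeg_less :: "nat \<Rightarrow> ('x list \<Rightarrow> 'w) \<Rightarrow> bool" where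
  "Adeg_less 0 \<omega> \<longleftrightarrow> (\<forall>xs. set xs \<subseteq> X \<longrightarrow> \<omega> xs = 0)"
| "Adeg_less (Suc k) \<omega> \<longleftrightarrow> (\<forall>a\<in>XA. Adeg_less k (contract a \<omega>))"

lemma Adeg_less_cong:
  "Adeg_less k \<omega> \<Longrightarrow> (\<And>xs. set xs \<subseteq> X \<Longrightarrow> \<eta> xs = \<omega> xs) \<Longrightarrow> Adeg_less k \<eta>"
proof (induction k arbitrary: \<omega> \<eta>)
  case (Suc k)
  have "Adeg_less k (contract a \<eta>)" if "a \<in> XA" for a
  proof (rule Suc.IH)
    show "Adeg_less k (contract a \<omega>)" using Suc.prems(1) that by simp
  qed (use Suc.prems(2) that XA_X in \<open>simp add: contract_apply\<close>)
  then show ?case by simp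
qed simp

lemma Adeg_less_diff: "Adeg_less k \<omega> \<Longrightarrow> Adeg_less k \<eta> \<Longrightarrow> Adeg_less k (\<omega> - \<eta>)"
  by (induction k arbitrary: \<omega> \<eta>) auto

lemma Adeg_less_zero: "(\<And>xs. set xs \<subseteq> X \<Longrightarrow> \<omega> xs = 0) \<Longrightarrow> Adeg_less k \<omega>"
proof (induction k arbitrary: \<omega>)
  case (Suc k)
  then have "Adeg_less k (contract a \<omega>)" if "a \<in> XA" for a
    using that by (intro Suc.IH) (simp add: contract_apply XA_X)
  then show ?case by simp
qed simp

text \<open>i_a' L_a = L_a i_a' - i_[a,a'], and [a, a'] lies in A again. This is where closedness of
  A under the bracket enters the bidegree argument.\<close>

lemma Adeg_less_lie_der: "frm \<omega> \<Longrightarrow> a \<in> XA \<Longrightarrow> Adeg_less k \<omega> \<Longrightarrow> Adeg_less k (Lie a \<omega>)"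
proof (induction k arbitrary: \<omega>)
  case 0
  have "Lie a \<omega> xs = Lie a 0 xs" if "set xs \<subseteq> X" for xs
    using 0 that by (intro lie_der_cong) (auto simp: XA_X)
  then show ?case using 0 by (simp add: lie_der_zero XA_X)
next
  case (Suc k)
  have "Adeg_less k (contract a' (Lie a \<omega>))" if "a' \<in> XA" for a'
    unfolding contract_lie_der using that Suc.prems
    by (intro Adeg_less_diff Suc.IH frm_contract) (auto simp: XA_X br_XA)
  then show ?case by simp
qed

text \<open>By i_a d = L_a - d i_a: the first term keeps the filtration, and in the second the
  contraction lowers it before \<open>d\<close> raises it.\<close>

lemma Adeg_less_cartan_d: "frm \<omega> \<Longrightarrow> Adeg_less k \<omega> \<Longrightarrow> Adeg_less (Suc k) (d \<omega>)"
proof (induction k arbitrary: \<omega>)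
  case 0
  have "d \<omega> xs = d 0 xs" if "set xs \<subseteq> X" for xs
    using 0 that by (intro cartan_d_cong) auto
  then show ?case by (intro Adeg_less_zero) (simp add: cartan_d_zero)
next
  case (Suc k)
  have "Adeg_less (Suc k) (contract a (d \<omega>))" if a: "a \<in> XA" for a
  proof -
    have "Adeg_less (Suc k) (d (contract a \<omega>))"
      using a Suc.prems by (intro Suc.IH frm_contract) (auto simp: XA_X)
    moreover have "Adeg_less (Suc k) (Lie a \<omega>)"
      using a Suc.prems by (intro Adeg_less_lie_der) auto
    ultimately show ?thesis unfolding contract_cartan_d by (intro Adeg_less_diff)
  qed
  then show ?case unfolding Adeg_less.simps(2) [of "Suc k"] by blast
qed

lemma hom_neg: "hom p q \<omega> \<Longrightarrow> p < 0 \<or> q < 0 \<Longrightarrow> set xs \<subseteq> X \<Longrightarrow> \<omega> xs = 0"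
  by (metis bip_eq_0 hom_bp_self)

lemma hom_Adeg_less: "hom p q \<omega> \<Longrightarrow> p < int k \<Longrightarrow> Adeg_less k \<omega>"
proof (induction k arbitrary: p \<omega>)
  case 0
  then show ?case using hom_neg by simp
next
  case (Suc k)
  have "Adeg_less k (contract a \<omega>)" if "a \<in> XA" for a
    using Suc.prems that by (intro Suc.IH [of "p - 1"] hom_contract_A) auto
  then show ?case by simp
qed

lemma Adeg_less_contract:
  "frm \<omega> \<Longrightarrow> x \<in> X \<Longrightarrow> Adeg_less k \<omega> \<Longrightarrow> Adeg_less k (contract x \<omega>)"
proof (induction k arbitrary: \<omega>)
  case 0
  then show ?case by (simp add: contract_apply)
next
  case (Suc k)
  have "Adeg_less k (contract a (contract x \<omega>))" if a: "a \<in> XA" for a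
  proof (rule Adeg_less_cong)
    have "Adeg_less k (contract x (contract a \<omega>))"
      using Suc.prems a by (intro Suc.IH frm_contract) (auto simp: XA_X)
    then show "Adeg_less k (0 - contract x (contract a \<omega>))"
      by (intro Adeg_less_diff) (simp_all add: Adeg_less_zero)
    show "contract a (contract x \<omega>) xs = (0 - contract x (contract a \<omega>)) xs" if "set xs \<subseteq> X" for xs
      using Suc.prems a that frm_swap [of \<omega> x a xs] by (simp add: contract_apply XA_X)
  qed
  then show ?case by simp
qed

text \<open>A contraction with \<open>pA x\<close> uses up one step of the filtration and one unit
  of \<open>p\<close>; a contraction with \<open>pB x\<close> uses up neither.\<close>

lemma bp_Adeg_less:
  assumes "frm \<omega>" "Adeg_less k \<omega>" "int k \<le> p" "set xs \<subseteq> X"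
  shows "bp p q \<omega> xs = 0"
  using assms
proof (induction xs arbitrary: k p q \<omega>)
  case Nil
  then show ?case by (cases k) auto
next
  case (Cons x xs)
  have x: "x \<in> X" "set xs \<subseteq> X" using Cons.prems by auto
  show ?case
  proof (cases k)
    case 0
    then have "bp p q \<omega> (x # xs) = bp p q 0 (x # xs)"
      using Cons.prems by (intro bp_cong) auto
    then show ?thesis by (simp add: bip_arith)
  next
    case (Suc m)
    have "bp (p - 1) q (contract (pA x) \<omega>) xs = 0"
      using Cons.prems Suc x pA_XA [of x]
      by (intro Cons.IH [where k = m] frm_contract) (auto simp: pA_closed)
    moreover have "bp p (q - 1) (contract (pB x) \<omega>) xs = 0"
      using Cons.prems x by (intro Cons.IH [where k = k] frm_contract Adeg_less_contract) (auto simp: pB_closed)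
    ultimately show ?thesis by simp
  qed
qed

text \<open>The filtration shows that \<open>d\<close> raises the A-degree by at most one. If
  \<open>p + 1\<close> is negative there is no natural number to serve as filtration index, but then
  the form itself vanishes.\<close>

lemma bp_cartan_d_eq_0:
  assumes "hom p q \<omega>" "p + 2 \<le> r" "0 \<le> r" "set xs \<subseteq> X"
  shows "bp r s (d \<omega>) xs = 0"
proof (cases "0 \<le> p + 1")
  case True
  have "Adeg_less (Suc (nat (p + 1))) (d \<omega>)"
    using assms True by (intro Adeg_less_cartan_d hom_Adeg_less [of p q] hom_frm [of p q]) auto
  then show ?thesis
    using assms True by (intro bp_Adeg_less [where k = "Suc (nat (p + 1))"] frm_cartan_d hom_frm [of p q]) auto
next
  case False
  have "bp r s (d \<omega>) xs = bp r s 0 xs"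
  proof (rule bp_cong [OF assms(4)])
    fix ys assume ys: "set ys \<subseteq> X"
    then have "d \<omega> ys = d 0 ys"
      using False assms by (intro cartan_d_cong) (auto simp: hom_neg)
    then show "d \<omega> ys = 0 ys" using ys by (simp add: cartan_d_zero)
  qed
  then show ?thesis by (simp add: bip_arith)
qed

lemma cartan_d_sum:
  assumes "finite I" "\<And>i. i \<in> I \<Longrightarrow> vals (\<omega> i)" "set xs \<subseteq> X"
  shows "d (\<Sum>i\<in>I. \<omega> i) xs = (\<Sum>i\<in>I. d (\<omega> i) xs)"
  using assms(1,2)
proof (induction I rule: finite_induct)
  case empty
  show "d (\<Sum>i\<in>{}. \<omega> i) xs = (\<Sum>i\<in>{}. d (\<omega> i) xs)"
    using cartan_d_zero [OF assms(3)] by simp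
next
  case (insert i I)
  have "vals (\<Sum>i\<in>I. \<omega> i)"
    using insert.prems insert.hyps(1) unfolding vals_def by (auto intro!: Y_sum simp: sum_fun_apply)
  then show "d (\<Sum>i\<in>insert i I. \<omega> i) xs = (\<Sum>i\<in>insert i I. d (\<omega> i) xs)"
    using insert cartan_d_add [OF assms(3), of "\<omega> i" "\<Sum>i\<in>I. \<omega> i"] by simp
qed

text \<open>The part of \<open>d\<close> of bidegree \<open>(-1, 2)\<close> lowers the \<open>A\<close>-degree too much to contribute here.\<close>

lemma bp_cartan_d_cartan_d:
  assumes h: "hom p q \<omega>" and pq: "0 \<le> p" "0 \<le> q" and xs: "set xs \<subseteq> X"
  shows "bp (p + 1) (q + 1) (d (d \<omega>)) xs
      = bp (p + 1) (q + 1) (d (bp (p + 1) q (d \<omega>))) xs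
      + bp (p + 1) (q + 1) (d (bp p (q + 1) (d \<omega>))) xs" (is ?A)
    and "bp (p + 2) q (d (d \<omega>)) xs
      = bp (p + 2) q (d (bp (p + 1) q (d \<omega>))) xs" (is ?B)
proof -
  define n where "n = nat (p + q)"
  let ?\<eta> = "d \<omega>"
  have f: "frm ?\<eta>" using h by (intro frm_cartan_d hom_frm)
  have deg: "?\<eta> ys = 0" if "set ys \<subseteq> X" "length ys \<noteq> Suc n" for ys
    using that h pq hom_length [OF h] by (intro cartan_d_degree [where n = n]) (auto simp: n_def)
  let ?P = "\<lambda>r. bp (int r) (int (Suc n) - int r) ?\<eta>"
  \<comment> \<open>\<open>d \<omega>\<close> lives in the single total degree \<open>Suc n\<close>,
    so finitely many components with a fixed range of \<open>r\<close> exhaust it at all list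
    lengths.\<close>
  have split: "?\<eta> ys = (\<Sum>r\<le>Suc n. ?P r) ys" if ys: "set ys \<subseteq> X" for ys
  proof (cases "length ys = Suc n")
    case True
    then show ?thesis using bp_total [OF f ys] by (simp add: sum_fun_apply del: sum.atMost_Suc)
  next
    case False
    then have "int (length ys) \<noteq> 1 + int n" by simp
    then show ?thesis using deg [OF ys False] by (simp add: sum_fun_apply bip_eq_0 del: sum.atMost_Suc)
  qed
  have sum: "bp P Q (d ?\<eta>) xs = (\<Sum>r\<le>Suc n. bp P Q (d (?P r)) xs)" for P Q
  proof -
    have "bp P Q (d ?\<eta>) xs = bp P Q (\<Sum>r\<le>Suc n. d (?P r)) xs"
    proof (rule bp_cong [OF xs])
      fix ys assume ys: "set ys \<subseteq> X"
      have "d ?\<eta> ys = d (\<Sum>r\<le>Suc n. ?P r) ys"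
        using split by (intro cartan_d_cong [OF ys])
      also have "\<dots> = (\<Sum>r\<le>Suc n. d (?P r) ys)"
        using f ys by (intro cartan_d_sum frm_vals frm_bp) auto
      finally show "d ?\<eta> ys = (\<Sum>r\<le>Suc n. d (?P r)) ys"
        by (simp add: sum_fun_apply del: sum.atMost_Suc)
    qed
    then show ?thesis by (simp add: bip_sum sum_fun_apply del: sum.atMost_Suc)
  qed
  \<comment> \<open>A component with \<open>r \<ge> p + 2\<close> vanishes before the second
    \<open>d\<close> is applied; by \<open>lo\<close> below, one with \<open>r \<le> P - 2\<close>
    cannot reach the A-degree \<open>P\<close>. This leaves \<open>r = p\<close> and
    \<open>r = p + 1\<close> for \<open>P = p + 1\<close>, and only \<open>r = p + 1\<close> for
    \<open>P = p + 2\<close>.\<close>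
  have hi: "bp P Q (d (?P r)) xs = 0" if "p + 2 \<le> int r" for r P Q
  proof -
    have "bp P Q (d (?P r)) xs = bp P Q 0 xs"
    proof (rule bp_cong [OF xs])
      fix ys assume ys: "set ys \<subseteq> X"
      have "d (?P r) ys = d 0 ys"
        using that h by (intro cartan_d_cong [OF ys]) (auto simp: bp_cartan_d_eq_0)
      then show "d (?P r) ys = 0 ys" using ys by (simp add: cartan_d_zero)
    qed
    then show ?thesis by (simp add: bip_arith)
  qed
  have lo: "bp P Q (d (?P r)) xs = 0" if "int r + 2 \<le> P" for r P Q
    by (rule bp_cartan_d_eq_0 [OF hom_bp [OF f]]) (use that xs in auto)
  have p: "int (nat p) = p" "int (Suc (nat p)) = p + 1" using pq by auto
  have n: "int n = p + q" using pq by (simp add: n_def)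
  have sub: "{nat p, Suc (nat p)} \<subseteq> {..Suc n}" using pq by (auto simp: n_def)
  have "bp (p + 1) (q + 1) (d ?\<eta>) xs
     = (\<Sum>r\<in>{nat p, Suc (nat p)}. bp (p + 1) (q + 1) (d (?P r)) xs)"
    unfolding sum
  proof (rule sum.mono_neutral_right [OF _ sub], simp, rule ballI)
    fix r assume "r \<in> {..Suc n} - {nat p, Suc (nat p)}"
    then have "p + 2 \<le> int r \<or> int r + 2 \<le> p + 1" using pq by auto
    then show "bp (p + 1) (q + 1) (d (?P r)) xs = 0" using hi lo by blast
  qed
  then show ?A using pq by (simp add: n add.commute)
  have "bp (p + 2) q (d ?\<eta>) xs
     = (\<Sum>r\<in>{Suc (nat p)}. bp (p + 2) q (d (?P r)) xs)"
    unfolding sum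
  proof (rule sum.mono_neutral_right, simp, use sub in blast, rule ballI)
    fix r assume "r \<in> {..Suc n} - {Suc (nat p)}"
    then have "p + 2 \<le> int r \<or> int r + 2 \<le> p + 2" using pq by auto
    then show "bp (p + 2) q (d (?P r)) xs = 0" using hi lo by blast
  qed
  then show ?B using pq by (simp add: n add.commute)
qed

end

section \<open>Bidegrees of wedge products\<close>

context lie_rinehart_conn_split
begin

text \<open>The bidegree of a homogeneous factor is simply subtracted, so the projection passes to
  the other factor. The induction contracts with \<open>pA x\<close> and \<open>pB x\<close>
  separately, as these contractions keep \<open>\<omega>\<close> homogeneous.\<close>

lemma bp_wdg_right:
  assumes "hom p q \<omega>" "set xs \<subseteq> X"
  shows "bp (r + p) (s + q) (wdg \<beta> \<omega>) xs = wdg (bip pA pB r s \<beta>) \<omega> xs"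
  using assms
proof (induction xs arbitrary: p q r s \<beta> \<omega>)
  case Nil
  then show ?case
    using hom_bp_self [OF Nil.prems(1), of "[]"] by auto
next
  case (Cons x xs)
  have x: "x \<in> X" "set xs \<subseteq> X" and h: "hom p q \<omega>" using Cons.prems by auto
  have A: "bp (r + p - 1) (s + q) (contract (pA x) (wdg \<beta> \<omega>)) xs
     = wdg (bip pA pB (r - 1) s (contract (pA x) \<beta>)) \<omega> xs
     + wdg (bip pA pB r s (gsign \<beta>)) (contract (pA x) \<omega>) xs"
    using Cons.IH [OF h x(2), where r = "r - 1" and s = s and \<beta> = "contract (pA x) \<beta>"]
      Cons.IH [OF hom_contract_A [OF h pA_XA [OF x(1)]] x(2), where r = r and s = s and \<beta> = "gsign \<beta>"]
    by (simp add: bip_arith algebra_simps)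
  have B: "bp (r + p) (s + q - 1) (contract (pB x) (wdg \<beta> \<omega>)) xs
     = wdg (bip pA pB r (s - 1) (contract (pB x) \<beta>)) \<omega> xs
     + wdg (bip pA pB r s (gsign \<beta>)) (contract (pB x) \<omega>) xs"
    using Cons.IH [OF h x(2), where r = r and s = "s - 1" and \<beta> = "contract (pB x) \<beta>"]
      Cons.IH [OF hom_contract_B [OF h pB_XB [OF x(1)]] x(2), where r = r and s = s and \<beta> = "gsign \<beta>"]
    by (simp add: bip_arith algebra_simps)
  have "wdg (gsign (bip pA pB r s \<beta>)) (contract x \<omega>) xs
      = wdg (gsign (bip pA pB r s \<beta>)) (contract (pA x) \<omega> + contract (pB x) \<omega>) xs"
    using x frm_add_head [OF hom_frm [OF h] pA_closed pB_closed, of x x]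
    by (intro wdg_cong) (auto simp: contract_apply pA_plus_pB)
  then show "bp (r + p) (s + q) (wdg \<beta> \<omega>) (x # xs) = wdg (bip pA pB r s \<beta>) \<omega> (x # xs)"
    unfolding bip.simps A B by (simp add: wdg_arith bip_gsign)
qed

lemma bp_wdg_left:
  assumes "S.hom p q \<alpha>" "set xs \<subseteq> X"
  shows "bp (p + r) (q + s) (wdg \<alpha> \<eta>) xs = wdg \<alpha> (bp r s \<eta>) xs"
  using assms
proof (induction xs arbitrary: p q r s \<alpha> \<eta>)
  case Nil
  then show ?case
    using S.hom_bp_self [OF Nil.prems(1), of "[]"] by auto
next
  case (Cons x xs)
  have x: "x \<in> X" "set xs \<subseteq> X" and h: "S.hom p q \<alpha>" using Cons.prems by auto
  note hg = S.hom_arith(5) [OF h]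
  have A: "bp (p + r - 1) (q + s) (contract (pA x) (wdg \<alpha> \<eta>)) xs
     = wdg (contract (pA x) \<alpha>) (bp r s \<eta>) xs
     + wdg (gsign \<alpha>) (bp (r - 1) s (contract (pA x) \<eta>)) xs"
    using Cons.IH [OF S.hom_contract_A [OF h pA_XA [OF x(1)]] x(2), where r = r and s = s and \<eta> = \<eta>]
      Cons.IH [OF hg x(2), where r = "r - 1" and s = s and \<eta> = "contract (pA x) \<eta>"]
    by (simp add: bip_arith algebra_simps)
  have B: "bp (p + r) (q + s - 1) (contract (pB x) (wdg \<alpha> \<eta>)) xs
     = wdg (contract (pB x) \<alpha>) (bp r s \<eta>) xs
     + wdg (gsign \<alpha>) (bp r (s - 1) (contract (pB x) \<eta>)) xs"
    using Cons.IH [OF S.hom_contract_B [OF h pB_XB [OF x(1)]] x(2), where r = r and s = s and \<eta> = \<eta>]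
      Cons.IH [OF hg x(2), where r = r and s = "s - 1" and \<eta> = "contract (pB x) \<eta>"]
    by (simp add: bip_arith algebra_simps)
  have "wdg (contract x \<alpha>) (bp r s \<eta>) xs
      = wdg (contract (pA x) \<alpha> + contract (pB x) \<alpha>) (bp r s \<eta>) xs"
    using x S.frm_add_head [OF S.hom_frm [OF h] pA_closed pB_closed, of x x]
    by (intro wdg_cong) (auto simp: contract_apply pA_plus_pB)
  then show "bp (p + r) (q + s) (wdg \<alpha> \<eta>) (x # xs) = wdg \<alpha> (bp r s \<eta>) (x # xs)"
    unfolding bip.simps A B by (simp add: wdg_arith)
qed

lemma hom_wdg:
  assumes "S.hom p q \<alpha>" "hom r s \<omega>"
  shows "hom (p + r) (q + s) (wdg \<alpha> \<omega>)"
proof (unfold hom_def, intro conjI allI impI)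
  show "frm (wdg \<alpha> \<omega>)" using assms by (intro frm_wdg S.hom_frm hom_frm)
  fix xs assume xs: "set xs \<subseteq> X"
  have "wdg (bip pA pB p q \<alpha>) \<omega> xs = wdg \<alpha> \<omega> xs"
    using assms by (intro wdg_cong xs) (auto simp: S.hom_bp_self)
  then show "bp (p + r) (q + s) (wdg \<alpha> \<omega>) xs = wdg \<alpha> \<omega> xs"
    by (simp add: bp_wdg_right [OF assms(2) xs])
qed

end

text \<open>Expanding the recursion \<open>bip\<close> gives one summand for each set of positions
  that receive \<open>pA\<close>; whether 0 belongs to the set decides between the two contractions
  of the first step.\<close>

lemma sum_card_eq_bip:
  "(\<Sum>S\<in>Pow {..<length xs}. if int (card S) = p
      then \<omega> (map (\<lambda>i. if i \<in> S then pA (xs ! i) else pB (xs ! i)) [0..<length xs]) else 0)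
    = bip pA pB p (int (length xs) - p) \<omega> xs"
proof (induction xs arbitrary: p \<omega>)
  case (Cons x xs)
  let ?n = "length xs"
  let ?m = "\<lambda>ys S. map (\<lambda>i. if i \<in> S then pA (ys ! i) else pB (ys ! i)) [0..<length ys]"
  have upt: "[0..<Suc ?n] = 0 # map Suc [0..<?n]"
    by (simp add: upt_conv_Cons map_Suc_upt del: upt_Suc)
  have m: "?m (x # xs) (Suc ` T) = pB x # ?m xs T" "?m (x # xs) (insert 0 (Suc ` T)) = pA x # ?m xs T" for T
    by (simp_all add: upt del: upt_Suc) (auto simp: o_def)
  have card: "card (Suc ` T) = card T" "card (insert 0 (Suc ` T)) = Suc (card T)" if "T \<in> Pow {..<?n}" for T
  proof -
    show "card (Suc ` T) = card T" by (simp add: card_image)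
    have "finite T" using that finite_subset by blast
    then show "card (insert 0 (Suc ` T)) = Suc (card T)" by (simp add: card_image)
  qed
  have "(\<Sum>S\<in>Pow {..<length (x # xs)}. if int (card S) = p then \<omega> (?m (x # xs) S) else 0)
    = (\<Sum>T\<in>Pow {..<?n}. if int (card T) = p then contract (pB x) \<omega> (?m xs T) else 0)
    + (\<Sum>T\<in>Pow {..<?n}. if int (card T) = p - 1 then contract (pA x) \<omega> (?m xs T) else 0)"
    unfolding list.size add_0_right add_Suc_right sum_Pow_lessThan_Suc
    using m card by (intro arg_cong2 [of _ _ _ _ "(+)"] sum.cong refl) (auto simp: contract_apply)
  also have "\<dots> = bip pA pB p (int ?n - p) (contract (pB x) \<omega>) xs
     + bip pA pB (p - 1) (int ?n - (p - 1)) (contract (pA x) \<omega>) xs"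
    by (simp only: Cons.IH)
  finally show "(\<Sum>S\<in>Pow {..<length (x # xs)}. if int (card S) = p then \<omega> (?m (x # xs) S) else 0)
     = bip pA pB p (int (length (x # xs)) - p) \<omega> (x # xs)"
    by (simp add: algebra_simps)
qed auto

lemma bipart_eq: "bipart X pA pB p q \<omega> = on_lists X (bip pA pB (int p) (int q) \<omega>)"
proof
  fix xs
  show "bipart X pA pB p q \<omega> xs = on_lists X (bip pA pB (int p) (int q) \<omega>) xs"
  proof (cases "length xs = p + q")
    case True
    have "{S. S \<subseteq> {..<length xs} \<and> card S = p} = Pow {..<length xs} \<inter> {S. int (card S) = int p}"
      by auto
    then show ?thesis
      using True sum_card_eq_bip [where xs = xs and p = "int p" and \<omega> = \<omega> and pA = pA and pB = pB]
      by (simp add: bipart_def on_lists_def sum.inter_restrict cong: if_cong)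
  next
    case False
    then show ?thesis by (simp add: bipart_def on_lists_def bip_eq_0)
  qed
qed

lemma on_lists_on_lists [simp]: "on_lists X (on_lists X \<omega>) = on_lists X \<omega>"
  by (auto simp: on_lists_def)

lemma on_lists_apply: "set xs \<subseteq> X \<Longrightarrow> on_lists X \<omega> xs = \<omega> xs"
  by (simp add: on_lists_def)

lemma on_lists_cong: "(\<And>xs. set xs \<subseteq> X \<Longrightarrow> \<omega> xs = \<eta> xs) \<Longrightarrow> on_lists X \<omega> = on_lists X \<eta>"
  by (auto simp: on_lists_def)

lemma on_lists_eq_0: "(\<And>xs. set xs \<subseteq> X \<Longrightarrow> \<omega> xs = 0) \<Longrightarrow> on_lists X \<omega> = 0"
  by (auto simp: on_lists_def)

lemma eq_by_lists:
  "\<omega> = on_lists X \<omega> \<Longrightarrow> \<eta> = on_lists X \<eta> \<Longrightarrow> (\<And>xs. set xs \<subseteq> X \<Longrightarrow> \<omega> xs = \<eta> xs) \<Longrightarrow> \<omega> = \<eta>"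
  by (metis on_lists_cong)

lemma on_lists_iff: "\<omega> = on_lists X \<omega> \<longleftrightarrow> (\<forall>xs. \<not> set xs \<subseteq> X \<longrightarrow> \<omega> xs = 0)"
  unfolding fun_eq_iff on_lists_def by (metis (mono_tags))

section \<open>The components of the differential on homogeneous forms\<close>

context lie_rinehart_conn_split
begin

definition comp :: "nat \<Rightarrow> nat \<Rightarrow> ('x list \<Rightarrow> 'w) set" where
  "comp p q = bideg XA XB (forms C X sX Y sY) p q"

text \<open>The abstract form of \<open>lp_d\<close> and of the two differentials of
  \<open>lp_alg\<close>, written so that these become instances by unfolding.\<close>

definition dpart :: "nat \<Rightarrow> nat \<Rightarrow> ('x list \<Rightarrow> 'w) \<Rightarrow> 'x list \<Rightarrow> 'w" where
  "dpart r s = on_homog comp (op_part X pA pB r s (ce_diff X br act))"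

lemma comp_iff: "\<omega> \<in> comp p q \<longleftrightarrow> hom (int p) (int q) \<omega> \<and> \<omega> = on_lists X \<omega>"
  unfolding comp_def by (rule bideg_forms_iff)

lemma compD: "\<omega> \<in> comp p q \<Longrightarrow> hom (int p) (int q) \<omega>" "\<omega> \<in> comp p q \<Longrightarrow> \<omega> = on_lists X \<omega>"
  "\<omega> \<in> comp p q \<Longrightarrow> frm \<omega>" "\<omega> \<in> comp p q \<Longrightarrow> vals \<omega>"
  by (auto simp: comp_iff dest: hom_frm frm_vals)

lemma compI: "hom (int p) (int q) \<omega> \<Longrightarrow> on_lists X \<omega> \<in> comp p q"
  by (auto simp: comp_iff hom_frm intro!: hom_cong [of _ _ \<omega>] frm_on_lists) (simp add: on_lists_apply)

lemma comp_eqI: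
  "\<omega> \<in> comp p q \<Longrightarrow> \<eta> \<in> comp r s \<Longrightarrow> (\<And>xs. set xs \<subseteq> X \<Longrightarrow> \<omega> xs = \<eta> xs) \<Longrightarrow> \<omega> = \<eta>"
  using eq_by_lists compD(2) by blast

lemma on_lists_arith:
  "\<omega> = on_lists X \<omega> \<Longrightarrow> \<eta> = on_lists X \<eta> \<Longrightarrow> \<omega> + \<eta> = on_lists X (\<omega> + \<eta> :: 'x list \<Rightarrow> 'w)"
  "\<omega> = on_lists X \<omega> \<Longrightarrow> - \<omega> = on_lists X (- \<omega> :: 'x list \<Rightarrow> 'w)"
  "0 = on_lists X (0 :: 'x list \<Rightarrow> 'w)"
  by (simp_all add: on_lists_iff)

lemma comp_add: "\<omega> \<in> comp p q \<Longrightarrow> \<eta> \<in> comp p q \<Longrightarrow> \<omega> + \<eta> \<in> comp p q"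
  unfolding comp_iff using hom_arith(1) on_lists_arith(1) by blast

lemma comp_uminus: "\<omega> \<in> comp p q \<Longrightarrow> - \<omega> \<in> comp p q"
  unfolding comp_iff using hom_arith(3) on_lists_arith(2) by blast

lemma comp_zero: "0 \<in> comp p q"
  unfolding comp_iff using hom_arith(4) on_lists_arith(3) by blast

lemma comp_bipart:
  assumes "\<omega> \<in> comp p q"
  shows "bipart X pA pB r s \<omega> = (if r = p \<and> s = q then \<omega> else 0)"
proof (cases "r = p \<and> s = q")
  case True
  have "on_lists X (bp (int p) (int q) \<omega>) = on_lists X \<omega>"
    using compD(1) [OF assms] by (intro on_lists_cong) (rule hom_bp_self)
  then show ?thesis using True compD(2) [OF assms] by (simp add: bipart_eq)
next
  case False
  have "on_lists X (bp (int r) (int s) \<omega>) = 0"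
    using hom_bp_other [OF compD(1) [OF assms]] False by (intro on_lists_eq_0) auto
  then show ?thesis using False by (simp only: bipart_eq if_False)
qed

text \<open>In \<open>op_part\<close> every summand except the one for \<open>p\<close> applies the
  differential to a zero component. At list lengths other than \<open>p + q + 1\<close> both sides
  vanish for reasons of degree; this uses \<open>r + s = 1\<close>.\<close>

lemma dpart_eq:
  assumes "\<omega> \<in> comp p q" "r + s = 1"
  shows "dpart r s \<omega> = on_lists X (bp (int (p + r)) (int (q + s)) (d \<omega>))"
proof
  fix xs
  let ?D = "ce_diff X br act"
  have D: "?D \<eta> = on_lists X (d \<eta>)" if "frm \<eta>" for \<eta>
    using that by (rule ce_diff_eq)
  have D0: "?D 0 = 0"
    unfolding D [OF frm_zero] by (intro on_lists_eq_0 cartan_d_zero)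
  have b0: "bipart X pA pB i k 0 = (0 :: 'x list \<Rightarrow> 'w)" for i k
    by (simp only: bipart_eq bip_arith) (intro on_lists_eq_0, simp)
  have "\<omega> \<in> homog comp" using assms by (auto simp: homog_def)
  then have "dpart r s \<omega> xs = (\<Sum>i<length xs. bipart X pA pB (i + r) (length xs - 1 - i + s)
       (?D (bipart X pA pB i (length xs - 1 - i) \<omega>)) xs)"
    by (simp add: dpart_def on_homog_def op_part_def)
  also have "\<dots> = (\<Sum>i<length xs. if i = p \<and> length xs - 1 - i = q
       then bipart X pA pB (p + r) (q + s) (?D \<omega>) xs else 0)"
    by (intro sum.cong refl) (auto simp: comp_bipart [OF assms(1)] D0 b0 simp del: zero_fun_apply, simp_all)
  also have "\<dots> = bipart X pA pB (p + r) (q + s) (?D \<omega>) xs"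
  proof (cases "length xs = p + q + 1")
    case True
    have "(\<Sum>i<length xs. if i = p \<and> length xs - 1 - i = q
       then bipart X pA pB (p + r) (q + s) (?D \<omega>) xs else 0)
     = (\<Sum>i<length xs. if i = p then bipart X pA pB (p + r) (q + s) (?D \<omega>) xs else 0)"
      using True by (intro sum.cong) auto
    then show ?thesis using True by simp
  next
    case False
    then have "length xs \<noteq> (p + r) + (q + s)" using assms(2) by simp
    then have "bipart X pA pB (p + r) (q + s) (?D \<omega>) xs = 0"
      by (simp add: bipart_def on_lists_def)
    then show ?thesis by (simp cong: if_cong)
  qed
  also have "\<dots> = on_lists X (bp (int (p + r)) (int (q + s)) (d \<omega>)) xs"
  proof -
    have "bp i k (on_lists X (d \<omega>)) ys = bp i k (d \<omega>) ys"
      if "set ys \<subseteq> X" for ys i k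
      using that by (intro bp_cong) (simp_all add: on_lists_apply)
    then show ?thesis
      unfolding bipart_eq D [OF compD(3) [OF assms(1)]]
      by (intro fun_cong [of "on_lists X _" "on_lists X _"] on_lists_cong)
  qed
  finally show "dpart r s \<omega> xs = on_lists X (bp (int (p + r)) (int (q + s)) (d \<omega>)) xs" .
qed

lemma dpart_comp:
  assumes "\<omega> \<in> comp p q" "r + s = 1"
  shows "dpart r s \<omega> \<in> comp (p + r) (q + s)"
  unfolding dpart_eq [OF assms] using assms by (intro compI hom_bp frm_cartan_d) (rule compD)

lemma dpart_add:
  assumes "\<omega> \<in> comp p q" "\<eta> \<in> comp p q" "r + s = 1"
  shows "dpart r s (\<omega> + \<eta>) = dpart r s \<omega> + dpart r s \<eta>"
proof (rule comp_eqI)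
  show "dpart r s (\<omega> + \<eta>) \<in> comp (p + r) (q + s)"
    using assms by (intro dpart_comp comp_add)
  show "dpart r s \<omega> + dpart r s \<eta> \<in> comp (p + r) (q + s)"
    using assms by (intro dpart_comp comp_add)
  fix xs assume xs: "set xs \<subseteq> X"
  let ?b = "bp (int (p + r)) (int (q + s))"
  have "?b (d (\<omega> + \<eta>)) xs = ?b (d \<omega> + d \<eta>) xs"
    using assms(1,2) by (intro bp_cong [OF xs]) (simp add: cartan_d_add compD(4) [where p = p and q = q])
  then show "dpart r s (\<omega> + \<eta>) xs = (dpart r s \<omega> + dpart r s \<eta>) xs"
    using xs assms by (simp add: dpart_eq [where p = p and q = q] comp_add on_lists_apply bip_arith)
qed

text \<open>Reduces compositions of components to components of \<open>d\<close> composed with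
  itself. Flatness is not assumed, so the right-hand sides express the curvature.\<close>

lemma dpart_dpart:
  assumes "\<omega> \<in> comp p q"
  shows "dpart 1 0 (dpart 0 1 \<omega>) + dpart 0 1 (dpart 1 0 \<omega>)
      = on_lists X (bp (int p + 1) (int q + 1) (d (d \<omega>)))"
    and "dpart 1 0 (dpart 1 0 \<omega>) = on_lists X (bp (int p + 2) (int q) (d (d \<omega>)))"
proof -
  have eq: "dpart r s (dpart t u \<omega>)
     = on_lists X (bp (int (p + t + r)) (int (q + u + s)) (d (bp (int (p + t)) (int (q + u)) (d \<omega>))))"
    if "r + s = 1" "t + u = 1" for r s t u
    unfolding dpart_eq [OF dpart_comp [OF assms that(2)] that(1)]
  proof (intro on_lists_cong bp_cong)
    fix ys assume ys: "set ys \<subseteq> X"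
    show "d (dpart t u \<omega>) ys = d (bp (int (p + t)) (int (q + u)) (d \<omega>)) ys"
      using assms that(2) by (intro cartan_d_cong [OF ys]) (simp add: dpart_eq on_lists_apply)
  qed
  note h = compD(1) [OF assms]
  have s: "int (Suc p) = int p + 1" "int (Suc (Suc p)) = int p + 2" "int (Suc q) = int q + 1" by simp_all
  show "dpart 1 0 (dpart 0 1 \<omega>) + dpart 0 1 (dpart 1 0 \<omega>)
      = on_lists X (bp (int p + 1) (int q + 1) (d (d \<omega>)))"
  proof (rule eq_by_lists [of _ X])
    fix xs assume xs: "set xs \<subseteq> X"
    show "(dpart 1 0 (dpart 0 1 \<omega>) + dpart 0 1 (dpart 1 0 \<omega>)) xs
      = on_lists X (bp (int p + 1) (int q + 1) (d (d \<omega>))) xs"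
      using bp_cartan_d_cartan_d(1) [OF h _ _ xs] xs by (simp add: eq on_lists_apply s del: of_nat_Suc)
  qed (use eq in \<open>auto simp: on_lists_def fun_eq_iff\<close>)
  show "dpart 1 0 (dpart 1 0 \<omega>) = on_lists X (bp (int p + 2) (int q) (d (d \<omega>)))"
  proof (rule eq_by_lists [of _ X])
    fix xs assume xs: "set xs \<subseteq> X"
    show "dpart 1 0 (dpart 1 0 \<omega>) xs
      = on_lists X (bp (int p + 2) (int q) (d (d \<omega>))) xs"
      using bp_cartan_d_cartan_d(2) [OF h _ _ xs] xs by (simp add: eq on_lists_apply s del: of_nat_Suc)
  qed (use eq in \<open>auto simp: on_lists_def fun_eq_iff\<close>)
qed

lemma wdg_signed: "wdg (signed n \<alpha>) \<omega> = signed n (wdg \<alpha> \<omega>)"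
  by (simp add: signed_def wdg_arith)

lemma wdg_on_lists:
  assumes "\<alpha> = on_lists X \<alpha>" "\<omega> = on_lists X \<omega>"
  shows "wdg \<alpha> \<omega> = on_lists X (wdg \<alpha> \<omega>)"
proof
  fix xs
  show "wdg \<alpha> \<omega> xs = on_lists X (wdg \<alpha> \<omega>) xs"
  proof (cases "set xs \<subseteq> X")
    case False
    have "sY (\<alpha> (nths xs S)) (\<omega> (nths xs (- S))) = 0" for S
    proof (cases "set (nths xs S) \<subseteq> X")
      case True
      have "set xs \<subseteq> set (nths xs S) \<union> set (nths xs (- S))"
      proof
        fix y assume "y \<in> set xs"
        then obtain i where "i < length xs" "y = xs ! i" by (auto simp: in_set_conv_nth)
        then show "y \<in> set (nths xs S) \<union> set (nths xs (- S))"
          by (cases "i \<in> S") (auto simp: set_nths)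
      qed
      then have "\<not> set (nths xs (- S)) \<subseteq> X" using True False by blast
      then have "\<omega> (nths xs (- S)) = 0"
        using fun_cong [OF assms(2), of "nths xs (- S)"] by (simp add: on_lists_def)
      then show ?thesis by simp
    next
      case False
      then have "\<alpha> (nths xs S) = 0"
        using fun_cong [OF assms(1), of "nths xs S"] by (simp add: on_lists_def)
      then show ?thesis by simp
    qed
    then show ?thesis using False by (simp add: wedge_def on_lists_def)
  qed (simp add: on_lists_apply)
qed

end

context lie_rinehart_conn_split
begin

lemma comp_wdg:
  assumes "\<alpha> \<in> S.comp p q" "\<omega> \<in> comp r s"
  shows "wdg \<alpha> \<omega> \<in> comp (p + r) (q + s)"
  unfolding comp_iff
  using hom_wdg [OF S.compD(1) [OF assms(1)] compD(1) [OF assms(2)]]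
    wdg_on_lists [OF S.compD(2) [OF assms(1)] compD(2) [OF assms(2)]]
  by simp

text \<open>A bidegree component of \<open>cartan_d_wdg\<close>. On a form of bidegree
  \<open>(p, q)\<close> the involution \<open>gsign\<close> is multiplication by a constant
  sign.\<close>

lemma dpart_wdg:
  assumes \<alpha>: "\<alpha> \<in> S.comp p q" and \<omega>: "\<omega> \<in> comp p' q'" and rs: "r + s = 1"
  shows "dpart r s (wdg \<alpha> \<omega>) = wdg (S.dpart r s \<alpha>) \<omega> + signed (p + q) (wdg \<alpha> (dpart r s \<omega>))"
proof (rule eq_by_lists [of _ X])
  show "dpart r s (wdg \<alpha> \<omega>) = on_lists X (dpart r s (wdg \<alpha> \<omega>))"
    by (rule compD(2) [OF dpart_comp [OF comp_wdg [OF \<alpha> \<omega>] rs]])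
  have "wdg (S.dpart r s \<alpha>) \<omega> = on_lists X (wdg (S.dpart r s \<alpha>) \<omega>)"
    "wdg \<alpha> (dpart r s \<omega>) = on_lists X (wdg \<alpha> (dpart r s \<omega>))"
    using S.compD(2) [OF \<alpha>] S.compD(2) [OF S.dpart_comp [OF \<alpha> rs]]
      compD(2) [OF \<omega>] compD(2) [OF dpart_comp [OF \<omega> rs]]
    by (auto intro: wdg_on_lists)
  then show "wdg (S.dpart r s \<alpha>) \<omega> + signed (p + q) (wdg \<alpha> (dpart r s \<omega>))
    = on_lists X (wdg (S.dpart r s \<alpha>) \<omega> + signed (p + q) (wdg \<alpha> (dpart r s \<omega>)))"
    unfolding on_lists_iff by (simp add: signed_def)
  fix xs assume xs: "set xs \<subseteq> X"
  let ?dS = "cartan_d br rho"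
  let ?b = "bp (int (p + p' + r)) (int (q + q' + s))"
  have g: "gsign \<alpha> ys = signed (p + q) \<alpha> ys" if "set ys \<subseteq> X" for ys
    using S.hom_length [OF S.compD(1) [OF \<alpha>] that]
    by (cases "length ys = p + q") (auto simp: gsign_apply signed_def)
  have "dpart r s (wdg \<alpha> \<omega>) xs = ?b (d (wdg \<alpha> \<omega>)) xs"
    using xs by (simp add: dpart_eq [OF comp_wdg [OF \<alpha> \<omega>] rs] on_lists_apply)
  also have "\<dots> = ?b (wdg (?dS \<alpha>) \<omega> + wdg (gsign \<alpha>) (d \<omega>)) xs"
    using cartan_d_wdg [OF _ S.compD(4) [OF \<alpha>] compD(4) [OF \<omega>]]
    by (intro bp_cong [OF xs]) simp
  also have "\<dots> = ?b (wdg (?dS \<alpha>) \<omega>) xs + ?b (wdg (gsign \<alpha>) (d \<omega>)) xs"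
    by (simp add: bip_arith)
  also have "?b (wdg (?dS \<alpha>) \<omega>) xs = wdg (bip pA pB (int (p + r)) (int (q + s)) (?dS \<alpha>)) \<omega> xs"
    using bp_wdg_right [OF compD(1) [OF \<omega>] xs, of "int (p + r)" "int (q + s)" "?dS \<alpha>"]
    by (simp add: algebra_simps)
  also have "\<dots> = wdg (S.dpart r s \<alpha>) \<omega> xs"
    by (intro wdg_cong [OF xs]) (simp_all add: S.dpart_eq [OF \<alpha> rs] on_lists_apply)
  also have "?b (wdg (gsign \<alpha>) (d \<omega>)) xs = wdg (gsign \<alpha>) (bp (int (p' + r)) (int (q' + s)) (d \<omega>)) xs"
    using bp_wdg_left [OF S.hom_arith(5) [OF S.compD(1) [OF \<alpha>]] xs, of "int (p' + r)" "int (q' + s)" "d \<omega>"]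
    by (simp add: algebra_simps)
  also have "\<dots> = wdg (signed (p + q) \<alpha>) (dpart r s \<omega>) xs"
    by (intro wdg_cong [OF xs]) (simp_all add: dpart_eq [OF \<omega> rs] on_lists_apply g)
  finally show "dpart r s (wdg \<alpha> \<omega>) xs = (wdg (S.dpart r s \<alpha>) \<omega> + signed (p + q) (wdg \<alpha> (dpart r s \<omega>))) xs"
    by (simp add: wdg_signed)
qed

end

text \<open>\<open>rho_br\<close> says that \<open>rho\<close> is flat on functions, so the scalar
  differential squares to zero, and so does each bidegree component of its square.\<close>

lemma (in lie_rinehart_split) dpart_dpart_scalar:
  assumes "\<alpha> \<in> S.comp p q"
  shows "S.dpart 1 0 (S.dpart 0 1 \<alpha>) + S.dpart 0 1 (S.dpart 1 0 \<alpha>) = 0"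
    and "S.dpart 1 0 (S.dpart 1 0 \<alpha>) = 0"
proof -
  have sq: "bip pA pB r s (cartan_d br rho (cartan_d br rho \<alpha>)) xs = 0" if "set xs \<subseteq> X" for r s xs
  proof -
    have "bip pA pB r s (cartan_d br rho (cartan_d br rho \<alpha>)) xs = bip pA pB r s 0 xs"
      using S.compD(3) [OF assms] rho_br
      by (intro S.bp_cong [OF that]) (simp add: S.cartan_d_square)
    then show ?thesis by (simp add: bip_arith)
  qed
  show "S.dpart 1 0 (S.dpart 0 1 \<alpha>) + S.dpart 0 1 (S.dpart 1 0 \<alpha>) = 0"
    unfolding S.dpart_dpart(1) [OF assms] by (rule on_lists_eq_0) (rule sq)
  show "S.dpart 1 0 (S.dpart 1 0 \<alpha>) = 0"
    unfolding S.dpart_dpart(2) [OF assms] by (rule on_lists_eq_0) (rule sq)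
qed

section \<open>Curvatures of connections on a DG-module\<close>

text \<open>That \<open>mdbar\<close> squares to zero is postponed to \<open>dg_pair_flat\<close>:
  for the module of a Lie pair this is itself derived inside \<open>dg_pair\<close>, from linearity
  of the square.\<close>

locale dg_pair =
  fixes aa :: "'c::ab_group_add ddg_alg" and mm :: "('c, 'b::ab_group_add) dg_mod"
  assumes mcomp_add: "\<omega> \<in> mcomp mm p q \<Longrightarrow> \<eta> \<in> mcomp mm p q \<Longrightarrow> \<omega> + \<eta> \<in> mcomp mm p q"
    and mcomp_uminus: "\<omega> \<in> mcomp mm p q \<Longrightarrow> - \<omega> \<in> mcomp mm p q"
    and mcomp_zero: "0 \<in> mcomp mm p q"
    and mact_comp: "\<alpha> \<in> acomp aa p q \<Longrightarrow> \<omega> \<in> mcomp mm r s \<Longrightarrow> mact mm \<alpha> \<omega> \<in> mcomp mm (p + r) (q + s)"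
    and mact_add_left: "mact mm (\<alpha> + \<beta>) \<omega> = mact mm \<alpha> \<omega> + mact mm \<beta> \<omega>"
    and mact_add: "mact mm \<alpha> (\<omega> + \<eta>) = mact mm \<alpha> \<omega> + mact mm \<alpha> \<eta>"
    and adbar_comp: "\<alpha> \<in> acomp aa p q \<Longrightarrow> adbar aa \<alpha> \<in> acomp aa (Suc p) q"
    and ad_comp: "\<alpha> \<in> acomp aa p q \<Longrightarrow> ad aa \<alpha> \<in> acomp aa p (Suc q)"
    and mdbar_map: "bigraded_map mm 1 0 (mdbar mm)"
    and mdbar_mact: "\<alpha> \<in> acomp aa p q \<Longrightarrow> \<omega> \<in> mcomp mm r s
      \<Longrightarrow> mdbar mm (mact mm \<alpha> \<omega>) = mact mm (adbar aa \<alpha>) \<omega> + signed (p + q) (mact mm \<alpha> (mdbar mm \<omega>))"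
    and anticommute: "\<alpha> \<in> acomp aa p q \<Longrightarrow> ad aa (adbar aa \<alpha>) + adbar aa (ad aa \<alpha>) = 0"
begin

lemma bigraded_mapD:
  assumes "bigraded_map mm r s F"
  shows "\<omega> \<in> mcomp mm p q \<Longrightarrow> F \<omega> \<in> mcomp mm (p + r) (q + s)"
    and "\<omega> \<in> mcomp mm p q \<Longrightarrow> \<eta> \<in> mcomp mm p q \<Longrightarrow> F (\<omega> + \<eta>) = F \<omega> + F \<eta>"
    and "F 0 = 0" "\<omega> \<in> mcomp mm p q \<Longrightarrow> F (- \<omega>) = - F \<omega>"
    and "\<omega> \<in> mcomp mm p q \<Longrightarrow> F (signed n \<omega>) = signed n (F \<omega>)"
    and "\<omega> \<notin> homog (mcomp mm) \<Longrightarrow> F \<omega> = 0"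
proof -
  have F: "F = on_homog (mcomp mm) F" and c: "\<omega> \<in> mcomp mm p q \<Longrightarrow> F \<omega> \<in> mcomp mm (p + r) (q + s)"
    and a: "\<omega> \<in> mcomp mm p q \<Longrightarrow> \<eta> \<in> mcomp mm p q \<Longrightarrow> F (\<omega> + \<eta>) = F \<omega> + F \<eta>" for \<omega> \<eta> p q
    using assms unfolding bigraded_map_def by blast+
  show "\<omega> \<in> mcomp mm p q \<Longrightarrow> F \<omega> \<in> mcomp mm (p + r) (q + s)" by (rule c)
  show "\<omega> \<in> mcomp mm p q \<Longrightarrow> \<eta> \<in> mcomp mm p q \<Longrightarrow> F (\<omega> + \<eta>) = F \<omega> + F \<eta>" by (rule a)
  show z: "F 0 = 0" using a [OF mcomp_zero mcomp_zero] by simp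
  show m: "F (- \<omega>) = - F \<omega>" if "\<omega> \<in> mcomp mm p q"
    using a [OF that mcomp_uminus [OF that]] z by (simp add: eq_neg_iff_add_eq_0 add.commute)
  then show "\<omega> \<in> mcomp mm p q \<Longrightarrow> F (signed n \<omega>) = signed n (F \<omega>)" by (simp add: signed_def)
  show "F \<omega> = 0" if "\<omega> \<notin> homog (mcomp mm)"
    using fun_cong [OF F, of \<omega>] that by (simp add: on_homog_def)
qed

lemma bigraded_mapI:
  assumes "\<And>\<omega>. \<omega> \<notin> homog (mcomp mm) \<Longrightarrow> F \<omega> = 0"
    and "\<And>p q \<omega>. \<omega> \<in> mcomp mm p q \<Longrightarrow> F \<omega> \<in> mcomp mm (p + r) (q + s)"
    and "\<And>p q \<omega> \<eta>. \<omega> \<in> mcomp mm p q \<Longrightarrow> \<eta> \<in> mcomp mm p q \<Longrightarrow> F (\<omega> + \<eta>) = F \<omega> + F \<eta>"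
  shows "bigraded_map mm r s F"
  using assms by (auto simp: bigraded_map_def on_homog_def fun_eq_iff)

lemma bigraded_map_comp:
  assumes F: "bigraded_map mm r s F" and G: "bigraded_map mm t u G"
  shows "bigraded_map mm (t + r) (u + s) (\<lambda>\<omega>. F (G \<omega>))"
proof (rule bigraded_mapI)
  show "F (G \<omega>) = 0" if "\<omega> \<notin> homog (mcomp mm)" for \<omega>
    using bigraded_mapD(6) [OF G that] bigraded_mapD(3) [OF F] by simp
  show "F (G \<omega>) \<in> mcomp mm (p + (t + r)) (q + (u + s))" if "\<omega> \<in> mcomp mm p q" for p q \<omega>
    using bigraded_mapD(1) [OF F bigraded_mapD(1) [OF G that]] by (simp add: add.assoc)
  show "F (G (\<omega> + \<eta>)) = F (G \<omega>) + F (G \<eta>)" if "\<omega> \<in> mcomp mm p q" "\<eta> \<in> mcomp mm p q" for p q \<omega> \<eta>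
    using bigraded_mapD(2) [OF G that] bigraded_mapD(2) [OF F bigraded_mapD(1) [OF G that(1)] bigraded_mapD(1) [OF G that(2)]]
    by simp
qed

lemma bigraded_map_add:
  assumes F: "bigraded_map mm r s F" and G: "bigraded_map mm r s G"
  shows "bigraded_map mm r s (\<lambda>\<omega>. F \<omega> + G \<omega>)"
  using bigraded_mapD [OF F] bigraded_mapD [OF G]
  by (intro bigraded_mapI mcomp_add) (simp_all add: algebra_simps)

lemma bigraded_map_uminus:
  assumes F: "bigraded_map mm r s F"
  shows "bigraded_map mm r s (\<lambda>\<omega>. - F \<omega>)"
  using bigraded_mapD [OF F]
  by (intro bigraded_mapI mcomp_uminus) simp_all

lemma bigraded_map_diff:
  assumes F: "bigraded_map mm r s F" and G: "bigraded_map mm r s G"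
  shows "bigraded_map mm r s (\<lambda>\<omega>. F \<omega> - G \<omega>)"
  using bigraded_map_add [OF F bigraded_map_uminus [OF G]] by simp

lemma mact_zero [simp]: "mact mm 0 \<omega> = 0" "mact mm \<alpha> 0 = 0"
  using mact_add_left [of 0 0 \<omega>] mact_add [of \<alpha> 0 0] by simp_all

lemma mact_uminus: "mact mm \<alpha> (- \<omega>) = - mact mm \<alpha> \<omega>"
  using mact_add [of \<alpha> \<omega> "- \<omega>"] by (simp add: eq_neg_iff_add_eq_0 add.commute)

lemma mact_diff: "mact mm \<alpha> (\<omega> - \<eta>) = mact mm \<alpha> \<omega> - mact mm \<alpha> \<eta>"
  using mact_add [of \<alpha> \<omega> "- \<eta>"] mact_uminus by simp

text \<open>In the Leibniz expansion of d dbar + dbar d the mixed terms cancel, since applying one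
  differential to \<alpha> changes the sign for the next. The terms that differentiate \<alpha>
  twice vanish by \<open>anticommute\<close>.\<close>

lemma dg_curvature_Hom:
  assumes d: "dg_connection aa mm d"
  shows "dg_curvature mm d \<in> dg_Hom aa mm 1 1"
proof -
  have dm: "bigraded_map mm 0 1 d"
    and dL: "\<And>p q p' q' \<alpha> \<omega>. \<alpha> \<in> acomp aa p q \<Longrightarrow> \<omega> \<in> mcomp mm p' q'
      \<Longrightarrow> d (mact mm \<alpha> \<omega>) = mact mm (ad aa \<alpha>) \<omega> + signed (p + q) (mact mm \<alpha> (d \<omega>))"
    using d unfolding dg_connection_def by blast+
  have "bigraded_map mm 1 1 (\<lambda>\<omega>. d (mdbar mm \<omega>))" "bigraded_map mm 1 1 (\<lambda>\<omega>. mdbar mm (d \<omega>))"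
    using bigraded_map_comp [OF dm mdbar_map] bigraded_map_comp [OF mdbar_map dm] by simp_all
  then have m: "bigraded_map mm 1 1 (dg_curvature mm d)"
    unfolding dg_curvature_def by (intro bigraded_map_uminus bigraded_map_add)
  have "dg_curvature mm d (mact mm \<alpha> \<omega>) = signed ((1 + 1) * (p + q)) (mact mm \<alpha> (dg_curvature mm d \<omega>))"
    if \<alpha>: "\<alpha> \<in> acomp aa p q" and \<omega>: "\<omega> \<in> mcomp mm p' q'" for p q p' q' \<alpha> \<omega>
  proof -
    note D = bigraded_mapD [OF dm] and B = bigraded_mapD [OF mdbar_map]
    have B\<omega>: "mdbar mm \<omega> \<in> mcomp mm (Suc p') q'" and D\<omega>: "d \<omega> \<in> mcomp mm p' (Suc q')"
      using B(1) [OF \<omega>] D(1) [OF \<omega>] by simp_all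
    have 1: "d (mdbar mm (mact mm \<alpha> \<omega>)) = d (mact mm (adbar aa \<alpha>) \<omega>) + signed (p + q) (d (mact mm \<alpha> (mdbar mm \<omega>)))"
    proof -
      have c: "mact mm (adbar aa \<alpha>) \<omega> \<in> mcomp mm (Suc (p + p')) (q + q')"
        "mact mm \<alpha> (mdbar mm \<omega>) \<in> mcomp mm (Suc (p + p')) (q + q')"
        using mact_comp [OF adbar_comp [OF \<alpha>] \<omega>] mact_comp [OF \<alpha> B\<omega>] by simp_all
      then have "signed (p + q) (mact mm \<alpha> (mdbar mm \<omega>)) \<in> mcomp mm (Suc (p + p')) (q + q')"
        by (simp add: signed_def mcomp_uminus)
      with c show ?thesis unfolding mdbar_mact [OF \<alpha> \<omega>] by (simp add: D(2) D(5))
    qed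
    have 2: "mdbar mm (d (mact mm \<alpha> \<omega>)) = mdbar mm (mact mm (ad aa \<alpha>) \<omega>) + signed (p + q) (mdbar mm (mact mm \<alpha> (d \<omega>)))"
    proof -
      have c: "mact mm (ad aa \<alpha>) \<omega> \<in> mcomp mm (p + p') (Suc (q + q'))"
        "mact mm \<alpha> (d \<omega>) \<in> mcomp mm (p + p') (Suc (q + q'))"
        using mact_comp [OF ad_comp [OF \<alpha>] \<omega>] mact_comp [OF \<alpha> D\<omega>] by simp_all
      then have "signed (p + q) (mact mm \<alpha> (d \<omega>)) \<in> mcomp mm (p + p') (Suc (q + q'))"
        by (simp add: signed_def mcomp_uminus)
      with c show ?thesis unfolding dL [OF \<alpha> \<omega>] by (simp add: B(2) B(5))
    qed
    have 3: "mact mm (ad aa (adbar aa \<alpha>)) \<omega> + mact mm (adbar aa (ad aa \<alpha>)) \<omega> = 0"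
      using anticommute [OF \<alpha>] mact_add_left [symmetric] by simp
    have "dg_curvature mm d (mact mm \<alpha> \<omega>)
      = - (mact mm (ad aa (adbar aa \<alpha>)) \<omega> + mact mm (adbar aa (ad aa \<alpha>)) \<omega>)
        - (mact mm \<alpha> (d (mdbar mm \<omega>)) + mact mm \<alpha> (mdbar mm (d \<omega>)))"
      unfolding dg_curvature_def 1 2
      by (simp add: dL [OF adbar_comp [OF \<alpha>] \<omega>] dL [OF \<alpha> B\<omega>] mdbar_mact [OF ad_comp [OF \<alpha>] \<omega>]
          mdbar_mact [OF \<alpha> D\<omega>] signed_add)
    also have "\<dots> = mact mm \<alpha> (dg_curvature mm d \<omega>)"
      unfolding 3 by (simp add: dg_curvature_def mact_add mact_uminus mact_diff)
    finally show ?thesis by (simp add: signed_even)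
  qed
  then show ?thesis using m unfolding dg_Hom_def by simp
qed

text \<open>The square of a derivation along a differential of square zero is linear, so it can be
  tested on generators of the module.\<close>

lemma mdbar_mdbar_Hom:
  assumes "\<And>p q \<alpha>. \<alpha> \<in> acomp aa p q \<Longrightarrow> adbar aa (adbar aa \<alpha>) = 0"
  shows "(\<lambda>\<omega>. mdbar mm (mdbar mm \<omega>)) \<in> dg_Hom aa mm 2 0"
proof -
  note B = bigraded_mapD [OF mdbar_map]
  have m: "bigraded_map mm 2 0 (\<lambda>\<omega>. mdbar mm (mdbar mm \<omega>))"
    using bigraded_map_comp [OF mdbar_map mdbar_map] by (simp add: numeral_2_eq_2)
  have "mdbar mm (mdbar mm (mact mm \<alpha> \<omega>)) = signed ((2 + 0) * (p + q)) (mact mm \<alpha> (mdbar mm (mdbar mm \<omega>)))"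
    if \<alpha>: "\<alpha> \<in> acomp aa p q" and \<omega>: "\<omega> \<in> mcomp mm p' q'" for p q p' q' \<alpha> \<omega>
  proof -
    have B\<omega>: "mdbar mm \<omega> \<in> mcomp mm (Suc p') q'"
      using B(1) [OF \<omega>] by simp
    have c: "mact mm (adbar aa \<alpha>) \<omega> \<in> mcomp mm (Suc (p + p')) (q + q')"
      "mact mm \<alpha> (mdbar mm \<omega>) \<in> mcomp mm (Suc (p + p')) (q + q')"
      using mact_comp [OF adbar_comp [OF \<alpha>] \<omega>] mact_comp [OF \<alpha> B\<omega>] by simp_all
    then have "signed (p + q) (mact mm \<alpha> (mdbar mm \<omega>)) \<in> mcomp mm (Suc (p + p')) (q + q')"
      by (simp add: signed_def mcomp_uminus)
    with c have "mdbar mm (mdbar mm (mact mm \<alpha> \<omega>)) = mdbar mm (mact mm (adbar aa \<alpha>) \<omega>)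
        + signed (p + q) (mdbar mm (mact mm \<alpha> (mdbar mm \<omega>)))"
      unfolding mdbar_mact [OF \<alpha> \<omega>] by (simp add: B(2) B(5))
    then show ?thesis
      by (simp add: mdbar_mact [OF adbar_comp [OF \<alpha>] \<omega>] mdbar_mact [OF \<alpha> B\<omega>] assms [OF \<alpha>]
          signed_add signed_even)
  qed
  then show ?thesis using m unfolding dg_Hom_def by simp
qed

end

locale dg_pair_flat = dg_pair +
  assumes mdbar_mdbar: "\<omega> \<in> mcomp mm p q \<Longrightarrow> mdbar mm (mdbar mm \<omega>) = 0"
begin

lemma mdbar_mdbar_all: "mdbar mm (mdbar mm \<omega>) = 0"
  using mdbar_mdbar [of \<omega>] bigraded_mapD(3,6) [OF mdbar_map] unfolding homog_def by fastforce

lemma dg_curvature_cocycle: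
  assumes d: "dg_connection aa mm d"
  shows "dg_commutator mm 2 (dg_curvature mm d) = 0"
    and "mdbar mm (dg_curvature mm d \<omega>) = dg_curvature mm d (mdbar mm \<omega>)"
proof -
  have dm: "bigraded_map mm 0 1 d" using d unfolding dg_connection_def by blast
  note D = bigraded_mapD [OF dm] and B = bigraded_mapD [OF mdbar_map]
  have c: "mdbar mm (dg_curvature mm d \<omega>) = dg_curvature mm d (mdbar mm \<omega>)" for \<omega>
  proof (cases "\<omega> \<in> homog (mcomp mm)")
    case True
    then obtain p q where \<omega>: "\<omega> \<in> mcomp mm p q" by (auto simp: homog_def)
    have "d (mdbar mm \<omega>) \<in> mcomp mm (Suc p) (Suc q)" "mdbar mm (d \<omega>) \<in> mcomp mm (Suc p) (Suc q)"
      using D(1) [OF B(1) [OF \<omega>]] B(1) [OF D(1) [OF \<omega>]] by simp_all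
    then have "mdbar mm (dg_curvature mm d \<omega>) = - (mdbar mm (d (mdbar mm \<omega>)) + mdbar mm (mdbar mm (d \<omega>)))"
      unfolding dg_curvature_def by (metis B(2) B(4) mcomp_add)
    then show ?thesis by (simp add: dg_curvature_def mdbar_mdbar_all D(3))
  next
    case False
    then show ?thesis by (simp add: dg_curvature_def B(3,6) D(3,6))
  qed
  then show "mdbar mm (dg_curvature mm d \<omega>) = dg_curvature mm d (mdbar mm \<omega>)" .
  from c show "dg_commutator mm 2 (dg_curvature mm d) = 0"
    by (simp add: dg_commutator_def signed_even fun_eq_iff)
qed

text \<open>Connections form an affine space over \<open>dg_Hom aa mm 0 1\<close>, and a translation
  changes the curvature by a coboundary. Hence the class consists of all curvatures, which also
  shows its independence of \<open>d\<close>.\<close>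

lemma Hom_cohom_dg_curvature:
  assumes d: "dg_connection aa mm d"
  shows "Hom_cohom aa mm `` {dg_curvature mm d} = {dg_curvature mm d' | d'. dg_connection aa mm d'}"
proof -
  let ?Z = "{F \<in> dg_Hom aa mm 1 1. dg_commutator mm 2 F = 0}"
  have Z: "dg_curvature mm d' \<in> ?Z" if "dg_connection aa mm d'" for d'
    using that dg_curvature_Hom dg_curvature_cocycle(1) by simp
  have dm: "bigraded_map mm 0 1 d" using d unfolding dg_connection_def by blast
  note B = bigraded_mapD [OF mdbar_map]
  have curv: "dg_curvature mm d' - dg_curvature mm d = dg_commutator mm 1 (\<lambda>\<omega>. d \<omega> - d' \<omega>)"
    if d'm: "bigraded_map mm 0 1 d'" for d'
  proof
    fix \<omega>
    show "(dg_curvature mm d' - dg_curvature mm d) \<omega> = dg_commutator mm 1 (\<lambda>\<omega>. d \<omega> - d' \<omega>) \<omega>"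
    proof (cases "\<omega> \<in> homog (mcomp mm)")
      case True
      then obtain p q where \<omega>: "\<omega> \<in> mcomp mm p q" by (auto simp: homog_def)
      have "mdbar mm (d \<omega> - d' \<omega>) = mdbar mm (d \<omega>) - mdbar mm (d' \<omega>)"
        using B(2) [OF bigraded_mapD(1) [OF dm \<omega>] mcomp_uminus [OF bigraded_mapD(1) [OF d'm \<omega>]]]
          B(4) [OF bigraded_mapD(1) [OF d'm \<omega>]] by simp
      then show ?thesis by (simp add: dg_curvature_def dg_commutator_def)
    next
      case False
      then show ?thesis
        by (simp add: dg_curvature_def dg_commutator_def B(3,6) bigraded_mapD(3,6) [OF dm] bigraded_mapD(3,6) [OF d'm])
    qed
  qed
  have sgn: "signed (p + q) (mact mm \<alpha> (d \<omega>)) - signed (p + q) (mact mm \<alpha> (h \<omega>)) = signed (p + q) (mact mm \<alpha> (d \<omega> - h \<omega>))"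
    for p q \<alpha> \<omega> and h :: "'b \<Rightarrow> 'b"
    by (simp add: mact_diff signed_diff)
  show ?thesis
  proof (intro equalityI subsetI)
    fix F assume "F \<in> Hom_cohom aa mm `` {dg_curvature mm d}"
    then obtain h where h: "h \<in> dg_Hom aa mm 0 1" and F: "F - dg_curvature mm d = dg_commutator mm 1 h"
      by (auto simp: Hom_cohom_def cohomologous_def)
    \<comment> \<open>Subtracting \<open>h\<close> adds its coboundary to the curvature, because of
      the minus sign in \<open>dg_curvature\<close>.\<close>
    let ?d = "\<lambda>\<omega>. d \<omega> - h \<omega>"
    have hm: "bigraded_map mm 0 1 h" using h by (simp add: dg_Hom_def)
    have dm': "bigraded_map mm 0 1 ?d" by (rule bigraded_map_diff [OF dm hm])
    have "dg_connection aa mm ?d"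
      unfolding dg_connection_def
    proof (intro conjI dm' allI ballI)
      fix p q p' q' \<alpha> \<omega> assume \<alpha>: "\<alpha> \<in> acomp aa p q" and \<omega>: "\<omega> \<in> mcomp mm p' q'"
      have "d (mact mm \<alpha> \<omega>) = mact mm (ad aa \<alpha>) \<omega> + signed (p + q) (mact mm \<alpha> (d \<omega>))"
        using d \<alpha> \<omega> unfolding dg_connection_def by blast
      moreover have "h (mact mm \<alpha> \<omega>) = signed (p + q) (mact mm \<alpha> (h \<omega>))"
        using h \<alpha> \<omega> unfolding dg_Hom_def by fastforce
      ultimately show "?d (mact mm \<alpha> \<omega>) = mact mm (ad aa \<alpha>) \<omega> + signed (p + q) (mact mm \<alpha> (?d \<omega>))"
        using sgn [of p q \<alpha> \<omega> h] by (simp add: algebra_simps)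
    qed
    moreover have "F = dg_curvature mm ?d"
      using curv [OF dm'] F by (simp add: diff_eq_eq)
    ultimately show "F \<in> {dg_curvature mm d' | d'. dg_connection aa mm d'}" by blast
  next
    fix F assume "F \<in> {dg_curvature mm d' | d'. dg_connection aa mm d'}"
    then obtain d' where d': "dg_connection aa mm d'" and F: "F = dg_curvature mm d'" by blast
    have d'm: "bigraded_map mm 0 1 d'" using d' unfolding dg_connection_def by blast
    let ?h = "\<lambda>\<omega>. d \<omega> - d' \<omega>"
    have "?h (mact mm \<alpha> \<omega>) = signed ((0 + 1) * (p + q)) (mact mm \<alpha> (?h \<omega>))"
      if \<alpha>: "\<alpha> \<in> acomp aa p q" and \<omega>: "\<omega> \<in> mcomp mm p' q'" for p q p' q' \<alpha> \<omega>
    proof -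
      have "d (mact mm \<alpha> \<omega>) = mact mm (ad aa \<alpha>) \<omega> + signed (p + q) (mact mm \<alpha> (d \<omega>))"
        "d' (mact mm \<alpha> \<omega>) = mact mm (ad aa \<alpha>) \<omega> + signed (p + q) (mact mm \<alpha> (d' \<omega>))"
        using d d' \<alpha> \<omega> unfolding dg_connection_def by blast+
      then show ?thesis using sgn [of p q \<alpha> \<omega> d'] by simp
    qed
    then have "?h \<in> dg_Hom aa mm 0 1"
      unfolding dg_Hom_def using bigraded_map_diff [OF dm d'm] by blast
    then show "F \<in> Hom_cohom aa mm `` {dg_curvature mm d}"
      using Z [OF d] Z [OF d'] curv [OF d'm] by (simp add: F Hom_cohom_def cohomologous_def)
  qed
qed

lemma dg_atiyah_class_eq:
  assumes "dg_connection aa mm d"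
  shows "dg_atiyah_class aa mm = {dg_curvature mm d' | d'. dg_connection aa mm d'}"
  unfolding dg_atiyah_class_def
  using assms Hom_cohom_dg_curvature by (intro the_equality) blast+

end

section \<open>Smooth functions\<close>

lemma Ck_on_cong:
  assumes "open S" "\<And>x. x \<in> S \<Longrightarrow> f x = g x"
  shows "Ck_on k S f \<longleftrightarrow> Ck_on k S g"
  using assms
proof (induction k arbitrary: f g)
  case 0
  then show ?case by (auto intro: continuous_on_cong [THEN iffD1])
next
  case (Suc k)
  have tr: "(f has_derivative f') (at x) \<longleftrightarrow> (g has_derivative f') (at x)" if "x \<in> S" for x f'
    using has_derivative_transform_within_open [OF _ Suc.prems(1) that] Suc.prems(2) by metis
  then have "frechet_derivative f (at x) = frechet_derivative g (at x)"
    and "f differentiable (at x) \<longleftrightarrow> g differentiable (at x)" if "x \<in> S" for x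
    using that by (simp_all add: frechet_derivative_def differentiable_def)
  then show ?case
    using Suc.IH [OF Suc.prems(1), of "\<lambda>x. frechet_derivative f (at x) v" "\<lambda>x. frechet_derivative g (at x) v" for v]
    by simp
qed

lemma Ck_on_subset: "Ck_on k S f \<Longrightarrow> T \<subseteq> S \<Longrightarrow> Ck_on k T f"
  by (induction k arbitrary: f) (auto intro: continuous_on_subset)

lemma Ck_on_lower: "Ck_on (Suc k) S f \<Longrightarrow> Ck_on k S f"
proof (induction k arbitrary: f)
  case 0
  then show ?case
    by (auto intro!: continuous_at_imp_continuous_on differentiable_imp_continuous_within)
next
  case (Suc k)
  then show ?case unfolding Ck_on.simps(2) [of "Suc k"] Ck_on.simps(2) [of k]  by blast
qed

lemma Ck_on_local:
  assumes "\<And>x. x \<in> S \<Longrightarrow> \<exists>T. open T \<and> x \<in> T \<and> Ck_on k T f"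
  shows "Ck_on k S f"
  using assms
proof (induction k arbitrary: f)
  case 0
  then show ?case
    by (metis Ck_on.simps(1) continuous_at_imp_continuous_on continuous_on_eq_continuous_at)
next
  case (Suc k)
  have "f differentiable (at x)" if "x \<in> S" for x
    using Suc.prems [OF that] by auto
  moreover have "Ck_on k S (\<lambda>x. frechet_derivative f (at x) v)" for v
    using Suc.prems by (intro Suc.IH) fastforce
  ultimately show ?case by simp
qed

lemma Ck_on_const: "Ck_on k S (\<lambda>x. c)"
proof (induction k arbitrary: c)
  case (Suc k)
  then show ?case by (simp add: frechet_derivative_const)
qed simp

lemma Ck_on_add:
  fixes f g :: "'a::real_normed_vector \<Rightarrow> 'b::real_normed_vector"
  assumes "open S" "Ck_on k S f" "Ck_on k S g"
  shows "Ck_on k S (\<lambda>x. f x + g x)"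
  using assms(2,3)
proof (induction k arbitrary: f g)
  case 0
  then show ?case by (auto intro: continuous_on_add)
next
  case (Suc k)
  have "frechet_derivative (\<lambda>x. f x + g x) (at x) w
      = frechet_derivative f (at x) w + frechet_derivative g (at x) w" if "x \<in> S" for x w
  proof -
    have "f differentiable (at x)" "g differentiable (at x)" using Suc.prems that by auto
    then have "((\<lambda>x. f x + g x) has_derivative
        (\<lambda>w. frechet_derivative f (at x) w + frechet_derivative g (at x) w)) (at x)"
      unfolding frechet_derivative_works by (rule has_derivative_add)
    then show ?thesis by (simp add: frechet_derivative_at [symmetric])
  qed
  then have "Ck_on k S (\<lambda>x. frechet_derivative (\<lambda>x. f x + g x) (at x) w)
      \<longleftrightarrow> Ck_on k S (\<lambda>x. frechet_derivative f (at x) w + frechet_derivative g (at x) w)" for w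
    by (intro Ck_on_cong assms(1))
  then show ?case using Suc by (auto intro: differentiable_add)
qed

text \<open>One product rule for multiplication, scalar multiplication and the inner product, all of
  which occur in the bump function.\<close>

lemma Ck_on_bilinear:
  assumes "bounded_bilinear pr" "open S" "Ck_on k S f" "Ck_on k S g"
  shows "Ck_on k S (\<lambda>x. pr (f x) (g x))"
  using assms(3,4)
proof (induction k arbitrary: f g)
  case 0
  then show ?case using bounded_bilinear.continuous_on [OF assms(1)] by auto
next
  case (Suc k)
  have der: "((\<lambda>x. pr (f x) (g x)) has_derivative
      (\<lambda>w. pr (f x) (frechet_derivative g (at x) w) + pr (frechet_derivative f (at x) w) (g x))) (at x)"
    if "x \<in> S" for x
  proof -
    have "f differentiable (at x)" "g differentiable (at x)" using Suc.prems that by auto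
    then show ?thesis
      unfolding frechet_derivative_works by (rule bounded_bilinear.FDERIV [OF assms(1)])
  qed
  have "Ck_on k S (\<lambda>x. pr (f x) (frechet_derivative g (at x) w) + pr (frechet_derivative f (at x) w) (g x))" for w
    using Suc.prems Ck_on_lower [OF Suc.prems(1)] Ck_on_lower [OF Suc.prems(2)]
    by (intro Ck_on_add Suc.IH assms(2)) auto
  moreover have "frechet_derivative (\<lambda>x. pr (f x) (g x)) (at x) w
      = pr (f x) (frechet_derivative g (at x) w) + pr (frechet_derivative f (at x) w) (g x)" if "x \<in> S" for x w
    by (simp add: frechet_derivative_at [OF der [OF that], symmetric])
  ultimately have "Ck_on k S (\<lambda>x. frechet_derivative (\<lambda>x. pr (f x) (g x)) (at x) w)" for w
    by (subst Ck_on_cong [OF assms(2)]) auto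
  then show ?case using der by (auto simp: differentiable_def)
qed

text \<open>The derivatives of \<open>flat_pow 0\<close> are combinations of the functions \<open>flat_pow n\<close>.\<close>

definition flat_pow :: "nat \<Rightarrow> real \<Rightarrow> real" where
  "flat_pow n t = (if 0 < t then exp (- inverse t) * inverse t ^ n else 0)"

text \<open>For t > 0 and s = 1/t the quotient is s^(n+1) / exp s. The limit is the derivative of
  \<open>flat_pow n\<close> at 0, the one point where the differentiation rules do not
  apply.\<close>

lemma flat_pow_tendsto: "((\<lambda>t. flat_pow n t / t) \<longlongrightarrow> 0) (at 0)"
proof -
  have "((\<lambda>t::real. inverse t ^ Suc n / exp (inverse t)) \<longlongrightarrow> 0) (at_right 0)"
    by (rule filterlim_compose [OF tendsto_power_div_exp_0 filterlim_inverse_at_top_right])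
  then have "((\<lambda>t. flat_pow n t / t) \<longlongrightarrow> 0) (at_right 0)"
    by (rule Lim_transform_eventually)
      (auto simp: eventually_at_right_field flat_pow_def exp_minus field_simps intro!: exI [of _ 1])
  moreover have "((\<lambda>t. flat_pow n t / t) \<longlongrightarrow> 0) (at_left 0)"
    by (rule Lim_transform_eventually [OF tendsto_const])
      (auto simp: eventually_at_left_field flat_pow_def intro!: exI [of _ "-1"])
  ultimately show ?thesis by (simp add: filterlim_split_at)
qed

lemma flat_pow_has_derivative:
  "(flat_pow n has_real_derivative flat_pow (n + 2) t - of_nat n * flat_pow (n + 1) t) (at t)"
proof (cases t "0 :: real" rule: linorder_cases)
  case less
  have "((\<lambda>t. 0) has_real_derivative 0) (at t)" by simp
  then have "(flat_pow n has_real_derivative 0) (at t)"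
    by (rule has_field_derivative_transform_within_open [of _ _ _ "{..<0}"]) (use less in \<open>auto simp: flat_pow_def\<close>)
  then show ?thesis using less by (simp add: flat_pow_def)
next
  case equal
  have "(flat_pow n has_real_derivative 0) (at 0)"
    using flat_pow_tendsto [of n] by (simp add: has_field_derivative_iff flat_pow_def)
  then show ?thesis using equal by (simp add: flat_pow_def)
next
  case greater
  define u where "u = inverse t"
  have inv: "(inverse has_real_derivative - (u * u)) (at t)"
    using DERIV_inverse [of t UNIV] greater by (simp add: u_def power2_eq_square)
  have "((\<lambda>t. exp (- inverse t)) has_real_derivative exp (- u) * (u * u)) (at t)"
    using DERIV_fun_exp [OF DERIV_minus [OF inv]] by (simp add: u_def)
  moreover have "((\<lambda>t. inverse t ^ n) has_real_derivative of_nat n * (- (u * u) * u ^ (n - 1))) (at t)"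
    using DERIV_power [OF inv, of n] by (simp add: u_def)
  ultimately have "((\<lambda>t. exp (- inverse t) * inverse t ^ n) has_real_derivative
      exp (- u) * (u * u) * u ^ n + of_nat n * (- (u * u) * u ^ (n - 1)) * exp (- u)) (at t)"
    using DERIV_mult by (force simp: u_def)
  moreover have "exp (- u) * (u * u) * u ^ n + of_nat n * (- (u * u) * u ^ (n - 1)) * exp (- u)
      = flat_pow (n + 2) t - of_nat n * flat_pow (n + 1) t"
    using greater by (cases n) (simp_all add: flat_pow_def u_def [symmetric] algebra_simps)
  ultimately have "((\<lambda>t. exp (- inverse t) * inverse t ^ n) has_real_derivative
      flat_pow (n + 2) t - of_nat n * flat_pow (n + 1) t) (at t)"
    by simp
  then show ?thesis
    by (rule has_field_derivative_transform_within_open [of _ _ _ "{0<..}"]) (use greater in \<open>auto simp: flat_pow_def\<close>)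
qed

text \<open>The induction on \<open>k\<close> has to treat all \<open>n\<close> at once, because the
  derivative of \<open>flat_pow n\<close> involves the indices \<open>n + 1\<close> and
  \<open>n + 2\<close>.\<close>

lemma Ck_on_flat_pow:
  assumes "open S" "Ck_on k S h"
  shows "Ck_on k S (\<lambda>x. flat_pow n (h x))"
  using assms(2)
proof (induction k arbitrary: n)
  case 0
  have "continuous_on UNIV (flat_pow n)"
    using flat_pow_has_derivative [of n]
    by (auto intro!: continuous_at_imp_continuous_on intro: DERIV_isCont)
  then show ?case using 0 by (auto intro: continuous_on_compose2)
next
  case (Suc k)
  let ?g = "\<lambda>x. flat_pow (n + 2) (h x) + - real n * flat_pow (n + 1) (h x)"
  have der: "((\<lambda>x. flat_pow n (h x)) has_derivative (\<lambda>w. ?g x * frechet_derivative h (at x) w)) (at x)"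
    if "x \<in> S" for x
  proof -
    have "(h has_derivative frechet_derivative h (at x)) (at x)"
      using Suc.prems that by (simp flip: frechet_derivative_works)
    moreover have "(flat_pow n has_derivative (\<lambda>w. ?g x * w)) (at (h x))"
      using flat_pow_has_derivative [of n "h x"] by (simp add: has_field_derivative_def)
    ultimately show ?thesis using has_derivative_compose by blast
  qed
  have h: "Ck_on k S h" using Suc.prems Ck_on_lower by blast
  have "Ck_on k S ?g"
    using Suc.IH [OF h] by (intro Ck_on_add Ck_on_bilinear [OF bounded_bilinear_mult] Ck_on_const assms(1))
  then have "Ck_on k S (\<lambda>x. ?g x * frechet_derivative h (at x) w)" for w
    using Suc.prems by (intro Ck_on_bilinear [OF bounded_bilinear_mult] assms(1)) auto
  moreover have "frechet_derivative (\<lambda>x. flat_pow n (h x)) (at x) w = ?g x * frechet_derivative h (at x) w"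
    if "x \<in> S" for x w
    by (simp add: frechet_derivative_at [OF der [OF that], symmetric])
  ultimately have "Ck_on k S (\<lambda>x. frechet_derivative (\<lambda>x. flat_pow n (h x)) (at x) w)" for w
    by (subst Ck_on_cong [OF assms(1)]) auto
  then show ?case using der by (auto simp: differentiable_def)
qed

text \<open>With respect to an orthogonal spanning set, the coefficients of the points of a ball are
  bounded by Cauchy--Schwarz. The ball is thus a closed part of a set of combinations with bounded
  coefficients, which is compact as a finite sum of segments.\<close>

lemma compact_cball_finite_span:
  fixes Bs :: "'a::real_inner set"
  assumes "finite Bs" "span Bs = UNIV"
  shows "compact (cball (x::'a) r)"
proof -
  obtain Cs where Cs: "finite Cs" "span Cs = span Bs" "pairwise orthogonal Cs"
    using basis_orthogonal [OF assms(1)] by auto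
  have cbox: "compact {\<Sum>b\<in>D. c b *\<^sub>R b | c. \<forall>b\<in>D. \<bar>c b\<bar> \<le> K}" if "finite D" for D :: "'a set" and K :: real
    using that
  proof (induction D rule: finite_induct)
    case empty
    have "{\<Sum>b\<in>{}. c b *\<^sub>R b | c. \<forall>b\<in>{}. \<bar>c b\<bar> \<le> K} = {0::'a}" by auto
    then show ?case by (metis compact_sing)
  next
    case (insert d D)
    let ?S = "{\<Sum>b\<in>D. c b *\<^sub>R b | c. \<forall>b\<in>D. \<bar>c b\<bar> \<le> K}"
    have "compact ((\<lambda>t. t *\<^sub>R d) ` {-K..K})"
      by (intro compact_continuous_image continuous_intros) simp
    then have "compact {u + v | u v. u \<in> (\<lambda>t. t *\<^sub>R d) ` {-K..K} \<and> v \<in> ?S}"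
      using insert.IH by (rule compact_sums)
    moreover have "{\<Sum>b\<in>insert d D. c b *\<^sub>R b | c. \<forall>b\<in>insert d D. \<bar>c b\<bar> \<le> K}
       = {u + v | u v. u \<in> (\<lambda>t. t *\<^sub>R d) ` {-K..K} \<and> v \<in> ?S}"
    proof (intro equalityI subsetI)
      fix y assume "y \<in> {\<Sum>b\<in>insert d D. c b *\<^sub>R b | c. \<forall>b\<in>insert d D. \<bar>c b\<bar> \<le> K}"
      then obtain c where "y = c d *\<^sub>R d + (\<Sum>b\<in>D. c b *\<^sub>R b)" "\<forall>b\<in>insert d D. \<bar>c b\<bar> \<le> K"
        using insert.hyps by auto
      then show "y \<in> {u + v | u v. u \<in> (\<lambda>t. t *\<^sub>R d) ` {-K..K} \<and> v \<in> ?S}"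
        by (intro CollectI exI [of _ "c d *\<^sub>R d"] exI [of _ "\<Sum>b\<in>D. c b *\<^sub>R b"]) (auto simp: abs_le_iff)
    next
      fix y assume "y \<in> {u + v | u v. u \<in> (\<lambda>t. t *\<^sub>R d) ` {-K..K} \<and> v \<in> ?S}"
      then obtain t c where y: "y = t *\<^sub>R d + (\<Sum>b\<in>D. c b *\<^sub>R b)" "\<bar>t\<bar> \<le> K" "\<forall>b\<in>D. \<bar>c b\<bar> \<le> K"
        by auto
      have "(\<Sum>b\<in>D. (c(d := t)) b *\<^sub>R b) = (\<Sum>b\<in>D. c b *\<^sub>R b)"
        using insert.hyps by (intro sum.cong) auto
      then show "y \<in> {\<Sum>b\<in>insert d D. c b *\<^sub>R b | c. \<forall>b\<in>insert d D. \<bar>c b\<bar> \<le> K}"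
        using y insert.hyps by (auto intro!: exI [of _ "c(d := t)"])
    qed
    ultimately show ?case by simp
  qed
  have "cball x r \<subseteq> {\<Sum>b\<in>Cs. c b *\<^sub>R b | c. \<forall>b\<in>Cs. \<bar>c b\<bar> \<le> K}" if "\<And>b. b \<in> Cs - {0} \<Longrightarrow> (norm x + r) / norm b \<le> K" "0 \<le> K" for K
  proof
    fix y assume y: "y \<in> cball x r"
    have "y \<in> range (\<lambda>c. \<Sum>b\<in>Cs. c b *\<^sub>R b)"
      using Cs(2) assms(2) span_finite [OF Cs(1)] by simp
    then obtain c where c: "y = (\<Sum>b\<in>Cs. c b *\<^sub>R b)" by blast
    \<comment> \<open>The orthogonal spanning set may contain 0, whose coefficient is not controlled
      by the vector and is therefore set to 0.\<close>
    let ?c = "\<lambda>b. if b = 0 then 0 else c b"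
    have "y = (\<Sum>b\<in>Cs. ?c b *\<^sub>R b)" unfolding c by (intro sum.cong) auto
    moreover have "\<bar>?c b\<bar> \<le> K" if b: "b \<in> Cs" for b
    proof (cases "b = 0")
      case False
      have "inner y b = (\<Sum>b'\<in>Cs. c b' * inner b' b)" by (simp add: c inner_sum_left)
      also have "\<dots> = (\<Sum>b'\<in>{b}. c b' * inner b' b)"
        using Cs b by (intro sum.mono_neutral_right) (auto simp: pairwise_def orthogonal_def)
      finally have "\<bar>c b\<bar> * (norm b * norm b) = \<bar>inner y b\<bar>"
        by (simp add: abs_mult dot_square_norm power2_eq_square)
      also have "\<dots> \<le> norm y * norm b" by (rule Cauchy_Schwarz_ineq2)
      finally have "\<bar>c b\<bar> * norm b \<le> norm y" using False by simp
      also have "\<dots> \<le> norm x + r"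
        using y norm_triangle_ineq2 [of y x] by (simp add: dist_norm norm_minus_commute)
      finally have "\<bar>c b\<bar> \<le> (norm x + r) / norm b" using False by (simp add: field_simps)
      then show ?thesis using False b \<open>\<And>b. b \<in> Cs - {0} \<Longrightarrow> (norm x + r) / norm b \<le> K\<close> [of b] by simp
    qed (use \<open>0 \<le> K\<close> in simp)
    ultimately show "y \<in> {\<Sum>b\<in>Cs. c b *\<^sub>R b | c. \<forall>b\<in>Cs. \<bar>c b\<bar> \<le> K}"
      by (intro CollectI exI [of _ ?c]) auto
  qed
  moreover obtain K where "0 \<le> K" "\<And>b. b \<in> Cs - {0} \<Longrightarrow> (norm x + r) / norm b \<le> K"
  proof
    show "0 \<le> Max (insert 0 ((\<lambda>b. (norm x + r) / norm b) ` (Cs - {0})))"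
      using Cs(1) by simp
    show "(norm x + r) / norm b \<le> Max (insert 0 ((\<lambda>b. (norm x + r) / norm b) ` (Cs - {0})))"
      if "b \<in> Cs - {0}" for b
      using Cs(1) that by (intro Max_ge) auto
  qed
  ultimately have "cball x r = {\<Sum>b\<in>Cs. c b *\<^sub>R b | c. \<forall>b\<in>Cs. \<bar>c b\<bar> \<le> K} \<inter> cball x r" by blast
  moreover have "compact ({\<Sum>b\<in>Cs. c b *\<^sub>R b | c. \<forall>b\<in>Cs. \<bar>c b\<bar> \<le> K} \<inter> cball x r)"
    by (intro compact_Int_closed cbox Cs(1) closed_cball)
  ultimately show ?thesis by simp
qed

section \<open>Smooth functions on a manifold and bump functions\<close>

context
  fixes atl :: "('m::{t2_space, second_countable_topology}, 'a::real_inner) atlas"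
  assumes man: "smooth_manifold atl"
begin

lemma atlas_chart:
  assumes "(V, \<phi>) \<in> atl"
  shows "open V" "open (\<phi> ` V)" "inj_on \<phi> V" "homeomorphism V (\<phi> ` V) \<phi> (inv_into V \<phi>)"
  using man assms unfolding smooth_manifold_def by blast+

lemma atlas_cover: "\<exists>U \<phi>. (U, \<phi>) \<in> atl \<and> x \<in> U"
proof -
  have "x \<in> (\<Union>(U, \<phi>)\<in>atl. U)" using man by (simp add: smooth_manifold_def)
  then show ?thesis by auto
qed

lemma atlas_transition:
  "(U, \<phi>) \<in> atl \<Longrightarrow> (V, \<psi>) \<in> atl \<Longrightarrow> smooth_on (\<phi> ` (U \<inter> V)) (\<psi> \<circ> inv_into U \<phi>)"
  using man unfolding smooth_manifold_def by blast

lemma open_chart_image: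
  assumes "(V, \<phi>) \<in> atl" "open U"
  shows "open (\<phi> ` (U \<inter> V))"
proof -
  have "openin (top_of_set V) (U \<inter> V)"
    using assms(2) by (auto simp: openin_open)
  then have "openin (top_of_set (\<phi> ` V)) (\<phi> ` (U \<inter> V))"
    using atlas_chart(4) [OF assms(1)] by (rule homeomorphism_imp_open_map [rotated])
  then show ?thesis using atlas_chart(2) [OF assms(1)] openin_open_trans by blast
qed

lemma smooth_fun_on_iff:
  "smooth_fun_on atl U f \<longleftrightarrow> (\<forall>V \<phi> k. (V, \<phi>) \<in> atl \<longrightarrow> Ck_on k (\<phi> ` (U \<inter> V)) (f \<circ> inv_into V \<phi>))"
  by (auto simp: smooth_fun_on_def smooth_on_def)

lemma smooth_fun_on_cong:
  assumes "open U" "\<And>x. x \<in> U \<Longrightarrow> f x = g x"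
  shows "smooth_fun_on atl U f \<longleftrightarrow> smooth_fun_on atl U g"
proof -
  have "Ck_on k (\<phi> ` (U \<inter> V)) (f \<circ> inv_into V \<phi>) \<longleftrightarrow> Ck_on k (\<phi> ` (U \<inter> V)) (g \<circ> inv_into V \<phi>)"
    if "(V, \<phi>) \<in> atl" for V \<phi> k
  proof (rule Ck_on_cong [OF open_chart_image [OF that assms(1)]])
    fix y assume "y \<in> \<phi> ` (U \<inter> V)"
    then show "(f \<circ> inv_into V \<phi>) y = (g \<circ> inv_into V \<phi>) y"
      using assms(2) atlas_chart(3) [OF that] by (auto simp: inv_into_f_f)
  qed
  then show ?thesis unfolding smooth_fun_on_iff by blast
qed

lemma smooth_fun_on_subset: "smooth_fun_on atl U f \<Longrightarrow> W \<subseteq> U \<Longrightarrow> smooth_fun_on atl W f"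
  unfolding smooth_fun_on_iff by (meson Ck_on_subset Int_mono image_mono subset_refl)

lemma smooth_fun_on_local:
  assumes "\<And>x. x \<in> U \<Longrightarrow> \<exists>W. open W \<and> x \<in> W \<and> smooth_fun_on atl W f"
  shows "smooth_fun_on atl U f"
  unfolding smooth_fun_on_iff
proof (intro allI impI Ck_on_local)
  fix V \<phi> k y assume V: "(V, \<phi>) \<in> atl" and "y \<in> \<phi> ` (U \<inter> V)"
  then obtain x where x: "x \<in> U" "x \<in> V" "y = \<phi> x" by blast
  then obtain W where W: "open W" "x \<in> W" "smooth_fun_on atl W f" using assms by blast
  then show "\<exists>T. open T \<and> y \<in> T \<and> Ck_on k T (f \<circ> inv_into V \<phi>)"
    using x V open_chart_image [OF V W(1)] unfolding smooth_fun_on_iff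
    by (intro exI [of _ "\<phi> ` (W \<inter> V)"]) auto
qed

lemma smooth_fun_on_const: "smooth_fun_on atl U (\<lambda>x. c)"
  unfolding smooth_fun_on_iff by (simp add: o_def Ck_on_const)

lemma smooth_fun_on_add:
  "open U \<Longrightarrow> smooth_fun_on atl U f \<Longrightarrow> smooth_fun_on atl U g \<Longrightarrow> smooth_fun_on atl U (\<lambda>x. f x + g x)"
  unfolding smooth_fun_on_iff o_def by (auto intro!: Ck_on_add open_chart_image)

lemma smooth_fun_on_mult:
  fixes f g :: "'m \<Rightarrow> 'k::real_normed_field"
  shows "open U \<Longrightarrow> smooth_fun_on atl U f \<Longrightarrow> smooth_fun_on atl U g \<Longrightarrow> smooth_fun_on atl U (\<lambda>x. f x * g x)"
  unfolding smooth_fun_on_iff o_def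
  by (auto intro!: Ck_on_bilinear [OF bounded_bilinear_mult] open_chart_image)

text \<open>Smoothness is local: the function is a product on \<open>W \<inter> V\<close> and zero
  on the complement of \<open>K\<close>, and these two open sets cover \<open>W\<close>.\<close>

lemma smooth_fun_on_extend_zero:
  fixes \<kappa> c :: "'m \<Rightarrow> 'k::real_normed_field"
  assumes "open V" "open W" "closed K" "K \<subseteq> V" "\<And>y. y \<notin> K \<Longrightarrow> \<kappa> y = 0"
    and "smooth_fun_on atl UNIV \<kappa>" "smooth_fun_on atl (W \<inter> V) c"
  shows "smooth_fun_on atl W (\<lambda>y. if y \<in> V then \<kappa> y * c y else 0)"
proof (rule smooth_fun_on_local)
  fix x assume x: "x \<in> W"
  show "\<exists>T. open T \<and> x \<in> T \<and> smooth_fun_on atl T (\<lambda>y. if y \<in> V then \<kappa> y * c y else 0)"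
  proof (cases "x \<in> V")
    case True
    have o: "open (W \<inter> V)" using assms by auto
    have "smooth_fun_on atl (W \<inter> V) (\<lambda>y. \<kappa> y * c y)"
      using assms o by (intro smooth_fun_on_mult) (auto intro: smooth_fun_on_subset)
    then have "smooth_fun_on atl (W \<inter> V) (\<lambda>y. if y \<in> V then \<kappa> y * c y else 0)"
      by (subst smooth_fun_on_cong [OF o]) auto
    then show ?thesis using x True o by blast
  next
    case False
    have o: "open (- K)" using assms by auto
    have "smooth_fun_on atl (- K) (\<lambda>y. if y \<in> V then \<kappa> y * c y else 0)"
      using assms(5) by (subst smooth_fun_on_cong [OF o, of _ "\<lambda>y. 0"]) (auto simp: smooth_fun_on_const)
    then show ?thesis using False o assms(4) by blast
  qed
qed

text \<open>In a chart, \<open>flat_pow 0\<close> is applied to e^2 - |\<phi> y - \<phi> x|^2 and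
  normalised to 1 at the centre; outside the chart domain the function is 0.\<close>

lemma exists_bump:
  assumes "open W" "x \<in> W"
  obtains \<kappa> :: "'m \<Rightarrow> 'k::real_normed_field" and K
  where "smooth_fun_on atl UNIV \<kappa>" "\<kappa> x = 1" "closed K" "K \<subseteq> W" "\<And>y. y \<notin> K \<Longrightarrow> \<kappa> y = 0"
proof -
  obtain Bs where Bs: "finite Bs" "span Bs = (UNIV :: 'a set)"
    using man by (auto simp: smooth_manifold_def)
  obtain U \<phi> where U: "(U, \<phi>) \<in> atl" and x: "x \<in> U" using atlas_cover by blast
  obtain e where e: "0 < e" "cball (\<phi> x) e \<subseteq> \<phi> ` (W \<inter> U)"
    using open_contains_cball [THEN iffD1, OF open_chart_image [OF U assms(1)]] assms(2) x by blast
  define K where "K = inv_into U \<phi> ` cball (\<phi> x) e"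
  \<comment> \<open>Differences are spelled as sums with multiples so that the closure rules for
    sums and bilinear products apply.\<close>
  define h where "h y = e\<^sup>2 + - 1 * ((\<phi> y + - \<phi> x) \<bullet> (\<phi> y + - \<phi> x))" for y
  define \<kappa> :: "'m \<Rightarrow> 'k" where
    "\<kappa> y = (if y \<in> U then (flat_pow 0 (h y) * inverse (flat_pow 0 (e\<^sup>2))) *\<^sub>R 1 else 0)" for y
  have "continuous_on (cball (\<phi> x) e) (inv_into U \<phi>)"
    using atlas_chart(4) [OF U] e(2) by (auto simp: homeomorphism_def intro: continuous_on_subset)
  \<comment> \<open>As a compact subset of a Hausdorff space, \<open>K\<close> is closed in the
    whole manifold and not merely in the chart domain; the extension by zero is smooth for this
    reason.\<close>
  then have "closed K"
    unfolding K_def by (intro compact_imp_closed compact_continuous_image compact_cball_finite_span [OF Bs])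
  have K: "y \<in> K \<longleftrightarrow> y \<in> U \<and> \<phi> y \<in> cball (\<phi> x) e" for y
  proof
    assume "y \<in> K"
    then obtain z where z: "z \<in> cball (\<phi> x) e" "y = inv_into U \<phi> z" by (auto simp: K_def)
    moreover obtain u where "u \<in> U" "z = \<phi> u" using z(1) e(2) by blast
    ultimately show "y \<in> U \<and> \<phi> y \<in> cball (\<phi> x) e" using atlas_chart(3) [OF U] by (simp add: inv_into_f_f)
  next
    assume "y \<in> U \<and> \<phi> y \<in> cball (\<phi> x) e"
    then show "y \<in> K" using atlas_chart(3) [OF U] unfolding K_def by (metis image_eqI inv_into_f_f)
  qed
  have "K \<subseteq> W"
  proof
    fix y assume "y \<in> K"
    then have "y \<in> U" "\<phi> y \<in> \<phi> ` (W \<inter> U)" using K e(2) by auto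
    then show "y \<in> W" using atlas_chart(3) [OF U] by (auto simp: inj_on_def)
  qed
  have zero: "\<kappa> y = 0" if "y \<notin> K" for y
  proof (cases "y \<in> U")
    case True
    then have "e < norm (\<phi> y - \<phi> x)" using that K by (simp add: dist_norm norm_minus_commute)
    then have "e\<^sup>2 \<le> (norm (\<phi> y - \<phi> x))\<^sup>2" using e(1) by (intro power_mono) auto
    then have "h y \<le> 0" by (simp add: h_def power2_norm_eq_inner)
    then show ?thesis by (simp add: \<kappa>_def flat_pow_def)
  qed (simp add: \<kappa>_def)
  have "\<kappa> x = 1" using x e(1) by (simp add: \<kappa>_def h_def flat_pow_def)
  have smU: "smooth_fun_on atl U \<kappa>"
    unfolding smooth_fun_on_iff
  proof (intro allI impI)
    fix V \<psi> k assume V: "(V, \<psi>) \<in> atl"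
    let ?S = "\<psi> ` (U \<inter> V)" and ?T = "\<lambda>y. \<phi> (inv_into V \<psi> y)"
    have o: "open ?S" using open_chart_image [OF V atlas_chart(1) [OF U]] .
    have T: "Ck_on k ?S ?T"
      using atlas_transition [OF V U] by (simp add: smooth_on_def o_def Int_commute)
    have "Ck_on k ?S (\<lambda>y. (flat_pow 0 (h (inv_into V \<psi> y)) * inverse (flat_pow 0 (e\<^sup>2))) *\<^sub>R (1 :: 'k))"
      unfolding h_def
      by (intro Ck_on_bilinear [OF bounded_bilinear_scaleR] Ck_on_bilinear [OF bounded_bilinear_mult]
          Ck_on_bilinear [OF bounded_bilinear_inner] Ck_on_flat_pow Ck_on_add Ck_on_const T o)
    moreover have "(\<kappa> \<circ> inv_into V \<psi>) y = (flat_pow 0 (h (inv_into V \<psi> y)) * inverse (flat_pow 0 (e\<^sup>2))) *\<^sub>R (1 :: 'k)"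
      if "y \<in> ?S" for y
      using that atlas_chart(3) [OF V] by (auto simp: \<kappa>_def inv_into_f_f)
    ultimately show "Ck_on k ?S (\<kappa> \<circ> inv_into V \<psi>)"
      by (subst Ck_on_cong [OF o]) auto
  qed
  have "smooth_fun_on atl UNIV \<kappa>"
  proof (rule smooth_fun_on_local)
    fix y
    show "\<exists>T. open T \<and> y \<in> T \<and> smooth_fun_on atl T \<kappa>"
    proof (cases "y \<in> U")
      case True
      then show ?thesis using smU atlas_chart(1) [OF U] by blast
    next
      case False
      have o: "open (- K)" using \<open>closed K\<close> by auto
      have "smooth_fun_on atl (- K) \<kappa>"
        using zero by (subst smooth_fun_on_cong [OF o, of _ "\<lambda>y. 0"]) (auto simp: smooth_fun_on_const)
      then show ?thesis using False K o by blast
    qed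
  qed
  then show thesis using that \<open>\<kappa> x = 1\<close> \<open>closed K\<close> \<open>K \<subseteq> W\<close> zero by blast
qed

end

section \<open>Forms of degree zero, and coefficients of module-valued forms\<close>

lemma form0_simps [simp]: "form0 w [] = w" "form0 w (x # xs) = 0"
  by (simp_all add: form0_def)

lemma contract_form0 [simp]: "contract x (form0 w) = 0"
  by (auto simp: fun_eq_iff contract_apply form0_def)

lemma gsign_form0 [simp]: "gsign (form0 w) = form0 w"
  by (auto simp: fun_eq_iff gsign_apply form0_def)

context lie_rinehart_conn_split
begin

lemma frm_form0:
  assumes "w \<in> Y" shows "frm (form0 w)"
proof -
  have "frm_upto n (form0 w)" for n
  proof (cases n)
    case (Suc k)
    have "frm_upto k (contract x (form0 w))" for x :: 'x
      unfolding contract_form0 by (rule frm_upto_zero)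
    then show ?thesis using Suc assms by (simp add: form0_def del: contract_form0)
  qed (simp add: form0_def assms)
  then show ?thesis by (simp add: frm_def)
qed

lemma comp_form0: "w \<in> Y \<Longrightarrow> form0 w \<in> comp 0 0"
proof -
  assume w: "w \<in> Y"
  have "bp 0 0 (form0 w) xs = form0 w xs" for xs :: "'x list"
    by (cases xs) (simp_all add: bip_arith)
  then show ?thesis
    unfolding comp_iff on_lists_iff
    using frm_form0 [OF w] by (auto simp: hom_def) (auto simp: form0_def split: if_splits)
qed

lemma wdg_form0_left: "wdg (form0 f) \<omega> = (\<lambda>xs. sY f (\<omega> xs))"
proof -
  have "wdg (form0 f) \<omega> xs = sY f (\<omega> xs)" for xs
  proof (induction xs arbitrary: \<omega>)
    case (Cons x xs)
    have "wdg (form0 f) \<omega> (x # xs) = wdg (form0 f) (contract x \<omega>) xs"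
      by (simp add: wdg_arith)
    also have "\<dots> = sY f (contract x \<omega> xs)" by (rule Cons.IH)
    finally show "wdg (form0 f) \<omega> (x # xs) = sY f (\<omega> (x # xs))" by (simp only: contract_apply)
  qed (simp add: form0_def)
  then show ?thesis by auto
qed

lemma wdg_form0_right: "wdg \<alpha> (form0 w) = (\<lambda>xs. sY (\<alpha> xs) w)"
proof -
  have "wdg \<alpha> (form0 w) xs = sY (\<alpha> xs) w" for xs
  proof (induction xs arbitrary: \<alpha>)
    case (Cons x xs)
    have "wdg \<alpha> (form0 w) (x # xs) = wdg (contract x \<alpha>) (form0 w) xs"
      by (simp add: wdg_arith)
    also have "\<dots> = sY (contract x \<alpha> xs) w" by (rule Cons.IH)
    finally show "wdg \<alpha> (form0 w) (x # xs) = sY (\<alpha> (x # xs)) w" by (simp only: contract_apply)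
  qed (simp add: form0_def)
  then show ?thesis by auto
qed

text \<open>Used with a coordinate function of a frame as \<open>\<Lambda>\<close>, to obtain the
  scalar coefficient forms of a module-valued form.\<close>

lemma comp_compose:
  assumes "\<omega> \<in> comp p q" "\<And>v. v \<in> Y \<Longrightarrow> \<Lambda> v \<in> C"
    and add: "\<And>v w. v \<in> Y \<Longrightarrow> w \<in> Y \<Longrightarrow> \<Lambda> (v + w) = \<Lambda> v + \<Lambda> w"
    and scale: "\<And>f v. f \<in> C \<Longrightarrow> v \<in> Y \<Longrightarrow> \<Lambda> (sY f v) = f * \<Lambda> v"
  shows "(\<lambda>xs. \<Lambda> (\<omega> xs)) \<in> S.comp p q"
proof -
  have z: "\<Lambda> 0 = 0" using add [OF Y_zero Y_zero] by simp
  have f: "\<omega> \<in> forms C X sX Y sY" using assms(1) by (simp add: comp_def bideg_def)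
  note frm = forms_frm [OF f]
  have "(\<lambda>xs. \<Lambda> (\<omega> xs)) = on_lists X (\<lambda>xs. \<Lambda> (\<omega> xs))"
    using compD(2) [OF assms(1)] z unfolding on_lists_iff by simp
  moreover have "xs[i := u] \<in> {ys. set ys \<subseteq> X}" if "set xs \<subseteq> X" "u \<in> X" for xs i u
    using that set_update_subset_insert [of xs i u] by auto
  ultimately have "(\<lambda>xs. \<Lambda> (\<omega> xs)) \<in> forms C X sX C (*)"
    unfolding forms_def
    using frm assms(2-) z
    by (simp add: frm_Y frm_list_update_add frm_list_update_scale frm_not_distinct)
  then show ?thesis
    using assms(1) z unfolding S.comp_def comp_def bideg_def by fastforce
qed

end

section \<open>Sections of vector bundles\<close>

context
  fixes atl :: "('m::{t2_space, second_countable_topology}, 'a::real_inner) atlas"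
  assumes man: "smooth_manifold atl"
begin

lemma smooth_funs_closed:
  "1 \<in> (smooth_funs atl :: ('m \<Rightarrow> 'k::real_normed_field) set)"
  "f \<in> smooth_funs atl \<Longrightarrow> g \<in> smooth_funs atl \<Longrightarrow> f + g \<in> (smooth_funs atl :: ('m \<Rightarrow> 'k) set)"
  "f \<in> smooth_funs atl \<Longrightarrow> g \<in> smooth_funs atl \<Longrightarrow> f * g \<in> (smooth_funs atl :: ('m \<Rightarrow> 'k) set)"
  "f \<in> smooth_funs atl \<Longrightarrow> - f \<in> (smooth_funs atl :: ('m \<Rightarrow> 'k) set)"
  "(\<lambda>x. c) \<in> (smooth_funs atl :: ('m \<Rightarrow> 'k) set)"
proof -
  show c: "(\<lambda>x. c) \<in> (smooth_funs atl :: ('m \<Rightarrow> 'k) set)" for c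
    by (simp add: smooth_funs_def smooth_fun_on_const [OF man])
  show "1 \<in> (smooth_funs atl :: ('m \<Rightarrow> 'k) set)"
    using c [of 1] by (simp add: one_fun_def)
  show "f \<in> smooth_funs atl \<Longrightarrow> g \<in> smooth_funs atl \<Longrightarrow> f + g \<in> (smooth_funs atl :: ('m \<Rightarrow> 'k) set)"
    using smooth_fun_on_add [OF man, of UNIV f g] by (simp add: smooth_funs_def plus_fun_def)
  show m: "f \<in> smooth_funs atl \<Longrightarrow> g \<in> smooth_funs atl \<Longrightarrow> f * g \<in> (smooth_funs atl :: ('m \<Rightarrow> 'k) set)" for f g
    using smooth_fun_on_mult [OF man, of UNIV f g] by (simp add: smooth_funs_def times_fun_def)
  have "- f = (\<lambda>x. - 1) * f" by (auto simp: fun_eq_iff)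
  then show "f \<in> smooth_funs atl \<Longrightarrow> - f \<in> (smooth_funs atl :: ('m \<Rightarrow> 'k) set)"
    using m [OF c [of "- 1"]] by simp
qed

context
  fixes E :: "('m, 'k::real_normed_field, 'v::ab_group_add, 'z) vbundle_scheme"
  assumes vb: "vector_bundle atl E"
begin

lemma vs: "vector_space (scl E)"
  using vb by (simp add: vector_bundle_def)

interpretation V: vector_space "scl E" by (rule vs)

lemma module_smul: "module (smul E)"
  by unfold_locales (auto simp: smul_def fun_eq_iff V.scale_right_distrib V.scale_left_distrib)

lemma fib_closed:
  "0 \<in> fib E x" "v \<in> fib E x \<Longrightarrow> w \<in> fib E x \<Longrightarrow> v + w \<in> fib E x" "v \<in> fib E x \<Longrightarrow> scl E c v \<in> fib E x"
proof -
  have "module.subspace (scl E) (fib E x)" using vb by (simp add: vector_bundle_def)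
  then show "0 \<in> fib E x" "v \<in> fib E x \<Longrightarrow> w \<in> fib E x \<Longrightarrow> v + w \<in> fib E x" "v \<in> fib E x \<Longrightarrow> scl E c v \<in> fib E x"
    by (auto intro: V.subspace_0 V.subspace_add V.subspace_scale)
qed

lemma frame:
  assumes "(V, es) \<in> frames E"
  shows "open V" "y \<in> V \<Longrightarrow> basis_at (scl E) es y (fib E y)" "e \<in> set es \<Longrightarrow> smooth_section_on atl E V e"
  using vb assms unfolding vector_bundle_def by blast+

lemma frame_cover: "\<exists>V es. (V, es) \<in> frames E \<and> x \<in> V"
proof -
  have "x \<in> (\<Union>(V, es)\<in>frames E. V)" using vb by (simp add: vector_bundle_def)
  then show ?thesis by auto
qed

lemma secs_fib: "s \<in> secs atl E \<Longrightarrow> s x \<in> fib E x"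
  by (simp add: secs_def smooth_section_on_def)

lemma secs_coefficients:
  assumes "s \<in> secs atl E" "(V, es) \<in> frames E"
  obtains c where "\<And>i. i < length es \<Longrightarrow> smooth_fun_on atl V (c i)"
    "\<And>x. x \<in> V \<Longrightarrow> s x = (\<Sum>i<length es. scl E (c i x) ((es ! i) x))"
  using assms unfolding secs_def smooth_section_on_def by force

lemma secsI:
  assumes "\<And>x. s x \<in> fib E x"
    and "\<And>V es. (V, es) \<in> frames E \<Longrightarrow> \<exists>c. (\<forall>i<length es. smooth_fun_on atl V (c i)) \<and>
        (\<forall>x\<in>V. s x = (\<Sum>i<length es. scl E (c i x) ((es ! i) x)))"
  shows "s \<in> secs atl E"
  using assms unfolding secs_def smooth_section_on_def by auto

lemma secs_add:
  assumes "s \<in> secs atl E" "t \<in> secs atl E"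
  shows "s + t \<in> secs atl E"
proof (rule secsI)
  show "(s + t) x \<in> fib E x" for x using assms by (simp add: fib_closed secs_fib)
  fix V es assume V: "(V, es) \<in> frames E"
  obtain c where c: "\<And>i. i < length es \<Longrightarrow> smooth_fun_on atl V (c i)"
    "\<And>x. x \<in> V \<Longrightarrow> s x = (\<Sum>i<length es. scl E (c i x) ((es ! i) x))"
    by (rule secs_coefficients [OF assms(1) V]) blast
  obtain d where d: "\<And>i. i < length es \<Longrightarrow> smooth_fun_on atl V (d i)"
    "\<And>x. x \<in> V \<Longrightarrow> t x = (\<Sum>i<length es. scl E (d i x) ((es ! i) x))"
    by (rule secs_coefficients [OF assms(2) V]) blast
  show "\<exists>c. (\<forall>i<length es. smooth_fun_on atl V (c i)) \<and>
        (\<forall>x\<in>V. (s + t) x = (\<Sum>i<length es. scl E (c i x) ((es ! i) x)))"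
    using c d frame(1) [OF V]
    by (intro exI [of _ "\<lambda>i x. c i x + d i x"])
      (auto simp: V.scale_left_distrib sum.distrib intro: smooth_fun_on_add [OF man])
qed

lemma secs_smul:
  assumes "f \<in> smooth_funs atl" "s \<in> secs atl E"
  shows "smul E f s \<in> secs atl E"
proof (rule secsI)
  show "smul E f s x \<in> fib E x" for x using assms by (simp add: smul_def fib_closed secs_fib)
  fix V es assume V: "(V, es) \<in> frames E"
  obtain c where c: "\<And>i. i < length es \<Longrightarrow> smooth_fun_on atl V (c i)"
    "\<And>x. x \<in> V \<Longrightarrow> s x = (\<Sum>i<length es. scl E (c i x) ((es ! i) x))"
    by (rule secs_coefficients [OF assms(2) V]) blast
  have "smooth_fun_on atl V f"
    using assms(1) by (auto simp: smooth_funs_def intro: smooth_fun_on_subset [OF man])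
  then show "\<exists>c. (\<forall>i<length es. smooth_fun_on atl V (c i)) \<and>
        (\<forall>x\<in>V. smul E f s x = (\<Sum>i<length es. scl E (c i x) ((es ! i) x)))"
    using c frame(1) [OF V]
    by (intro exI [of _ "\<lambda>i x. f x * c i x"])
      (auto simp: smul_def V.scale_sum_right intro: smooth_fun_on_mult [OF man])
qed

lemma secs_zero: "0 \<in> secs atl E"
  by (rule secsI) (auto simp: fib_closed intro!: exI [of _ "\<lambda>i x. 0"] smooth_fun_on_const [OF man])

text \<open>A frame is a list, whereas independence concerns the set of its values; distinctness of
  the values lets the coefficients be reindexed by vectors.\<close>

lemma frame_coefficients_unique:
  assumes V: "(V, es) \<in> frames E" "y \<in> V"
    and eq: "(\<Sum>i<length es. scl E (c i) ((es ! i) y)) = (\<Sum>i<length es. scl E (d i) ((es ! i) y))"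
    and i: "i < length es"
  shows "c i = d i"
proof -
  define b where "b = map (\<lambda>e. e y) es"
  have b: "distinct b" "V.independent (set b)" "length b = length es"
    using frame(2) [OF V] by (simp_all add: basis_at_def b_def)
  define idx where "idx = inv_into {..<length es} ((!) b)"
  have bij: "bij_betw ((!) b) {..<length es} (set b)"
    using bij_betw_nth [OF b(1) refl refl] b(3) by simp
  have idx: "idx (b ! k) = k" if "k < length es" for k
    unfolding idx_def using bij that by (simp add: bij_betw_def inv_into_f_f)
  have "(\<Sum>v\<in>set b. scl E (c (idx v) - d (idx v)) v) = (\<Sum>k<length es. scl E (c (idx (b ! k)) - d (idx (b ! k))) (b ! k))"
    by (rule sum.reindex_bij_betw [OF bij, symmetric])
  also have "\<dots> = (\<Sum>k<length es. scl E (c k - d k) ((es ! k) y))"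
    by (intro sum.cong) (auto simp: idx, simp add: b_def)
  also have "\<dots> = 0" using eq by (simp add: V.scale_left_diff_distrib sum_subtractf)
  finally have "c (idx (b ! i)) - d (idx (b ! i)) = 0"
    using V.independentD [OF b(2) _ subset_refl, of "\<lambda>v. c (idx v) - d (idx v)" "b ! i"] i b(3) by simp
  then show ?thesis using idx [OF i] by simp
qed

text \<open>A local frame and its coordinate functions become global after multiplication with the
  bump function. Each of the two carries one factor \<open>\<kappa>\<close>, hence the square. Off
  the frame domain both sides of the decomposition vanish.\<close>

lemma cutoff_frame:
  obtains n :: nat and \<kappa> :: "'m \<Rightarrow> 'k" and \<Lambda> :: "nat \<Rightarrow> ('m \<Rightarrow> 'v) \<Rightarrow> 'm \<Rightarrow> 'k" and e :: "nat \<Rightarrow> 'm \<Rightarrow> 'v"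
  where "\<kappa> \<in> smooth_funs atl" "\<kappa> x = 1" "\<And>i. i < n \<Longrightarrow> e i \<in> secs atl E"
    and "\<And>i s. i < n \<Longrightarrow> s \<in> secs atl E \<Longrightarrow> \<Lambda> i s \<in> smooth_funs atl"
    and "\<And>i s t. i < n \<Longrightarrow> s \<in> secs atl E \<Longrightarrow> t \<in> secs atl E \<Longrightarrow> \<Lambda> i (s + t) = \<Lambda> i s + \<Lambda> i t"
    and "\<And>i f s. i < n \<Longrightarrow> f \<in> smooth_funs atl \<Longrightarrow> s \<in> secs atl E \<Longrightarrow> \<Lambda> i (smul E f s) = f * \<Lambda> i s"
    and "\<And>s. s \<in> secs atl E \<Longrightarrow> smul E (\<kappa> * \<kappa>) s = (\<Sum>i<n. smul E (\<Lambda> i s) (e i))"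
proof -
  obtain V es where V: "(V, es) \<in> frames E" and x: "x \<in> V" using frame_cover by blast
  obtain \<kappa> :: "'m \<Rightarrow> 'k" and K where \<kappa>: "smooth_fun_on atl UNIV \<kappa>" "\<kappa> x = 1"
    and K: "closed K" "K \<subseteq> V" "\<And>y. y \<notin> K \<Longrightarrow> \<kappa> y = 0"
    by (rule exists_bump [OF man frame(1) [OF V] x]) blast
  define n where "n = length es"
  define e where "e i y = (if y \<in> V then scl E (\<kappa> y) ((es ! i) y) else 0)" for i y
  \<comment> \<open>Coefficients are chosen pointwise; by uniqueness they agree with any given
    family, and so inherit its smoothness and linearity.\<close>
  define coef where "coef y v = (SOME c. v = (\<Sum>i<n. scl E (c i) ((es ! i) y)))" for y v
  define \<Lambda> where "\<Lambda> i s y = (if y \<in> V then \<kappa> y * coef y (s y) i else 0)" for i s and y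
  have coef: "coef y (s y) i = c i y"
    if "y \<in> V" "s y = (\<Sum>i<n. scl E (c i y) ((es ! i) y))" "i < n" for y s c i
  proof -
    have "s y = (\<Sum>i<n. scl E (coef y (s y) i) ((es ! i) y))"
      unfolding coef_def by (rule someI [of _ "\<lambda>i. c i y"]) (rule that(2))
    then show ?thesis
      using frame_coefficients_unique [OF V that(1), of "coef y (s y)" "\<lambda>i. c i y" i] that by (simp add: n_def)
  qed
  show thesis
  proof (rule that [of \<kappa> n e \<Lambda>])
    show "\<kappa> \<in> smooth_funs atl" "\<kappa> x = 1" using \<kappa> by (simp_all add: smooth_funs_def)
    show "e i \<in> secs atl E" if i: "i < n" for i
    proof (rule secsI)
      have sec: "smooth_section_on atl E V (es ! i)" using frame(3) [OF V] i by (simp add: n_def)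
      then show "e i y \<in> fib E y" for y by (auto simp: e_def smooth_section_on_def fib_closed)
      fix W fs assume W: "(W, fs) \<in> frames E"
      \<comment> \<open>The coefficients with respect to another frame are smooth only on the
        overlap; the factor \<open>\<kappa>\<close> lets them extend by zero to all of
        \<open>W\<close>.\<close>
      have "\<exists>c. (\<forall>k<length fs. smooth_fun_on atl (V \<inter> W) (c k)) \<and>
          (\<forall>y\<in>V \<inter> W. (es ! i) y = (\<Sum>k<length fs. scl E (c k y) ((fs ! k) y)))"
        using sec W unfolding smooth_section_on_def by blast
      then obtain c where c: "\<And>k. k < length fs \<Longrightarrow> smooth_fun_on atl (W \<inter> V) (c k)"
        "\<And>y. y \<in> V \<Longrightarrow> y \<in> W \<Longrightarrow> (es ! i) y = (\<Sum>k<length fs. scl E (c k y) ((fs ! k) y))"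
        by (auto simp: Int_commute)
      show "\<exists>c. (\<forall>k<length fs. smooth_fun_on atl W (c k)) \<and>
        (\<forall>y\<in>W. e i y = (\<Sum>k<length fs. scl E (c k y) ((fs ! k) y)))"
      proof (intro exI conjI allI impI ballI)
        show "smooth_fun_on atl W (\<lambda>y. if y \<in> V then \<kappa> y * c k y else 0)" if "k < length fs" for k
          by (rule smooth_fun_on_extend_zero [OF man frame(1) [OF V] frame(1) [OF W] K(1,2,3) \<kappa>(1) c(1) [OF that]])
        show "e i y = (\<Sum>k<length fs. scl E (if y \<in> V then \<kappa> y * c k y else 0) ((fs ! k) y))" if "y \<in> W" for y
          using c(2) that by (auto simp: e_def V.scale_sum_right)
      qed
    qed
    show "\<Lambda> i s \<in> smooth_funs atl" if i: "i < n" and s: "s \<in> secs atl E" for i s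
    proof -
      obtain c where c: "\<And>i. i < length es \<Longrightarrow> smooth_fun_on atl V (c i)"
        "\<And>x. x \<in> V \<Longrightarrow> s x = (\<Sum>i<length es. scl E (c i x) ((es ! i) x))"
        by (rule secs_coefficients [OF s V]) blast
      have "\<Lambda> i s = (\<lambda>y. if y \<in> V then \<kappa> y * c i y else 0)"
        using coef [of _ s c i] c(2) i by (auto simp: \<Lambda>_def fun_eq_iff n_def)
      moreover have "smooth_fun_on atl UNIV (\<lambda>y. if y \<in> V then \<kappa> y * c i y else 0)"
        using smooth_fun_on_extend_zero [OF man frame(1) [OF V] open_UNIV K(1,2,3) \<kappa>(1), of "c i"] c(1) i
        by (simp add: n_def)
      ultimately show ?thesis by (simp add: smooth_funs_def)
    qed
    show "\<Lambda> i (s + t) = \<Lambda> i s + \<Lambda> i t" if i: "i < n" and s: "s \<in> secs atl E" and t: "t \<in> secs atl E" for i s t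
    proof -
      obtain c where c: "\<And>x. x \<in> V \<Longrightarrow> s x = (\<Sum>i<length es. scl E (c i x) ((es ! i) x))"
        by (rule secs_coefficients [OF s V]) blast
      obtain d where d: "\<And>x. x \<in> V \<Longrightarrow> t x = (\<Sum>i<length es. scl E (d i x) ((es ! i) x))"
        by (rule secs_coefficients [OF t V]) blast
      have "coef y ((s + t) y) i = c i y + d i y" if "y \<in> V" for y
        using coef [of y "s + t" "\<lambda>i y. c i y + d i y" i] c d i that
        by (simp add: n_def V.scale_left_distrib sum.distrib)
      then show ?thesis
        using coef [of _ s c i] coef [of _ t d i] c d i
        by (auto simp: \<Lambda>_def fun_eq_iff n_def distrib_left)
    qed
    show "\<Lambda> i (smul E f s) = f * \<Lambda> i s" if i: "i < n" and f: "f \<in> smooth_funs atl" and s: "s \<in> secs atl E" for i f s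
    proof -
      obtain c where c: "\<And>x. x \<in> V \<Longrightarrow> s x = (\<Sum>i<length es. scl E (c i x) ((es ! i) x))"
        by (rule secs_coefficients [OF s V]) blast
      have "coef y (smul E f s y) i = f y * c i y" if "y \<in> V" for y
        using coef [of y "smul E f s" "\<lambda>i y. f y * c i y" i] c i that
        by (simp add: n_def smul_def V.scale_sum_right)
      then show ?thesis
        using coef [of _ s c i] c i by (auto simp: \<Lambda>_def fun_eq_iff n_def)
    qed
    show "smul E (\<kappa> * \<kappa>) s = (\<Sum>i<n. smul E (\<Lambda> i s) (e i))" if s: "s \<in> secs atl E" for s
    proof
      fix y
      show "smul E (\<kappa> * \<kappa>) s y = (\<Sum>i<n. smul E (\<Lambda> i s) (e i)) y"
      proof (cases "y \<in> V")
        case True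
        obtain c where c: "\<And>x. x \<in> V \<Longrightarrow> s x = (\<Sum>i<length es. scl E (c i x) ((es ! i) x))"
          by (rule secs_coefficients [OF s V]) blast
        have "smul E (\<kappa> * \<kappa>) s y = (\<Sum>i<n. scl E (\<kappa> y * \<kappa> y * c i y) ((es ! i) y))"
          using True c by (simp add: smul_def V.scale_sum_right n_def)
        also have "\<dots> = (\<Sum>i<n. smul E (\<Lambda> i s) (e i) y)"
          using True coef [of y s c] c [OF True]
          by (intro sum.cong) (auto simp: smul_def \<Lambda>_def e_def n_def mult_ac)
        finally show ?thesis by (simp add: sum_fun_apply)
      next
        case False
        then have "\<kappa> y = 0" using K by blast
        then show ?thesis using False by (simp add: smul_def sum_fun_apply e_def)
      qed
    qed
  qed
qed

end

end

section \<open>The Lie pair\<close>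

lemma bundle_mapD:
  assumes "bundle_map atl E F h" "v \<in> fib E x"
  shows "h x v \<in> fib F x" "w \<in> fib E x \<Longrightarrow> h x (v + w) = h x v + h x w" "h x (scl E c v) = scl F c (h x v)"
  using assms unfolding bundle_map_def by blast+

lemma bundle_map_secs: "bundle_map atl E F h \<Longrightarrow> s \<in> secs atl E \<Longrightarrow> app h s \<in> secs atl F"
  unfolding bundle_map_def secs_def app_def by auto

lemma app_linear:
  assumes "smooth_manifold atl" "vector_bundle atl E" "bundle_map atl E F h" "s \<in> secs atl E"
  shows "t \<in> secs atl E \<Longrightarrow> app h (s + t) = app h s + app h t"
    and "app h (smul E f s) = smul F f (app h s)"
  using bundle_mapD [OF assms(3)] secs_fib [OF assms(1,2,4)] secs_fib [OF assms(1,2)]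
  by (auto simp: app_def smul_def fun_eq_iff)

locale lie_pair_split =
  fixes atl :: "('m::{t2_space, second_countable_topology}, 'a::real_inner) atlas"
    and L :: "('m, 'k::real_normed_field, 'l::ab_group_add) lie_algebroid"
    and A :: "'m \<Rightarrow> 'l set"
    and Q :: "('m, 'k, 'q::ab_group_add) vbundle"
    and q :: "'m \<Rightarrow> 'l \<Rightarrow> 'q"
    and j :: "'m \<Rightarrow> 'q \<Rightarrow> 'l"
  assumes man: "smooth_manifold atl"
    and lie_pair: "lie_pair atl L A"
    and quotient: "quotient_bundle atl L A Q q"
    and split: "splitting atl L Q q j"
begin

lemma la: "is_lie_algebroid atl L"
  using lie_pair by (simp add: lie_pair_def)

lemma vbL: "vector_bundle atl L" and vbQ: "vector_bundle atl Q"
  using la quotient by (simp_all add: is_lie_algebroid_def quotient_bundle_def)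

lemma bmq: "bundle_map atl L Q q" and bmj: "bundle_map atl Q L j"
  using quotient split by (simp_all add: quotient_bundle_def splitting_def)

lemmas fibL = fib_closed [OF man vbL] and fibQ = fib_closed [OF man vbQ]
  and secsL = secs_fib [OF man vbL] and secsQ = secs_fib [OF man vbQ]

lemma bracketD:
  assumes "l \<in> secs atl L" "l' \<in> secs atl L"
  shows "bracket L l l' \<in> secs atl L" "bracket L l l' = - bracket L l' l"
    and "l'' \<in> secs atl L \<Longrightarrow> bracket L l (l' + l'') = bracket L l l' + bracket L l l''"
    and "l'' \<in> secs atl L \<Longrightarrow> bracket L l (bracket L l' l'') + bracket L l' (bracket L l'' l)
      + bracket L l'' (bracket L l l') = 0"
    and "f \<in> smooth_funs atl \<Longrightarrow> bracket L l (smul L f l') = smul L f (bracket L l l') + smul L (der L l f) l'"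
    and "f \<in> smooth_funs atl \<Longrightarrow> der L (bracket L l l') f = der L l (der L l' f) - der L l' (der L l f)"
  using la assms unfolding is_lie_algebroid_def by blast+

lemma anchorD:
  assumes "v \<in> fib L x" "f \<in> smooth_funs atl"
  shows "w \<in> fib L x \<Longrightarrow> anchor L x (v + w) f = anchor L x v f + anchor L x w f"
    and "anchor L x (scl L c v) f = c * anchor L x v f"
    and "g \<in> smooth_funs atl \<Longrightarrow> anchor L x v (f + g) = anchor L x v f + anchor L x v g"
    and "g \<in> smooth_funs atl \<Longrightarrow> anchor L x v (f * g) = anchor L x v f * g x + f x * anchor L x v g"
proof -
  have 1: "\<forall>x. \<forall>v\<in>fib L x. \<forall>f\<in>smooth_funs atl.
        (\<forall>w\<in>fib L x. anchor L x (v + w) f = anchor L x v f + anchor L x w f) \<and>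
        (\<forall>c. anchor L x (scl L c v) f = c * anchor L x v f)"
    using la unfolding is_lie_algebroid_def by blast
  show "w \<in> fib L x \<Longrightarrow> anchor L x (v + w) f = anchor L x v f + anchor L x w f"
    "anchor L x (scl L c v) f = c * anchor L x v f"
    using 1 assms by blast+
  have 2: "tangent_vector atl x (anchor L x v)"
    using la assms unfolding is_lie_algebroid_def by blast
  show "g \<in> smooth_funs atl \<Longrightarrow> anchor L x v (f + g) = anchor L x v f + anchor L x v g"
    "g \<in> smooth_funs atl \<Longrightarrow> anchor L x v (f * g) = anchor L x v f * g x + f x * anchor L x v g"
    using 2 assms unfolding tangent_vector_def by blast+
qed

lemma q_zero: "q x 0 = 0" and j_zero: "j x 0 = 0"
  using bundle_mapD(2) [OF bmq fibL(1) fibL(1), of x] bundle_mapD(2) [OF bmj fibQ(1) fibQ(1), of x] by simp_all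

lemma qj: "w \<in> fib Q x \<Longrightarrow> q x (j x w) = w"
  using split by (simp add: splitting_def)

lemma app_qj: "w \<in> secs atl Q \<Longrightarrow> app q (app j w) = w"
  using secsQ qj by (simp add: app_def)

lemma mem_A_iff: "v \<in> A x \<longleftrightarrow> v \<in> fib L x \<and> q x v = 0"
  using quotient by (auto simp: quotient_bundle_def)

lemma secs_in_A_iff: "l \<in> secs_in atl L A \<longleftrightarrow> l \<in> secs atl L \<and> app q l = 0"
  using secsL by (auto simp: secs_in_def mem_A_iff app_def fun_eq_iff)

lemmas app_q_secs = bundle_map_secs [OF bmq] and app_j_secs = bundle_map_secs [OF bmj]

lemmas app_q_linear = app_linear [OF man vbL bmq] and app_j_linear = app_linear [OF man vbQ bmj]

lemma app_q_diff: "s \<in> secs atl L \<Longrightarrow> t \<in> secs atl L \<Longrightarrow> app q (s - t) = app q s - app q t"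
  using app_q_linear(1) [of "s - t" t] secs_add [OF man vbL, of s "- t"] secs_smul [OF man vbL, of "- 1" t]
    smooth_funs_closed(1,4) [OF man, where 'k = 'k] module.scale_minus_left [OF module_smul [OF man vbL]]
    module.scale_one [OF module_smul [OF man vbL]]
  by simp

lemma projB_secs: "l \<in> secs atl L \<Longrightarrow> projB q j l \<in> secs atl L"
  by (simp add: projB_def app_q_secs app_j_secs)

lemma app_q_projB: "l \<in> secs atl L \<Longrightarrow> app q (projB q j l) = app q l"
  by (simp add: projB_def app_qj app_q_secs)

lemma app_j_0: "app j 0 = 0" and app_q_0: "app q 0 = 0"
  by (auto simp: app_def fun_eq_iff q_zero j_zero)

lemma projB_eq_0_iff: "l \<in> secs atl L \<Longrightarrow> projB q j l = 0 \<longleftrightarrow> app q l = 0"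
  using app_q_projB [of l] by (auto simp: app_q_0) (simp add: projB_def app_j_0)

lemma lie_rinehart_secs: "lie_rinehart (smul L) (smooth_funs atl) (secs atl L) (bracket L) (der L)"
proof (unfold lie_rinehart_def, intro conjI module_smul [OF man vbL], unfold_locales)
  fix f g :: "'m \<Rightarrow> 'k" and x y z
  show "(1 :: 'm \<Rightarrow> 'k) \<in> smooth_funs atl" by (rule smooth_funs_closed(1) [OF man])
  show "0 \<in> secs atl L" by (rule secs_zero [OF man vbL])
  show "f \<in> smooth_funs atl \<Longrightarrow> g \<in> smooth_funs atl \<Longrightarrow> f + g \<in> smooth_funs atl"
    "f \<in> smooth_funs atl \<Longrightarrow> - f \<in> smooth_funs atl"
    "f \<in> smooth_funs atl \<Longrightarrow> g \<in> smooth_funs atl \<Longrightarrow> f * g \<in> smooth_funs atl"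
    by (rule smooth_funs_closed [OF man]; assumption)+
  show "x \<in> secs atl L \<Longrightarrow> y \<in> secs atl L \<Longrightarrow> x + y \<in> secs atl L" by (rule secs_add [OF man vbL])
  show "f \<in> smooth_funs atl \<Longrightarrow> x \<in> secs atl L \<Longrightarrow> smul L f x \<in> secs atl L" by (rule secs_smul [OF man vbL])
  show "x \<in> secs atl L \<Longrightarrow> y \<in> secs atl L \<Longrightarrow> bracket L x y \<in> secs atl L" by (rule bracketD)
  show "x \<in> secs atl L \<Longrightarrow> y \<in> secs atl L \<Longrightarrow> bracket L x y = - bracket L y x" by (rule bracketD)
  show "bracket L x x = 0" if "x \<in> secs atl L"
  proof
    fix p
    interpret V: vector_space "scl L" by (rule vs [OF man vbL])
    have "bracket L x x p = - bracket L x x p"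
      using bracketD(2) [OF that that] by (metis uminus_apply)
    \<comment> \<open>Skewness gives only twice the bracket; the scalars form a field in which 2 is
      invertible.\<close>
    then have "scl L 2 (bracket L x x p) = 0"
      using V.scale_left_distrib [of 1 1 "bracket L x x p"] by (simp add: eq_neg_iff_add_eq_0)
    then show "bracket L x x p = 0 p" by simp
  qed
  show "x \<in> secs atl L \<Longrightarrow> y \<in> secs atl L \<Longrightarrow> z \<in> secs atl L \<Longrightarrow>
      bracket L x (y + z) = bracket L x y + bracket L x z" by (rule bracketD)
  show "f \<in> smooth_funs atl \<Longrightarrow> x \<in> secs atl L \<Longrightarrow> y \<in> secs atl L \<Longrightarrow>
      bracket L x (smul L f y) = smul L f (bracket L x y) + smul L (der L x f) y" by (rule bracketD)
  show "x \<in> secs atl L \<Longrightarrow> y \<in> secs atl L \<Longrightarrow> z \<in> secs atl L \<Longrightarrow>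
      bracket L x (bracket L y z) + bracket L y (bracket L z x) + bracket L z (bracket L x y) = 0" by (rule bracketD)
  show "x \<in> secs atl L \<Longrightarrow> f \<in> smooth_funs atl \<Longrightarrow> der L x f \<in> smooth_funs atl"
    using la unfolding is_lie_algebroid_def by blast
  show "x \<in> secs atl L \<Longrightarrow> y \<in> secs atl L \<Longrightarrow> f \<in> smooth_funs atl \<Longrightarrow> der L (x + y) f = der L x f + der L y f"
    using secsL by (simp add: der_def fun_eq_iff anchorD)
  show "x \<in> secs atl L \<Longrightarrow> f \<in> smooth_funs atl \<Longrightarrow> g \<in> smooth_funs atl \<Longrightarrow> der L (smul L f x) g = f * der L x g"
    using secsL by (simp add: der_def fun_eq_iff anchorD smul_def)
  show "x \<in> secs atl L \<Longrightarrow> f \<in> smooth_funs atl \<Longrightarrow> g \<in> smooth_funs atl \<Longrightarrow> der L x (f + g) = der L x f + der L x g"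
    using secsL by (simp add: der_def fun_eq_iff anchorD)
  show "x \<in> secs atl L \<Longrightarrow> f \<in> smooth_funs atl \<Longrightarrow> g \<in> smooth_funs atl \<Longrightarrow> der L x (f * g) = f * der L x g + der L x f * g"
    using secsL by (simp add: der_def fun_eq_iff anchorD)
  show "x \<in> secs atl L \<Longrightarrow> y \<in> secs atl L \<Longrightarrow> f \<in> smooth_funs atl \<Longrightarrow>
      der L (bracket L x y) f = der L x (der L y f) - der L y (der L x f)" by (rule bracketD)
qed

end

sublocale lie_pair_split \<subseteq> G: lie_rinehart_split "smul L" "smooth_funs atl" "secs atl L" "bracket L" "der L" "projA q j" "projB q j"
proof (unfold lie_rinehart_split_def, intro conjI lie_rinehart_secs, unfold_locales)
  fix x y f
  show "x \<in> secs atl L \<Longrightarrow> projB q j x \<in> secs atl L" by (rule projB_secs)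
  show "projA q j x = x - projB q j x" by (rule projA_def)
  show "x \<in> secs atl L \<Longrightarrow> y \<in> secs atl L \<Longrightarrow> projB q j (x + y) = projB q j x + projB q j y"
    by (simp add: projB_def app_q_linear app_j_linear app_q_secs)
  show "x \<in> secs atl L \<Longrightarrow> f \<in> smooth_funs atl \<Longrightarrow> projB q j (smul L f x) = smul L f (projB q j x)"
    by (simp add: projB_def app_q_linear app_j_linear app_q_secs)
  show "x \<in> secs atl L \<Longrightarrow> projB q j (projB q j x) = projB q j x"
    using app_q_projB [of x] by (simp add: projB_def)
  show "projB q j (bracket L x y) = 0"
    if "x \<in> secs atl L" "y \<in> secs atl L" "projB q j x = 0" "projB q j y = 0"
  proof -
    have "x \<in> secs_in atl L A" "y \<in> secs_in atl L A" using that by (auto simp: secs_in_A_iff projB_eq_0_iff)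
    then have "bracket L x y \<in> secs_in atl L A" using lie_pair by (simp add: lie_pair_def)
    then show ?thesis by (simp add: secs_in_A_iff projB_eq_0_iff)
  qed
qed

context lie_pair_split
begin

lemma XA_eq: "secs_in atl L A = G.XA"
  by (auto simp: G.XA_def secs_in_A_iff projB_eq_0_iff)

lemma XB_eq: "secs_in atl L (compl Q j) = G.XB"
proof (intro equalityI subsetI)
  fix l assume "l \<in> G.XB"
  then have l: "l \<in> secs atl L" "projB q j l = l" by (auto simp: G.XB_def)
  have "l x \<in> compl Q j x" for x
    using fun_cong [OF l(2), of x] secsQ [OF app_q_secs [OF l(1)], of x]
    unfolding projB_def compl_def app_def [of j] by (metis image_eqI)
  then show "l \<in> secs_in atl L (compl Q j)" using l by (simp add: secs_in_def)
next
  fix l assume l: "l \<in> secs_in atl L (compl Q j)"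
  have "j x (q x (l x)) = l x" for x
  proof -
    obtain w where "w \<in> fib Q x" "l x = j x w" using l by (auto simp: secs_in_def compl_def)
    then show ?thesis by (simp add: qj)
  qed
  then show "l \<in> G.XB" using l by (auto simp: G.XB_def secs_in_def projB_def app_def)
qed

lemma lp_alg_eq:
  "lp_alg atl L A Q q j = \<lparr>acomp = G.S.comp, amult = wedge (*), adbar = G.S.dpart 1 0, ad = G.S.dpart 0 1\<rparr>"
proof -
  have "lp_comp atl L A Q j (smooth_funs atl) (*) = G.S.comp"
    by (intro ext) (simp add: lp_comp_def G.S.comp_def XA_eq XB_eq)
  then show ?thesis
    by (simp add: lp_alg_def Let_def G.S.dpart_def)
qed

end

section \<open>The DG-module of an A-module with an extending connection\<close>

locale lie_pair_mod = lie_pair_split atl L A Q q j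
  for atl :: "('m::{t2_space, second_countable_topology}, 'a::real_inner) atlas"
    and L :: "('m, 'k::real_normed_field, 'l::ab_group_add) lie_algebroid"
    and A :: "'m \<Rightarrow> 'l set"
    and Q :: "('m, 'k, 'q::ab_group_add) vbundle"
    and q :: "'m \<Rightarrow> 'l \<Rightarrow> 'q"
    and j :: "'m \<Rightarrow> 'q \<Rightarrow> 'l" +
  fixes E :: "('m, 'k, 'e::ab_group_add) vbundle"
    and act nabla :: "('m \<Rightarrow> 'l) \<Rightarrow> ('m \<Rightarrow> 'e) \<Rightarrow> 'm \<Rightarrow> 'e"
  assumes module: "lie_module atl L A E act"
    and extending: "extending_connection atl L A E act nabla"
begin

lemma vbE: "vector_bundle atl E"
  using module by (simp add: lie_module_def)

lemma nablaD:
  assumes "l \<in> secs atl L" "e \<in> secs atl E"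
  shows "nabla l e \<in> secs atl E"
    and "l' \<in> secs atl L \<Longrightarrow> nabla (l + l') e = nabla l e + nabla l' e"
    and "e' \<in> secs atl E \<Longrightarrow> nabla l (e + e') = nabla l e + nabla l e'"
    and "f \<in> smooth_funs atl \<Longrightarrow> nabla (smul L f l) e = smul E f (nabla l e)"
    and "f \<in> smooth_funs atl \<Longrightarrow> nabla l (smul E f e) = smul E f (nabla l e) + smul E (der L l f) e"
  using extending assms unfolding extending_connection_def lie_connection_def by blast+

end

sublocale lie_pair_mod \<subseteq> M: lie_rinehart_conn_split "smul L" "smooth_funs atl" "secs atl L" "bracket L" "der L"
    "projA q j" "projB q j" "smul E" "secs atl E" nabla
proof (intro lie_rinehart_conn_split.intro lie_rinehart_conn.intro G.lie_rinehart_split_axioms G.lie_rinehart_axioms module_smul [OF man vbE], unfold_locales)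
  show "0 \<in> secs atl E" by (rule secs_zero [OF man vbE])
qed (auto intro: secs_add [OF man vbE] secs_smul [OF man vbE] nablaD)

context lie_pair_mod
begin

abbreviation "aa \<equiv> lp_alg atl L A Q q j"

abbreviation "mm \<equiv> lp_mod atl L A Q q j E nabla"

lemma lp_comp_eq: "lp_comp atl L A Q j (secs atl E) (smul E) = M.comp"
  by (intro ext) (simp add: lp_comp_def M.comp_def XA_eq XB_eq)

lemma lp_d_eq: "lp_d atl L A Q q j E nabla = M.dpart"
  by (intro ext) (simp add: lp_d_def lp_comp_eq M.dpart_def)

lemma lp_mod_eq: "mm = \<lparr>mcomp = M.comp, mact = M.wdg, mdbar = M.dpart 1 0\<rparr>"
  by (simp add: lp_mod_def lp_comp_eq lp_d_eq)

lemma aa_simps [simp]: "acomp aa = G.S.comp" "adbar aa = G.S.dpart 1 0" "ad aa = G.S.dpart 0 1"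
  by (simp_all add: lp_alg_eq)

lemma mm_simps [simp]: "mcomp mm = M.comp" "mact mm = M.wdg" "mdbar mm = M.dpart 1 0"
  by (simp_all add: lp_mod_eq)

lemma dpart_bigraded_map: "r + s = 1 \<Longrightarrow> bigraded_map mm r s (M.dpart r s)"
  unfolding bigraded_map_def
  using M.dpart_comp M.dpart_add by (auto simp: M.dpart_def on_homog_def fun_eq_iff)

end

sublocale lie_pair_mod \<subseteq> dg: dg_pair aa mm
proof (unfold_locales, simp_all only: aa_simps mm_simps)
  show "bigraded_map mm 1 0 (M.dpart 1 0)" by (rule dpart_bigraded_map) simp
  show "G.S.dpart 0 1 (G.S.dpart 1 0 \<alpha>) + G.S.dpart 1 0 (G.S.dpart 0 1 \<alpha>) = 0" if "\<alpha> \<in> G.S.comp p q" for \<alpha> p q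
    using G.dpart_dpart_scalar(1) [OF that] by (simp add: add.commute)
  show "G.S.dpart 1 0 \<alpha> \<in> G.S.comp (Suc p) q" "G.S.dpart 0 1 \<alpha> \<in> G.S.comp p (Suc q)"
    if "\<alpha> \<in> G.S.comp p q" for \<alpha> p q
    using G.S.dpart_comp [OF that, of 1 0] G.S.dpart_comp [OF that, of 0 1] by simp_all
qed (auto intro: M.comp_add M.comp_uminus M.comp_zero M.comp_wdg M.wdg_arith M.dpart_wdg)

context lie_pair_mod
begin

lemma dpart_dg_connection: "dg_connection aa mm (M.dpart 0 1)"
  unfolding dg_connection_def using dpart_bigraded_map [of 0 1] M.dpart_wdg [of _ _ _ _ _ _ 0 1] by auto

lemma dg_Hom_sum:
  assumes "bigraded_map mm r s F" "finite I" "\<And>i. i \<in> I \<Longrightarrow> \<omega> i \<in> M.comp p u"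
  shows "(\<Sum>i\<in>I. \<omega> i) \<in> M.comp p u \<and> F (\<Sum>i\<in>I. \<omega> i) = (\<Sum>i\<in>I. F (\<omega> i))"
  using assms(2,3)
proof (induction I rule: finite_induct)
  case empty
  then show ?case using dg.bigraded_mapD(3) [OF assms(1)] by (simp add: M.comp_zero del: zero_fun_apply)
next
  case (insert i I)
  then show "(\<Sum>i\<in>insert i I. \<omega> i) \<in> M.comp p u \<and> F (\<Sum>i\<in>insert i I. \<omega> i) = (\<Sum>i\<in>insert i I. F (\<omega> i))"
    using dg.bigraded_mapD(2) [OF assms(1), of "\<omega> i" p u "\<Sum>i\<in>I. \<omega> i"] by (simp add: M.comp_add)
qed

text \<open>The module is generated by \<open>\<Gamma>(E)\<close> up to multiplication with bump functions.\<close>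

lemma dg_Hom_eqI:
  assumes F: "F \<in> dg_Hom aa mm r s" and G: "G \<in> dg_Hom aa mm r s"
    and eq: "\<And>e. e \<in> secs atl E \<Longrightarrow> F (form0 e) = G (form0 e)"
  shows "F = G"
proof
  fix \<omega>
  have m: "bigraded_map mm r s F" "bigraded_map mm r s G" using F G by (simp_all add: dg_Hom_def)
  show "F \<omega> = G \<omega>"
  proof (cases "\<omega> \<in> homog (mcomp mm)")
    case False
    then show ?thesis using dg.bigraded_mapD(6) m by simp
  next
    case True
    then obtain p u where \<omega>: "\<omega> \<in> M.comp p u" by (auto simp: homog_def)
    show ?thesis
    proof (intro ext)
      fix xs x
      obtain n :: nat and \<kappa> \<Lambda> e where \<kappa>: "\<kappa> \<in> smooth_funs atl" "\<kappa> x = 1"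
        and e: "\<And>i. i < n \<Longrightarrow> e i \<in> secs atl E"
        and \<Lambda>: "\<And>i s. i < n \<Longrightarrow> s \<in> secs atl E \<Longrightarrow> \<Lambda> i s \<in> smooth_funs atl"
        "\<And>i s t. i < n \<Longrightarrow> s \<in> secs atl E \<Longrightarrow> t \<in> secs atl E \<Longrightarrow> \<Lambda> i (s + t) = \<Lambda> i s + \<Lambda> i t"
        "\<And>i f s. i < n \<Longrightarrow> f \<in> smooth_funs atl \<Longrightarrow> s \<in> secs atl E \<Longrightarrow> \<Lambda> i (smul E f s) = f * \<Lambda> i s"
        and dec: "\<And>s. s \<in> secs atl E \<Longrightarrow> smul E (\<kappa> * \<kappa>) s = (\<Sum>i<n. smul E (\<Lambda> i s) (e i))"
        by (rule cutoff_frame [OF man vbE, of x]) (rule that)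
      define \<alpha> where "\<alpha> i = (\<lambda>xs. \<Lambda> i (\<omega> xs))" for i
      have \<alpha>: "\<alpha> i \<in> G.S.comp p u" if "i < n" for i
        unfolding \<alpha>_def by (rule M.comp_compose [OF \<omega>]; rule \<Lambda> [OF that]; assumption)
      have \<kappa>2: "form0 (\<kappa> * \<kappa>) \<in> G.S.comp 0 0"
        by (intro G.S.comp_form0 smooth_funs_closed [OF man] \<kappa>)
      have "M.wdg (form0 (\<kappa> * \<kappa>)) \<omega> ys = (\<Sum>i<n. M.wdg (\<alpha> i) (form0 (e i))) ys" for ys
      proof (cases "set ys \<subseteq> secs atl L")
        case True
        then have "\<omega> ys \<in> secs atl E" using M.compD(4) [OF \<omega>] by (intro M.valsD)
        then show ?thesis by (simp add: M.wdg_form0_left M.wdg_form0_right sum_fun_apply \<alpha>_def dec)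
      next
        case False
        have "\<Lambda> i 0 = 0" if "i < n" for i using \<Lambda>(2) [OF that M.Y_zero M.Y_zero] by simp
        moreover have "\<omega> ys = 0" using False M.compD(2) [OF \<omega>] unfolding on_lists_iff by blast
        ultimately show ?thesis
          by (simp add: M.wdg_form0_left M.wdg_form0_right sum_fun_apply \<alpha>_def)
      qed
      then have \<omega>2: "M.wdg (form0 (\<kappa> * \<kappa>)) \<omega> = (\<Sum>i<n. M.wdg (\<alpha> i) (form0 (e i)))" by blast
      \<comment> \<open>\<open>form0 (\<kappa> * \<kappa>)\<close> has degree 0 and passes through
        \<open>H\<close> without a sign, so \<open>H \<omega>\<close>, multiplied by the square of
        \<open>\<kappa>\<close>, depends only on the values of \<open>H\<close> on the sections
        \<open>e i\<close>.\<close>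
      have H: "smul E (\<kappa> * \<kappa>) (H \<omega> xs)
          = (\<Sum>i<n. signed ((r + s) * (p + u)) (M.wdg (\<alpha> i) (H (form0 (e i))))) xs"
        if H: "H \<in> dg_Hom aa mm r s" for H
      proof -
        have lin: "H (M.wdg \<beta> \<eta>) = signed ((r + s) * (a + b)) (M.wdg \<beta> (H \<eta>))"
          if "\<beta> \<in> G.S.comp a b" "\<eta> \<in> M.comp c d" for \<beta> \<eta> a b c d
          using H that unfolding dg_Hom_def by simp
        have "M.wdg (form0 (\<kappa> * \<kappa>)) (H \<omega>) = H (M.wdg (form0 (\<kappa> * \<kappa>)) \<omega>)"
          using lin [OF \<kappa>2 \<omega>] by simp
        also have "\<dots> = (\<Sum>i<n. H (M.wdg (\<alpha> i) (form0 (e i))))"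
          unfolding \<omega>2
        proof (rule dg_Hom_sum [THEN conjunct2])
          show "bigraded_map mm r s H" using H by (simp add: dg_Hom_def)
          show "M.wdg (\<alpha> i) (form0 (e i)) \<in> M.comp p u" if "i \<in> {..<n}" for i
            using M.comp_wdg [OF \<alpha> M.comp_form0 [OF e], of i i] that by simp
        qed simp
        also have "\<dots> = (\<Sum>i<n. signed ((r + s) * (p + u)) (M.wdg (\<alpha> i) (H (form0 (e i)))))"
          by (intro sum.cong refl lin [OF \<alpha> M.comp_form0 [OF e]]) auto
        finally show ?thesis by (metis M.wdg_form0_left)
      qed
      have "smul E (\<kappa> * \<kappa>) (F \<omega> xs) = smul E (\<kappa> * \<kappa>) (G \<omega> xs)"
        unfolding H [OF F] H [OF G] using eq e by simp
      \<comment> \<open>Since \<open>\<kappa> x = 1\<close>, evaluation at the point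
        \<open>x\<close> removes the cut-off.\<close>
      then have "smul E (\<kappa> * \<kappa>) (F \<omega> xs) x = smul E (\<kappa> * \<kappa>) (G \<omega> xs) x" by simp
      then show "F \<omega> xs x = G \<omega> xs x"
        by (simp add: smul_def \<kappa>(2) vector_space.vector_space_assms(4) [OF vs [OF man vbE]])
    qed
  qed
qed

end

section \<open>The curvature as the square of the covariant differential\<close>

context lie_rinehart_conn
begin

lemma cartan_d_cartan_d_form0:
  "d (d (form0 w)) [x, y] = act x (act y w) - act y (act x w) - act (br x y) w"
  by (simp add: algebra_simps)

text \<open>\<open>Lie x\<close> involves the action only along \<open>x\<close> itself. This is
  applied to two connections that agree along A.\<close>

lemma lie_der_act_cong:
  assumes "set xs \<subseteq> X" "x \<in> X" "vals \<omega>" "\<And>w. w \<in> Y \<Longrightarrow> act' x w = act x w"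
  shows "lie_der br act' x \<omega> xs = Lie x \<omega> xs"
  using assms(1-3)
proof (induction xs arbitrary: \<omega>)
  case (Cons y ys)
  have "lie_der br act' x (contract y \<omega>) ys = Lie x (contract y \<omega>) ys"
    using Cons.prems by (intro Cons.IH vals_contract) auto
  then show ?case by simp
qed (simp add: assms(4) valsD)

end

lemma length_delete_at: "i < length xs \<Longrightarrow> length (delete_at i xs) = length xs - 1"
  by (simp add: delete_at_def)

text \<open>The complex of A with values in Hom(L/A \<otimes> E, E) matters only in degrees 0 to 2,
  where the defining sum is evaluated directly; this disposes of all other list lengths.\<close>

lemma ce_diff_eq_0:
  assumes "\<And>ys. length ys \<noteq> n \<Longrightarrow> \<phi> ys = 0" "\<And>x. x \<in> X \<Longrightarrow> act x 0 = 0" "length xs \<noteq> Suc n"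
  shows "ce_diff X br act \<phi> xs = 0"
proof -
  have "(\<Sum>i<length xs. signed i (act (xs ! i) (\<phi> (delete_at i xs)))) = 0" if "set xs \<subseteq> X"
  proof (intro sum.neutral ballI)
    fix i assume i: "i \<in> {..<length xs}"
    then have "\<phi> (delete_at i xs) = 0"
      using assms(3) by (intro assms(1)) (auto simp: length_delete_at)
    moreover have "xs ! i \<in> X" using i that by auto
    ultimately show "signed i (act (xs ! i) (\<phi> (delete_at i xs))) = 0" using assms(2) by simp
  qed
  moreover have "(\<Sum>(i, k) | i < k \<and> k < length xs.
      signed (i + k) (\<phi> (br (xs ! i) (xs ! k) # delete_at i (delete_at k xs)))) = 0"
  proof (intro sum.neutral ballI)
    fix p assume "p \<in> {(i, k). i < k \<and> k < length xs}"
    then obtain i k where p: "p = (i, k)" "i < k" "k < length xs" by blast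
    then have "\<phi> (br (xs ! i) (xs ! k) # delete_at i (delete_at k xs)) = 0"
      using assms(3) by (intro assms(1)) (auto simp: length_delete_at)
    then show "(case p of (i, k) \<Rightarrow> signed (i + k) (\<phi> (br (xs ! i) (xs ! k) # delete_at i (delete_at k xs)))) = 0"
      using p by simp
  qed
  ultimately show ?thesis by (simp add: ce_diff_def on_lists_def)
qed

lemma ce_diff_1: "x \<in> X \<Longrightarrow> ce_diff X br act \<phi> [x] = act x (\<phi> [])"
  by (auto simp: ce_diff_def on_lists_def delete_at_def intro!: sum.neutral)

lemma ce_diff_2:
  "x \<in> X \<Longrightarrow> y \<in> X \<Longrightarrow> ce_diff X br act \<phi> [x, y] = act x (\<phi> [y]) - act y (\<phi> [x]) - \<phi> [br x y]"
proof -
  have "{(i :: nat, k). i < k \<and> k < Suc (Suc 0)} = {(0, 1)}" by auto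
  then show "x \<in> X \<Longrightarrow> y \<in> X \<Longrightarrow> ce_diff X br act \<phi> [x, y] = act x (\<phi> [y]) - act y (\<phi> [x]) - \<phi> [br x y]"
    by (simp add: ce_diff_def on_lists_def delete_at_def lessThan_Suc)
qed

context lie_pair_mod
begin

abbreviation K :: "('m \<Rightarrow> 'l) \<Rightarrow> ('m \<Rightarrow> 'l) \<Rightarrow> ('m \<Rightarrow> 'e) \<Rightarrow> 'm \<Rightarrow> 'e" where
  "K \<equiv> conn_curv L nabla"

text \<open>The curvature packaged as a form: skewness and linearity of \<open>K\<close> in its
  first two arguments then follow from \<open>frm_dd\<close> without computation.\<close>

definition dd :: "('m \<Rightarrow> 'e) \<Rightarrow> ('m \<Rightarrow> 'l) list \<Rightarrow> 'm \<Rightarrow> 'e" where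
  "dd e = cartan_d (bracket L) nabla (cartan_d (bracket L) nabla (form0 e))"

lemma dd_pair: "dd e [x, y] = K x y e"
  unfolding dd_def M.cartan_d_cartan_d_form0 by (simp add: conn_curv_def)

lemma frm_dd: "e \<in> secs atl E \<Longrightarrow> M.frm (dd e)"
  unfolding dd_def by (intro M.frm_cartan_d M.frm_form0)

lemma K_closed: "l \<in> secs atl L \<Longrightarrow> l' \<in> secs atl L \<Longrightarrow> e \<in> secs atl E \<Longrightarrow> K l l' e \<in> secs atl E"
  using M.frm_Y [OF frm_dd, of e "[l, l']"] by (simp add: dd_pair)

lemma K_skew: "l \<in> secs atl L \<Longrightarrow> l' \<in> secs atl L \<Longrightarrow> e \<in> secs atl E \<Longrightarrow> K l l' e = - K l' l e"
  using M.frm_swap [OF frm_dd, of e l l' "[]"] by (simp add: dd_pair)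

lemma K_left:
  assumes "l \<in> secs atl L" "l' \<in> secs atl L" "e \<in> secs atl E"
  shows "l'' \<in> secs atl L \<Longrightarrow> K (l + l'') l' e = K l l' e + K l'' l' e"
    and "f \<in> smooth_funs atl \<Longrightarrow> K (smul L f l) l' e = smul E f (K l l' e)"
  using M.frm_add_head [OF frm_dd, of e l l'' "[l']"] M.frm_scale_head [OF frm_dd, of e l f "[l']"] assms
  by (simp_all add: dd_pair)

lemma K_zero_left: "l \<in> secs atl L \<Longrightarrow> e \<in> secs atl E \<Longrightarrow> K 0 l e = 0"
  using M.frm_zero_head [OF frm_dd, of e "[l]"] by (simp add: dd_pair)

lemma K_right:
  assumes "l \<in> secs atl L" "l' \<in> secs atl L" "e \<in> secs atl E"
  shows "l'' \<in> secs atl L \<Longrightarrow> K l (l' + l'') e = K l l' e + K l l'' e"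
    and "f \<in> smooth_funs atl \<Longrightarrow> K l (smul L f l') e = smul E f (K l l' e)"
proof -
  note f = M.frm_contract [OF frm_dd [OF assms(3)] assms(1)]
  show "l'' \<in> secs atl L \<Longrightarrow> K l (l' + l'') e = K l l' e + K l l'' e"
    "f \<in> smooth_funs atl \<Longrightarrow> K l (smul L f l') e = smul E f (K l l' e)"
    using M.frm_add_head [OF f, of l' l'' "[]"] M.frm_scale_head [OF f, of l' f "[]"] assms
    by (simp_all add: dd_pair contract_apply)
qed

lemma K_zero_right: "l \<in> secs atl L \<Longrightarrow> e \<in> secs atl E \<Longrightarrow> K l 0 e = 0"
  using K_zero_left [of l e] K_skew [of l 0 e] G.X_zero by simp

text \<open>The terms with one derivative of \<open>f\<close> are symmetric in the two directions
  and cancel; those with two cancel against the bracket term, because the anchor preserves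
  brackets.\<close>

lemma K_section:
  assumes "l \<in> secs atl L" "l' \<in> secs atl L" "e \<in> secs atl E"
  shows "e' \<in> secs atl E \<Longrightarrow> K l l' (e + e') = K l l' e + K l l' e'"
    and "f \<in> smooth_funs atl \<Longrightarrow> K l l' (smul E f e) = smul E f (K l l' e)"
proof -
  show "K l l' (e + e') = K l l' e + K l l' e'" if "e' \<in> secs atl E"
    using assms that by (simp add: conn_curv_def nablaD bracketD(1) algebra_simps)
  show "K l l' (smul E f e) = smul E f (K l l' e)" if f: "f \<in> smooth_funs atl"
  proof -
    have exp: "nabla x (nabla y (smul E f e)) = smul E f (nabla x (nabla y e)) + smul E (der L x f) (nabla y e)
       + smul E (der L y f) (nabla x e) + smul E (der L x (der L y f)) e"
      if "x \<in> secs atl L" "y \<in> secs atl L" for x y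
      using that f assms(3)
      by (simp add: nablaD G.rho_closed M.Y_scale add.assoc)
    show ?thesis
      using assms f unfolding conn_curv_def exp [OF assms(1,2)] exp [OF assms(2,1)]
      by (simp add: nablaD(5) bracketD(1,6) M.Y.scale_right_diff_distrib M.Y.scale_left_diff_distrib)
  qed
qed

lemma nabla_A: "a \<in> secs_in atl L A \<Longrightarrow> e \<in> secs atl E \<Longrightarrow> nabla a e = act a e"
  using extending by (simp add: extending_connection_def)

lemma A_secs: "a \<in> secs_in atl L A \<Longrightarrow> a \<in> secs atl L"
  by (simp add: secs_in_A_iff)

lemma bracket_A: "a \<in> secs_in atl L A \<Longrightarrow> b \<in> secs_in atl L A \<Longrightarrow> bracket L a b \<in> secs_in atl L A"
  using lie_pair by (simp add: lie_pair_def)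

lemma K_A:
  assumes "a \<in> secs_in atl L A" "b \<in> secs_in atl L A" "e \<in> secs atl E"
  shows "K a b e = 0"
proof -
  have "conn_curv L act a b e = 0" using module assms by (simp add: lie_module_def)
  moreover have "act a e \<in> secs atl E" "act b e \<in> secs atl E"
    using assms nablaD(1) [OF A_secs] by (simp_all flip: nabla_A)
  ultimately show ?thesis
    using assms by (simp add: conn_curv_def nabla_A bracket_A)
qed

lemma zero_dg_Hom: "(\<lambda>\<omega>. 0) \<in> dg_Hom aa mm r s"
  unfolding dg_Hom_def by (auto intro!: dg.bigraded_mapI simp: M.comp_zero M.wdg_arith)

text \<open>The (2,0)-part of \<open>dd e\<close> evaluates the curvature on the A-parts of both
  arguments, where \<open>nabla\<close> is the flat A-action.\<close>

lemma dpart_square_form0: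
  assumes e: "e \<in> secs atl E"
  shows "M.dpart 1 0 (M.dpart 1 0 (form0 e)) = 0"
proof -
  have "M.bp 2 0 (dd e) xs = 0" if xs: "set xs \<subseteq> secs atl L" for xs
  proof (cases "length xs = 2")
    case True
    then obtain x y where "xs = [x, y]" by (auto simp: length_Suc_conv numeral_2_eq_2)
    then show ?thesis
      using xs K_A [OF _ _ e] G.pA_XA by (simp add: dd_pair [unfolded] contract_apply XA_eq)
  next
    case False
    then show ?thesis by (intro bip_eq_0) simp
  qed
  then show ?thesis
    unfolding M.dpart_dpart(2) [OF M.comp_form0 [OF e]] dd_def [symmetric]
    by (intro on_lists_eq_0) simp
qed

text \<open>\<open>cartan_d_square\<close> does not apply, as \<open>nabla\<close> need not be flat.
  Instead the square and the zero map are compared as linear maps that agree on sections of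
  E.\<close>

lemma dpart_square: "\<omega> \<in> M.comp p r \<Longrightarrow> M.dpart 1 0 (M.dpart 1 0 \<omega>) = 0"
proof -
  have "(\<lambda>\<omega>. mdbar mm (mdbar mm \<omega>)) = (\<lambda>\<omega>. 0)"
  proof (rule dg_Hom_eqI [OF dg.mdbar_mdbar_Hom zero_dg_Hom])
    show "adbar aa (adbar aa \<alpha>) = 0" if "\<alpha> \<in> acomp aa p s" for \<alpha> p s
      using G.dpart_dpart_scalar(2) that by simp
  qed (simp only: mm_simps dpart_square_form0)
  then have "mdbar mm (mdbar mm \<omega>) = 0" by (rule fun_cong)
  then show ?thesis by simp
qed

end

sublocale lie_pair_mod \<subseteq> dg: dg_pair_flat aa mm
  by unfold_locales (use dpart_square in simp)

section \<open>The curvature of the DG-module and its characterization\<close>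

context lie_pair_mod
begin

definition curv :: "(('m \<Rightarrow> 'l) list \<Rightarrow> 'm \<Rightarrow> 'e) \<Rightarrow> ('m \<Rightarrow> 'l) list \<Rightarrow> 'm \<Rightarrow> 'e" where
  "curv = dg_curvature mm (lp_d atl L A Q q j E nabla 0 1)"

lemma lp_d_dg_connection: "dg_connection aa mm (lp_d atl L A Q q j E nabla 0 1)"
  unfolding lp_d_eq by (rule dpart_dg_connection)

lemma curv_Hom: "curv \<in> dg_Hom aa mm 1 1"
  unfolding curv_def by (rule dg.dg_curvature_Hom [OF lp_d_dg_connection])

lemma curv_form0_comp: "e \<in> secs atl E \<Longrightarrow> curv (form0 e) \<in> M.comp 1 1"
  using curv_Hom dg.bigraded_mapD(1) [of 1 1 curv "form0 e" 0 0] M.comp_form0 by (simp add: dg_Hom_def)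

lemma curv_form0:
  assumes "e \<in> secs atl E"
  shows "curv (form0 e) = - on_lists (secs atl L) (M.bp 1 1 (dd e))"
proof -
  have "M.dpart 0 1 (M.dpart 1 0 (form0 e)) + M.dpart 1 0 (M.dpart 0 1 (form0 e))
      = on_lists (secs atl L) (M.bp 1 1 (dd e))"
    using M.dpart_dpart(1) [OF M.comp_form0 [OF assms]]
    by (simp add: dd_def add.commute del: One_nat_def)
  then show ?thesis
    by (simp only: curv_def dg_curvature_def lp_d_eq mm_simps)
qed

lemma curv_pair:
  assumes "x \<in> secs atl L" "y \<in> secs atl L" "e \<in> secs atl E"
  shows "curv (form0 e) [x, y] = - (K (projA q j x) (projB q j y) e + K (projB q j x) (projA q j y) e)"
  using assms by (simp add: curv_form0 on_lists_def contract_apply dd_pair)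

lemma curv_other:
  assumes "length xs \<noteq> 2 \<or> \<not> set xs \<subseteq> secs atl L" "e \<in> secs atl E"
  shows "curv (form0 e) xs = 0"
  using assms by (auto simp: curv_form0 on_lists_def bip_eq_0)

text \<open>Two lifts of a section of L/A differ by a section of A, on which \<open>K a\<close>
  vanishes by flatness. This makes \<open>At\<close> well defined.\<close>

lemma conn_curv_A_eq:
  assumes "a \<in> secs_in atl L A" "l \<in> secs atl L" "l' \<in> secs atl L" "app q l = app q l'" "e \<in> secs atl E"
  shows "K a l e = K a l' e"
proof -
  have "l' - l \<in> secs_in atl L A" using assms by (simp add: secs_in_A_iff app_q_diff G.X_diff)
  then have "K a (l' - l) e = 0" "l' - l \<in> secs atl L" using assms K_A by (simp_all add: A_secs)
  then show ?thesis
    using K_right(1) [of a l e "l' - l"] assms A_secs by simp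
qed

lemma At_app:
  assumes "a \<in> secs_in atl L A" "l \<in> secs atl L" "e \<in> secs atl E"
  shows "At atl L q nabla a (app q l) e = K a l e"
  unfolding At_def
proof (rule the_equality)
  show "\<exists>l'\<in>secs atl L. app q l' = app q l \<and> K a l e = K a l' e" using assms by blast
  show "u = K a l e" if "\<exists>l'\<in>secs atl L. app q l' = app q l \<and> u = K a l' e" for u
    using that conn_curv_A_eq assms by blast
qed

lemma quot_act_app:
  assumes "a \<in> secs_in atl L A" "l \<in> secs atl L"
  shows "quot_act atl L q a (app q l) = app q (bracket L a l)"
  unfolding quot_act_def
proof (rule the_equality)
  show "\<exists>l'\<in>secs atl L. app q l' = app q l \<and> app q (bracket L a l) = app q (bracket L a l')" using assms by blast
  fix u assume "\<exists>l'\<in>secs atl L. app q l' = app q l \<and> u = app q (bracket L a l')"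
  then obtain l' where l': "l' \<in> secs atl L" "app q l' = app q l" "u = app q (bracket L a l')" by blast
  have d: "l' - l \<in> secs_in atl L A" using assms l' by (simp add: secs_in_A_iff app_q_diff G.X_diff)
  have "bracket L a l' = bracket L a l + bracket L a (l' - l)"
    using bracketD(3) [of a l "l' - l"] assms d A_secs by simp
  moreover have "app q (bracket L a (l' - l)) = 0"
    using bracket_A [OF assms(1) d] by (simp add: secs_in_A_iff)
  ultimately show "u = app q (bracket L a l)"
    using l'(3) assms d A_secs bracketD(1) app_q_linear(1) by simp
qed

text \<open>The contractions evaluate at the list \<open>[b, a]\<close>, where only the second term
  of \<open>curv_pair\<close> survives; the value is \<open>- K b a e = K a b e\<close>.\<close>

lemma curv_atiyah:
  assumes a: "a \<in> secs_in atl L A" and b: "b \<in> secs_in atl L (compl Q j)" and e: "e \<in> secs atl E"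
  shows "contract a (contract b (curv (form0 e))) = form0 (At atl L q nabla a (app q b) e)"
proof
  fix zs
  show "contract a (contract b (curv (form0 e))) zs = form0 (At atl L q nabla a (app q b) e) zs"
  proof (cases zs)
    case Nil
    have ab: "a \<in> G.XA" "b \<in> G.XB" "a \<in> secs atl L" "b \<in> secs atl L"
      using a b by (simp_all add: XA_eq XB_eq G.XA_X G.XB_X)
    then have "curv (form0 e) [b, a] = - K b a e"
      using e by (simp add: curv_pair G.XA_simps G.XB_simps K_zero_left G.X_zero)
    then show ?thesis
      using K_skew [of b a e] ab e a by (simp add: Nil contract_apply At_app)
  next
    case (Cons z zs')
    then show ?thesis using curv_other [OF _ e, of "b # a # zs"] by (simp add: contract_apply)
  qed
qed

lemma curv_dg_map: "dg_map_shift11 aa mm curv"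
proof -
  have "curv (mact mm \<alpha> \<omega>) = mact mm \<alpha> (curv \<omega>)"
    if h: "\<alpha> \<in> homog (acomp aa)" "\<omega> \<in> homog (mcomp mm)" for \<alpha> \<omega>
  proof -
    obtain p r where "\<alpha> \<in> acomp aa p r" using h(1) by (auto simp: homog_def)
    moreover obtain p' r' where "\<omega> \<in> mcomp mm p' r'" using h(2) by (auto simp: homog_def)
    ultimately have "curv (mact mm \<alpha> \<omega>) = signed ((1 + 1) * (p + r)) (mact mm \<alpha> (curv \<omega>))"
      using curv_Hom unfolding dg_Hom_def by blast
    then show ?thesis by (simp add: signed_even)
  qed
  then show ?thesis
    unfolding dg_map_shift11_def
    using curv_Hom dg.dg_curvature_cocycle(2) [OF lp_d_dg_connection, folded curv_def] by (simp add: dg_Hom_def)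
qed

text \<open>The value on a section of E has bidegree (1, 1) and is therefore fixed by the pairs of
  one section of A and one of B. The condition prescribes exactly these values, and
  \<open>dg_Hom_eqI\<close> extends the equality to the module.\<close>

lemma curv_unique:
  assumes F: "dg_map_shift11 aa mm F"
    and at: "\<forall>a\<in>secs_in atl L A. \<forall>b\<in>secs_in atl L (compl Q j). \<forall>e\<in>secs atl E.
       contract a (contract b (F (form0 e))) = form0 (At atl L q nabla a (app q b) e)"
  shows "F = curv"
proof (rule dg_Hom_eqI [OF _ curv_Hom])
  have "F (mact mm \<alpha> \<omega>) = signed ((1 + 1) * (p + r)) (mact mm \<alpha> (F \<omega>))"
    if "\<alpha> \<in> acomp aa p r" "\<omega> \<in> mcomp mm p' r'" for \<alpha> \<omega> p r p' r'
    using F that unfolding dg_map_shift11_def homog_def by (simp add: signed_even)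
  then show "F \<in> dg_Hom aa mm 1 1"
    using F unfolding dg_map_shift11_def dg_Hom_def by blast
  fix e assume e: "e \<in> secs atl E"
  have Fe: "F (form0 e) \<in> M.comp 1 1"
    using F dg.bigraded_mapD(1) [of 1 1 F "form0 e" 0 0] M.comp_form0 [OF e] by (simp add: dg_map_shift11_def)
  define \<delta> where "\<delta> = F (form0 e) - curv (form0 e)"
  have \<delta>: "\<delta> \<in> M.comp 1 1"
    using M.comp_add [OF Fe M.comp_uminus [OF curv_form0_comp [OF e]]] by (simp add: \<delta>_def)
  have zero: "\<delta> (as @ bs) = 0" if "set as \<subseteq> G.XA" "set bs \<subseteq> G.XB" for as bs
  proof (rule ccontr)
    assume nz: "\<delta> (as @ bs) \<noteq> 0"
    then have "length as = 1 \<and> length bs = 1"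
      using \<delta> that unfolding M.comp_def bideg_def by blast
    then obtain a b where ab: "as = [a]" "bs = [b]" by (auto simp: length_Suc_conv)
    have "contract a (contract b (F (form0 e))) = contract a (contract b (curv (form0 e)))"
      using that e at curv_atiyah by (simp add: ab XA_eq XB_eq)
    then have "contract a (contract b (F (form0 e))) [] = contract a (contract b (curv (form0 e))) []" by simp
    then have "\<delta> [b, a] = 0" by (simp add: \<delta>_def contract_apply)
    moreover have "\<delta> [a, b] = - \<delta> [b, a]"
      using that G.XA_X G.XB_X by (intro M.frm_swap [OF M.compD(3) [OF \<delta>]]) (auto simp: ab)
    ultimately show False using nz ab by simp
  qed
  have "\<delta> xs = 0" if "set xs \<subseteq> secs atl L" for xs
    by (rule M.frm_eq_0 [OF M.compD(3) [OF \<delta>] zero that])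
  then show "F (form0 e) = curv (form0 e)"
    by (intro M.comp_eqI [OF Fe curv_form0_comp [OF e]]) (simp add: \<delta>_def)
qed

end

section \<open>The Atiyah classes\<close>

lemma length_nths_Compl: "length (nths xs S) + length (nths xs (- S)) = length xs"
proof (induction xs arbitrary: S)
  case (Cons x xs)
  have "{k. Suc k \<in> - S} = - {k. Suc k \<in> S}" by auto
  then show ?case using Cons.IH [of "{k. Suc k \<in> S}"] by (simp add: nths_Cons)
qed simp

lemma set_nths_Un_Compl: "set xs = set (nths xs S) \<union> set (nths xs (- S))"
proof (induction xs arbitrary: S)
  case (Cons x xs)
  have "{k. Suc k \<in> - S} = - {k. Suc k \<in> S}" by auto
  then show ?case using Cons.IH [of "{k. Suc k \<in> S}"] by (auto simp: nths_Cons)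
qed simp

context lie_pair_mod
begin

abbreviation AtF :: "('m \<Rightarrow> 'l) list \<Rightarrow> ('m \<Rightarrow> 'q) \<Rightarrow> ('m \<Rightarrow> 'e) \<Rightarrow> 'm \<Rightarrow> 'e" where
  "AtF \<equiv> At_form atl L A Q q E nabla"

lemma At_eq:
  assumes "a \<in> secs_in atl L A" "w \<in> secs atl Q" "e \<in> secs atl E"
  shows "At atl L q nabla a w e = K a (app j w) e"
  using At_app [OF assms(1) app_j_secs [OF assms(2)] assms(3)] app_qj [OF assms(2)] by simp

lemma AtF_1:
  assumes "a \<in> secs_in atl L A"
  shows "AtF [a] = (\<lambda>w e. if w \<in> secs atl Q \<and> e \<in> secs atl E then K a (app j w) e else 0)"
  using assms by (auto simp: At_form_def on_lists_def At_eq fun_eq_iff)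

lemma AtF_other: "length xs \<noteq> 1 \<or> \<not> set xs \<subseteq> secs_in atl L A \<Longrightarrow> AtF xs = 0"
  by (auto simp: At_form_def on_lists_def split: list.split)

text \<open>The wedge with the tautological 1-form gives K(pA x, pB y) - K(pA y, pB x), and skewness
  turns this into the sum in \<open>curv_pair\<close>. The overall minus sign of
  \<open>to_end_form\<close> matches the one of the curvature.\<close>

lemma to_end_AtF:
  "to_end_form atl L q j AtF xs e = (if e \<in> secs atl E then curv (form0 e) xs else 0)"
proof -
  define \<alpha> where "\<alpha> = on_lists (secs atl L) (\<lambda>xs. AtF (map (projA q j) xs))"
  define \<beta> where "\<beta> = on_lists (secs atl L) (\<lambda>xs. case xs of [l] \<Rightarrow> app q l | _ \<Rightarrow> 0)"
  let ?pr = "\<lambda>(\<Phi> :: ('m \<Rightarrow> 'q) \<Rightarrow> ('m \<Rightarrow> 'e) \<Rightarrow> 'm \<Rightarrow> 'e) w. \<Phi> w"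
  have \<alpha>_other: "\<alpha> ys = 0" if "length ys \<noteq> 1 \<or> \<not> set ys \<subseteq> secs atl L" for ys
    using that AtF_other [of "map (projA q j) ys"] by (auto simp: \<alpha>_def on_lists_def)
  have \<beta>_other: "\<beta> ys = 0" if "length ys \<noteq> 1 \<or> \<not> set ys \<subseteq> secs atl L" for ys
    using that by (auto simp: \<beta>_def on_lists_def split: list.split)
  have pA: "projA q j x \<in> secs_in atl L A" if "x \<in> secs atl L" for x
    using G.pA_XA that by (simp add: XA_eq)
  have \<alpha>_1: "\<alpha> [x] = (\<lambda>w e. if w \<in> secs atl Q \<and> e \<in> secs atl E then K (projA q j x) (app j w) e else 0)"
    if "x \<in> secs atl L" for x
    using that AtF_1 [OF pA [OF that]] by (simp add: \<alpha>_def on_lists_def)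
  have \<alpha>_0: "\<alpha> ys 0 = 0" for ys
  proof (cases "length ys = 1 \<and> set ys \<subseteq> secs atl L")
    case True
    then obtain x where "ys = [x]" "x \<in> secs atl L" by (auto simp: length_Suc_conv)
    then show ?thesis
      using pA [THEN A_secs] by (auto simp: \<alpha>_1 app_j_0 K_zero_right fun_eq_iff)
  next
    case False
    then show ?thesis using \<alpha>_other [of ys] by auto
  qed
  have eq: "to_end_form atl L q j AtF xs e = - (wedge ?pr \<alpha> \<beta> xs e)"
    by (simp add: to_end_form_def \<alpha>_def \<beta>_def)
  show ?thesis
  proof (cases "length xs = 2 \<and> set xs \<subseteq> secs atl L")
    case True
    then obtain x y where xs: "xs = [x, y]" and xy: "x \<in> secs atl L" "y \<in> secs atl L"
      by (auto simp: length_Suc_conv numeral_2_eq_2)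
    have wC: "wedge ?pr \<omega> \<eta> (z # zs) = wedge ?pr (contract z \<omega>) \<eta> zs + wedge ?pr (gsign \<omega>) (contract z \<eta>) zs"
      for \<omega> \<eta> and z :: "'m \<Rightarrow> 'l" and zs
      by (rule wedge_Cons) simp
    have "wedge ?pr \<alpha> \<beta> xs = \<alpha> [x] (\<beta> [y]) - \<alpha> [y] (\<beta> [x])"
      by (simp add: xs wC contract_apply gsign_apply \<alpha>_other)
    also have "\<dots> = \<alpha> [x] (app q y) - \<alpha> [y] (app q x)"
      using xy by (simp add: \<beta>_def on_lists_def)
    finally have w: "wedge ?pr \<alpha> \<beta> xs e = \<alpha> [x] (app q y) e - \<alpha> [y] (app q x) e" by simp
    show ?thesis
    proof (cases "e \<in> secs atl E")
      case True
      have "K (projA q j y) (projB q j x) e = - K (projB q j x) (projA q j y) e"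
        using xy True by (intro K_skew G.pA_closed projB_secs)
      then show ?thesis
        using xy True unfolding eq w unfolding xs
        by (simp add: \<alpha>_1 app_q_secs curv_pair flip: projB_def)
    next
      case False
      then show ?thesis unfolding eq w using xy by (simp add: \<alpha>_1)
    qed
  next
    case False
    have "?pr (\<alpha> (nths xs S)) (\<beta> (nths xs (- S))) = 0" for S
    proof (cases "length (nths xs S) = 1 \<and> set (nths xs S) \<subseteq> secs atl L")
      case True
      then have "length (nths xs (- S)) \<noteq> 1 \<or> \<not> set (nths xs (- S)) \<subseteq> secs atl L"
        using False length_nths_Compl [of xs S] set_nths_Un_Compl [of xs S] by auto
      then show ?thesis using \<beta>_other \<alpha>_0 by simp
    next
      case False
      then have "\<alpha> (nths xs S) = 0" by (intro \<alpha>_other) blast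
      then show ?thesis by simp
    qed
    then have "wedge ?pr \<alpha> \<beta> xs = 0" by (simp add: wedge_def)
    moreover have "e \<in> secs atl E \<Longrightarrow> curv (form0 e) xs = 0" using False by (intro curv_other) auto
    ultimately show ?thesis unfolding eq by simp
  qed
qed

lemma curv_form0_add:
  assumes "e \<in> secs atl E" "e' \<in> secs atl E"
  shows "curv (form0 (e + e')) = curv (form0 e) + curv (form0 e')"
proof -
  have "form0 (e + e') = (form0 e + form0 e' :: ('m \<Rightarrow> 'l) list \<Rightarrow> 'm \<Rightarrow> 'e)"
    by (auto simp: form0_def fun_eq_iff)
  moreover have "bigraded_map mm 1 1 curv" using curv_Hom by (simp add: dg_Hom_def)
  ultimately show ?thesis
    using dg.bigraded_mapD(2) [of 1 1 curv "form0 e" 0 0 "form0 e'"] M.comp_form0 assms by simp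
qed

lemma curv_form0_smul:
  assumes "f \<in> smooth_funs atl" "e \<in> secs atl E"
  shows "curv (form0 (smul E f e)) = (\<lambda>xs. smul E f (curv (form0 e) xs))"
proof -
  have f: "form0 f \<in> acomp aa 0 0" and e: "form0 e \<in> mcomp mm 0 0"
    using G.S.comp_form0 M.comp_form0 assms by simp_all
  have "form0 (smul E f e) = mact mm (form0 f) (form0 e)"
    unfolding mm_simps M.wdg_form0_left by (auto simp: form0_def fun_eq_iff)
  then have "curv (form0 (smul E f e)) = curv (mact mm (form0 f) (form0 e))" by (rule arg_cong)
  also have "\<dots> = mact mm (form0 f) (curv (form0 e))"
    using curv_dg_map f e unfolding dg_map_shift11_def homog_def by blast
  finally show ?thesis unfolding mm_simps M.wdg_form0_left .
qed

text \<open>By \<open>to_end_AtF\<close> all conditions can be checked for each section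
  \<open>e\<close> separately, where they are properties of the form \<open>curv (form0 e)\<close>;
  linearity in \<open>e\<close> is that of \<open>curv\<close>.\<close>

lemma to_end_AtF_comp:
  "to_end_form atl L q j AtF \<in> lp_comp atl L A Q j (end_secs atl E) (end_smul E) 1 1"
proof -
  let ?\<tau> = "to_end_form atl L q j AtF"
  have \<tau>: "?\<tau> xs = (\<lambda>e. if e \<in> secs atl E then curv (form0 e) xs else 0)" for xs
    by (auto simp: to_end_AtF)
  have C: "curv (form0 e) \<in> M.comp 1 1" if "e \<in> secs atl E" for e
    using that by (rule curv_form0_comp)
  note fr = M.compD(3) [OF C]
  have "?\<tau> xs \<in> end_secs atl E" if "set xs \<subseteq> secs atl L" for xs
    unfolding end_secs_def lin_maps_def \<tau>
    using that by (auto simp: curv_form0_add curv_form0_smul M.Y_add M.Y_scale M.frm_Y [OF fr])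
  moreover have "?\<tau> = on_lists (secs atl L) ?\<tau>"
    unfolding on_lists_iff using curv_other by (auto simp: to_end_AtF fun_eq_iff)
  moreover have "?\<tau> (xs[i := x + y]) = ?\<tau> (xs[i := x]) + ?\<tau> (xs[i := y])"
    if "set xs \<subseteq> secs atl L" "i < length xs" "x \<in> secs atl L" "y \<in> secs atl L" for xs i x y
    unfolding \<tau> using that M.frm_list_update_add [OF fr] by (auto simp: fun_eq_iff)
  moreover have "?\<tau> (xs[i := smul L f x]) = end_smul E f (?\<tau> (xs[i := x]))"
    if "set xs \<subseteq> secs atl L" "i < length xs" "x \<in> secs atl L" "f \<in> smooth_funs atl" for xs i x f
    unfolding \<tau> using that M.frm_list_update_scale [OF fr] by (auto simp: end_smul_def)
  moreover have "?\<tau> xs = 0" if "set xs \<subseteq> secs atl L" "\<not> distinct xs" for xs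
    unfolding \<tau> using that M.frm_not_distinct [OF fr] by auto
  ultimately have "?\<tau> \<in> forms (smooth_funs atl) (secs atl L) (smul L) (end_secs atl E) (end_smul E)"
    unfolding forms_def by blast
  moreover have "length as = 1 \<and> length bs = 1"
    if h: "set as \<subseteq> G.XA" "set bs \<subseteq> G.XB" "?\<tau> (as @ bs) \<noteq> 0" for as bs
  proof -
    have "\<exists>e. e \<in> secs atl E \<and> curv (form0 e) (as @ bs) \<noteq> 0"
    proof (rule ccontr)
      assume "\<nexists>e. e \<in> secs atl E \<and> curv (form0 e) (as @ bs) \<noteq> 0"
      then have "?\<tau> (as @ bs) = 0" unfolding \<tau> by auto
      then show False using h(3) by blast
    qed
    then obtain e where "e \<in> secs atl E" "curv (form0 e) (as @ bs) \<noteq> 0" by blast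
    then show ?thesis using C [of e] h(1,2) unfolding M.comp_def bideg_def by blast
  qed
  ultimately show ?thesis
    unfolding lp_comp_def bideg_def XA_eq XB_eq by blast
qed

lemma dg_Hom_form0:
  assumes "F \<in> dg_Hom aa mm p r" "e \<in> secs atl E"
  shows "F (form0 e) \<in> M.comp p r"
  using assms dg.bigraded_mapD(1) [of p r F "form0 e" 0 0] M.comp_form0 by (simp add: dg_Hom_def)

text \<open>\<open>curv\<close> satisfies the description by \<open>to_end_AtF\<close>. For
  uniqueness, \<open>dg_Hom_eqI\<close> applies once the bidegree is known, which the description
  leaves open.\<close>

lemma mu_to_end_AtF: "mu atl L A Q q j E nabla (to_end_form atl L q j AtF) = curv"
  unfolding mu_def
proof (rule the_equality)
  let ?\<tau> = "to_end_form atl L q j AtF"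
  show "\<exists>p r. ?\<tau> \<in> lp_comp atl L A Q j (end_secs atl E) (end_smul E) p r \<and> curv \<in> dg_Hom aa mm p r \<and>
      (\<forall>e\<in>secs atl E. curv (form0 e) = (\<lambda>xs. ?\<tau> xs e))"
    using to_end_AtF_comp curv_Hom by (intro exI [of _ 1] conjI ballI) (auto simp: to_end_AtF)
  fix F assume "\<exists>p r. ?\<tau> \<in> lp_comp atl L A Q j (end_secs atl E) (end_smul E) p r \<and> F \<in> dg_Hom aa mm p r \<and>
      (\<forall>e\<in>secs atl E. F (form0 e) = (\<lambda>xs. ?\<tau> xs e))"
  then obtain p r where F: "F \<in> dg_Hom aa mm p r"
    and eq: "\<And>e. e \<in> secs atl E \<Longrightarrow> F (form0 e) = curv (form0 e)"
    by (auto simp: to_end_AtF)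
  show "F = curv"
  proof (cases "p = 1 \<and> r = 1")
    case True
    then show ?thesis using F eq by (intro dg_Hom_eqI [OF _ curv_Hom]) auto
  next
    \<comment> \<open>A second bidegree is possible only for the zero form:
      \<open>curv (form0 e)\<close> would be homogeneous of two different bidegrees, so it vanishes,
      and both maps are zero.\<close>
    case False
    have z: "curv (form0 e) = 0" if e: "e \<in> secs atl E" for e
    proof -
      have "curv (form0 e) \<in> M.comp p r" using dg_Hom_form0 [OF F e] eq e by simp
      then have "bipart (secs atl L) (projA q j) (projB q j) 1 1 (curv (form0 e)) = 0"
        using False M.comp_bipart [of "curv (form0 e)" p r 1 1] by (auto simp del: zero_fun_apply One_nat_def)
      then show ?thesis
        using M.comp_bipart [OF curv_form0_comp [OF e], of 1 1] by (simp del: One_nat_def)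
    qed
    have "F = (\<lambda>\<omega>. 0)" "curv = (\<lambda>\<omega>. 0)"
      using z eq by (auto intro!: dg_Hom_eqI [OF F zero_dg_Hom] dg_Hom_eqI [OF curv_Hom zero_dg_Hom])
    then show ?thesis by simp
  qed
qed

lemma lie_pair_mod_other: "extending_connection atl L A E act nabla' \<Longrightarrow> lie_pair_mod atl L A Q q j E act nabla'"
  using lie_pair_split_axioms module by (simp add: lie_pair_mod_def lie_pair_mod_axioms_def)

text \<open>On forms of \<open>A\<close>-degree less than \<open>k\<close>, the difference of two covariant differentials, a wedge
  product with an \<open>End(E)\<close>-valued 1-form vanishing on \<open>A\<close>, does not raise the \<open>A\<close>-degree.\<close>

lemma lp_mod_independent:
  assumes ext: "extending_connection atl L A E act nabla'"
  shows "lp_mod atl L A Q q j E nabla' = mm"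
proof -
  interpret N: lie_pair_mod atl L A Q q j E act nabla' by (rule lie_pair_mod_other [OF ext])
  let ?d = "cartan_d (bracket L) nabla" and ?d' = "cartan_d (bracket L) nabla'"
  have A: "M.Adeg_less k (?d' \<omega> - ?d \<omega>)" if "M.frm \<omega>" "M.Adeg_less k \<omega>" for k \<omega>
    using that
  proof (induction k arbitrary: \<omega>)
    case 0
    have "?d' \<omega> xs = 0" "?d \<omega> xs = 0" if xs: "set xs \<subseteq> secs atl L" for xs
    proof -
      have z: "\<omega> ys = 0 ys" if "set ys \<subseteq> secs atl L" for ys using 0 that by simp
      show "?d' \<omega> xs = 0" "?d \<omega> xs = 0"
        using N.M.cartan_d_cong [OF xs z] M.cartan_d_cong [OF xs z] N.M.cartan_d_zero [OF xs] M.cartan_d_zero [OF xs]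
        by (simp_all del: zero_fun_apply)
    qed
    then show ?case by (simp add: zero_fun_def)
  next
    case (Suc k)
    have "M.Adeg_less k (contract a (?d' \<omega> - ?d \<omega>))" if a: "a \<in> G.XA" for a
    proof (rule M.Adeg_less_cong)
      show "M.Adeg_less k (0 - (?d' (contract a \<omega>) - ?d (contract a \<omega>)))"
        using Suc.prems a
        by (intro M.Adeg_less_diff [OF M.Adeg_less_zero Suc.IH] M.frm_contract) (auto simp: G.XA_X)
      fix xs assume xs: "set xs \<subseteq> secs atl L"
      \<comment> \<open>Along A both connections are the given action, hence i_a (d' - d) = - (d' -
        d) i_a.\<close>
      have "lie_der (bracket L) nabla' a \<omega> xs = lie_der (bracket L) nabla a \<omega> xs"
        using a N.nabla_A nabla_A
        by (intro M.lie_der_act_cong [OF xs G.XA_X [OF a] M.frm_vals [OF Suc.prems(1)]]) (simp add: XA_eq)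
      then show "contract a (?d' \<omega> - ?d \<omega>) xs = (0 - (?d' (contract a \<omega>) - ?d (contract a \<omega>))) xs"
        by simp
    qed
    then show "M.Adeg_less (Suc k) (?d' \<omega> - ?d \<omega>)" unfolding M.Adeg_less.simps by blast
  qed
  have "N.M.dpart 1 0 \<omega> = M.dpart 1 0 \<omega>" for \<omega>
  proof (cases "\<omega> \<in> homog M.comp")
    case True
    then obtain p r where \<omega>: "\<omega> \<in> M.comp p r" by (auto simp: homog_def)
    \<comment> \<open>\<open>\<omega>\<close> has A-degree \<open>p\<close>, so the difference of
      the two differentials has A-degree at most \<open>p\<close> and no component of bidegree
      \<open>(p + 1, r)\<close>.\<close>
    have "M.Adeg_less (Suc p) \<omega>" by (rule M.hom_Adeg_less [OF M.compD(1) [OF \<omega>]]) simp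
    then have "M.Adeg_less (Suc p) (?d' \<omega> - ?d \<omega>)" by (rule A [OF M.compD(3) [OF \<omega>]])
    moreover have "M.frm (?d' \<omega> - ?d \<omega>)"
      using M.compD(3) [OF \<omega>] by (intro M.frm_diff M.frm_cartan_d N.M.frm_cartan_d)
    ultimately have "M.bp (int (p + 1)) (int (r + 0)) (?d' \<omega> - ?d \<omega>) xs = 0" if "set xs \<subseteq> secs atl L" for xs
      using that by (intro M.bp_Adeg_less [where k = "Suc p"]) auto
    then show ?thesis
      unfolding M.dpart_eq [OF \<omega> add_0_right] N.M.dpart_eq [OF \<omega> add_0_right]
      by (intro on_lists_cong) (simp add: bip_arith)
  next
    case False
    then show ?thesis by (simp add: M.dpart_def N.M.dpart_def on_homog_def)
  qed
  then have "N.M.dpart 1 0 = M.dpart 1 0" by blast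
  then show ?thesis by (simp only: lp_mod_eq N.lp_mod_eq)
qed

lemma mu_independent:
  "extending_connection atl L A E act nabla' \<Longrightarrow> mu atl L A Q q j E nabla' = mu atl L A Q q j E nabla"
  by (intro ext) (simp only: mu_def lp_mod_independent)

section \<open>The Atiyah cocycle in the complex of A\<close>

abbreviation "HomB \<equiv> forms (smooth_funs atl) (secs_in atl L A) (smul L)
  (hom_secs atl Q E) (\<lambda>f \<Phi> w. end_smul E f (\<Phi> w))"

abbreviation "dA \<equiv> ce_diff (secs_in atl L A) (bracket L) (hom_act atl L Q q E act)"

lemma AtF_hom_secs:
  assumes a: "a \<in> secs_in atl L A"
  shows "AtF [a] \<in> hom_secs atl Q E"
proof -
  have "(\<lambda>e. if e \<in> secs atl E then K a (app j w) e else 0) \<in> end_secs atl E" if "w \<in> secs atl Q" for w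
    unfolding end_secs_def lin_maps_def
    using that a by (auto simp: K_closed K_section A_secs app_j_secs M.Y_add M.Y_scale)
  moreover have "K a (app j (w + w')) e = K a (app j w) e + K a (app j w') e"
    if "w \<in> secs atl Q" "w' \<in> secs atl Q" "e \<in> secs atl E" for w w' e
    using that a by (simp add: app_j_linear K_right A_secs app_j_secs)
  moreover have "K a (app j (smul Q f w)) e = smul E f (K a (app j w) e)"
    if "w \<in> secs atl Q" "e \<in> secs atl E" "f \<in> smooth_funs atl" for w e f
    using that a by (simp add: app_j_linear K_right A_secs app_j_secs)
  ultimately show ?thesis
    unfolding hom_secs_def lin_maps_def AtF_1 [OF a] end_smul_def
    using secs_add [OF man vbQ] secs_smul [OF man vbQ]
    by auto
qed

lemma AtF_form: "AtF \<in> of_degree 1 HomB"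
proof -
  have scale: "smul L f a \<in> secs_in atl L A" if "a \<in> secs_in atl L A" "f \<in> smooth_funs atl" for f a
    using that by (simp add: secs_in_A_iff G.X_scale app_q_linear) (auto simp: smul_def fun_eq_iff module.scale_zero_right [OF module_smul [OF man vbQ], unfolded smul_def fun_eq_iff, simplified])
  have add: "a + b \<in> secs_in atl L A" if "a \<in> secs_in atl L A" "b \<in> secs_in atl L A" for a b
    using that by (simp add: secs_in_A_iff G.X_add app_q_linear)
  have hom0: "0 \<in> hom_secs atl Q E"
    by (auto simp: hom_secs_def end_secs_def lin_maps_def end_smul_def M.Y_zero)
  have vals: "AtF xs \<in> hom_secs atl Q E" if "set xs \<subseteq> secs_in atl L A" for xs
  proof (cases "length xs = 1")
    case True
    then obtain a where "xs = [a]" by (auto simp: length_Suc_conv)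
    then show ?thesis using that AtF_hom_secs by simp
  next
    case False
    then show ?thesis using AtF_other [of xs] hom0 by simp
  qed
  have "AtF (xs[i := a + b]) = AtF (xs[i := a]) + AtF (xs[i := b])"
    if "i < length xs" "a \<in> secs_in atl L A" "b \<in> secs_in atl L A" for xs i a b
  proof (cases "length xs = 1")
    case True
    then obtain c where "xs = [c]" "i = 0" using \<open>i < length xs\<close> by (auto simp: length_Suc_conv)
    then show ?thesis
      using that add by (auto simp: AtF_1 K_left A_secs app_j_secs fun_eq_iff)
  next
    case False
    then show ?thesis by (simp add: AtF_other)
  qed
  moreover have "AtF (xs[i := smul L f a]) = (\<lambda>w. end_smul E f (AtF (xs[i := a]) w))"
    if "i < length xs" "a \<in> secs_in atl L A" "f \<in> smooth_funs atl" for xs i a f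
  proof (cases "length xs = 1")
    case True
    then obtain c where "xs = [c]" "i = 0" using \<open>i < length xs\<close> by (auto simp: length_Suc_conv)
    then show ?thesis
      using that scale by (auto simp: AtF_1 K_left A_secs app_j_secs fun_eq_iff end_smul_def)
  next
    case False
    then show ?thesis by (auto simp: AtF_other end_smul_def fun_eq_iff)
  qed
  moreover have "AtF xs = 0" if "\<not> distinct xs" for xs
    using that by (intro AtF_other) (auto simp: length_Suc_conv)
  moreover have "AtF = on_lists (secs_in atl L A) AtF"
    unfolding on_lists_iff by (simp add: AtF_other)
  ultimately have "AtF \<in> HomB"
    unfolding forms_def using vals by blast
  then show ?thesis using AtF_other by (auto simp: of_degree_def)
qed

lemma act_0: "a \<in> secs_in atl L A \<Longrightarrow> act a 0 = 0"
  using nabla_A [OF _ M.Y_zero] M.act_zero [OF A_secs] by metis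

lemma hom_act_0: "a \<in> secs_in atl L A \<Longrightarrow> hom_act atl L Q q E act a 0 = 0"
  by (auto simp: hom_act_def act_0 fun_eq_iff)

text \<open>This is the Bianchi identity of \<open>nabla\<close> for two sections of A and a lift of
  a section of L/A; the terms containing \<open>K a b\<close> are absent by flatness.\<close>

lemma AtF_cocycle: "dA AtF = 0"
proof
  fix xs
  show "dA AtF xs = 0 xs"
  proof (cases "length xs = 2 \<and> set xs \<subseteq> secs_in atl L A")
    case False
    then consider "length xs \<noteq> Suc 1" | "\<not> set xs \<subseteq> secs_in atl L A" by auto
    then show ?thesis
    proof cases
      case 1
      then have "dA AtF xs = 0"
        by (intro ce_diff_eq_0 [where n = 1] AtF_other hom_act_0) auto
      then show ?thesis by simp
    qed (simp add: ce_diff_def on_lists_def)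
  next
    case True
    then obtain a b where xs: "xs = [a, b]" and ab: "a \<in> secs_in atl L A" "b \<in> secs_in atl L A"
      by (auto simp: length_Suc_conv numeral_2_eq_2)
    note abL = ab [THEN A_secs]
    have exp: "hom_act atl L Q q E act x (AtF [y]) w e
       = nabla x (K y l e) - K y (bracket L x l) e - K y l (nabla x e)"
      if x: "x \<in> secs_in atl L A" and y: "y \<in> secs_in atl L A" and w: "w \<in> secs atl Q" and e: "e \<in> secs atl E"
        and l: "l = app j w" for x y w e l
    proof -
      have lL: "l \<in> secs atl L" and wl: "w = app q l" using app_j_secs w app_qj l by simp_all
      have "AtF [y] w e = K y l e" "AtF [y] w (act x e) = K y l (nabla x e)"
        using y w e x nablaD(1) [OF A_secs [OF x] e] by (simp_all add: AtF_1 l nabla_A)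
      moreover have "AtF [y] (quot_act atl L q x w) e = K y (bracket L x l) e"
      proof -
        have bL: "bracket L x l \<in> secs atl L" by (rule bracketD(1) [OF A_secs [OF x] lL])
        have "quot_act atl L q x w = app q (bracket L x l)"
          using quot_act_app [OF x lL] wl by simp
        \<comment> \<open>\<open>AtF\<close> evaluates on the lift by \<open>j\<close>, which
          differs from \<open>bracket L x l\<close> only by a section of A.\<close>
        moreover have "K y (app j (app q (bracket L x l))) e = K y (bracket L x l) e"
          using y e bL by (intro conn_curv_A_eq) (auto simp: app_q_secs app_j_secs app_qj)
        ultimately show ?thesis using y e bL by (simp add: AtF_1 app_q_secs)
      qed
      ultimately show ?thesis
        using w e nabla_A [OF x e] nabla_A [OF x K_closed [OF A_secs [OF y] lL e]]
        by (simp add: hom_act_def)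
    qed
    have "dA AtF [a, b] w e = 0" for w e
    proof (cases "w \<in> secs atl Q \<and> e \<in> secs atl E")
      case True
      then have w: "w \<in> secs atl Q" and e: "e \<in> secs atl E" by auto
      define l where "l = app j w"
      have l: "l \<in> secs atl L" unfolding l_def by (rule app_j_secs [OF w])
      note mem = abL l e nablaD(1) bracketD(1)
      \<comment> \<open>Flatness along A is applied to the sections \<open>nabla l e\<close> and
        \<open>e\<close>, so that derivatives along [a, b] become commutators; \<open>jac\<close>
        treats the nested brackets. The remaining terms then cancel in pairs.\<close>
      have flat1: "nabla (bracket L a b) (nabla l e) = nabla a (nabla b (nabla l e)) - nabla b (nabla a (nabla l e))"
        using K_A [OF ab nablaD(1) [OF l e]] by (simp add: conn_curv_def)
      have flat2: "nabla (bracket L a b) e = nabla a (nabla b e) - nabla b (nabla a e)"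
        using K_A [OF ab e] by (simp add: conn_curv_def)
      have flat3: "nabla l (nabla (bracket L a b) e) = nabla l (nabla a (nabla b e)) - nabla l (nabla b (nabla a e))"
        unfolding flat2 using mem by (intro M.act_diff) auto
      have jac: "nabla (bracket L a (bracket L b l)) e
        = nabla (bracket L (bracket L a b) l) e + nabla (bracket L b (bracket L a l)) e"
      proof -
        have "bracket L b (bracket L l a) = - bracket L b (bracket L a l)"
          using mem bracketD(2) [of l a] G.br_uminus [of b "bracket L a l"] by simp
        moreover have "bracket L l (bracket L a b) = - bracket L (bracket L a b) l"
          using mem by (intro bracketD(2)) auto
        ultimately have "bracket L a (bracket L b l) = bracket L (bracket L a b) l + bracket L b (bracket L a l)"
          using bracketD(4) [OF abL l] by (simp add: algebra_simps)
        then show ?thesis using mem by (simp add: nablaD(2))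
      qed
      have dist: "nabla x (K y l e) = nabla x (nabla y (nabla l e)) - nabla x (nabla l (nabla y e))
          - nabla x (nabla (bracket L y l) e)" if "x \<in> secs atl L" "y \<in> secs atl L" for x y
        unfolding conn_curv_def using that mem by (simp add: M.act_diff M.Y_diff)
      have At: "AtF [bracket L a b] w e = K (bracket L a b) l e"
        using bracket_A [OF ab] w e by (simp add: AtF_1 l_def)
      have "dA AtF [a, b] w e = nabla a (K b l e) - K b (bracket L a l) e - K b l (nabla a e)
         - (nabla b (K a l e) - K a (bracket L b l) e - K a l (nabla b e)) - K (bracket L a b) l e"
        by (simp add: ce_diff_2 [OF ab] exp [OF _ _ w e l_def] ab At)
      also have "\<dots> = 0"
        unfolding dist [OF abL] dist [OF abL(2,1)] unfolding conn_curv_def flat1 flat3 jac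
        by (simp add: algebra_simps)
      finally show ?thesis .
    next
      case False
      then show ?thesis
        using bracket_A [OF ab] by (auto simp: ce_diff_2 [OF ab] hom_act_def AtF_1)
    qed
    then show ?thesis unfolding xs by (auto simp: fun_eq_iff)
  qed
qed

text \<open>The correction \<open>\<psi>\<close> vanishes along \<open>a\<close>, so the curvature
  changes by terms of first order in \<open>\<psi>\<close> only, without a product of
  \<open>\<psi>\<close> with itself. These terms are the A-action on \<open>\<psi>\<close>.\<close>

lemma AtF_difference:
  assumes ext: "extending_connection atl L A E act nabla'"
    and \<psi>: "\<psi> \<in> hom_secs atl Q E"
    and eq: "\<And>l e. l \<in> secs atl L \<Longrightarrow> e \<in> secs atl E \<Longrightarrow> nabla' l e = nabla l e + \<psi> (app q l) e"
  shows "At_form atl L A Q q E nabla' - AtF = dA (form0 \<psi>)"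
proof
  interpret N: lie_pair_mod atl L A Q q j E act nabla' by (rule lie_pair_mod_other [OF ext])
  have \<psi>_secs: "\<psi> w e \<in> secs atl E" if "w \<in> secs atl Q" "e \<in> secs atl E" for w e
    using \<psi> that unfolding hom_secs_def lin_maps_def end_secs_def by blast
  have \<psi>_0: "\<psi> 0 = 0"
  proof -
    have "\<psi> (0 + 0) = \<psi> 0 + \<psi> 0"
      using \<psi> secs_zero [OF man vbQ] unfolding hom_secs_def lin_maps_def by blast
    then show ?thesis by simp
  qed
  fix xs
  show "(N.AtF - AtF) xs = dA (form0 \<psi>) xs"
  proof (cases "length xs = 1 \<and> set xs \<subseteq> secs_in atl L A")
    case False
    then have "dA (form0 \<psi>) xs = 0"
    proof (cases "length xs = 1")
      case True
      then show ?thesis using False by (simp add: ce_diff_def on_lists_def)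
    next
      case False
      then show ?thesis
        by (intro ce_diff_eq_0 [where n = 0] hom_act_0) (auto simp: form0_def)
    qed
    then show ?thesis using False by (simp add: AtF_other N.AtF_other)
  next
    case True
    then obtain a where xs: "xs = [a]" and a: "a \<in> secs_in atl L A" by (auto simp: length_Suc_conv)
    note aL = A_secs [OF a]
    have "N.AtF [a] w e - AtF [a] w e = hom_act atl L Q q E act a \<psi> w e" for w e
    proof (cases "w \<in> secs atl Q \<and> e \<in> secs atl E")
      case True
      then have w: "w \<in> secs atl Q" and e: "e \<in> secs atl E" by auto
      define l where "l = app j w"
      have l: "l \<in> secs atl L" and ql: "app q l = w" unfolding l_def using w app_j_secs app_qj by simp_all
      note mem = aL l e nablaD(1) bracketD(1) N.nablaD(1)
      have qa: "app q a = 0" using a by (simp add: secs_in_A_iff)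
      have n1: "nabla a (nabla l e + \<psi> w e) = nabla a (nabla l e) + nabla a (\<psi> w e)"
        using mem \<psi>_secs w by (intro nablaD(3)) auto
      have "N.K a l e - K a l e = nabla a (\<psi> w e) - \<psi> w (nabla a e) - \<psi> (app q (bracket L a l)) e"
        using mem w \<psi>_secs
        by (simp add: conn_curv_def eq ql n1 M.Y_add qa \<psi>_0)
      then show ?thesis
        using w e a mem quot_act_app [OF a l] ql \<psi>_secs
        by (simp add: AtF_1 N.AtF_1 hom_act_def l_def [symmetric] nabla_A)
    next
      case False
      then show ?thesis using a by (auto simp: AtF_1 N.AtF_1 hom_act_def)
    qed
    then show ?thesis by (simp add: xs ce_diff_1 [OF a] fun_eq_iff)
  qed
qed

text \<open>Extending connections form an affine space over the sections of Hom(L/A \<otimes> E, E),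
  and a translation changes the cocycle by a coboundary. So the class is the set of the cocycles of
  all extending connections.\<close>

lemma A_cohom_AtF:
  "A_cohom atl L A Q q E act `` {AtF}
    = {At_form atl L A Q q E nabla' | nabla'. extending_connection atl L A E act nabla'}"
proof (intro equalityI subsetI)
  fix y assume "y \<in> A_cohom atl L A Q q E act `` {AtF}"
  then obtain \<theta> where \<theta>: "\<theta> \<in> of_degree 0 HomB" and y: "y - AtF = dA \<theta>"
    by (auto simp: A_cohom_def cohomologous_def Let_def)
  define \<psi> where "\<psi> = \<theta> []"
  have "\<theta> = form0 \<psi>" using \<theta> by (auto simp: of_degree_def form0_def \<psi>_def fun_eq_iff)
  have \<psi>: "\<psi> \<in> hom_secs atl Q E" using \<theta> by (auto simp: of_degree_def forms_def \<psi>_def dest!: spec [of _ "[]"])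
  have \<psi>D: "\<psi> w \<in> end_secs atl E" "w' \<in> secs atl Q \<Longrightarrow> \<psi> (w + w') = \<psi> w + \<psi> w'"
    "f \<in> smooth_funs atl \<Longrightarrow> \<psi> (smul Q f w) = end_smul E f (\<psi> w)" if "w \<in> secs atl Q" for w w' f
    using \<psi> that unfolding hom_secs_def lin_maps_def by blast+
  have \<psi>E: "\<psi> w e \<in> secs atl E" "e' \<in> secs atl E \<Longrightarrow> \<psi> w (e + e') = \<psi> w e + \<psi> w e'"
    "f \<in> smooth_funs atl \<Longrightarrow> \<psi> w (smul E f e) = smul E f (\<psi> w e)"
    if "w \<in> secs atl Q" "e \<in> secs atl E" for w e e' f
    using \<psi>D(1) [OF that(1)] that unfolding end_secs_def lin_maps_def by blast+
  \<comment> \<open>The correction factors through \<open>app q\<close> and thus vanishes on A, so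
    the new connection still extends the action.\<close>
  define nabla' where "nabla' l e = nabla l e + \<psi> (app q l) e" for l e
  have "\<psi> 0 = 0" using \<psi>D(2) [OF secs_zero [OF man vbQ] secs_zero [OF man vbQ]] by simp
  then have ext: "extending_connection atl L A E act nabla'"
    unfolding extending_connection_def lie_connection_def
    by (simp add: nabla'_def nablaD \<psi>D \<psi>E app_q_secs app_q_linear M.Y_add end_smul_def
        M.Y.scale_right_distrib secs_in_A_iff nabla_A algebra_simps)
  have "y = At_form atl L A Q q E nabla'"
    using AtF_difference [OF ext \<psi>] y \<open>\<theta> = form0 \<psi>\<close> by (simp add: nabla'_def algebra_simps)
  then show "y \<in> {At_form atl L A Q q E nabla' | nabla'. extending_connection atl L A E act nabla'}"
    using ext by blast
next
  fix y assume "y \<in> {At_form atl L A Q q E nabla' | nabla'. extending_connection atl L A E act nabla'}"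
  then obtain nabla' where ext: "extending_connection atl L A E act nabla'"
    and y: "y = At_form atl L A Q q E nabla'" by blast
  interpret N: lie_pair_mod atl L A Q q j E act nabla' by (rule lie_pair_mod_other [OF ext])
  \<comment> \<open>The difference of two extending connections vanishes on A and descends to L/A;
    it is computed on the lift by \<open>j\<close>.\<close>
  define \<psi> where "\<psi> w e = (if w \<in> secs atl Q \<and> e \<in> secs atl E then nabla' (app j w) e - nabla (app j w) e else 0)" for w e
  have "\<psi> w \<in> end_secs atl E" if "w \<in> secs atl Q" for w
    unfolding end_secs_def lin_maps_def
    using that by (simp add: \<psi>_def nablaD N.nablaD app_j_secs M.Y_diff M.Y_add M.Y_scale M.Y.scale_right_diff_distrib)
  moreover have "\<psi> w = 0" if "w \<notin> secs atl Q" for w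
    using that by (auto simp: \<psi>_def)
  moreover have "\<psi> (w + w') = \<psi> w + \<psi> w'" if "w \<in> secs atl Q" "w' \<in> secs atl Q" for w w'
    by (rule HOL.ext, insert that secs_add [OF man vbQ that]) (simp add: \<psi>_def nablaD(2) N.nablaD(2) app_j_secs app_j_linear)
  moreover have "\<psi> (smul Q f w) = end_smul E f (\<psi> w)" if "w \<in> secs atl Q" "f \<in> smooth_funs atl" for w f
    by (rule HOL.ext, insert that secs_smul [OF man vbQ that(2,1)]) (simp add: \<psi>_def end_smul_def nablaD(4) N.nablaD(4) app_j_secs app_j_linear M.Y.scale_right_diff_distrib)
  ultimately have \<psi>: "\<psi> \<in> hom_secs atl Q E"
    unfolding hom_secs_def lin_maps_def by blast
  have "nabla' l e = nabla l e + \<psi> (app q l) e" if l: "l \<in> secs atl L" and e: "e \<in> secs atl E" for l e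
  proof -
    have B: "projB q j l \<in> secs atl L" and A: "projA q j l \<in> secs_in atl L A"
      using l projB_secs G.pA_XA by (simp_all add: XA_eq)
    have "nabla' l e = nabla' (projA q j l) e + nabla' (projB q j l) e"
      using N.nablaD(2) [OF A_secs [OF A] e B] G.pA_plus_pB [OF l] by simp
    moreover have "nabla l e = nabla (projA q j l) e + nabla (projB q j l) e"
      using nablaD(2) [OF A_secs [OF A] e B] G.pA_plus_pB [OF l] by simp
    moreover have "nabla' (projA q j l) e = nabla (projA q j l) e"
      using nabla_A [OF A e] N.nabla_A [OF A e] by simp
    moreover have "\<psi> (app q l) e = nabla' (projB q j l) e - nabla (projB q j l) e"
      using l e by (simp add: \<psi>_def app_q_secs projB_def)
    ultimately show ?thesis by simp
  qed
  then have diff: "y - AtF = dA (form0 \<psi>)" unfolding y by (rule AtF_difference [OF ext \<psi>])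
  have "form0 \<psi> \<in> of_degree 0 HomB"
  proof -
    have "0 \<in> hom_secs atl Q E"
      by (auto simp: hom_secs_def end_secs_def lin_maps_def end_smul_def M.Y_zero)
    then show ?thesis using \<psi> by (auto simp: of_degree_def forms_def form0_def on_lists_def end_smul_def fun_eq_iff)
  qed
  then show "y \<in> A_cohom atl L A Q q E act `` {AtF}"
    using AtF_form AtF_cocycle N.AtF_form N.AtF_cocycle diff unfolding y A_cohom_def cohomologous_def Let_def
    by blast
qed

end

section \<open>Comparison of the two Atiyah classes\<close>

context lie_pair_mod
begin

lemma atiyah_class_eq:
  "atiyah_class atl L A Q q E act
    = {At_form atl L A Q q E nabla' | nabla'. extending_connection atl L A E act nabla'}"
  unfolding atiyah_class_def
proof (rule the_equality)
  show "\<exists>nabla'. extending_connection atl L A E act nabla' \<and>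
      {At_form atl L A Q q E nabla' | nabla'. extending_connection atl L A E act nabla'}
      = A_cohom atl L A Q q E act `` {At_form atl L A Q q E nabla'}"
    using extending A_cohom_AtF by blast
next
  fix c assume "\<exists>nabla'. extending_connection atl L A E act nabla' \<and>
      c = A_cohom atl L A Q q E act `` {At_form atl L A Q q E nabla'}"
  then obtain nabla' where ext: "extending_connection atl L A E act nabla'"
    and c: "c = A_cohom atl L A Q q E act `` {At_form atl L A Q q E nabla'}" by blast
  interpret N: lie_pair_mod atl L A Q q j E act nabla' by (rule lie_pair_mod_other [OF ext])
  show "c = {At_form atl L A Q q E nabla' | nabla'. extending_connection atl L A E act nabla'}"
    unfolding c by (rule N.A_cohom_AtF)
qed

text \<open>Each representative comes from its own connection \<open>nabla'\<close>, whereas the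
  module and \<open>mu\<close> are formed with \<open>nabla\<close>;
  \<open>lp_mod_independent\<close> and \<open>mu_independent\<close> reconcile the two. The image
  is then a curvature on the fixed DG-module, and any curvature determines the whole class.\<close>

lemma mu_atiyah_class:
  "Hom_cohom aa mm `` (mu atl L A Q q j E nabla ` to_end_form atl L q j ` atiyah_class atl L A Q q E act)
    = dg_atiyah_class aa mm"
proof -
  have cl: "dg_atiyah_class aa mm = {dg_curvature mm d | d. dg_connection aa mm d}"
    by (rule dg.dg_atiyah_class_eq [OF lp_d_dg_connection])
  have each: "Hom_cohom aa mm `` {mu atl L A Q q j E nabla (to_end_form atl L q j (At_form atl L A Q q E nabla'))}
      = dg_atiyah_class aa mm" if ext: "extending_connection atl L A E act nabla'" for nabla'
  proof -
    interpret N: lie_pair_mod atl L A Q q j E act nabla' by (rule lie_pair_mod_other [OF ext])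
    have "mu atl L A Q q j E nabla (to_end_form atl L q j N.AtF)
        = dg_curvature mm (lp_d atl L A Q q j E nabla' 0 1)"
      using N.mu_to_end_AtF by (simp only: mu_independent [OF ext] N.curv_def lp_mod_independent [OF ext])
    moreover have "dg_connection aa mm (lp_d atl L A Q q j E nabla' 0 1)"
      using N.lp_d_dg_connection by (simp only: lp_mod_independent [OF ext])
    ultimately show ?thesis
      using dg.Hom_cohom_dg_curvature cl by simp
  qed
  have "Hom_cohom aa mm `` (mu atl L A Q q j E nabla ` to_end_form atl L q j ` atiyah_class atl L A Q q E act)
     = (\<Union>nabla'\<in>{nabla'. extending_connection atl L A E act nabla'}.
         Hom_cohom aa mm `` {mu atl L A Q q j E nabla (to_end_form atl L q j (At_form atl L A Q q E nabla'))})"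
    unfolding atiyah_class_eq by blast
  \<comment> \<open>All members of the union are equal, and \<open>nabla\<close> itself shows that
    there is at least one.\<close>
  also have "\<dots> = dg_atiyah_class aa mm" using each extending by auto
  finally show ?thesis .
qed

end

theorem proposition3p1:
  fixes atl :: "('m::{t2_space, second_countable_topology}, 'a::real_inner) atlas"
    and L :: "('m, 'k::{real_normed_field, euclidean_space}, 'l::ab_group_add) lie_algebroid"
    and A :: "'m \<Rightarrow> 'l set"
    and Q :: "('m, 'k, 'q::ab_group_add) vbundle"
    and q :: "'m \<Rightarrow> 'l \<Rightarrow> 'q"
    and j :: "'m \<Rightarrow> 'q \<Rightarrow> 'l"
    and E :: "('m, 'k, 'e::ab_group_add) vbundle"
    and act nabla :: "('m \<Rightarrow> 'l) \<Rightarrow> ('m \<Rightarrow> 'e) \<Rightarrow> 'm \<Rightarrow> 'e"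
  assumes "smooth_manifold atl"
    and "lie_pair atl L A"
    and "quotient_bundle atl L A Q q"
    and "splitting atl L Q q j"
    and "lie_module atl L A E act"
    and "extending_connection atl L A E act nabla"
  shows "let \<aa> = lp_alg atl L A Q q j;
             \<mm> = lp_mod atl L A Q q j E nabla;
             R = dg_curvature \<mm> (lp_d atl L A Q q j E nabla 0 1);
             atiyah_prop = (\<lambda>F. \<forall>a\<in>secs_in atl L A. \<forall>b\<in>secs_in atl L (compl Q j). \<forall>e\<in>secs atl E.
                       contract a (contract b (F (form0 e))) = form0 (At atl L q nabla a (app q b) e))
         in (dg_map_shift11 \<aa> \<mm> R \<and> atiyah_prop R) \<and>
            (\<forall>F. dg_map_shift11 \<aa> \<mm> F \<and> atiyah_prop F \<longrightarrow> F = R) \<and>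
            Hom_cohom \<aa> \<mm> `` (mu atl L A Q q j E nabla ` to_end_form atl L q j `
                atiyah_class atl L A Q q E act)
              = dg_atiyah_class \<aa> \<mm>"
proof -
  interpret lie_pair_mod atl L A Q q j E act nabla
    using assms by unfold_locales
  show ?thesis
    unfolding Let_def curv_def [symmetric]
    using curv_dg_map curv_atiyah curv_unique mu_atiyah_class by blast
qed

end
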